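(* Let $G$ be a connected linear semisimple Lie group without compact factors, $\Gamma$ a uniform lattice in $G$, $Q$ a parabolic subgroup of $G$, and $\rho_0:\Gamma\to\mathrm{Homeo}(G/Q)$ the action by left multiplication. Then there are a neighborhood $\mathcal U_0$ of $\rho_0$ in the space of actions of $\Gamma$ on $G/Q$ by homeomorphisms and a neighborhood $V_0$ of $\mathrm{id}$ in the space of continuous maps $G/Q\to G/Q$ such that for every $\rho\in\mathcal U_0$ there exists a unique $(\rho,\rho_0)$-semi-conjugacy $\phi_\rho\in V_0$. Moreover, $\phi_\rho$ converges to $\mathrm{id}$ uniformly as $\rho$ converges to $\rho_0$.
   Context: $\mathrm{Homeo}(G/Q)$ carries the compact-open topology, and the space of actions (homomorphisms $\Gamma\to\mathrm{Homeo}(G/Q)$) the induced topology: $\rho$ is close to $\rho_0$ if $\rho(\gamma)$ is close to $\rho_0(\gamma)$ for all $\gamma$ in a fixed finite generating set of $\Gamma$. The space of continuous self-maps of $G/Q$ carries the topology of uniform convergence. A $(\rho,\rho_0)$-semi-conjugacy is a continuous surjective map $\phi:G/Q\to G/Q$ with $\phi\circ\rho(\gamma)=\rho_0(\gamma)\circ\phi$ for all $\gamma\in\Gamma$. A parabolic subgroup of $G$ is the stabilizer in $G$ of a point of the geodesic boundary of the symmetric space $G/K$. *)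

theory Defs
  imports
    "HOL-Analysis.Analysis"
    "HOL-Algebra.Left_Coset"
    "HOL-Algebra.Generated_Groups"
begin

section \<open>Linear Lie groups and their Lie algebras\<close>

definition GL :: "(real^'n^'n) monoid" where
  "GL = \<lparr>carrier = {A. invertible A}, mult = (**), one = mat 1\<rparr>"

lemma group_GL: "group (GL :: (real^'n^'n) monoid)"
proof (rule groupI)
  fix A :: "real^'n^'n" assume "A \<in> carrier GL"
  then obtain B where "A ** B = mat 1" "B ** A = mat 1"
    by (auto simp: GL_def invertible_def)
  then show "\<exists>B\<in>carrier GL. B \<otimes>\<^bsub>GL\<^esub> A = \<one>\<^bsub>GL\<^esub>"
    by (auto simp: GL_def invertible_def)
qed (auto simp: GL_def invertible_mult matrix_mul_assoc intro!: invertible_mult,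
     auto simp: invertible_def)

abbreviation grp :: "(real^'n^'n) set \<Rightarrow> (real^'n^'n) monoid" where
  "grp G \<equiv> GL\<lparr>carrier := G\<rparr>"

text \<open>Linear Lie groups are taken as closed subgroups of the general linear group, with the
  subspace topology. A connected semisimple Lie subgroup of the general linear group is
  automatically closed, so no linear semisimple group is lost.\<close>

definition linear_lie_group :: "(real^'n^'n) set \<Rightarrow> bool" where
  "linear_lie_group G \<longleftrightarrow> subgroup G GL \<and> closedin (top_of_set {A. invertible A}) G"

definition mat_exp :: "real^'n^'n \<Rightarrow> real^'n^'n" where
  "mat_exp A = (\<Sum>k. (1 / fact k) *\<^sub>R (((**) A ^^ k) (mat 1)))"

definition lie_algebra :: "(real^'n^'n) set \<Rightarrow> (real^'n^'n) set" where
  "lie_algebra G = {X. \<forall>t. mat_exp (t *\<^sub>R X) \<in> G}"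

definition bracket :: "real^'n^'n \<Rightarrow> real^'n^'n \<Rightarrow> real^'n^'n" where
  "bracket X Y = X ** Y - Y ** X"

definition lie_ideal :: "(real^'n^'n) set \<Rightarrow> (real^'n^'n) set \<Rightarrow> bool" where
  "lie_ideal I L \<longleftrightarrow> I \<subseteq> L \<and> subspace I \<and> (\<forall>X\<in>L. \<forall>Y\<in>I. bracket X Y \<in> I)"

definition derived_algebra :: "(real^'n^'n) set \<Rightarrow> (real^'n^'n) set" where
  "derived_algebra L = span {bracket X Y | X Y. X \<in> L \<and> Y \<in> L}"

definition lie_solvable :: "(real^'n^'n) set \<Rightarrow> bool" where
  "lie_solvable L \<longleftrightarrow> (\<exists>k. (derived_algebra ^^ k) L = {0})"

definition lie_simple :: "(real^'n^'n) set \<Rightarrow> bool" where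
  "lie_simple L \<longleftrightarrow> derived_algebra L \<noteq> {0} \<and> (\<forall>I. lie_ideal I L \<longrightarrow> I = {0} \<or> I = L)"

definition semisimple :: "(real^'n^'n) set \<Rightarrow> bool" where
  "semisimple G \<longleftrightarrow> (\<forall>I. lie_ideal I (lie_algebra G) \<and> lie_solvable I \<longrightarrow> I = {0})"

definition simple_factor :: "(real^'n^'n) set \<Rightarrow> (real^'n^'n) set \<Rightarrow> bool" where
  "simple_factor N G \<longleftrightarrow> N \<lhd> grp G \<and> closedin (top_of_set G) N \<and> connected N
     \<and> lie_simple (lie_algebra N)"

definition no_compact_factors :: "(real^'n^'n) set \<Rightarrow> bool" where
  "no_compact_factors G \<longleftrightarrow> (\<forall>N. simple_factor N G \<longrightarrow> \<not> compact N)"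


section \<open>Homogeneous spaces and uniform lattices\<close>

text \<open>The quotient topology on the set \<open>G/H\<close> of left cosets.\<close>

definition coset_topology :: "(real^'n^'n) set \<Rightarrow> (real^'n^'n) set \<Rightarrow> (real^'n^'n) set topology" where
  "coset_topology G H = topology (\<lambda>U. U \<subseteq> lcosets\<^bsub>grp G\<^esub> H
     \<and> openin (top_of_set G) {g \<in> G. g <#\<^bsub>GL\<^esub> H \<in> U})"

lemma openin_coset_topology:
  "openin (coset_topology G H) U \<longleftrightarrow>
     U \<subseteq> lcosets\<^bsub>grp G\<^esub> H \<and> openin (top_of_set G) {g \<in> G. g <#\<^bsub>GL\<^esub> H \<in> U}"
proof -
  let ?P = "\<lambda>U. U \<subseteq> lcosets\<^bsub>grp G\<^esub> H \<and> openin (top_of_set G) {g \<in> G. g <#\<^bsub>GL\<^esub> H \<in> U}"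
  have "istopology ?P"
    unfolding istopology_def
  proof (intro conjI allI impI)
    fix U V assume UV: "?P U" "?P V"
    have eq: "{g \<in> G. g <#\<^bsub>GL\<^esub> H \<in> U \<inter> V} =
        {g \<in> G. g <#\<^bsub>GL\<^esub> H \<in> U} \<inter> {g \<in> G. g <#\<^bsub>GL\<^esub> H \<in> V}" by auto
    show "U \<inter> V \<subseteq> lcosets\<^bsub>grp G\<^esub> H" using UV by auto
    show "openin (top_of_set G) {g \<in> G. g <#\<^bsub>GL\<^esub> H \<in> U \<inter> V}"
      unfolding eq using UV by (intro openin_Int) auto
  next
    fix \<K> assume K: "\<forall>U\<in>\<K>. ?P U"
    have eq: "{g \<in> G. g <#\<^bsub>GL\<^esub> H \<in> \<Union>\<K>} = \<Union>((\<lambda>U. {g \<in> G. g <#\<^bsub>GL\<^esub> H \<in> U}) ` \<K>)" by auto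
    show "\<Union>\<K> \<subseteq> lcosets\<^bsub>grp G\<^esub> H" using K by blast
    show "openin (top_of_set G) {g \<in> G. g <#\<^bsub>GL\<^esub> H \<in> \<Union>\<K>}"
      unfolding eq using K by (intro openin_Union) auto
  qed
  then show ?thesis by (simp add: coset_topology_def)
qed

lemma topspace_coset_topology [simp]: "topspace (coset_topology G H) = lcosets\<^bsub>grp G\<^esub> H"
proof
  show "topspace (coset_topology G H) \<subseteq> lcosets\<^bsub>grp G\<^esub> H"
    using openin_coset_topology openin_topspace by blast
  have "{g \<in> G. g <#\<^bsub>GL\<^esub> H \<in> lcosets\<^bsub>grp G\<^esub> H} = G"
    by (auto simp: LCOSETS_def l_coset_def)
  then have "openin (coset_topology G H) (lcosets\<^bsub>grp G\<^esub> H)"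
    by (simp add: openin_coset_topology)
  then show "lcosets\<^bsub>grp G\<^esub> H \<subseteq> topspace (coset_topology G H)"
    by (rule openin_subset)
qed

definition uniform_lattice :: "(real^'n^'n) set \<Rightarrow> (real^'n^'n) set \<Rightarrow> bool" where
  "uniform_lattice \<Gamma> G \<longleftrightarrow> subgroup \<Gamma> (grp G) \<and> discrete \<Gamma> \<and> compact_space (coset_topology G \<Gamma>)"


section \<open>The symmetric space, its geodesic boundary, and parabolic subgroups\<close>

definition maximal_compact_subgroup :: "(real^'n^'n) set \<Rightarrow> (real^'n^'n) set \<Rightarrow> bool" where
  "maximal_compact_subgroup K G \<longleftrightarrow> subgroup K (grp G) \<and> compact K
     \<and> (\<forall>L. subgroup L (grp G) \<and> compact L \<and> K \<subseteq> L \<longrightarrow> L = K)"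

text \<open>The trace of a linear endomorphism of a subspace; it does not depend on the basis chosen.\<close>

definition trace_on :: "(real^'n^'n) set \<Rightarrow> (real^'n^'n \<Rightarrow> real^'n^'n) \<Rightarrow> real" where
  "trace_on V f = (let B = (SOME B. independent B \<and> span B = V)
                   in \<Sum>b\<in>B. representation B (f b) b)"

definition killing_form :: "(real^'n^'n) set \<Rightarrow> real^'n^'n \<Rightarrow> real^'n^'n \<Rightarrow> real" where
  "killing_form G X Y = trace_on (lie_algebra G) (\<lambda>Z. bracket X (bracket Y Z))"

text \<open>The Killing-orthogonal complement \<open>\<pp>\<close> of \<open>\<kk>\<close> in \<open>\<gg> = \<kk> \<oplus> \<pp>\<close>,
  identified with the tangent space of \<open>G/K\<close> at the base point. The Killing form is positive
  definite on \<open>\<pp>\<close> and gives the \<open>G\<close>-invariant Riemannian metric.\<close>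

definition cartan_complement :: "(real^'n^'n) set \<Rightarrow> (real^'n^'n) set \<Rightarrow> (real^'n^'n) set" where
  "cartan_complement G K =
     {X \<in> lie_algebra G. \<forall>Y\<in>lie_algebra K. killing_form G X Y = 0}"

definition cartan_projection :: "(real^'n^'n) set \<Rightarrow> (real^'n^'n) set \<Rightarrow> real^'n^'n \<Rightarrow> real^'n^'n" where
  "cartan_projection G K X = (THE Y. Y \<in> cartan_complement G K \<and> X - Y \<in> lie_algebra K)"

text \<open>A \<open>C\<^sup>1\<close> curve in \<open>G/K\<close> is the projection of a \<open>C\<^sup>1\<close> curve \<open>c\<close> in \<open>G\<close>. Its velocity at time
  \<open>t\<close>, translated back to the base point by \<open>c(t)\<^sup>-\<^sup>1\<close>, is the \<open>\<pp>\<close>-part of \<open>c(t)\<^sup>-\<^sup>1 c'(t)\<close>.\<close>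

definition riemannian_length ::
  "(real^'n^'n) set \<Rightarrow> (real^'n^'n) set \<Rightarrow> (real \<Rightarrow> real^'n^'n) \<Rightarrow> real" where
  "riemannian_length G K c = integral {0..1} (\<lambda>t.
     let V = cartan_projection G K (matrix_inv (c t) ** vector_derivative c (at t))
     in sqrt (killing_form G V V))"

definition symmetric_dist ::
  "(real^'n^'n) set \<Rightarrow> (real^'n^'n) set \<Rightarrow> (real^'n^'n) set \<Rightarrow> (real^'n^'n) set \<Rightarrow> real" where
  "symmetric_dist G K x y = Inf {riemannian_length G K c | c.
     c C1_differentiable_on {0..1} \<and> c ` {0..1} \<subseteq> G \<and> c 0 \<in> x \<and> c 1 \<in> y}"

text \<open>The symmetric space is a Hadamard manifold, so its unit speed geodesic rays are the
  isometric embeddings of \<open>[0, \<infinity>)\<close>.\<close>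

definition geodesic_rays ::
  "(real^'n^'n) set \<Rightarrow> (real^'n^'n) set \<Rightarrow> (real \<Rightarrow> (real^'n^'n) set) set" where
  "geodesic_rays G K = {r \<in> {0..} \<rightarrow>\<^sub>E lcosets\<^bsub>grp G\<^esub> K.
     \<forall>s\<ge>0. \<forall>t\<ge>0. symmetric_dist G K (r s) (r t) = \<bar>s - t\<bar>}"

definition asymptotic :: "(real^'n^'n) set \<Rightarrow> (real^'n^'n) set \<Rightarrow>
    ((real \<Rightarrow> (real^'n^'n) set) \<times> (real \<Rightarrow> (real^'n^'n) set)) set" where
  "asymptotic G K = {(r, r'). r \<in> geodesic_rays G K \<and> r' \<in> geodesic_rays G K
     \<and> (\<exists>C. \<forall>t\<ge>0. symmetric_dist G K (r t) (r' t) \<le> C)}"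

definition geodesic_boundary ::
  "(real^'n^'n) set \<Rightarrow> (real^'n^'n) set \<Rightarrow> (real \<Rightarrow> (real^'n^'n) set) set set" where
  "geodesic_boundary G K = geodesic_rays G K // asymptotic G K"

definition boundary_action ::
  "real^'n^'n \<Rightarrow> (real \<Rightarrow> (real^'n^'n) set) set \<Rightarrow> (real \<Rightarrow> (real^'n^'n) set) set" where
  "boundary_action g \<xi> = (\<lambda>r. \<lambda>t\<in>{0..}. g <#\<^bsub>GL\<^esub> r t) ` \<xi>"

definition parabolic_subgroup :: "(real^'n^'n) set \<Rightarrow> (real^'n^'n) set \<Rightarrow> bool" where
  "parabolic_subgroup Q G \<longleftrightarrow>
     (\<exists>K \<xi>. maximal_compact_subgroup K G \<and> \<xi> \<in> geodesic_boundary G K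
        \<and> Q = {g \<in> G. boundary_action g \<xi> = \<xi>})"


section \<open>Spaces of homeomorphisms and of actions\<close>

text \<open>Maps defined on a space \<open>X\<close> are represented by extensional functions, so that equality
  of functions is equality on \<open>topspace X\<close>.\<close>

definition compact_open_topology :: "'a topology \<Rightarrow> 'b topology \<Rightarrow> ('a \<Rightarrow> 'b) topology" where
  "compact_open_topology X Y = topology_generated_by
     {{f \<in> extensional (topspace X). continuous_map X Y f \<and> f ` C \<subseteq> U} | C U.
        compactin X C \<and> openin Y U}"

definition homeo_group :: "'a topology \<Rightarrow> ('a \<Rightarrow> 'a) monoid" where
  "homeo_group X = \<lparr>carrier = {f \<in> extensional (topspace X). homeomorphic_map X X f},
     mult = compose (topspace X), one = (\<lambda>x\<in>topspace X. x)\<rparr>"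

definition homeo_topology :: "'a topology \<Rightarrow> ('a \<Rightarrow> 'a) topology" where
  "homeo_topology X = subtopology (compact_open_topology X X) (carrier (homeo_group X))"

definition actions :: "(real^'n^'n) set \<Rightarrow> 'a topology \<Rightarrow> (real^'n^'n \<Rightarrow> 'a \<Rightarrow> 'a) set" where
  "actions \<Gamma> X = hom (grp \<Gamma>) (homeo_group X) \<inter> extensional \<Gamma>"

text \<open>Here \<open>S\<close> is a finite generating set of \<open>\<Gamma>\<close>.\<close>

definition action_topology ::
  "(real^'n^'n) set \<Rightarrow> (real^'n^'n) set \<Rightarrow> 'a topology \<Rightarrow> (real^'n^'n \<Rightarrow> 'a \<Rightarrow> 'a) topology" where
  "action_topology S \<Gamma> X = pullback_topology (actions \<Gamma> X) (\<lambda>\<rho>. restrict \<rho> S)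
     (product_topology (\<lambda>_. homeo_topology X) S)"

definition left_mult_action ::
  "(real^'n^'n) set \<Rightarrow> (real^'n^'n) set \<Rightarrow> (real^'n^'n) set \<Rightarrow>
     real^'n^'n \<Rightarrow> (real^'n^'n) set \<Rightarrow> (real^'n^'n) set" where
  "left_mult_action \<Gamma> G Q = (\<lambda>\<gamma>\<in>\<Gamma>. \<lambda>x\<in>lcosets\<^bsub>grp G\<^esub> Q. \<gamma> <#\<^bsub>GL\<^esub> x)"

definition semi_conjugacy ::
  "(real^'n^'n) set \<Rightarrow> 'a topology \<Rightarrow> (real^'n^'n \<Rightarrow> 'a \<Rightarrow> 'a) \<Rightarrow> (real^'n^'n \<Rightarrow> 'a \<Rightarrow> 'a)
     \<Rightarrow> ('a \<Rightarrow> 'a) \<Rightarrow> bool" where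
  "semi_conjugacy \<Gamma> X \<rho> \<rho>0 \<phi> \<longleftrightarrow> continuous_map X X \<phi> \<and> \<phi> ` topspace X = topspace X
     \<and> (\<forall>\<gamma>\<in>\<Gamma>. \<forall>x\<in>topspace X. \<phi> (\<rho> \<gamma> x) = \<rho>0 \<gamma> (\<phi> x))"

definition neighbourhood_in :: "'a topology \<Rightarrow> 'a \<Rightarrow> 'a set \<Rightarrow> bool" where
  "neighbourhood_in T x N \<longleftrightarrow> N \<subseteq> topspace T \<and> (\<exists>U. openin T U \<and> x \<in> U \<and> U \<subseteq> N)"

end

theory Submission
 imports Defs "HOL-Computational_Algebra.Fundamental_Theorem_Algebra"
begin

text \<open>
A geodesic ray exists because \<open>Q\<close> is parabolic; as path lengths are bounded below along it, the
Killing form is positive on the orthogonal complement \<open>\<pp>\<close> of the maximal compact subalgebra, which gives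
the Cartan decomposition. Since \<open>exp : \<pp> \<rightarrow> G/K\<close> does not decrease distances, geodesic rays are
\<open>g exp (t H) K\<close>, and \<open>Q\<close> consists of the \<open>q\<close> for which \<open>exp (- t H) q exp (t H)\<close> stays bounded.
So \<open>exp (- H)\<close> expands \<open>G/Q\<close> near its base point, and every point has such an expanding sequence. A
perturbed action \<open>\<rho>\<close> and a point \<open>x\<close> give an almost equivariant map \<open>G \<rightarrow> G/Q\<close>; a
shadowing argument along the expanding sequences corrects it to an exactly equivariant one, whose
value is \<open>\<phi> x\<close>. Expansion also yields uniqueness and the convergence to the identity; \<open>\<phi>\<close> is surjective
because its image is a closed \<open>\<Gamma>\<close>-invariant set which is nearly dense.
\<close>

text \<open>A shadowing sequence is built separately from every \<open>g\<close>, with no control on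
  how its correction \<open>c g\<close> depends on \<open>g\<close>. Uniqueness of shadowing makes
  the resulting point \<open>pt (g ** c g)\<close> locally constant in \<open>g\<close>, and
  connectedness of \<open>G\<close> makes it constant; this is how exact equivariance arises. On the
  side of \<open>Q\<close>, one eigenbasis of \<open>ad H\<close> and the boundedness of conjugates
  along \<open>exp (t H)\<close> replace roots and Weyl chambers. The Lie-theoretic half is shaped
  by how little is known of \<open>K\<close>: it is a compact subgroup, without a given Cartan
  involution, and nothing says a priori that the bracket of two elements of the complement returns
  to \<open>kk\<close>. This is extracted from the orthogonality of \<open>kk\<close> and its
  complement by a moment-map argument. Semisimplicity speaks of solvable ideals, so nondegeneracy of
  the Killing form has to come through Cartan's criterion and Engel's theorem, carried out on
  complexified real operators.\<close>

typedef (overloaded) 'a endo = "UNIV :: ('a::euclidean_space \<Rightarrow>\<^sub>L 'a) set"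
 morphisms blinfun_of_endo endo_of_blinfun ..

setup_lifting type_definition_endo

text \<open>Composition has to be the ring multiplication for powers and \<open>exp\<close> in
  Banach algebras to apply. One such algebra serves for matrices, for \<open>ad\<close>, and for
  their complexifications.\<close>

instantiation endo :: (euclidean_space) real_normed_algebra_1
begin

lift_definition zero_endo :: "'a endo" is 0 .
lift_definition one_endo :: "'a endo" is id_blinfun .
lift_definition plus_endo :: "'a endo => 'a endo => 'a endo" is "(+)" .
lift_definition minus_endo :: "'a endo => 'a endo => 'a endo" is "(-)" .
lift_definition uminus_endo :: "'a endo => 'a endo" is uminus .
lift_definition scaleR_endo :: "real => 'a endo => 'a endo" is scaleR .
lift_definition times_endo :: "'a endo => 'a endo => 'a endo" is "(o\<^sub>L)" .
lift_definition norm_endo :: "'a endo => real" is norm .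
lift_definition dist_endo :: "'a endo => 'a endo => real" is dist .
lift_definition sgn_endo :: "'a endo => 'a endo" is sgn .

definition uniformity_endo :: "('a endo \<times> 'a endo) filter" where "uniformity_endo = (INF e\<in>{0 <..}. principal {(x, y). dist x y < e})"

definition open_endo :: "'a endo set => bool" where "open_endo U = (ALL x:U. \<forall>\<^sub>F (x', y) in uniformity. x' = x --> y : U)"

instance
proof
 fix a b c :: "'a endo" and r s :: real
 show "a + b + c = a + (b + c)" by transfer (simp add:add.assoc)
 show "a + b = b + a" by transfer (simp add:add.commute)
 show "0 + a = a" by transfer simp
 show "- a + a = 0" by transfer simp
 show "a - b = a + - b" by transfer simp
 show "r *\<^sub>R (a + b) = r *\<^sub>R a + r *\<^sub>R b" by transfer (simp add:scaleR_add_right)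
 show "(r + s) *\<^sub>R a = r *\<^sub>R a + s *\<^sub>R a" by transfer (simp add:scaleR_add_left)
 show "r *\<^sub>R s *\<^sub>R a = (r * s) *\<^sub>R a" by transfer simp
 show "1 *\<^sub>R a = a" by transfer simp
 show "a * b * c = a * (b * c)" by transfer (simp add:blinfun_eqI)
 show "(a + b) * c = a * c + b * c" by transfer (simp add:blinfun.bilinear_simps blinfun_eqI)
 show "a * (b + c) = a * b + a * c" by transfer (simp add:blinfun.bilinear_simps blinfun_eqI)
 show "(r *\<^sub>R a) * b = r *\<^sub>R (a * b)" by transfer (simp add:blinfun.bilinear_simps blinfun_eqI)
 show "a * (r *\<^sub>R b) = r *\<^sub>R (a * b)" by transfer (simp add:blinfun.bilinear_simps blinfun_eqI)
 show "1 * a = a" by transfer (simp add:blinfun_eqI)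
 show "a * 1 = a" by transfer (simp add:blinfun_eqI)
 have "(id_blinfun :: 'a \<Rightarrow>\<^sub>L 'a) ~= 0"
 proof
  assume z: "(id_blinfun :: 'a \<Rightarrow>\<^sub>L 'a) = 0"
  obtain e :: 'a where e: "e : Basis" using nonempty_Basis by blast
  have "blinfun_apply (id_blinfun :: 'a \<Rightarrow>\<^sub>L 'a) e = blinfun_apply 0 e" using z by simp
  thus False using e nonzero_Basis by auto
 qed
 thus "(0::'a endo) ~= 1" by transfer auto
 show "dist a b = norm (a - b)" by transfer (simp add:dist_norm)
 show "sgn a = scaleR (inverse (norm a)) a" by transfer (simp add:sgn_div_norm)
 show "uniformity = (INF e\<in>{0 <..}. principal {(x, y::'a endo). dist x y < e})" by(rule uniformity_endo_def)
 show "open U = (ALL x:U. \<forall>\<^sub>F (x', y) in uniformity. x' = x --> y : U)" for U :: "'a endo set" by(rule open_endo_def)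
 show "(norm a = 0) = (a = 0)" by transfer simp
 show "norm (a + b) <= norm a + norm b" by transfer (rule norm_triangle_ineq)
 show "norm (r *\<^sub>R a) = \<bar>r\<bar> * norm a" by transfer simp
 show "norm (a * b) <= norm a * norm b" by transfer (rule norm_blinfun_compose)
 show "norm (1::'a endo) = 1" by transfer simp
qed

end

lemma dist_blinfun_of_endo: "dist (blinfun_of_endo x) (blinfun_of_endo y) = dist x y" by transfer simp

instance endo :: (euclidean_space) banach
proof
 fix X :: "nat => 'a endo" assume X: "Cauchy X"
 hence "Cauchy (%n. blinfun_of_endo (X n))" by(simp add:Cauchy_def dist_blinfun_of_endo)
 then obtain L where L: "(%n. blinfun_of_endo (X n)) \<longlonglongrightarrow> L" using convergent_eq_Cauchy by blast
 have "X \<longlonglongrightarrow> endo_of_blinfun L" using L unfolding lim_sequentially by(metis UNIV_I endo_of_blinfun_inverse dist_blinfun_of_endo)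
 thus "convergent X" by(auto simp: convergent_def)
qed

abbreviation mi where "mi == matrix_inv"
abbreviation mexp where "mexp == mat_exp"
abbreviation lb where "lb == bracket"
abbreviation scale (infixr "*." 75) where "c *. x == c *\<^sub>R x"
abbreviation tends ("(_)/ ----> (_)" [60, 60] 60) where "X ----> L == X \<longlonglongrightarrow> L"
abbreviation hvd (infix "hvd" 50) where "f hvd D == (f has_vector_derivative D)"
lemmas mma = matrix_mul_assoc
lemmas mms = mma[symmetric]

lift_definition eapp :: "'a::euclidean_space endo => 'a => 'a" is blinfun_apply .

lift_definition endo :: "('a => 'a) => 'a::euclidean_space endo" is Blinfun .

lemma eapp_endo [simp]: "linear f ==> eapp (endo f) = f" by transfer (simp add:bounded_linear_Blinfun_apply linear_conv_bounded_linear)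

lemma endo_eqI: "(!!x. eapp S x = eapp T x) ==> S = T" by transfer (rule blinfun_eqI)

lemma bounded_bilinear_eapp: "bounded_bilinear eapp"
proof
 fix a a' :: "'a endo" and b b' :: 'a and r :: real
 show "eapp (a + a') b = eapp a b + eapp a' b" by transfer (simp add:blinfun.add_left)
 show "eapp a (b + b') = eapp a b + eapp a b'" by transfer (simp add:blinfun.add_right)
 show "eapp (r *. a) b = r *. eapp a b" by transfer (simp add:blinfun.scaleR_left)
 show "eapp a (r *. b) = r *. eapp a b" by transfer (simp add:blinfun.scaleR_right)
 show "EX K. ALL a b. norm (eapp a (b::'a)) <= norm a * norm b * K" by(rule exI[of _ 1]) (transfer, simp add:norm_blinfun)
qed

interpretation eapp: bounded_bilinear "eapp :: 'a::euclidean_space endo => 'a => 'a" by(rule bounded_bilinear_eapp)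

lemma linear_eapp: "linear (eapp T)" by(simp add:eapp.bounded_linear_right bounded_linear.linear)

lemma eapp_mult [simp]: "eapp (S * T) x = eapp S (eapp T x)" by transfer simp

lemma eapp_one [simp]: "eapp 1 x = x" by transfer simp

lemma norm_eapp: "norm (eapp T x) <= norm T * norm x" by transfer (rule norm_blinfun)

lemma norm_endo_le: "0 <= b ==> (!!x. norm (eapp T x) <= b * norm x) ==> norm T <= b" by transfer (rule norm_blinfun_bound)

section \<open>The exponential series in Banach algebras\<close>

lemma exp_algebra_hom:
 fixes h :: "'a::{real_normed_algebra_1,banach} => 'b::{real_normed_algebra_1,banach}"
 assumes h: "bounded_linear h" and hp: "!!n. h (x ^ n) = h x ^ n"
 shows "h (exp x) = exp (h x)"
proof -
 have "(%n. h (x ^ n /\<^sub>R fact n)) sums h (exp x)" using bounded_linear.sums[OF h exp_converges] .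
 moreover have "h (x ^ n /\<^sub>R fact n) = h x ^ n /\<^sub>R fact n" for n by(simp add:hp linear_simps[OF h])
 ultimately show ?thesis using exp_converges[of "h x"] sums_unique2 by fastforce
qed

text \<open>The intertwiner \<open>a\<close> may be singular. Later it is also a projection, which
  allows flows to be compared on a subspace.\<close>

lemma exp_mult_left_eq:
 fixes x a y :: "'a::{real_normed_algebra_1,banach}"
 assumes "x * a = a * y"
 shows "exp x * a = a * exp y"
proof -
 have p: "x ^ n * a = a * y ^ n" for n
 proof (induction n)
  case (Suc n)
  have "x ^ Suc n * a = x ^ n * (x * a)" by(simp add:power_Suc2 mult.assoc del: power_Suc)
  also have "... = (x ^ n * a) * y" by(simp add:assms mult.assoc)
  finally show ?case by(simp add:Suc mult.assoc power_Suc2 del: power_Suc)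
 qed simp
 have "(%n. (x ^ n /\<^sub>R fact n) * a) sums (exp x * a)" by(intro sums_mult2 exp_converges)
 moreover have "(%n. a * (y ^ n /\<^sub>R fact n)) sums (a * exp y)" by(intro sums_mult exp_converges)
 ultimately show ?thesis by(simp add:p sums_iff)
qed

lemma norm_power_diff_le:
 fixes x y :: "'a::real_normed_algebra_1"
 assumes "norm x <= r" "norm y <= r"
 shows "norm (x ^ Suc n - y ^ Suc n) <= (real n + 1) * r ^ n * norm (x - y)"
proof (induction n)
 case (Suc n)
 have r: "0 <= r" using assms(1) norm_ge_zero order_trans by blast
 have nx: "norm (x ^ Suc n) <= r ^ Suc n" using norm_power_ineq[of x "Suc n"] power_mono[OF assms(1), of "Suc n"] by(simp add:order_trans)
 have "x ^ Suc (Suc n) - y ^ Suc (Suc n) = x ^ Suc n * (x - y) + (x ^ Suc n - y ^ Suc n) * y"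
  unfolding power_Suc2[of x "Suc n"] power_Suc2[of y "Suc n"] by(simp only: algebra_simps)
 hence "norm (x ^ Suc (Suc n) - y ^ Suc (Suc n)) \<le>
   norm (x ^ Suc n * (x - y)) + norm ((x ^ Suc n - y ^ Suc n) * y)" using norm_triangle_ineq[of "x ^ Suc n * (x - y)" "(x ^ Suc n - y ^ Suc n) * y"] by(simp only:)
 also have "... <= norm (x ^ Suc n) * norm (x - y) + norm (x ^ Suc n - y ^ Suc n) * norm y" by(intro add_mono norm_mult_ineq)
 also have "... <= r ^ Suc n * norm (x - y) + ((real n + 1) * r ^ n * norm (x - y)) * r" using Suc nx assms r by(intro add_mono mult_mono) auto
 also have "... = (real (Suc n) + 1) * r ^ Suc n * norm (x - y)" by(simp add:algebra_simps)
 finally show ?case .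
qed simp

text \<open>After the terms of degree 0 and 1 are dropped, the power estimate bounds the series
  termwise by that of \<open>(exp r - 1) * norm (x - y)\<close>. Both arguments vary, so this is
  strict differentiability at 0 and also gives local injectivity of \<open>exp\<close>.\<close>

lemma norm_exp_diff_le:
 fixes x y :: "'a::{real_normed_algebra_1,banach}"
 assumes "norm x <= r" "norm y <= r"
 shows "norm (exp x - exp y - (x - y)) <= (exp r - 1) * norm (x - y)"
proof -
 have r: "0 <= r" using assms(1) norm_ge_zero order_trans by blast
 have s: "(%n. x ^ n /\<^sub>R fact n - y ^ n /\<^sub>R fact n) sums (exp x - exp y)" by(intro sums_diff exp_converges)
 have s2: "(%n. x ^ Suc (Suc n) /\<^sub>R fact (Suc (Suc n)) - y ^ Suc (Suc n) /\<^sub>R fact (Suc (Suc n)))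
  sums (exp x - exp y - (x - y))" using sums_Suc_iff[of "%n. x ^ (Suc n) /\<^sub>R fact (Suc n) - y ^ (Suc n) /\<^sub>R fact (Suc n)"]
   sums_Suc_iff[of "%n. x ^ n /\<^sub>R fact n - y ^ n /\<^sub>R fact n"] s by simp
 have e: "(%n. r ^ n /\<^sub>R fact n) sums exp r" by(rule exp_converges)
 have e2: "(%n. r ^ Suc n /\<^sub>R fact (Suc n)) sums (exp r - 1)" using sums_Suc_iff[of "%n. r ^ n /\<^sub>R fact n"] e by simp
 hence e3: "(%n. (r ^ Suc n /\<^sub>R fact (Suc n)) * norm (x - y)) sums ((exp r - 1) * norm (x - y))" by(rule sums_mult2)
 have le: "norm (x ^ Suc (Suc n) /\<^sub>R fact (Suc (Suc n)) - y ^ Suc (Suc n) /\<^sub>R fact (Suc (Suc n)))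
   <= (r ^ Suc n /\<^sub>R fact (Suc n)) * norm (x - y)" for n
 proof -
  have "norm (x ^ Suc (Suc n) /\<^sub>R fact (Suc (Suc n)) - y ^ Suc (Suc n) /\<^sub>R fact (Suc (Suc n)))
   = norm (x ^ Suc (Suc n) - y ^ Suc (Suc n)) / fact (Suc (Suc n))" by(simp only: scaleR_diff_right[symmetric] norm_scaleR) (simp add:divide_simps)
  also have "... <= ((real (Suc n) + 1) * r ^ Suc n * norm (x - y)) / fact (Suc (Suc n))" by(intro divide_right_mono norm_power_diff_le assms) auto
  also have "... = (r ^ Suc n /\<^sub>R fact (Suc n)) * norm (x - y)"
  proof -
   have "(real (Suc n) + 1) ~= 0" "fact (Suc (Suc n)) = (real (Suc n) + 1) * fact (Suc n)" by(simp_all add: algebra_simps)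
   thus ?thesis by(simp only:) (simp add:divide_simps del: fact_Suc of_nat_Suc)
  qed
  finally show ?thesis .
 qed
 have "norm (exp x - exp y - (x - y)) <= (exp r - 1) * norm (x - y)" using norm_suminf_le[OF le sums_summable[OF e3]] s2 e3 by(simp add:sums_iff)
 thus ?thesis .
qed

text \<open>The series of \<open>(1 - e\<^sup>-\<^sup>t) / t\<close>, which gives the logarithmic derivative of \<open>exp\<close>.\<close>

definition dexp :: "'a::{real_normed_algebra_1,banach} => 'a" where "dexp t = (\<Sum>k. (-1) ^ k *. t ^ k /\<^sub>R fact (Suc k))"

lemma dexp_summable:
 fixes t :: "'a::{real_normed_algebra_1,banach}"
 shows "summable (%k. norm ((-1) ^ k *. t ^ k /\<^sub>R fact (Suc k)))"
proof (rule summable_comparison_test)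
 have "norm ((-1) ^ k *. t ^ k /\<^sub>R fact (Suc k)) <= norm t ^ k /\<^sub>R fact k" for k
 proof -
  have "norm ((-1) ^ k *. t ^ k /\<^sub>R fact (Suc k)) = norm (t ^ k) / fact (Suc k)" by(simp add:power_abs divide_simps)
  also have "... <= norm t ^ k / fact k" by(intro frac_le norm_power_ineq fact_mono) auto
  finally show ?thesis by(simp add:divide_simps)
 qed
 thus "EX N. ALL n>=N. norm (norm ((-1) ^ n *. t ^ n /\<^sub>R fact (Suc n))) <= norm t ^ n /\<^sub>R fact n" by auto
 show "summable (%n. norm t ^ n /\<^sub>R fact n)" using exp_converges[of "norm t"] sums_summable by blast
qed

lemma dexp_sums: "(%k. (-1) ^ k *. t ^ k /\<^sub>R fact (Suc k)) sums dexp t" unfolding dexp_def by(rule summable_sums[OF summable_norm_cancel[OF dexp_summable]])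

section \<open>Matrices as operators, and the matrix exponential\<close>

lemma bounded_bilinear_matrix_mult: "bounded_bilinear ((**) :: real^'n^'n => real^'n^'n => real^'n^'n)" unfolding bilinear_conv_bounded_bilinear[symmetric] bilinear_def
 by(auto intro!: linearI simp: matrix_matrix_mult_def vec_eq_iff sum_distrib_left
   sum.distrib distrib_left distrib_right algebra_simps)

interpretation mm: bounded_bilinear "(**) :: real^'n^'n => real^'n^'n => real^'n^'n" by(rule bounded_bilinear_matrix_mult)

lemmas continuous_on_matrix_mult [continuous_intros] =
 bounded_bilinear.continuous_on[OF bounded_bilinear_matrix_mult]

lemmas matrix_ring_simps = mm.add_left mm.add_right mm.diff_left mm.diff_right
 mm.minus_left mm.minus_right mm.scaleR_left mm.scaleR_right mma

definition emat :: "real^'n^'n => (real^'n) endo" where "emat A = endo (%x. A *v x)"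

lemma eapp_emat [simp]: "eapp (emat A) x = A *v x" by(simp add:emat_def matrix_vector_mul_linear)

lemma emat_mult: "emat (A**B) = emat A * emat B" by(rule endo_eqI) (simp add:matrix_vector_mul_assoc)

lemma emat_one [simp]: "emat (mat 1) = 1" by(rule endo_eqI) simp

lemma linear_emat: "linear emat" by(rule linearI; rule endo_eqI)
  (simp_all add: eapp.add_left eapp.scaleR_left matrix_vector_mult_add_rdistrib scaleR_matrix_vector_assoc)

lemma bounded_linear_emat: "bounded_linear emat" using linear_emat by(simp add:linear_conv_bounded_linear)

definition mat_of :: "(real^'n) endo => real^'n^'n" where "mat_of T = matrix (eapp T)"

lemma emat_mat_of [simp]: "emat (mat_of T) = T" by(rule endo_eqI) (simp add:mat_of_def matrix_works linear_eapp)

lemma mat_of_emat [simp]: "mat_of (emat A) = A"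
proof -
 have "eapp (emat A) = (%x. A *v x)" by(rule ext) simp
 thus ?thesis by(simp add:mat_of_def)
qed

lemma emat_inject [simp]: "emat A = emat B \<longleftrightarrow> A = B" by(metis mat_of_emat)

lemma linear_mat_of: "linear mat_of"
proof (rule linearI)
 fix S T :: "(real^'n) endo" and r :: real
 show "mat_of (S + T) = mat_of S + mat_of T" using mat_of_emat[of "mat_of S + mat_of T"] by(simp add:linear_add[OF linear_emat])
 show "mat_of (r *. S) = r *. mat_of S" using mat_of_emat[of "r *. mat_of S"] by(simp add:linear_scale[OF linear_emat])
qed

lemma mat_of_mult: "mat_of (S * T) = mat_of S**mat_of T" using mat_of_emat[of "mat_of S**mat_of T"] by(simp add:emat_mult)

lemma mat_of_one [simp]: "mat_of 1 = mat 1" using mat_of_emat[of "mat 1"] by simp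

lemma bounded_linear_mat_of: "bounded_linear (mat_of :: (real^'n) endo => real^'n^'n)"
proof (rule bounded_linear_intro)
 fix S T :: "(real^'n) endo" and r :: real
 show "mat_of (S + T) = mat_of S + mat_of T" by(rule linear_add[OF linear_mat_of])
 show "mat_of (r *. S) = r *. mat_of S" by(rule linear_scale[OF linear_mat_of])
 have e: "\<bar>mat_of T $ i $ j\<bar> <= norm T" for i j
 proof -
  have "\<bar>mat_of T $ i $ j\<bar> = \<bar>eapp T (axis j 1) $ i\<bar>" by(simp add:mat_of_def matrix_def)
  also have "... <= norm (eapp T (axis j 1))" by(rule component_le_norm_cart)
  also have "... <= norm T" using norm_eapp[of T "axis j 1"] by simp
  finally show ?thesis .
 qed
 have "norm (mat_of T) <= (SUM i:UNIV. norm (mat_of T $ i))" unfolding norm_vec_def[of "mat_of T"] by(rule L2_set_le_sum) simp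
 also have "... <= (SUM i:(UNIV::'n set). SUM j:(UNIV::'n set). norm T)" by(intro sum_mono order_trans[OF norm_le_l1_cart] e)
 finally show "norm (mat_of T) <= norm T * (real CARD('n) * real CARD('n))" by(simp add:mult_ac)
qed

lemma mat_exp_sums: "(%k. (1 / fact k) *. (((**) A ^^ k) (mat 1))) sums mat_of (exp (emat A))"
proof -
 have p: "emat (((**) A ^^ k) (mat 1)) = emat A ^ k" for k by(induction k) (simp_all add: emat_mult)
 have "(%k. mat_of (emat A ^ k /\<^sub>R fact k)) sums mat_of (exp (emat A))" by(intro bounded_linear.sums[OF bounded_linear_mat_of] exp_converges)
 moreover have "mat_of (emat A ^ k /\<^sub>R fact k) = (1 / fact k) *. (((**) A ^^ k) (mat 1))" for k by(simp add:linear_scale[OF linear_mat_of] p[symmetric] inverse_eq_divide)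
 ultimately show ?thesis by simp
qed

lemma mat_exp_eq: "mexp A = mat_of (exp (emat A))" unfolding mat_exp_def by(rule sums_unique[OF mat_exp_sums, symmetric])

lemma emat_exp: "emat (mexp A) = exp (emat A)" by(simp add:mat_exp_eq)

lemma mat_exp_0 [simp]: "mexp 0 = mat 1" by(simp add:mat_exp_eq linear_0[OF linear_emat])

lemma mat_exp_add: "A**B = B**A ==> mexp (A + B) = mexp A**mexp B" by(simp add:mat_exp_eq linear_add[OF linear_emat] exp_add_commuting emat_mult[symmetric] mat_of_mult)

lemma mat_exp_scale_add: "mexp ((s + t) *. A) = mexp (s *. A)**mexp (t *. A)" by(simp add:scaleR_add_left mat_exp_add matrix_ring_simps)

lemma mat_exp_minus_right [simp]: "mexp A**mexp (- A) = mat 1" using mat_exp_scale_add[of 1 "-1" A] by simp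

lemma mat_exp_minus_left [simp]: "mexp (- A)**mexp A = mat 1" using mat_exp_scale_add[of "-1" 1 A] by simp

lemma invertible_mat_exp [simp]: "invertible (mexp A)" unfolding invertible_def using mat_exp_minus_right mat_exp_minus_left by blast

lemma matrix_inv_eqI: "A**B = mat 1 ==> mi A = (B :: real^'n^'n)"
proof -
 assume AB: "A**B = mat 1"
 hence "A**B = mat 1 & B**A = mat 1" using iffD1[OF matrix_left_right_inverse AB] by simp
 hence "A**mi A = mat 1 & mi A**A = mat 1" unfolding matrix_inv_def by(rule someI)
 hence "mi A**A**B = B" by simp
 thus ?thesis by(simp add:mms AB)
qed

lemma matrix_inv_mat_exp [simp]: "mi (mexp A) = mexp (- A)" by(simp add:matrix_inv_eqI)

lemma mat_exp_of_nat: "mexp (real k *. A) = ((**) (mexp A) ^^ k) (mat 1)" by(induction k) (simp_all add: scaleR_add_left mat_exp_add matrix_ring_simps)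

lemma mat_exp_conj:
 assumes "P**P' = mat 1"
 shows "mexp (P**A**P') = P**mexp A**(P' :: real^'n^'n)"
proof -
 have P: "P'**P = mat 1" by(rule iffD1[OF matrix_left_right_inverse assms])
 have "emat (P**A**P') * emat P = emat P * emat A" by(simp add:emat_mult[symmetric] mms P)
 hence "exp (emat (P**A**P')) * emat P = emat P * exp (emat A)" by(rule exp_mult_left_eq)
 hence "mexp (P**A**P')**P = P**mexp A" by(simp add:emat_exp[symmetric] emat_mult[symmetric])
 hence "mexp (P**A**P')**P**P' = P**mexp A**P'" by simp
 thus ?thesis by(simp add:mms assms)
qed

lemma continuous_on_exp_algebra:
 fixes f :: "'a::topological_space => 'b::{real_normed_algebra_1,banach}"
 assumes "continuous_on S f"
 shows "continuous_on S (%x. exp (f x))"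
proof -
 have "isCont exp x" for x :: 'b unfolding continuous_at_eps_delta
 proof (intro allI impI)
  fix e :: real assume e: "0 < e"
  define r where "r = norm x + 1"
  define d where "d = min 1 (e / (2 * exp r))"
  show "EX d>0. ALL y. dist y x < d --> dist (exp y) (exp x) < e"
  proof (intro exI[of _ d] conjI allI impI)
   show "d > 0" using e by(simp add:d_def)
   fix y assume y: "dist y x < d"
   hence n: "norm y <= r" "norm x <= r" using norm_triangle_ineq[of "y - x" x] by(auto simp: r_def d_def dist_norm)
   have "norm (exp y - exp x) <= norm (exp y - exp x - (y - x)) + norm (y - x)" using norm_triangle_ineq[of "exp y - exp x - (y - x)" "y - x"] by simp
   also have "... <= (exp r - 1) * norm (y - x) + norm (y - x)" using norm_exp_diff_le[OF n] by simp
   also have "... = exp r * norm (y - x)" by(simp add:algebra_simps)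
   also have "... <= exp r * (e / (2 * exp r))" using y by(intro mult_left_mono) (auto simp: d_def dist_norm)
   also have "... < e" using e by simp
   finally show "dist (exp y) (exp x) < e" by(simp add:dist_norm)
  qed
 qed
 hence "continuous_on UNIV (exp :: 'b => 'b)" by(simp add:continuous_at_imp_continuous_on)
 thus ?thesis using continuous_on_compose2[OF _ assms] by fastforce
qed

lemma continuous_on_mat_exp [continuous_intros]: "continuous_on S f ==> continuous_on S (%x. mexp (f x :: real^'n^'n))" unfolding mat_exp_eq
 by(rule bounded_linear.continuous_on[OF bounded_linear_mat_of], rule continuous_on_exp_algebra,
   rule bounded_linear.continuous_on[OF bounded_linear_emat])

lemma tendsto_mat_exp [tendsto_intros]: "(f \<longlongrightarrow> l) F ==> ((%x. mexp (f x :: real^'n^'n)) \<longlongrightarrow> mexp l) F"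
 using continuous_on_mat_exp[OF continuous_on_id, of "UNIV :: (real^'n^'n) set"] by(rule continuous_on_tendsto_compose) auto

lemma mat_exp_has_vector_derivative_right: "((%t. mexp (t *. A)) hvd mexp (t *. A)**A) (at t within S)"
proof -
 have "((%t. mat_of (exp (t *. emat A))) hvd
   mat_of (exp (t *. emat A) * emat A)) (at t within S)" by(intro bounded_linear.has_vector_derivative[OF bounded_linear_mat_of]
   exp_scaleR_has_vector_derivative_right)
 thus ?thesis by(simp add:mat_exp_eq linear_scale[OF linear_emat] mat_of_mult)
qed

lemma mat_exp_commute: "A**mexp (t *. A) = mexp (t *. A)**A"
proof -
 have "emat A * exp (t *. emat A) = exp (t *. emat A) * emat A" by(simp add:exp_times_scaleR_commute)
 thus ?thesis by(simp add:emat_mult[symmetric] emat_exp[symmetric] linear_scale[OF linear_emat, symmetric])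
qed

lemma mat_exp_has_vector_derivative_left: "((%t. mexp (t *. A)) hvd A**mexp (t *. A)) (at t within S)" by(simp add:mat_exp_commute mat_exp_has_vector_derivative_right)

text \<open>The Banach algebra estimate with a small radius. The constants \<open>K\<close> and
  \<open>L\<close> pay for changing between the Euclidean norm of matrices and the operator
  norm.\<close>

lemma mat_exp_near_0:
 fixes e :: real assumes "0 < e"
 obtains r where "0 < r" "!!x y :: real^'n^'n. norm x <= r ==> norm y <= r ==>
  norm (mexp x - mexp y - (x - y)) <= e * norm (x - y)"
proof -
 obtain K where K: "K > 0" "!!A::real^'n^'n. norm (emat A) <= norm A * K" using bounded_linear.pos_bounded[OF bounded_linear_emat] by blast
 obtain L where L: "L > 0" "!!T::(real^'n) endo. norm (mat_of T) <= norm T * L" using bounded_linear.pos_bounded[OF bounded_linear_mat_of] by blast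
 have "((%s. exp s - 1) \<longlongrightarrow> exp 0 - (1::real)) (at 0)" by(intro tendsto_intros)
 hence "\<forall>\<^sub>F s in at 0. dist (exp s - 1) (0::real) < e / (K * L)" using assms K L by(intro tendstoD) auto
 then obtain d where d: "d > 0" "!!s::real. s ~= 0 ==> \<bar>s\<bar> < d ==> \<bar>exp s - 1\<bar> < e / (K * L)" unfolding eventually_at by(auto simp: dist_real_def)
 define s where "s = d / 2"
 have s: "s > 0" "exp s - 1 < e / (K * L)" using d(2)[of s] d(1) by(auto simp: s_def)
 show ?thesis
 proof (rule that)
  show "0 < s / K" using s K by simp
  fix x y :: "real^'n^'n" assume xy: "norm x <= s / K" "norm y <= s / K"
  have "norm (emat x) <= s" "norm (emat y) <= s" using xy K(2)[of x] K(2)[of y] K(1) by(auto simp: field_simps)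
  hence "norm (exp (emat x) - exp (emat y) - (emat x - emat y)) <= (exp s - 1) * norm (emat x - emat y)" by(rule norm_exp_diff_le)
  moreover have eq: "mexp x - mexp y - (x - y) = mat_of (exp (emat x) - exp (emat y) - (emat x - emat y))" by(simp add:mat_exp_eq linear_diff[OF linear_mat_of])
  ultimately have "norm (mexp x - mexp y - (x - y)) <= ((exp s - 1) * norm (emat (x - y))) * L" using L(2)[of "exp (emat x) - exp (emat y) - (emat x - emat y)"] L(1)
   by(simp add:linear_diff[OF linear_emat] mult_right_mono order_trans)
  also have "... <= ((e / (K * L)) * (norm (x - y) * K)) * L" using s K(2)[of "x - y"] L K assms by(intro mult_right_mono mult_mono) auto
  also have "... = e * norm (x - y)" using K L by simp
  finally show "norm (mexp x - mexp y - (x - y)) <= e * norm (x - y)" .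
 qed
qed

lemma mat_exp_has_derivative_0: "((mexp :: real^'n^'n => _) has_derivative (%x. x)) (at 0)" unfolding has_derivative_within_alt
proof (intro conjI allI impI)
 show "bounded_linear (%x::real^'n^'n. x)" by(rule bounded_linear_ident)
 fix e :: real assume "0 < e"
 then obtain r where r: "0 < r" "!!x y :: real^'n^'n. norm x <= r ==> norm y <= r ==>
  norm (mexp x - mexp y - (x - y)) <= e * norm (x - y)" using mat_exp_near_0 by blast
 thus "EX d>0. ALL y:(UNIV :: (real^'n^'n) set). norm (y - 0) < d -->
   norm (mexp y - mexp 0 - (y - 0)) <= e * norm (y - 0)" using r(2)[where y = 0] by(intro exI[of _ r]) (auto simp: less_imp_le)
qed

section \<open>The operator \<open>ad\<close> and the logarithmic derivative of the
  exponential\<close>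

definition adE :: "real^'n^'n => (real^'n^'n) endo" where "adE X = endo (lb X)"

lemma linear_bracket: "linear (lb X)" by(rule linearI) (simp_all add: bracket_def matrix_ring_simps algebra_simps)

lemma eapp_adE [simp]: "eapp (adE X) = lb X" by(simp add:adE_def linear_bracket)

lemma bracket_add_left: "lb (X + Y) Z = lb X Z + lb Y Z"
 and bracket_add_right: "lb X (Y + Z) = lb X Y + lb X Z"
 and bracket_diff_left: "lb (X - Y) Z = lb X Z - lb Y Z"
 and bracket_diff_right: "lb X (Y - Z) = lb X Y - lb X Z"
 and bracket_scale_left: "lb (c *. X) Z = c *. lb X Z"
 and bracket_scale_right: "lb X (c *. Z) = c *. lb X Z"
 and bracket_minus_left: "lb (- X) Z = - lb X Z"
 and bracket_minus_right: "lb X (- Z) = - lb X Z" by(simp_all add: bracket_def matrix_ring_simps algebra_simps)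

lemma bracket_zero_left [simp]: "lb 0 X = 0" and bracket_zero_right [simp]: "lb X 0 = 0" by(simp_all add: bracket_def)

lemmas bracket_simps = bracket_add_left bracket_add_right bracket_diff_left bracket_diff_right
 bracket_scale_left bracket_scale_right bracket_minus_left bracket_minus_right

lemma bracket_self [simp]: "lb X X = 0" by(simp add:bracket_def)

lemma bracket_commute: "lb X Y = - lb Y X" by(simp add:bracket_def)

lemma jacobi: "lb X (lb Y Z) = lb (lb X Y) Z + lb Y (lb X Z)" by(simp add:bracket_def matrix_ring_simps)

lemma linear_adE: "linear adE" by(rule linearI; rule endo_eqI) (simp_all add: bracket_simps eapp.add_left eapp.scaleR_left)

text \<open>\<open>ad X\<close> is the sum of left multiplication by \<open>X\<close> and right
  multiplication by \<open>-X\<close>. These commute, so the exponential factors. Right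
  multiplication reverses products, which is harmless for powers of a single matrix.\<close>

lemma exp_adE:
 fixes X Y :: "real^'n^'n"
 shows "eapp (exp (adE X)) Y = mexp X**Y**mexp (- X)"
proof -
 define l where "l A = endo (%Y :: real^'n^'n. A**Y)" for A :: "real^'n^'n"
 define r where "r A = endo (%Y :: real^'n^'n. Y**A)" for A :: "real^'n^'n"
 have ll: "linear (%Y :: real^'n^'n. A**Y)" "linear (%Y :: real^'n^'n. Y**A)" for A :: "real^'n^'n"
  using mm.bounded_linear_left mm.bounded_linear_right by(auto intro: bounded_linear.linear)
 have el [simp]: "eapp (l A) Y = A**Y" "eapp (r A) Y = Y**A" for A Y by(simp_all add: l_def r_def ll)
 have bl: "bounded_linear l" "bounded_linear r" unfolding linear_conv_bounded_linear[symmetric]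
  by(rule linearI; rule endo_eqI; simp add:eapp.add_left eapp.scaleR_left matrix_ring_simps)+
 have lm: "l (A**B) = l A * l B" "r (A**B) = r B * r A" for A B by(rule endo_eqI; simp add:mma)+
 have one: "l (mat 1) = 1" "r (mat 1) = 1" by(rule endo_eqI; simp)+
 have lp: "l (mat_of (T ^ n)) = l (mat_of T) ^ n" "r (mat_of (T ^ n)) = r (mat_of T) ^ n" for T n by(induction n) (simp_all add: one mat_of_mult lm power_commutes)
 have hl: "l (mat_of (exp T)) = exp (l (mat_of T))" "r (mat_of (exp T)) = exp (r (mat_of T))" for T
  by(rule exp_algebra_hom[of "%T. l (mat_of T)"] exp_algebra_hom[of "%T. r (mat_of T)"],
    rule bounded_linear_compose[OF _ bounded_linear_mat_of], rule bl, rule lp)+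
 have ad: "adE X = l X + r (- X)" by(rule endo_eqI) (simp add:eapp.add_left bracket_def matrix_ring_simps)
 have "l X * r (- X) = r (- X) * l X" by(rule endo_eqI) (simp add:matrix_ring_simps)
 hence "exp (adE X) = exp (l X) * exp (r (- X))" unfolding ad by(rule exp_add_commuting)
 also have "... = l (mexp X) * r (mexp (- X))" using hl(1)[of "emat X"] hl(2)[of "emat (- X)"] by(simp add:mat_exp_eq)
 finally show ?thesis by(simp add:mma)
qed

text \<open>The function \<open>s dexp (s T)\<close> is the integral of \<open>exp (- s T)\<close>
  from 0, found by termwise differentiation. It turns the series \<open>dexp\<close> into an
  integrated conjugation.\<close>

lemma scaled_dexp_has_vector_derivative:
 fixes T :: "'a::{real_normed_algebra_1,banach}"
 assumes s: "s : {0..1}"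
 shows "((%s. s *. dexp (s *. T)) hvd exp (- (s *. T))) (at s within {0..1})"
proof -
 define f where "f k s = ((-1) ^ k * s ^ Suc k / fact (Suc k)) *. T ^ k" for k and s :: real
 define d where "d k s = ((-1) ^ k * s ^ k / fact k) *. T ^ k" for k and s :: real
 have der: "(f k has_derivative (%h. h *. d k s)) (at s within {0..1})" for k s
 proof -
  have "((%s. (-1) ^ k / fact (Suc k) * s ^ Suc k) has_real_derivative
    (-1) ^ k / fact (Suc k) * (real (Suc k) * s ^ k)) (at s within {0..1})" by(intro DERIV_cmult) (use DERIV_pow[of "Suc k" s] in \<open>simp del: power_Suc of_nat_Suc\<close>)
  moreover have "(-1) ^ k / fact (Suc k) * (real (Suc k) * s ^ k) = (-1) ^ k * s ^ k / fact k"
  proof -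
   have "fact (Suc k) = real (Suc k) * fact k" by(rule fact_Suc)
   thus ?thesis by(simp del: of_nat_Suc)
  qed
  ultimately have "((%s. (-1) ^ k * s ^ Suc k / fact (Suc k)) has_real_derivative (-1) ^ k * s ^ k / fact k) (at s within {0..1})" by simp
  hence "(f k hvd ((-1) ^ k * s ^ k / fact k) *. T ^ k) (at s within {0..1})" unfolding f_def by(rule has_vector_derivative_scaleR[where g = "%_. T ^ k" and g' = 0, simplified])
  thus ?thesis by(simp add:has_vector_derivative_def d_def)
 qed
 have dsums: "(%k. d k s) sums exp (- (s *. T))" for s
 proof -
  have "(%k. (- (s *. T)) ^ k /\<^sub>R fact k) sums exp (- (s *. T))" by(rule exp_converges)
  moreover have "(- (s *. T)) ^ k /\<^sub>R fact k = d k s" for k using scaleR_power[of "- s" T k] by(simp add:d_def power_minus[of s] divide_inverse mult_ac)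
  ultimately show ?thesis by simp
 qed
 have ul: "uniform_limit {0..1} (%n s. \<Sum>k<n. d k s) (%s. \<Sum>k. d k s) sequentially"
 proof (rule Weierstrass_m_test)
  show "norm (d k s) <= norm T ^ k /\<^sub>R fact k" if "s : {0..1}" for k s
  proof -
   have "norm (d k s) = \<bar>s\<bar> ^ k / fact k * norm (T ^ k)" by(simp add:d_def abs_mult power_abs)
   also have "... <= 1 / fact k * norm T ^ k" using that by(intro mult_mono divide_right_mono norm_power_ineq power_le_one) auto
   finally show ?thesis by(simp add:divide_inverse)
  qed
  show "summable (%k. norm T ^ k /\<^sub>R fact k)" using exp_converges[of "norm T"] by(rule sums_summable)
 qed
 have "EX g. ALL x:{0..1}. (%n. f n x) sums (g x) &
   (g has_derivative (%h. h *. exp (- (x *. T)))) (at x within {0..1})"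
 proof (rule has_derivative_series[OF _ der])
  show "convex {0..1::real}" by simp
  show "(0::real) : {0..1}" by simp
  show "(%n. f n 0) sums 0" by(simp add:f_def)
  fix e :: real assume "0 < e"
  hence "\<forall>\<^sub>F n in sequentially. ALL x:{0..1}. dist (\<Sum>k<n. d k x) (\<Sum>k. d k x) < e" using ul by(simp add:uniform_limit_iff)
  thus "\<forall>\<^sub>F n in sequentially. ALL x:{0..1}. ALL h. norm ((\<Sum>i<n. h *. d i x) - h *. exp (- (x *. T))) <= e * norm h"
  proof (rule eventually_mono, intro ballI allI)
   fix n x h assume a: "ALL x:{0..1}. dist (\<Sum>k<n. d k x) (\<Sum>k. d k x) < e" and x: "x : {0..1::real}"
   have "norm ((\<Sum>i<n. h *. d i x) - h *. exp (- (x *. T))) = \<bar>h\<bar> * norm ((\<Sum>i<n. d i x) - exp (- (x *. T)))"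
    by(simp add:scaleR_sum_right[symmetric] scaleR_diff_right[symmetric])
   also have "... <= \<bar>h\<bar> * e" using a x sums_unique[OF dsums[of x]] by(intro mult_left_mono) (auto simp: dist_norm less_imp_le)
   finally show "norm ((\<Sum>i<n. h *. d i x) - h *. exp (- (x *. T))) <= e * norm h" by(simp add:mult.commute)
  qed
 qed
 then obtain g where g: "!!x. x : {0..1} ==> (%n. f n x) sums (g x)"
  "!!x. x : {0..1} ==> (g has_derivative (%h. h *. exp (- (x *. T)))) (at x within {0..1})" by blast
 have "g x = x *. dexp (x *. T)" if "x : {0..1}" for x
 proof -
  have "(%k. x *. ((-1) ^ k *. (x *. T) ^ k /\<^sub>R fact (Suc k))) sums (x *. dexp (x *. T))" by(intro sums_scaleR_right dexp_sums)
  moreover have "x *. ((-1) ^ k *. (x *. T) ^ k /\<^sub>R fact (Suc k)) = f k x" for k by(simp add:f_def scaleR_power divide_inverse mult_ac)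
  ultimately show ?thesis using sums_unique2[OF g(1)[OF that]] by simp
 qed
 thus ?thesis using has_derivative_transform[OF s _ g(2)[OF s]] by(simp add:has_vector_derivative_def)
qed

lemma norm_matrix_mult: "norm (a**b) <= norm a * norm b" for a b :: "real^'n^'n"
proof -
 have sq: "(norm x)\<^sup>2 = (SUM i:UNIV. SUM j:UNIV. (x $ i $ j)\<^sup>2)" for x :: "real^'n^'n" unfolding power2_norm_eq_inner by(simp add:inner_vec_def power2_eq_square)
 have "((a**b) $ i $ j)\<^sup>2 <= (SUM k:UNIV. (a $ i $ k)\<^sup>2) * (SUM k:UNIV. (b $ k $ j)\<^sup>2)" for i j
  unfolding matrix_matrix_mult_def vec_lambda_beta by(rule Cauchy_Schwarz_ineq_sum)
 hence "(norm (a**b))\<^sup>2 <= (SUM i:UNIV. SUM j:UNIV. (SUM k:UNIV. (a $ i $ k)\<^sup>2) * (SUM k:UNIV. (b $ k $ j)\<^sup>2))" unfolding sq by(intro sum_mono)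
 also have "... = (norm a)\<^sup>2 * (norm b)\<^sup>2" unfolding sq sum_product[symmetric] by(simp add:sum.swap[of "%j k. (b $ k $ j)\<^sup>2"])
 finally show ?thesis by(simp flip: power_mult_distrib)
qed

lemma vector_mean_value_bound:
 fixes f :: "real => 'a::real_normed_vector"
 assumes "!!s. s : {0..1} ==> (f hvd f' s) (at s within {0..1})"
  and "!!s. s : {0..1} ==> norm (f' s) <= B" and "t : {0..1}"
 shows "norm (f t - f 0) <= B"
proof -
 have B: "0 <= B" by(rule order_trans[OF norm_ge_zero assms(2)[of 0]]) simp
 have "norm (f t - f 0) <= B * norm (t - 0)"
 proof (rule differentiable_bound[of "{0..1}" f "%s h. h *. f' s"])
  show "onorm (%h. h *. f' s) <= B" if "s : {0..1}" for s using assms(2)[OF that] by(intro onorm_bound[OF B]) (simp add:mult.commute[of B] mult_left_mono)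
 qed (use assms in \<open>auto simp: has_vector_derivative_def\<close>)
 also have "... <= B * 1" using assms(3) B by(intro mult_left_mono) auto
 finally show ?thesis by simp
qed

lemma mat_exp_bounded: "EX C>0. ALL A :: real^'n^'n. norm A <= R --> norm (mexp A) <= C"
proof -
 have "compact (mexp ` cball (0 :: real^'n^'n) R)" by(intro compact_continuous_image continuous_intros compact_cball)
 then obtain C where "C > 0" "!!x. x : mexp ` cball (0 :: real^'n^'n) R ==> norm x <= C" using compact_imp_bounded bounded_pos by metis
 thus ?thesis by(intro exI[of _ C]) auto
qed

text \<open>Duhamel's argument. The curve \<open>y s = exp (- s V) exp (s (V + W))\<close> solves
  \<open>y' = c y\<close>, where \<open>c s\<close> is \<open>W\<close> conjugated by
  \<open>exp (- s V)\<close>, and \<open>z\<close> is the integral of \<open>c\<close>. Hence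
  \<open>y - 1 - z\<close> has the derivative \<open>c (y - 1)\<close>, which is quadratic in
  \<open>W\<close>.\<close>

lemma mat_exp_has_derivative_left:
 fixes V :: "real^'n^'n"
 shows "((%W. mexp (- V)**mexp (V + W)) has_derivative eapp (dexp (adE V))) (at 0)"
proof -
 obtain C where C: "C > 0" "!!A :: real^'n^'n. norm A <= norm V + 1 ==> norm (mexp A) <= C" using mat_exp_bounded[of "norm V + 1"] by auto
 \<comment> \<open>Two factors \<open>C\<close> come from \<open>c\<close>, and four from the bound
   on \<open>y - 1\<close>, which contains \<open>c\<close> and \<open>y\<close>.\<close>
 define M where "M = C ^ 6"
 have main: "norm (mexp (- V)**mexp (V + W) - mat 1 - eapp (dexp (adE V)) W) <= M * norm W ^ 2"
  if W: "norm W <= 1" for W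
 proof -
  define y where "y s = mexp (s *. (- V))**mexp (s *. (V + W))" for s
  define c where "c s = mexp (s *. (- V))**W**mexp (s *. V)" for s
  define z where "z s = eapp (s *. dexp (s *. adE V)) W" for s
  have small: "norm (mexp (s *. (- V))) <= C" "norm (mexp (s *. V)) <= C"
   "norm (mexp (s *. (V + W))) <= C" if "s : {0..1}" for s
  proof -
   have "norm V * s <= norm V * 1" using that by(intro mult_left_mono) auto
   moreover have "norm (V + W) * s <= (norm V + 1) * 1" using that W norm_triangle_ineq[of V W] by(intro mult_mono) auto
   ultimately show "norm (mexp (s *. (- V))) <= C" "norm (mexp (s *. V)) <= C"
   "norm (mexp (s *. (V + W))) <= C" using that by(auto intro!: C(2) simp: mult.commute)
  qed
  have y': "(y hvd c s**y s) (at s within {0..1})" for s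
  proof -
   have "(y hvd
     mexp (s *. (- V))**((V + W)**mexp (s *. (V + W))) +
     (mexp (s *. (- V))**(- V))**mexp (s *. (V + W))) (at s within {0..1})" unfolding y_def
    by(intro mm.has_vector_derivative mat_exp_has_vector_derivative_left mat_exp_has_vector_derivative_right)
   moreover have "mexp (s *. V)**mexp (s *. (- V)) = mat 1" by simp
   hence "c s**y s = mexp (s *. (- V))**W**mexp (s *. (V + W))" unfolding c_def y_def by(metis mma matrix_mul_lid)
   ultimately show ?thesis by(simp add:matrix_ring_simps)
  qed
  have cz: "c s = eapp (exp (- (s *. adE V))) W" for s using exp_adE[of "- s *. V" W] by(simp add:c_def linear_scale[OF linear_adE] linear_neg[OF linear_adE])
  have z': "(z hvd c s) (at s within {0..1})" if "s : {0..1}" for s unfolding z_def cz by(rule bounded_linear.has_vector_derivative[OF eapp.bounded_linear_left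
      scaled_dexp_has_vector_derivative[OF that]])
  have cb: "norm (c s) <= C * C * norm W" if "s : {0..1}" for s
  proof -
   have "norm (c s) <= norm (mexp (s *. (- V))**W) * norm (mexp (s *. V))" unfolding c_def by(rule norm_matrix_mult)
   also have "... <= ((C * norm W) * C)" using small[OF that] C by(intro mult_right_mono mult_mono order_trans[OF norm_matrix_mult]) auto
   finally show ?thesis by(simp add:mult_ac)
  qed
  have yb: "norm (y s) <= C * C" if "s : {0..1}" for s unfolding y_def using small[OF that] C by(intro order_trans[OF norm_matrix_mult] mult_right_mono mult_mono) auto
  have ya: "norm (y s - mat 1) <= C * C * norm W * (C * C)" if "s : {0..1}" for s
  proof -
   have "norm (y s - y 0) <= C * C * norm W * (C * C)"
   proof (rule vector_mean_value_bound[OF y' _ that])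
    show "norm (c s**y s) <= C * C * norm W * (C * C)" if "s : {0..1}" for s using cb[OF that] yb[OF that] C
     by(intro order_trans[OF norm_matrix_mult] mult_right_mono mult_mono) auto
   qed
   thus ?thesis by(simp add:y_def)
  qed
  have d': "((%s. y s - z s) hvd c s**(y s - mat 1)) (at s within {0..1})"
   if "s : {0..1}" for s using has_vector_derivative_diff[OF y' z'[OF that]] by(simp add:matrix_ring_simps)
  have "norm ((y 1 - z 1) - (y 0 - z 0)) \<le>
   (C * C * norm W) * (C * C * norm W * (C * C))"
  proof (rule vector_mean_value_bound[OF d'])
   show "norm (c s**(y s - mat 1)) <= (C * C * norm W) * (C * C * norm W * (C * C))"
    if "s : {0..1}" for s using cb[OF that] ya[OF that] C by(intro order_trans[OF norm_matrix_mult] mult_right_mono mult_mono) auto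
  qed auto
  thus ?thesis by(simp add:y_def z_def M_def eapp.zero_left eval_nat_numeral algebra_simps)
 qed
 show ?thesis unfolding has_derivative_within_alt
 proof (intro conjI allI impI)
  show "bounded_linear (eapp (dexp (adE V)))" by(rule eapp.bounded_linear_right)
  fix e :: real assume e: "0 < e"
  define N where "N = \<bar>M\<bar> + 1"
  show "EX d>0. ALL W:UNIV. norm (W - 0) < d --> norm (mexp (- V)**mexp (V + W) -
    mexp (- V)**mexp (V + 0) - eapp (dexp (adE V)) (W - 0)) <= e * norm (W - 0)"
  proof (intro exI[of _ "min 1 (e / N)"] conjI ballI impI)
   have N: "N > 0" by(simp add:N_def)
   show "0 < min 1 (e / N)" using e N by simp
   fix W :: "real^'n^'n" assume W: "norm (W - 0) < min 1 (e / N)"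
   hence "norm (mexp (- V)**mexp (V + W) - mat 1 - eapp (dexp (adE V)) W) <= (M) * norm W * norm W" using main[of W] by(simp add:power2_eq_square mult_ac)
   also have "... <= N * norm W * norm W" by(intro mult_right_mono) (auto simp: N_def)
   also have "... <= e * norm W" using W N by(intro mult_right_mono) (auto simp: field_simps)
   finally show "norm (mexp (- V)**mexp (V + W) -
    mexp (- V)**mexp (V + 0) - eapp (dexp (adE V)) (W - 0)) <= e * norm (W - 0)" by simp
  qed
 qed
qed

definition proj :: "'a::euclidean_space set => 'a => 'a" where "proj V = (SOME f. linear f & (ALL x. f x : V) & (ALL x:V. f x = x) & (ALL x y. f x \<bullet> y = x \<bullet> f y))"

lemma proj_exists:
 fixes V :: "'a::euclidean_space set"
 assumes "subspace V"
 shows "EX f. linear f & (ALL x. f x : V) & (ALL x:V. f x = x) & (ALL x y. f x \<bullet> y = x \<bullet> f y)"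
proof -
 obtain B where B: "B <= V" "pairwise orthogonal B" "!!x. x : B ==> norm x = 1" "independent B" "span B = V" using orthonormal_basis_subspace[OF assms] by metis
 have fin: "finite B" using B(4) by(rule independent_imp_finite)
 define f where "f x = (SUM b:B. (x \<bullet> b) *. b)" for x
 have lin: "linear f" unfolding f_def by(rule linearI) (simp_all add: inner_add_left scaleR_add_left sum.distrib scaleR_sum_right)
 have fb: "f b = b" if b: "b : B" for b
 proof -
  have "f b = (SUM c:B. if c = b then b else 0)" unfolding f_def
  proof (rule sum.cong)
   fix c assume "c : B"
   thus "(b \<bullet> c) *. c = (if c = b then b else 0)" using B(2) B(3)[OF b] b by(auto simp: pairwise_def orthogonal_def inner_commute norm_eq_1)
  qed simp
  thus ?thesis using b fin by simp
 qed
 have "f x = x" if "x : V" for x using linear_eq_on_span[OF lin linear_id, of B x] fb that B(5) by simp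
 moreover have "f x : V" for x unfolding f_def using B(1) assms by(intro subspace_sum subspace_scale) auto
 moreover have "f x \<bullet> y = x \<bullet> f y" for x y by(simp add:f_def inner_sum_left inner_sum_right inner_commute mult.commute)
 ultimately show ?thesis using lin by blast
qed

lemma
 assumes "subspace V"
 shows linear_proj: "linear (proj V)" and proj_in: "proj V x : V"
  and proj_id: "x : V ==> proj V x = x" and proj_sym: "proj V x \<bullet> y = x \<bullet> proj V y" using someI_ex[OF proj_exists[OF assms]] unfolding proj_def[symmetric] by auto

lemma has_vector_derivative_quotient:
 assumes "(f hvd X) (at a within S)"
 shows "((%s. (f s - f a) /\<^sub>R (s - a)) \<longlongrightarrow> X) (at a within S)"
proof -
 have 0: "((%s. (f s - f a - (s - a) *. X) /\<^sub>R norm (s - a)) \<longlongrightarrow> 0) (at a within S)"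
  using assms by(simp add:has_vector_derivative_def has_derivative_at_within)
 have "((%s. (f s - f a) /\<^sub>R (s - a) - X) \<longlongrightarrow> 0) (at a within S)"
 proof (rule Lim_transform_eventually[OF tendsto_norm_zero_cancel, rotated])
  show "\<forall>\<^sub>F s in at a within S. (f s - f a - (s - a) *. X) /\<^sub>R (s - a) = (f s - f a) /\<^sub>R (s - a) - X"
   unfolding eventually_at_filter by(rule always_eventually) (simp add:scaleR_diff_right)
  show "((%s. norm ((f s - f a - (s - a) *. X) /\<^sub>R (s - a))) \<longlongrightarrow> 0) (at a within S)" using tendsto_norm_zero[OF 0] by simp
 qed
 thus ?thesis by(simp add:LIM_zero_iff)
qed

section \<open>Closed linear groups\<close>

text \<open>Closedness is relative to the invertible matrices and is stated by sequences: a limit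
  belongs to the group once it is invertible. In this form the locale serves both \<open>G\<close>
  and its compact subgroup \<open>K\<close>.\<close>

locale matgroup =
 fixes G :: "(real^'n^'n) set"
 assumes inv: "A : G ==> invertible A"
  and one: "mat 1 : G"
  and mult: "A : G ==> B : G ==> A**B : G"
  and minv: "A : G ==> mi A : G"
  and lim: "(!!n. g n : G) ==> g ----> L ==> invertible L ==> L : G"

lemma matrix_inv_right [simp]: "invertible A ==> A**mi A = mat 1"
 and matrix_inv_left [simp]: "invertible A ==> mi A**A = mat 1" for A :: "real^'n^'n" unfolding matrix_inv_def invertible_def by(metis (mono_tags, lifting) someI)+

lemma invertible_matrix_inv [simp]: "invertible A ==> invertible (mi A)" for A :: "real^'n^'n" unfolding invertible_def[of "mi A"] by(metis matrix_inv_left matrix_inv_right)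

lemma matrix_inv_matrix_inv [simp]: "invertible A ==> mi (mi A) = A" for A :: "real^'n^'n" by(simp add:matrix_inv_eqI)

lemma matrix_inv_mult: "invertible A ==> invertible B ==> mi (A**B) = mi B**mi A"
 for A B :: "real^'n^'n"
proof (rule matrix_inv_eqI)
 assume "invertible A" "invertible B"
 have "A**B**(mi B**mi A) = A**(B**mi B)**mi A" by(simp only: mma)
 thus "A**B**(mi B**mi A) = mat 1" using `invertible A` `invertible B` by simp
qed

lemma matrix_inv_one [simp]: "mi (mat 1 :: real^'n^'n) = mat 1" by(simp add:matrix_inv_eqI)

text \<open>An open mapping theorem that asks for differentiability at the single point 0 gives
  logarithms near 1; no smooth inverse is constructed.\<close>

lemma mat_exp_log_near_1:
 fixes r :: real assumes "0 < r"
 obtains d where "0 < d" "!!g :: real^'n^'n. norm (g - mat 1) < d ==> EX w. norm w < r & mexp w = g"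
proof -
 have "mexp (0 :: real^'n^'n) : interior (mexp ` ball 0 r)"
 proof (rule sussmann_open_mapping[where S = UNIV and g' = "%x. x" and f' = "%x. x"])
  show "(mexp has_derivative (%x. x)) (at (0 :: real^'n^'n))" by(rule mat_exp_has_derivative_0)
  show "(0 :: real^'n^'n) : interior (ball 0 r)" using assms by(simp add:interior_open)
 qed (auto intro!: continuous_intros bounded_linear_ident)
 then obtain d where "0 < d" "ball (mat 1) d <= (mexp ` ball (0 :: real^'n^'n) r)" unfolding mem_interior by auto
 thus ?thesis by(intro that[of d]) (fastforce simp: dist_norm norm_minus_commute subset_iff image_iff)+
qed

context matgroup
begin

lemma power_in: "A : G ==> ((**) A ^^ k) (mat 1) : G" by(induction k) (auto simp: one mult)

lemma lie_exp: "X : lie_algebra G ==> mexp X : G" unfolding lie_algebra_def by(drule CollectD, drule spec[of _ 1]) simp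

text \<open>Small logarithms \<open>w n\<close> of \<open>g n\<close> satisfy
  \<open>w n / t n --> X\<close>. Powers of \<open>g n\<close> then converge to
  \<open>exp (s X)\<close>, and closedness of the group keeps the limit inside.\<close>

lemma lie_algebra_limit:
 assumes g: "!!n. g n : G" and t: "!!n. t n > 0" "t ----> 0"
  and X: "(%n. (g n - mat 1) /\<^sub>R t n) ----> X"
 shows "X : lie_algebra G"
proof -
 have g1: "(%n. norm (g n - mat 1)) ----> 0"
 proof -
  have "(%n. t n *. ((g n - mat 1) /\<^sub>R t n)) ----> 0 *. X" by(intro tendsto_intros t X)
  moreover have "t n *. ((g n - mat 1) /\<^sub>R t n) = g n - mat 1" for n using t(1)[of n] by simp
  ultimately show ?thesis using tendsto_norm_zero by fastforce
 qed
 obtain r where r: "0 < r" "!!x y :: real^'n^'n. norm x <= r ==> norm y <= r ==>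
  norm (mexp x - mexp y - (x - y)) <= (1/2) * norm (x - y)" using mat_exp_near_0[of "1/2"] by(metis half_gt_zero zero_less_one)
 obtain d where d: "0 < d" "!!h :: real^'n^'n. norm (h - mat 1) < d ==> EX w. norm w < r & mexp w = h" using mat_exp_log_near_1[OF r(1)] by blast
 define w where "w n = (if norm (g n - mat 1) < d then SOME w. norm w < r & mexp w = g n else 0)" for n
 have w: "norm (w n) < r & mexp (w n) = g n" if "norm (g n - mat 1) < d" for n using someI_ex[OF d(2)[OF that]] that by(simp add:w_def)
 have ev: "\<forall>\<^sub>F n in sequentially. norm (g n - mat 1) < d" using g1 d(1) by(rule order_tendstoD)
 \<comment> \<open>The error of \<open>exp\<close> is at most half its argument on this ball, so the
   logarithm is at most twice as long as \<open>g n - 1\<close>.\<close>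
 have wle: "norm (w n) <= 2 * norm (g n - mat 1)" if "norm (g n - mat 1) < d" for n
 proof -
  have "norm (mexp (w n) - mexp 0 - (w n - 0)) <= 1/2 * norm (w n - 0)" using w[OF that] r by(intro r(2)) auto
  hence "norm (g n - mat 1 - w n) <= 1/2 * norm (w n)" using w[OF that] by simp
  thus ?thesis using norm_triangle_ineq3[of "g n - mat 1" "w n"] by linarith
 qed
 have wX: "(%n. w n /\<^sub>R t n) ----> X"
 proof -
  have "(%n. (g n - mat 1 - w n) /\<^sub>R t n) ----> 0"
  proof (rule tendstoI)
   fix e :: real assume e: "0 < e"
   obtain B where B: "B > 0" "!!n. norm ((g n - mat 1) /\<^sub>R t n) <= B" using convergent_imp_Bseq[of "%n. (g n - mat 1) /\<^sub>R t n"] X by(auto simp: convergent_def Bseq_def)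
   define e' where "e' = e / (4 * B)"
   have e': "0 < e'" using e B by(simp add:e'_def)
   obtain s where s: "0 < s" "!!x y :: real^'n^'n. norm x <= s ==> norm y <= s ==>
     norm (mexp x - mexp y - (x - y)) <= e' * norm (x - y)" using mat_exp_near_0[OF e'] by blast
   have "\<forall>\<^sub>F n in sequentially. norm (g n - mat 1) < s / 2" using g1 s(1) by(intro order_tendstoD) auto
   with ev show "\<forall>\<^sub>F n in sequentially. dist ((g n - mat 1 - w n) /\<^sub>R t n) 0 < e"
   proof eventually_elim
    case (elim n)
    have "norm (mexp (w n) - mexp 0 - (w n - 0)) <= e' * norm (w n - 0)" using wle[OF elim(1)] elim s by(intro s(2)) auto
    hence "norm (g n - mat 1 - w n) <= e' * (2 * norm (g n - mat 1))"
     using w[OF elim(1)] mult_left_mono[OF wle[OF elim(1)], of e'] e' by(simp only: mat_exp_0 diff_0_right) linarith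
    hence "norm (g n - mat 1 - w n) / t n <= e' * 2 * (norm (g n - mat 1) / t n)" using t(1)[of n] by(simp add:divide_right_mono)
    also have "... <= e' * 2 * B" using B(2)[of n] e' t(1)[of n] by(intro mult_left_mono) (auto simp: divide_inverse_commute)
    also have "... < e" using e B(1) by(simp add:e'_def)
    finally show ?case using t(1)[of n] by(simp add:divide_inverse_commute)
   qed
  qed
  hence "(%n. (g n - mat 1) /\<^sub>R t n - (g n - mat 1 - w n) /\<^sub>R t n) ----> X - 0" by(intro tendsto_diff X)
  thus ?thesis by(simp add:scaleR_diff_right[symmetric])
 qed
 have pos: "mexp (s *. X) : G" if s: "0 <= s" for s
 proof -
  \<comment> \<open>\<open>k n\<close> steps of length \<open>t n\<close> reach time
    \<open>s\<close> up to less than one step.\<close>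
  define k where "k n = nat \<lfloor>s / t n\<rfloor>" for n
  have k1: "real (k n) <= s / t n" and k2: "s / t n < real (k n) + 1" for n using s t(1)[of n] by(auto simp: k_def)
  have kt: "(%n. real (k n) * t n) ----> s"
  proof (rule tendsto_sandwich[of "%n. s - t n" _ _ "%n. s"])
   show "\<forall>\<^sub>F n in sequentially. s - t n <= real (k n) * t n" using k2 t(1) by(intro always_eventually allI) (simp add:field_simps less_imp_le)
   show "\<forall>\<^sub>F n in sequentially. real (k n) * t n <= s" using k1 t(1) by(intro always_eventually allI) (simp add:field_simps)
   show "(%n. s - t n) ----> s" using tendsto_diff[OF tendsto_const t(2), of s] by simp
  qed simp
  have "(%n. (real (k n) * t n) *. (w n /\<^sub>R t n)) ----> s *. X" by(intro tendsto_intros kt wX)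
  moreover have "(real (k n) * t n) *. (w n /\<^sub>R t n) = real (k n) *. w n" for n using t(1)[of n] by(simp add:field_simps)
  ultimately have kw: "(%n. real (k n) *. w n) ----> s *. X" by(simp only:)
  have "isCont (mexp :: real^'n^'n => _) (s *. X)" using continuous_on_mat_exp[OF continuous_on_id, of "UNIV :: (real^'n^'n) set"] by(simp add:continuous_on_eq_continuous_at)
  hence "(%n. mexp (real (k n) *. w n)) ----> mexp (s *. X)" using kw by(rule isCont_tendsto_compose)
  moreover have "\<forall>\<^sub>F n in sequentially. mexp (real (k n) *. w n) = ((**) (g n) ^^ k n) (mat 1)" using ev by eventually_elim (simp add:mat_exp_of_nat w)
  ultimately have "(%n. ((**) (g n) ^^ k n) (mat 1)) ----> mexp (s *. X)" by(rule Lim_transform_eventually)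
  thus ?thesis using lim[OF power_in[OF g]] by simp
 qed
 have "mexp (s *. X) : G" for s
 proof (cases "0 <= s")
  case False
  hence "mexp ((- s) *. X) : G" by(intro pos) simp
  from minv[OF this] show ?thesis by simp
 qed (rule pos)
 thus ?thesis by(simp add:lie_algebra_def)
qed

text \<open>A one-sided derivative is used so that the criterion also applies at the end points of a
  path.\<close>

lemma lie_algebra_curve:
 assumes d: "0 < d" and c: "!!s. 0 <= s ==> s <= d ==> c s : G" and c0: "c 0 = mat 1"
  and der: "(c hvd X) (at 0 within {0..d})"
 shows "X : lie_algebra G"
proof (rule lie_algebra_limit[of "%n. c (d / real (Suc n))" "%n. d / real (Suc n)"])
 show t0: "(%n. d / real (Suc n)) ----> 0" using LIMSEQ_inverse_real_of_nat[THEN tendsto_mult_left, of d] by(simp add:divide_inverse)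
 have le: "d / real (Suc n) <= d" for n using d by(simp add:field_simps)
 show "c (d / real (Suc n)) : G" for n using d le by(intro c) auto
 show pos: "0 < d / real (Suc n)" for n using d by simp
 have fl: "filterlim (%n. d / real (Suc n)) (at 0 within {0..d}) sequentially" unfolding filterlim_at using t0 pos le by(auto intro!: always_eventually simp: less_imp_le)
 from filterlim_compose[OF has_vector_derivative_quotient[OF der] fl]
 show "(%n. (c (d / real (Suc n)) - mat 1) /\<^sub>R (d / real (Suc n))) ----> X" by(simp add:c0)
qed

text \<open>For sums: \<open>exp (t X) exp (t Y)\<close> is a curve in the group with initial
  velocity \<open>X + Y\<close>.\<close>

lemma subspace_lie_algebra: "subspace (lie_algebra G)" unfolding subspace_def
proof (intro conjI ballI allI)
 show "0 : lie_algebra G" by(simp add:lie_algebra_def one)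
 show "c *. X : lie_algebra G" if "X : lie_algebra G" for c X using that by(auto simp: lie_algebra_def)
 fix X Y assume XY: "X : lie_algebra G" "Y : lie_algebra G"
 have "((%t. mexp (t *. X)**mexp (t *. Y)) hvd
   (mexp (0 *. X)**(mexp (0 *. Y)**Y) + (mexp (0 *. X)**X)**mexp (0 *. Y)))
   (at 0 within {0..1})" by(intro mm.has_vector_derivative mat_exp_has_vector_derivative_right)
 hence "((%t. mexp (t *. X)**mexp (t *. Y)) hvd X + Y) (at 0 within {0..1})" by(simp add:add.commute)
 thus "X + Y : lie_algebra G" by(rule lie_algebra_curve[rotated -1]) (use XY in \<open>auto simp: lie_algebra_def intro: mult\<close>)
qed

lemma lie_algebra_Ad: "g : G ==> X : lie_algebra G ==> g**X**mi g : lie_algebra G"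
proof -
 assume g: "g : G" and X: "X : lie_algebra G"
 have "mexp (t *. (g**X**mi g)) = g**mexp (t *. X)**mi g" for t using mat_exp_conj[of g "mi g" "t *. X"] inv[OF g] by(simp add:matrix_ring_simps)
 thus ?thesis using X g by(auto simp: lie_algebra_def intro!: mult minv)
qed

text \<open>The bracket is the derivative at 0 of \<open>Y\<close> conjugated by
  \<open>exp (t X)\<close>, a curve in a subspace and hence in a closed set.\<close>

lemma lie_algebra_bracket:
 assumes X: "X : lie_algebra G" and Y: "Y : lie_algebra G"
 shows "lb X Y : lie_algebra G"
proof -
 define h where "h t = mexp (t *. X)**Y**mexp (t *. (- X))" for t
 have h: "h t : lie_algebra G" for t using lie_algebra_Ad[of "mexp (t *. X)" Y] X Y by(auto simp: h_def lie_algebra_def)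
 have "(h hvd ((mexp (0 *. X)**Y)**(mexp (0 *. (- X))**(- X)) +
   ((mexp (0 *. X)**0 + mexp (0 *. X)**X**Y)**mexp (0 *. (- X))))) (at 0)" unfolding h_def
  by(intro mm.has_vector_derivative mat_exp_has_vector_derivative_right has_vector_derivative_const)
 hence "(h hvd lb X Y) (at 0)" by(simp add:bracket_def matrix_ring_simps)
 hence "((%s. (h (0 + s) - h 0) /\<^sub>R s) \<longlongrightarrow> lb X Y) (at 0)" using has_vector_derivative_quotient[of h "lb X Y" 0 UNIV] by simp
 moreover have "(h (0 + s) - h 0) /\<^sub>R s : lie_algebra G" for s using h subspace_lie_algebra by(intro subspace_scale subspace_diff) auto
 moreover have "closed (lie_algebra G)" by(rule closed_subspace[OF subspace_lie_algebra])
 ultimately show ?thesis by(intro Lim_in_closed_set[of "lie_algebra G" "%s. (h (0 + s) - h 0) /\<^sub>R s" "at 0"]) auto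
qed

end

context matgroup
begin

lemma curve_velocity_in_lie_algebra:
 assumes c: "!!t. t : {0..1} ==> c t : G" and t: "t : {0..1}"
  and der: "(c hvd v) (at t within {0..1})"
 shows "mi (c t)**v : lie_algebra G"
proof -
 \<comment> \<open>\<open>sg\<close> is the direction of time. At \<open>t = 1\<close> the curve can
   only be followed backwards, which yields the negative of the velocity.\<close>
 have main: "sg *. (mi (c t)**v) : lie_algebra G"
  if d: "0 < d" and sub: "(%s. t + sg * s) ` {0..d} <= {0..1}" for sg d :: real
 proof (rule lie_algebra_curve[OF d])
  show "mi (c t)**c (t + sg * s) : G" if "0 <= s" "s <= d" for s
  proof -
   have "t + sg * s : {0..1}" by(rule subsetD[OF sub]) (use that in auto)
   thus ?thesis using t by(intro mult minv c)
  qed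
  show "mi (c t)**c (t + sg * 0) = mat 1" using inv[OF c[OF t]] by simp
  have 1: "((%s. t + sg * s) hvd sg) (at 0 within {0..d})" by(auto intro!: derivative_eq_intros)
  have "(c hvd v) (at (t + sg * 0) within (%s. t + sg * s) ` {0..d})" using has_vector_derivative_within_subset[OF der sub] by simp
  from vector_diff_chain_within[OF 1 this]
  have "((%s. c (t + sg * s)) hvd sg *. v) (at 0 within {0..d})" by(simp add:o_def)
  from bounded_linear.has_vector_derivative[OF mm.bounded_linear_right this]
  show "((%s. mi (c t)**c (t + sg * s)) hvd sg *. (mi (c t)**v))
    (at 0 within {0..d})" by(simp add:matrix_ring_simps)
 qed
 show ?thesis
 proof (cases "t < 1")
  case True
  with main[of "1 - t" 1] t show ?thesis by auto
 next
  case False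
  hence "(-1) *. (mi (c t)**v) : lie_algebra G" using main[of 1 "-1"] t by auto
  thus ?thesis using subspace_neg[OF subspace_lie_algebra] by fastforce
 qed
qed

abbreviation "gproj == proj (lie_algebra G)"

lemmas linear_gproj = linear_proj[OF subspace_lie_algebra]
 and gproj_in = proj_in[OF subspace_lie_algebra]
 and gproj_id = proj_id[OF subspace_lie_algebra]

text \<open>The heart of the closed subgroup theorem. If there were arbitrarily short nonzero
  \<open>w\<close> orthogonal to the Lie algebra with \<open>exp w\<close> in \<open>G\<close>, a
  limit of their directions would lie in the Lie algebra by \<open>lie_algebra_limit\<close> and yet
  be killed by \<open>gproj\<close>, although it has norm 1.\<close>

lemma transversal_exp_trivial:
 obtains e where "0 < e" "!!w. norm w < e ==> gproj w = 0 ==> mexp w : G ==> w = 0"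
proof (rule ccontr)
 assume "~ thesis"
 with that have "ALL e>0. EX w. norm w < e & gproj w = 0 & mexp w : G & w ~= 0" by blast
 hence "ALL n. EX w. norm w < 1 / real (Suc n) & gproj w = 0 & mexp w : G & w ~= 0" by simp
 then obtain w where w: "!!n. norm (w n) < 1 / real (Suc n)" "!!n. gproj (w n) = 0"
  "!!n. mexp (w n) : G" "!!n. w n ~= 0" by metis
 define u where "u n = w n /\<^sub>R norm (w n)" for n
 have un: "norm (u n) = 1" for n using w(4)[of n] by(simp add:u_def)
 hence "!!n. u n : sphere 0 1" by simp
 then obtain l r where l: "l : sphere 0 1" "strict_mono r" "(u \<circ> r) ----> l" using compact_sphere[of "0 :: real^'n^'n" 1] unfolding compact_def by metis
 have w0: "w ----> 0" by(rule Lim_null_comparison[OF _ LIMSEQ_inverse_real_of_nat])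
   (use w(1) in \<open>auto simp: inverse_eq_divide intro!: always_eventually less_imp_le simp del: of_nat_Suc\<close>)
 have "l : lie_algebra G"
 proof (rule lie_algebra_limit[of "%n. mexp (w (r n))" "%n. norm (w (r n))"])
  show "mexp (w (r n)) : G" "0 < norm (w (r n))" for n using w by auto
  have wr: "(%n. w (r n)) ----> 0" using LIMSEQ_subseq_LIMSEQ[OF w0 l(2)] by(simp add:o_def)
  thus "(%n. norm (w (r n))) ----> 0" by(rule tendsto_norm_zero)
  have "((%x :: real^'n^'n. (mexp x - mexp 0 - (x - 0)) /\<^sub>R norm (x - 0)) \<longlongrightarrow> 0) (at 0)"
   using mat_exp_has_derivative_0 by(simp add:has_derivative_at_within)
  moreover have "filterlim (%n. w (r n)) (at 0) sequentially" using wr w(4) by(simp add:filterlim_at)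
  ultimately have "(%n. (mexp (w (r n)) - mexp 0 - (w (r n) - 0)) /\<^sub>R norm (w (r n) - 0)) ----> 0" by(rule filterlim_compose)
  from tendsto_add[OF this l(3)]
  show "(%n. (mexp (w (r n)) - mat 1) /\<^sub>R norm (w (r n))) ----> l" by(simp add:u_def o_def scaleR_diff_right)
 qed
 moreover have "gproj l = 0"
 proof -
  have "(%n. gproj (u (r n))) ----> gproj l" using bounded_linear.tendsto[OF linear_gproj[unfolded linear_conv_bounded_linear] l(3)] by(simp add:o_def)
  moreover have "gproj (u n) = 0" for n by(simp add:u_def linear_scale[OF linear_gproj] w)
  ultimately show ?thesis by(simp add:LIMSEQ_const_iff)
 qed
 ultimately show False using l(1) gproj_id[of l] by auto
qed

text \<open>The closed subgroup theorem as an open mapping statement: every chart of \<open>G\<close> at the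
 identity covers a neighbourhood of the identity.\<close>

lemma chart_covers:
 fixes F :: "real^'n^'n => real^'n^'n"
 assumes cont: "continuous_on UNIV F" and FG: "!!u. F u : G" and F0: "F 0 = mat 1"
  and der: "(F has_derivative F') (at 0)"
  and F'in: "!!u. F' u : lie_algebra G"
  and inj: "!!u. u : lie_algebra G ==> F' u = 0 ==> u = 0"
  and Fp: "!!u. F' (gproj u) = F' u"
  and e: "0 < e"
 obtains d where "0 < d" "!!g. g : G ==> norm (g - mat 1) < d ==>
  EX u:lie_algebra G. norm u < e & g = F u"
proof -
 obtain e0 where e0: "0 < e0" "!!w. norm w < e0 ==> gproj w = 0 ==> mexp w : G ==> w = 0" using transversal_exp_trivial by blast
 have bp: "bounded_linear gproj" using linear_gproj by(simp add:linear_conv_bounded_linear)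
 have lF': "linear F'" using der by(rule has_derivative_linear)
 obtain K where K: "K > 0" "!!u. norm (gproj u) <= norm u * K" using bounded_linear.pos_bounded[OF bp] by blast
 \<comment> \<open>The second factor supplies the directions transversal to \<open>G\<close>, so
   that \<open>f\<close> covers a neighbourhood of 1 among all matrices. Where \<open>f u\<close>
   lies in \<open>G\<close>, this factor lies in \<open>G\<close> too and must be trivial.\<close>
 define f where "f u = F u**mexp (u - gproj u)" for u
 define f' where "f' u = F' u + (u - gproj u)" for u
 have lf': "linear f'" unfolding f'_def by(intro linear_compose_add lF' linear_compose_sub linear_gproj linear_ident)
 have contf: "continuous_on UNIV f" unfolding f_def using bounded_linear.continuous_on[OF bp continuous_on_id] by(intro continuous_intros cont) auto
 have derf: "(f has_derivative f') (at 0)"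
 proof -
  have g: "((%u. u - gproj u) has_derivative (%u. u - gproj u)) (at 0)" by(intro derivative_intros bounded_linear.has_derivative[OF bp])
  have m: "(mexp has_derivative (%x. x)) (at (0 - gproj (0 :: real^'n^'n)))" using mat_exp_has_derivative_0 by(simp add:linear_0[OF linear_gproj])
  have "((%u. mexp (u - gproj u)) has_derivative (%u. u - gproj u)) (at 0)" using diff_chain_at[OF g m] by(simp add:o_def)
  from mm.FDERIV[OF der this] show ?thesis unfolding f_def f'_def by(simp add:F0 linear_0[OF linear_gproj] add.commute)
 qed
 have "inj f'" unfolding linear_injective_0[OF lf']
 proof (intro allI impI)
  fix u assume u: "f' u = 0"
  have "gproj (f' u) = F' u + (gproj u - gproj u)" unfolding f'_def linear_add[OF linear_gproj] linear_diff[OF linear_gproj] by(simp add:gproj_id F'in gproj_in)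
  hence F'u: "F' u = 0" using u by(simp add:linear_0[OF linear_gproj])
  hence "u = gproj u" using u by(simp add:f'_def)
  thus "u = 0" using inj[of u] F'u gproj_in[of u] by simp
 qed
 then obtain g' where g': "linear g'" "!!x. g' (f' x) = x" "!!x. f' (g' x) = x" using linear_injective_isomorphism[OF lf'] by metis
 define r where "r = min (e / K) (min (e0 / (1 + K)) e)"
 have r: "0 < r" using e e0 K by(simp add:r_def)
 have "f 0 : interior (f ` ball 0 r)" by(rule sussmann_open_mapping[OF open_UNIV contf _ derf, of g'])
   (use g' r in \<open>auto simp: linear_conv_bounded_linear interior_open\<close>)
 hence "mat 1 : interior (f ` ball 0 r)" by(simp add:f_def F0 linear_0[OF linear_gproj])
 then obtain d where d: "0 < d" "ball (mat 1) d <= f ` ball 0 r" unfolding mem_interior by blast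
 show ?thesis
 proof (rule that[OF d(1)])
  fix g assume g: "g : G" "norm (g - mat 1) < d"
  hence "g : ball (mat 1) d" by(simp add:dist_norm norm_minus_commute)
  then obtain u where u: "norm u < r" "g = f u" using d(2) by auto
  have "mi (F u)**g = mi (F u)**F u**mexp (u - gproj u)" by(simp add:u f_def mma)
  hence "mi (F u)**g = mexp (u - gproj u)" using inv[OF FG[of u]] by simp
  hence "mexp (u - gproj u) : G" using g FG mult minv by metis
  moreover have "gproj (u - gproj u) = 0" by(simp add:linear_diff[OF linear_gproj] gproj_id gproj_in)
  moreover have "norm (u - gproj u) < e0"
  proof -
   have "norm (u - gproj u) <= norm u * (1 + K)" using norm_triangle_ineq4[of u "gproj u"] K(2)[of u] by(simp add:algebra_simps)
   also have "... < (e0 / (1 + K)) * (1 + K)" using u K by(intro mult_strict_right_mono) (auto simp: r_def)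
   finally show ?thesis using K by simp
  qed
  ultimately have u0: "u - gproj u = 0" using e0(2) by blast
  hence "u : lie_algebra G" using gproj_in[of u] by simp
  moreover have "g = F u" using u u0 by(simp add:f_def)
  ultimately show "EX u:lie_algebra G. norm u < e & g = F u" using u by(auto simp: r_def)
 qed
qed

text \<open>The derivative of \<open>exp (a u) exp (b u)\<close> at 0 is \<open>a + b\<close>, the
  identity. The maps \<open>a\<close> and \<open>b\<close> may overlap and need not be projections;
  the chart by \<open>K\<close> and \<open>QH\<close> below relies on this.\<close>

lemma exp_product_chart:
 fixes a b :: "real^'n^'n => real^'n^'n"
 assumes a: "linear a" "!!u. u : lie_algebra G ==> a u : lie_algebra G"
  and b: "linear b" "!!u. u : lie_algebra G ==> b u : lie_algebra G"
  and ab: "!!u. u : lie_algebra G ==> a u + b u = u" and e: "0 < e"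
 obtains d where "0 < d" "!!g. g : G ==> norm (g - mat 1) < d ==>
  EX u:lie_algebra G. norm u < e & g = mexp (a u)**mexp (b u)"
proof -
 have l: "linear (%u. a (gproj u))" "linear (%u. b (gproj u))" using linear_compose[OF linear_gproj a(1)] linear_compose[OF linear_gproj b(1)] by(auto simp: o_def)
 hence bl: "bounded_linear (%u. a (gproj u))" "bounded_linear (%u. b (gproj u))" by(simp_all add: linear_conv_bounded_linear)
 have ex: "((%u. mexp (h u)) has_derivative h) (at 0)" if h: "bounded_linear h"
  for h :: "real^'n^'n => real^'n^'n"
 proof -
  have "(mexp has_derivative (%x. x)) (at (h 0))" using mat_exp_has_derivative_0 by(simp add:linear_simps[OF h])
  from diff_chain_at[OF bounded_linear_imp_has_derivative[OF h] this] show ?thesis by(simp add:o_def)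
 qed
 obtain d where d: "0 < d" "!!g. g : G ==> norm (g - mat 1) < d ==>
  EX u:lie_algebra G. norm u < e & g = mexp (a (gproj u))**mexp (b (gproj u))"
 proof (rule chart_covers[where F = "%u. mexp (a (gproj u))**mexp (b (gproj u))" and F' = gproj, OF _ _ _ _ _ _ _ e])
  show "continuous_on UNIV (%u. mexp (a (gproj u))**mexp (b (gproj u)))" by(intro continuous_intros bounded_linear.continuous_on[OF bl(1)] bounded_linear.continuous_on[OF bl(2)])
  show "mexp (a (gproj u))**mexp (b (gproj u)) : G" for u by(intro mult lie_exp a b gproj_in)
  show "mexp (a (gproj 0))**mexp (b (gproj 0)) = mat 1" by(simp add:linear_simps[OF bl(1)] linear_simps[OF bl(2)])
  show "((%u. mexp (a (gproj u))**mexp (b (gproj u))) has_derivative gproj) (at 0)" using mm.FDERIV[OF ex[OF bl(1)] ex[OF bl(2)]]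
   by(simp add:linear_simps[OF bl(1)] linear_simps[OF bl(2)] add.commute[of "b _"] ab gproj_in)
 qed (auto simp: gproj_in gproj_id)
 show ?thesis by(rule that[OF d(1)]) (metis d(2) gproj_id)
qed

lemma exp_chart:
 assumes "0 < e"
 obtains d where "0 < d" "!!g. g : G ==> norm (g - mat 1) < d ==>
  EX u:lie_algebra G. norm u < e & g = mexp u" by(rule exp_product_chart[of "%u. u" "%u. 0", OF _ _ _ _ _ assms])
  (auto simp: linear_zero linear_ident subspace_0[OF subspace_lie_algebra])

text \<open>Bounding the inverse as well keeps limits invertible: \<open>g n\<close> and its inverse
  converge along a common subsequence, and their product remains 1.\<close>

lemma compact_bounded_part: "compact {g : G. norm g <= R & norm (mi g) <= R}" unfolding compact_def
proof (intro allI impI)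
 fix f :: "nat => real^'n^'n" assume f: "ALL n. f n : {g : G. norm g <= R & norm (mi g) <= R}"
 hence fn: "ALL n. (f n, mi (f n)) : cball 0 R \<times> cball 0 R" by simp
 have cpt: "compact (cball (0 :: real^'n^'n) R \<times> cball (0 :: real^'n^'n) R)" by(intro compact_Times compact_cball)
 obtain l r where l: "l : cball 0 R \<times> cball 0 R" "strict_mono r"
  "((%n. (f n, mi (f n))) \<circ> r) ----> l" by(rule seq_compactE[OF compact_imp_seq_compact[OF cpt] fn])
 have l1: "(%n. f (r n)) ----> fst l" "(%n. mi (f (r n))) ----> snd l" using tendsto_fst[OF l(3)] tendsto_snd[OF l(3)] by(simp_all add: o_def)
 have "(%n. f (r n)**mi (f (r n))) ----> fst l**snd l" by(intro mm.tendsto l1)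
 moreover have "f (r n)**mi (f (r n)) = mat 1" for n using f inv by simp
 ultimately have e: "fst l**snd l = mat 1" by(simp add:LIMSEQ_const_iff)
 hence i: "invertible (fst l)" unfolding invertible_def using matrix_left_right_inverse[of "fst l" "snd l"] by blast
 have "fst l : G" using lim[OF _ l1(1) i] f by simp
 moreover have "mi (fst l) = snd l" using e by(rule matrix_inv_eqI)
 ultimately show "EX l:{g : G. norm g <= R & norm (mi g) <= R}. EX r. strict_mono r & (f \<circ> r) ----> l"
  using l l1 by(intro bexI[of _ "fst l"] exI[of _ r]) (auto simp: o_def mem_Times_iff)
qed

end

lemma matgroup_linear_lie_group:
 assumes "linear_lie_group G"
 shows "matgroup G"
proof -
 have sub: "subgroup G GL" and cl: "closedin (top_of_set {A. invertible A}) G" using assms by(auto simp: linear_lie_group_def)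
 have inv: "A : G ==> invertible A" for A using subgroup.subset[OF sub] by(auto simp: GL_def)
 show ?thesis
 proof
  show "A : G ==> invertible A" for A by(rule inv)
  show "mat 1 : G" using subgroup.one_closed[OF sub] by(simp add:GL_def)
  show "A**B : G" if "A : G" "B : G" for A B using subgroup.m_closed[OF sub that] by(simp add:GL_def)
  show "mi A : G" if A: "A : G" for A
  proof -
   have "inv\<^bsub>GL\<^esub> A : G" using subgroup.m_inv_closed[OF sub A] .
   moreover have "A \<otimes>\<^bsub>GL\<^esub> inv\<^bsub>GL\<^esub> A = \<one>\<^bsub>GL\<^esub>" by(rule group.r_inv[OF group_GL]) (use A inv in \<open>simp add:GL_def\<close>)
   hence "mi A = inv\<^bsub>GL\<^esub> A" by(intro matrix_inv_eqI) (simp add:GL_def)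
   ultimately show ?thesis by simp
  qed
  show "L : G" if g: "!!n. g n : G" and lim: "g ----> L" and L: "invertible L" for g L
  proof -
   obtain C where C: "closed C" "G = {A. invertible A} \<inter> C" using cl by(auto simp: closedin_closed)
   have "L : C" using closed_sequentially[OF C(1) _ lim] g C(2) by auto
   thus ?thesis using C L by auto
  qed
 qed
qed

lemma matgroup_subgroup:
 assumes G: "matgroup G" and sub: "subgroup K (grp G)" and cl: "closed K"
 shows "matgroup K"
proof -
 interpret matgroup G by(rule G)
 have KG: "K <= G" using subgroup.subset[OF sub] by simp
 have inv_eq: "inv\<^bsub>grp G\<^esub> A = mi A" if A: "A : G" for A
 proof -
  have "group (grp G)"
  proof (rule groupI)
   fix x assume "x : carrier (grp G)"
   thus "EX y:carrier (grp G). y \<otimes>\<^bsub>grp G\<^esub> x = \<one>\<^bsub>grp G\<^esub>" using minv inv by(auto simp: GL_def intro!: bexI[of _ "mi x"])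
  qed (auto simp: GL_def mult one mma)
  hence "A \<otimes>\<^bsub>grp G\<^esub> inv\<^bsub>grp G\<^esub> A = \<one>\<^bsub>grp G\<^esub>" using A by(intro group.r_inv) auto
  hence "A**inv\<^bsub>grp G\<^esub> A = mat 1" by(simp add:GL_def)
  thus ?thesis by(rule matrix_inv_eqI[symmetric])
 qed
 show ?thesis
 proof
  show "A : K ==> invertible A" for A using KG inv by blast
  show "mat 1 : K" using subgroup.one_closed[OF sub] by(simp add:GL_def)
  show "A**B : K" if "A : K" "B : K" for A B using subgroup.m_closed[OF sub that] by(simp add:GL_def)
  show "mi A : K" if A: "A : K" for A using subgroup.m_inv_closed[OF sub A] inv_eq A KG by auto
  show "L : K" if "!!n. g n : K" "g ----> L" for g L using closed_sequentially[OF cl _ that(2)] that by auto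
 qed
qed

section \<open>Traces of operators\<close>

definition tr :: "'a::euclidean_space endo => real" where "tr T = (SUM e:Basis. eapp T e \<bullet> e)"

lemma tr_add [simp]: "tr (S + T) = tr S + tr T"
 and tr_scale [simp]: "tr (c *. T) = c * tr T"
 and tr_zero [simp]: "tr 0 = 0"
 and tr_diff [simp]: "tr (S - T) = tr S - tr T"
 and tr_minus [simp]: "tr (- T) = - tr T" by(simp_all add: tr_def eapp.add_left eapp.scaleR_left eapp.zero_left eapp.diff_left eapp.minus_left inner_simps
   sum.distrib sum_distrib_left sum_subtractf sum_negf)

lemma tr_sum [simp]: "tr (SUM i:I. T i) = (SUM i:I. tr (T i))" by(induction I rule: infinite_finite_induct) simp_all

lemma tr_commute: "tr (S * T) = tr (T * S)"
proof -
 have e: "tr (S * T) = (SUM e:Basis. SUM f:Basis. (eapp T e \<bullet> f) * (eapp S f \<bullet> e))" for S T :: "'a endo"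
 proof -
  have "eapp S (eapp T e) \<bullet> e = (SUM f:Basis. (eapp T e \<bullet> f) * (eapp S f \<bullet> e))" for e
  proof -
   have "eapp S (eapp T e) = eapp S (SUM f:Basis. (eapp T e \<bullet> f) *. f)" by(simp add:euclidean_representation)
   thus ?thesis by(simp add:linear_sum[OF linear_eapp] linear_scale[OF linear_eapp] inner_sum_left)
  qed
  thus ?thesis by(simp add:tr_def)
 qed
 show ?thesis unfolding e by(subst sum.swap) (simp add:mult.commute)
qed

definition eproj :: "'a::euclidean_space set => 'a endo" where "eproj V = endo (proj V)"

lemma eapp_eproj [simp]: "subspace V ==> eapp (eproj V) = proj V" by(simp add:eproj_def linear_proj)

text \<open>As \<open>T\<close> maps \<open>V\<close> into \<open>U\<close>, inserting the
  projection to \<open>U\<close> in front changes nothing, and cyclicity of the trace moves it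
  behind.\<close>

lemma tr_restrict:
 assumes U: "subspace U" and V: "subspace V" and UV: "U <= V" and T: "!!x. x : V ==> eapp T x : U"
 shows "tr (T * eproj V) = tr (T * eproj U)"
proof -
 have 1: "eproj U * (T * eproj V) = T * eproj V" by(rule endo_eqI) (simp add:U V proj_id T proj_in)
 have 2: "eproj V * eproj U = eproj U" using UV by(intro endo_eqI) (simp add:U V proj_id subsetD proj_in)
 have "tr (T * eproj V) = tr (eproj U * (T * eproj V))" by(simp add:1)
 also have "... = tr (T * (eproj V * eproj U))" by(subst tr_commute) (simp add:mult.assoc)
 finally show ?thesis by(simp add:2)
qed

lemma subspace_range_eapp: "subspace (range (eapp T))" using linear_subspace_image[OF linear_eapp subspace_UNIV] .

lemma tr_range: "tr T = tr (T * eproj (range (eapp T)))"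
proof -
 have "tr (T * eproj UNIV) = tr (T * eproj (range (eapp T)))" by(intro tr_restrict subspace_range_eapp subspace_UNIV) auto
 moreover have "eproj UNIV = (1 :: 'a endo)" by(rule endo_eqI) (simp add:subspace_UNIV proj_id)
 ultimately show ?thesis by simp
qed

text \<open>The trace may be computed on the range of \<open>T ^ j\<close> for every
  \<open>j\<close>, by restricting from each range to the next, and the last range is zero.\<close>

lemma tr_nilpotent:
 assumes "T ^ k = 0"
 shows "tr T = 0"
proof -
 have "tr T = tr (T * eproj (range (eapp (T ^ j))))" for j
 proof (induction j)
  case 0
  have "eapp 1 = (%x :: 'a. x)" by(rule ext) simp
  hence "eproj (range (eapp (1 :: 'a endo))) = 1" by(intro endo_eqI) (simp add:proj_id)
  thus ?case by simp
 next
  case (Suc j)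
  have "tr (T * eproj (range (eapp (T ^ j)))) = tr (T * eproj (range (eapp (T ^ Suc j))))"
  proof (intro tr_restrict subspace_range_eapp)
   show "range (eapp (T ^ Suc j)) <= range (eapp (T ^ j))" unfolding power_Suc2 by auto
  qed auto
  with Suc show ?case by simp
 qed
 from this[of k] have "tr T = tr (T * eproj (range (eapp (0 :: 'a endo))))" by(simp add:assms)
 moreover have "eproj (range (eapp (0 :: 'a endo))) = 0"
 proof (rule endo_eqI)
  fix x :: 'a
  have "proj (range (eapp (0 :: 'a endo))) x : range (eapp 0)" by(rule proj_in) (rule subspace_range_eapp)
  thus "eapp (eproj (range (eapp (0 :: 'a endo)))) x = eapp 0 x" by(auto simp: subspace_range_eapp eapp.zero_left)
 qed
 ultimately show ?thesis by simp
qed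

text \<open>An idempotent has the same trace as the orthogonal projection to its range, and that
  trace is the sum of the squared norms of the projected basis vectors.\<close>

lemma tr_idempotent:
 assumes "P * P = P"
 shows "0 <= tr P" and "tr P = 0 ==> P = 0"
proof -
 let ?R = "range (eapp P)"
 have R: "subspace ?R" by(rule subspace_range_eapp)
 have fixR: "eapp P y = y" if "y : ?R" for y using that assms by(auto simp flip: eapp_mult)
 have "P * eproj ?R = eproj ?R" using fixR[OF proj_in[OF R]] by(intro endo_eqI) (simp add:R)
 hence "tr P = tr (eproj ?R)" using tr_range[of P] by simp
 also have "... = (SUM e:Basis. proj ?R e \<bullet> proj ?R e)"
 proof -
  have "proj ?R e \<bullet> e = proj ?R e \<bullet> proj ?R e" for e using proj_sym[OF R, of "proj ?R e" e] proj_id[OF R proj_in[OF R, of e]] by simp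
  thus ?thesis by(simp add:tr_def R)
 qed
 finally have eq: "tr P = (SUM e:Basis. proj ?R e \<bullet> proj ?R e)" .
 show "0 <= tr P" unfolding eq by(intro sum_nonneg) simp
 assume "tr P = 0"
 hence "ALL e:Basis. proj ?R e \<bullet> proj ?R e = 0" unfolding eq by(subst (asm) sum_nonneg_eq_0_iff) simp_all
 hence z: "ALL e:Basis. proj ?R e = 0" by simp
 have "proj ?R x = 0" for x by(rule linear_eq_0_on_span[OF linear_proj[OF R], of Basis]) (use z span_Basis in auto)
 hence "eapp P x = 0" for x using proj_id[OF R, of "eapp P x"] by simp
 thus "P = 0" by(intro endo_eqI) (simp add:eapp.zero_left)
qed

text \<open>Complexification: \<open>(u, v)\<close> stands for \<open>u + \<i>v\<close>.\<close>

definition Jc :: "('a::euclidean_space \<times> 'a) endo" where "Jc = endo (%z. (- snd z, fst z))"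

definition cpx :: "'a::euclidean_space endo => ('a \<times> 'a) endo" where "cpx T = endo (%z. (eapp T (fst z), eapp T (snd z)))"

text \<open>The complex structure acts by \<open>Jc\<close> from the left. Moving a scalar past a
  left factor requires that factor to commute with \<open>Jc\<close>, hence the recurring hypotheses
  \<open>X * Jc = Jc * X\<close>.\<close>

definition sc :: "complex => ('a::euclidean_space \<times> 'a) endo => ('a \<times> 'a) endo" where "sc c A = Re c *. A + Im c *. (Jc * A)"

lemma eapp_Jc [simp]: "eapp Jc z = (- snd z, fst z)"
proof -
 have "linear (%z :: 'a \<times> 'a. (- snd z, fst z))" by(rule linearI) auto
 thus ?thesis by(simp add:Jc_def)
qed

lemma eapp_cpx [simp]: "eapp (cpx T) z = (eapp T (fst z), eapp T (snd z))"
proof -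
 have "linear (%z. (eapp T (fst z), eapp T (snd z)))" by(rule linearI) (auto simp: eapp.add_right eapp.scaleR_right)
 thus ?thesis by(simp add:cpx_def)
qed

lemma Jc_square: "Jc * Jc = - 1" by(rule endo_eqI) (simp add:eapp.minus_left prod_eq_iff)

lemma Jc_square': "Jc * (Jc * A) = - A" by(simp add:mult.assoc[symmetric] Jc_square)

lemma cpx_Jc: "cpx T * Jc = Jc * cpx T" by(rule endo_eqI) (simp add:eapp.minus_right)

lemma cpx_mult: "cpx (S * T) = cpx S * cpx T"
 and cpx_add: "cpx (S + T) = cpx S + cpx T"
 and cpx_diff: "cpx (S - T) = cpx S - cpx T"
 and cpx_scale: "cpx (r *. T) = r *. cpx T"
 and cpx_one: "cpx 1 = 1" and cpx_zero: "cpx 0 = 0" by(rule endo_eqI; simp add:eapp.add_left eapp.diff_left eapp.scaleR_left eapp.zero_left zero_prod_def)+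

lemma cpx_eq_0: "cpx T = 0 ==> T = 0"
proof (rule endo_eqI)
 fix x assume "cpx T = 0"
 hence "eapp (cpx T) (x, 0) = 0" by(simp add:eapp.zero_left)
 thus "eapp T x = eapp 0 x" by(simp add:eapp.zero_left zero_prod_def)
qed

lemma cpx_power: "cpx (T ^ k) = cpx T ^ k" by(induction k) (simp_all add: cpx_one cpx_mult)

lemma tr_cpx: "tr (cpx T) = 2 * tr T"
proof -
 have "tr (cpx T) = (SUM e:(%u. (u, 0)) ` Basis \<union> (%v. (0, v)) ` Basis. eapp (cpx T) e \<bullet> e)" by(simp add:tr_def Basis_prod_def)
 also have "... = (SUM e:(%u. (u, 0)) ` Basis. eapp (cpx T) e \<bullet> e) + (SUM e:(%v. (0, v)) ` Basis. eapp (cpx T) e \<bullet> e)" by(rule sum.union_disjoint) auto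
 also have "... = 2 * tr T" by(simp add:sum.reindex inj_on_def tr_def)
 finally show ?thesis .
qed

lemma tr_Jc_cpx: "tr (Jc * cpx T) = 0"
proof -
 have "tr (Jc * cpx T) = (SUM e:(%u. (u, 0)) ` Basis \<union> (%v. (0, v)) ` Basis. eapp (Jc * cpx T) e \<bullet> e)" by(simp add:tr_def Basis_prod_def)
 also have "... = (SUM e:(%u. (u, 0)) ` Basis. eapp (Jc * cpx T) e \<bullet> e) + (SUM e:(%v. (0, v)) ` Basis. eapp (Jc * cpx T) e \<bullet> e)" by(rule sum.union_disjoint) auto
 also have "... = 0" by(simp add:sum.reindex inj_on_def eapp.zero_right)
 finally show ?thesis .
qed

lemma sc_add_right: "sc c (A + B) = sc c A + sc c B"
 and sc_add_left: "sc (c + d) A = sc c A + sc d A"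
 and sc_diff_right: "sc c (A - B) = sc c A - sc c B"
 and sc_diff_left: "sc (c - d) A = sc c A - sc d A"
 and sc_minus_left: "sc (- c) A = - sc c A"
 and sc_one [simp]: "sc 1 A = A" and sc_zero [simp]: "sc 0 A = 0" and sc_zero_right [simp]: "sc c 0 = 0" by(simp_all add: sc_def algebra_simps)

lemma sc_sc [simp]: "sc c (sc d A) = sc (c * d) A" by(simp add:sc_def algebra_simps Jc_square')

lemma sc_mult_left: "sc c A * B = sc c (A * B)" by(simp add:sc_def algebra_simps)

lemma sc_mult_right: "A * Jc = Jc * A ==> A * sc c B = sc c (A * B)" by(simp add:sc_def algebra_simps) (simp add:mult.assoc[symmetric])

lemma sc_of_real: "sc (complex_of_real r) A = r *. A" by(simp add:sc_def)

lemma sc_sum_right: "sc c (SUM i:I. A i) = (SUM i:I. sc c (A i))" by(induction I rule: infinite_finite_induct) (simp_all add: sc_add_right)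

definition clin :: "(('a::euclidean_space \<times> 'a) endo => ('a \<times> 'a) endo) => bool" where "clin T \<longleftrightarrow> (ALL A B. T (A + B) = T A + T B) & (ALL c A. T (sc c A) = sc c (T A))"

lemma clinD: "clin T ==> T (A + B) = T A + T B" "clin T ==> T (sc c A) = sc c (T A)" "clin T ==> T 0 = 0" unfolding clin_def by(blast, blast, metis sc_zero)

lemma clin_left: "X * Jc = Jc * X ==> clin (%A. X * A)" by(simp add:clin_def distrib_left sc_mult_right)

lemma clin_ad: "X * Jc = Jc * X ==> clin (%A. X * A - A * X)" by(simp add:clin_def distrib_left distrib_right sc_mult_right sc_mult_left sc_diff_right)

text \<open>This is \<open>p(T) A\<close>, evaluated by Horner's scheme. Applying it to an argument
  lets \<open>T\<close> be any complex linear map on operators: it is left multiplication in the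
  spectral decomposition and a commutator in Cartan's criterion.\<close>

definition pev :: "complex poly => (('a::euclidean_space \<times> 'a) endo => ('a \<times> 'a) endo) => ('a \<times> 'a) endo => ('a \<times> 'a) endo" where "pev p T A = fold_coeffs (%a B. sc a A + T B) p 0"

lemma pev_0 [simp]: "pev 0 T A = 0" by(simp add:pev_def)

lemma pev_pCons: "clin T ==> pev (pCons a p) T A = sc a A + T (pev p T A)" by(cases "p = 0 & a = 0") (auto simp: pev_def clinD)

lemma pev_one [simp]: "clin T ==> pev 1 T A = A" by(simp add:one_pCons pev_pCons clinD)

lemma pev_add: "clin T ==> pev (p + q) T A = pev p T A + pev q T A"
proof (induction p q rule: poly_induct2)
 case (pCons a p b q)
 thus ?case by(simp add:pev_pCons clinD sc_add_left algebra_simps)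
qed simp

lemma pev_smult: "clin T ==> pev (smult c p) T A = sc c (pev p T A)" by(induction p) (simp_all add: pev_pCons clinD sc_add_right)

lemma pev_linear: "clin T ==> pev p T (A + B) = pev p T A + pev p T B"
 and pev_sc: "clin T ==> pev p T (sc c A) = sc c (pev p T A)" by(induction p) (simp_all add: pev_pCons clinD sc_add_right algebra_simps)

lemma clin_pev: "clin T ==> clin (pev p T)" unfolding clin_def[of "pev p T"] by(simp add:pev_linear pev_sc)

lemma pev_commute: "clin T ==> pev p T (T A) = T (pev p T A)" by(induction p) (simp_all add: pev_pCons clinD)

lemma pev_mult: "clin T ==> pev (p * q) T A = pev p T (pev q T A)" by(induction p) (simp_all add: pev_pCons pev_add pev_smult clinD mult_pCons_left)

lemma pev_monom: "clin T ==> pev (monom c i) T A = sc c ((T ^^ i) A)" by(induction i) (simp_all add: monom_0 monom_Suc pev_pCons clinD)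

lemma pev_sum: "clin T ==> pev (SUM i:I. p i) T A = (SUM i:I. pev (p i) T A)" by(induction I rule: infinite_finite_induct) (simp_all add: pev_add)

lemma power_add_decomp: "EX w. (u + v) ^ m = v ^ m + u * w" for u v :: "'a::comm_ring_1"
proof (induction m)
 case 0
 show ?case by(rule exI[of _ 0]) simp
next
 case (Suc m)
 then obtain w where "(u + v) ^ m = v ^ m + u * w" by blast
 hence "(u + v) ^ Suc m = v ^ Suc m + u * (v ^ m + (u + v) * w)" by(simp add:algebra_simps)
 thus ?case by blast
qed

text \<open>The constant \<open>r(nu)\<close> is \<open>r\<close> minus a multiple of the linear
  factor. Scaled to 1 and raised to the power \<open>m\<close>, this identity separates the
  \<open>m\<close>-th power of the linear factor from a multiple of \<open>r\<close>.\<close>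

lemma linear_power_bezout:
 fixes r :: "complex poly"
 assumes "poly r nu ~= 0"
 shows "EX a b. a * [:- nu, 1:] ^ m + b * r = 1"
proof -
 have "[:- nu, 1:] dvd r - [:poly r nu:]" by(simp add:poly_eq_0_iff_dvd[symmetric])
 then obtain s where "r - [:poly r nu:] = [:- nu, 1:] * s" by(auto elim: dvdE)
 hence "[:poly r nu:] = r - [:- nu, 1:] * s" by(simp add:algebra_simps)
 hence "smult (1 / poly r nu) (r - [:- nu, 1:] * s) = smult (1 / poly r nu) [:poly r nu:]" by simp
 also have "... = 1" using assms by(simp add:one_pCons)
 also have "smult (1 / poly r nu) (r - [:- nu, 1:] * s) =
   r * [:1 / poly r nu:] + [:- nu, 1:] * (- smult (1 / poly r nu) s)" by(simp add:smult_diff_right del: mult_pCons_left)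
 finally have "1 = r * [:1 / poly r nu:] + [:- nu, 1:] * (- smult (1 / poly r nu) s)" by simp
 moreover obtain w where "(r * [:1 / poly r nu:] + [:- nu, 1:] * (- smult (1 / poly r nu) s)) ^ m =
   ([:- nu, 1:] * (- smult (1 / poly r nu) s)) ^ m + r * [:1 / poly r nu:] * w" using power_add_decomp by blast
 ultimately have "1 = [:- nu, 1:] ^ m * (- smult (1 / poly r nu) s) ^ m + r * [:1 / poly r nu:] * w" by(metis power_mult_distrib power_one)
 hence "(- smult (1 / poly r nu) s) ^ m * [:- nu, 1:] ^ m + ([:1 / poly r nu:] * w) * r = 1" by(simp only: mult.commute mult.left_commute mult.assoc)
 thus ?thesis by blast
qed

text \<open>The components are values of polynomials in \<open>T\<close>, so they stay in every \<open>T\<close>-invariant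
 subspace containing \<open>A\<close>.\<close>

lemma generalized_eigen_decomposition:
 assumes T: "clin T" and "p ~= 0" and "pev p T A = 0"
 shows "EX S q. finite S & A = (SUM nu:S. pev (q nu) T A) & (ALL nu:S. poly p nu = 0) &
  (ALL nu:S. EX k. pev ([:- nu, 1:] ^ k) T (pev (q nu) T A) = 0)" using assms(2,3)
proof (induction "degree p" arbitrary: p A rule: less_induct)
 case less
 show ?case
 proof (cases "degree p = 0")
  case True
  then obtain c where c: "p = [:c:]" by(auto elim: degree_eq_zeroE)
  hence "c ~= 0" "sc c A = 0" using less T by(auto simp: pev_pCons clinD)
  hence "sc (1 / c) (sc c A) = 0" by simp
  hence "A = 0" using `c ~= 0` by simp
  thus ?thesis by(intro exI[of _ "{}"]) simp
 next
  case False
  hence "~ constant (poly p)" by(simp add:constant_degree)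
  then obtain nu where nu: "poly p nu = 0" using fundamental_theorem_of_algebra by blast
  define m where "m = Polynomial.order nu p"
  have m: "m > 0" using nu less.prems(1) by(simp add:m_def order_root)
  obtain r where r: "p = [:- nu, 1:] ^ m * r" "~ [:- nu, 1:] dvd r" using order_decomp[OF less.prems(1), of nu] by(auto simp: m_def)
  have r0: "poly r nu ~= 0" using r(2) by(simp add:poly_eq_0_iff_dvd)
  have rn: "r ~= 0" using r(2) by auto
  obtain a b where ab: "a * [:- nu, 1:] ^ m + b * r = 1" using linear_power_bezout[OF r0] by blast
  \<comment> \<open>By the Bezout identity \<open>A\<close> is the sum of \<open>A2\<close>, killed
    by \<open>r\<close>, which has lower degree, and of a part killed by
    \<open>(T - nu)^m\<close>.\<close>
  define A2 where "A2 = pev (a * [:- nu, 1:] ^ m) T A"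
  have A: "A = A2 + pev (b * r) T A" using pev_add[OF T, of "a * [:- nu, 1:] ^ m" "b * r" A] ab T by(simp add:A2_def)
  have deg: "degree r < degree p" using m rn by(simp add:r(1) degree_mult_eq degree_power_eq)
  have k1: "pev ([:- nu, 1:] ^ m) T (pev (b * r) T A) = 0"
  proof -
   have "pev ([:- nu, 1:] ^ m) T (pev (b * r) T A) = pev (b * p) T A" unfolding r(1) pev_mult[OF T, symmetric] by(simp only: mult_ac)
   also have "... = 0" by(simp add:pev_mult[OF T] less.prems clinD(3)[OF clin_pev[OF T]])
   finally show ?thesis .
  qed
  have k2: "pev r T A2 = 0"
  proof -
   have "pev r T A2 = pev (a * p) T A" unfolding r(1) A2_def pev_mult[OF T, symmetric] by(simp only: mult_ac)
   also have "... = 0" by(simp add:pev_mult[OF T] less.prems clinD(3)[OF clin_pev[OF T]])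
   finally show ?thesis .
  qed
  obtain S q where Sq: "finite S" "A2 = (SUM mu:S. pev (q mu) T A2)" "ALL mu:S. poly r mu = 0"
   "ALL mu:S. EX k. pev ([:- mu, 1:] ^ k) T (pev (q mu) T A2) = 0" using less.hyps[OF deg rn k2] by blast
  have nS: "nu ~: S" using Sq(3) r0 by auto
  define q' where "q' mu = (if mu = nu then b * r else q mu * (a * [:- nu, 1:] ^ m))" for mu
  have q': "pev (q' mu) T A = pev (q mu) T A2" if "mu : S" for mu using that nS by(auto simp: q'_def A2_def pev_mult[OF T])
  show ?thesis
  proof (intro exI[of _ "insert nu S"] exI[of _ q'] conjI)
   show "A = (SUM mu:insert nu S. pev (q' mu) T A)" using A Sq(1,2) nS q' by(simp add:q'_def add.commute)
   show "ALL mu:insert nu S. poly p mu = 0" using Sq(3) nu by(auto simp: r(1))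
   show "ALL mu:insert nu S. EX k. pev ([:- mu, 1:] ^ k) T (pev (q' mu) T A) = 0" using Sq(4) k1 q' by(auto simp: q'_def)
  qed (use Sq in auto)
 qed
qed

lemma linear_iterates_dependent:
 fixes f :: "'a::euclidean_space => 'a"
 shows "EX c. (EX i<=DIM('a). c i ~= 0) & (\<Sum>i\<le>DIM('a). c i *. (f ^^ i) v) = 0"
proof (cases "inj_on (%i. (f ^^ i) v) {..DIM('a)}")
 case True
 let ?B = "(%i. (f ^^ i) v) ` {..DIM('a)}"
 have "card ?B = Suc (DIM('a))" using True by(simp add:card_image)
 hence "dependent ?B" using independent_bound[of ?B] by auto
 then obtain u where u: "EX v:?B. u v ~= 0" "(SUM v:?B. u v *. v) = 0" using dependent_finite[of ?B] by auto
 thus ?thesis by(intro exI[of _ "%i. u ((f ^^ i) v)"]) (auto simp: sum.reindex[OF True])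
next
 case False
 then obtain i j where ij: "i <= DIM('a)" "j <= DIM('a)" "i ~= j" "(f ^^ i) v = (f ^^ j) v" by(auto simp: inj_on_def)
 have "(\<Sum>k\<le>DIM('a). ((if k = i then 1 else 0) - (if k = j then 1 else 0 :: real)) *. (f ^^ k) v) = (f ^^ i) v - (f ^^ j) v"
  using ij by(simp add:scaleR_diff_left sum_subtractf if_distrib[of "%c. c *. _"] cong: if_cong)
 thus ?thesis using ij by(intro exI[of _ "%k. (if k = i then 1 else 0) - (if k = j then 1 else 0)"]) auto
qed

text \<open>A real linear dependence among the iterates of \<open>f\<close> at \<open>v\<close> is
  carried over by \<open>C\<close> and becomes a polynomial annihilating \<open>C v\<close>.\<close>

lemma iterates_poly_annihilator:
 fixes f :: "'v::euclidean_space => 'v" and C :: "'v => ('a::euclidean_space \<times> 'a) endo"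
 assumes T: "clin T" and C: "linear C" and it: "!!i. (T ^^ i) (C v) = C ((f ^^ i) v)"
 shows "EX p. p ~= 0 & pev p T (C v) = 0"
proof -
 obtain c where c: "EX i<=DIM('v). c i ~= 0" "(\<Sum>i\<le>DIM('v). c i *. (f ^^ i) v) = 0" using linear_iterates_dependent by blast
 define p where "p = (\<Sum>i\<le>DIM('v). monom (complex_of_real (c i)) i)"
 have "coeff p i = complex_of_real (c i)" if "i <= DIM('v)" for i using that by(simp add:p_def coeff_sum)
 hence "p ~= 0" using c(1) by(metis coeff_0 of_real_eq_0_iff)
 moreover have "pev p T (C v) = C (\<Sum>i\<le>DIM('v). c i *. (f ^^ i) v)" by(simp add:p_def pev_sum[OF T] pev_monom[OF T] it sc_of_real linear_sum[OF C] linear_scale[OF C])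
 ultimately show ?thesis using c(2) linear_0[OF C] by(intro exI[of _ p]) simp
qed

definition ev :: "complex poly => ('a::euclidean_space \<times> 'a) endo => ('a \<times> 'a) endo" where "ev p X = pev p (%A. X * A) 1"

lemma pev_left_eq: "X * Jc = Jc * X ==> pev p (%A. X * A) B = ev p X * B" unfolding ev_def
 by(induction p) (simp_all add: pev_pCons[OF clin_left] distrib_right sc_mult_left mult.assoc)

lemma ev_commutes: "X * Jc = Jc * X ==> Y * Jc = Jc * Y ==> X * Y = Y * X ==> ev p X * Y = Y * ev p X" unfolding ev_def
proof (induction p)
 case (pCons a p)
 have "X * (pev p (%A. X * A) 1) * Y = Y * (X * pev p (%A. X * A) 1)" using pCons by(metis mult.assoc)
 thus ?case using pCons by(simp add:pev_pCons[OF clin_left] distrib_right distrib_left sc_mult_left sc_mult_right mult.assoc)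
qed simp

lemma ev_Jc: "X * Jc = Jc * X ==> ev p X * Jc = Jc * ev p X" by(rule ev_commutes) auto

lemma ev_mult: "X * Jc = Jc * X ==> ev (p * q) X = ev p X * ev q X" using pev_left_eq[of X p "ev q X"] by(simp add:ev_def pev_mult clin_left)

text \<open>Basis vectors of the real space are annihilated one after the other by multiplying
  polynomials. Commutation with \<open>Jc\<close> then extends the annihilation to the whole
  complexification.\<close>

lemma ev_poly_annihilator:
 fixes T :: "'a::euclidean_space endo"
 shows "EX p. p ~= 0 & ev p (cpx T) = 0"
proof -
 have J: "cpx T * Jc = Jc * cpx T" by(rule cpx_Jc)
 have "EX p. p ~= 0 & (ALL e:F. eapp (ev p (cpx T)) (e, 0) = 0)" if "finite F" for F :: "'a set" using that
 proof (induction F)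
  case empty
  show ?case by(intro exI[of _ 1]) simp
 next
  case (insert e F)
  then obtain p where p: "p ~= 0" "ALL e:F. eapp (ev p (cpx T)) (e, 0) = 0" by blast
  obtain c where c: "EX i<=DIM('a). c i ~= 0" "(\<Sum>i\<le>DIM('a). c i *. ((eapp T) ^^ i) e) = 0" using linear_iterates_dependent by blast
  define q where "q = (\<Sum>i\<le>DIM('a). monom (complex_of_real (c i)) i)"
  have "coeff q i = complex_of_real (c i)" if "i <= DIM('a)" for i using that by(simp add:q_def coeff_sum)
  hence q: "q ~= 0" using c(1) by(metis coeff_0 of_real_eq_0_iff)
  have it: "((%A. cpx T * A) ^^ i) 1 = cpx T ^ i" for i by(induction i) auto
  have it2: "eapp (cpx T ^ i) (e, 0) = ((eapp T ^^ i) e, 0)" for i by(induction i) (auto simp: eapp.zero_right)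
  have "eapp (ev q (cpx T)) (e, 0) = (\<Sum>i\<le>DIM('a). c i *. ((eapp T ^^ i) e, 0))"
   by(simp add:q_def ev_def pev_sum[OF clin_left[OF J]] pev_monom[OF clin_left[OF J]] it sc_of_real
    eapp.sum_left eapp.scaleR_left it2)
  also have "... = (\<Sum>i\<le>DIM('a). c i *. (eapp T ^^ i) e, 0)" by(simp add:sum_prod)
  finally have qe: "eapp (ev q (cpx T)) (e, 0) = 0" using c(2) by(simp add:zero_prod_def)
  have 1: "ev (q * p) (cpx T) = ev q (cpx T) * ev p (cpx T)" "ev (q * p) (cpx T) = ev p (cpx T) * ev q (cpx T)"
   using ev_mult[OF J, of q p] ev_mult[OF J, of p q] by(simp_all add: mult.commute)
  have "eapp (ev (q * p) (cpx T)) (x, 0) = 0" if "x : insert e F" for x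
  proof (cases "x = e")
   case True
   thus ?thesis unfolding 1(2) by(simp add:qe eapp.zero_right)
  next
   case False
   thus ?thesis unfolding 1(1) using that p(2) by(simp add:eapp.zero_right)
  qed
  thus ?case using p(1) q by(intro exI[of _ "q * p"]) auto
 qed
 from this[of Basis] obtain p where p: "p ~= 0" "ALL e:(Basis :: 'a set). eapp (ev p (cpx T)) (e, 0) = 0" by auto
 have z: "eapp (ev p (cpx T)) (u, 0) = 0" for u
 proof -
  have "linear (%u. eapp (ev p (cpx T)) (u, 0))"
  proof -
   have "linear (%u::'a. (u, 0::'a))" by(rule linearI) auto
   from linear_compose[OF this linear_eapp] show ?thesis by(simp add:o_def)
  qed
  thus ?thesis by(rule linear_eq_0_on_span[of _ Basis]) (use p(2) span_Basis in auto)
 qed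
 have "eapp (ev p (cpx T)) w = 0" for w
 proof -
  have "w = (fst w, 0) + eapp Jc (snd w, 0)" by simp
  hence "eapp (ev p (cpx T)) w = eapp (ev p (cpx T)) (fst w, 0) + eapp (ev p (cpx T) * Jc) (snd w, 0)" by(metis eapp.add_right eapp_mult)
  also have "... = 0" by(simp add:z ev_Jc[OF J] eapp.zero_right del: eapp_Jc)
  finally show ?thesis .
 qed
 hence "ev p (cpx T) = 0" by(intro endo_eqI) (simp add:eapp.zero_left)
 thus ?thesis using p(1) by blast
qed

lemma mult_commuting: "A * C = C * A ==> B * C = C * B ==> A * B * C = C * (A * (B :: 'a::semigroup_mult))" by(simp add:mult.assoc) (simp add:mult.assoc[symmetric])

lemma power_mult_commuting: "A * B = B * A ==> (A * B) ^ k = A ^ k * (B :: 'a::monoid_mult) ^ k"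
proof (induction k)
 case (Suc k)
 have "B * A ^ k = A ^ k * B" using Suc.prems by(metis power_commuting_commutes)
 thus ?case using Suc by(simp add:mult.assoc) (metis mult.assoc)
qed simp

definition lin :: "complex => ('a::euclidean_space \<times> 'a) endo => ('a \<times> 'a) endo" where "lin nu X = X - sc nu 1"

lemma lin_Jc: "X * Jc = Jc * X ==> lin nu X * Jc = Jc * lin nu X" by(simp add:lin_def algebra_simps sc_mult_left sc_mult_right)

lemma lin_mult: "lin nu X * A = X * A - sc nu A" by(simp add:lin_def algebra_simps sc_mult_left)

lemma pev_linear_power: "X * Jc = Jc * X ==> pev ([:- nu, 1:] ^ k) (%A. X * A) B = lin nu X ^ k * B"
proof (induction k)
 case (Suc k)
 have "pev [:- nu, 1:] (%A. X * A) A = lin nu X * A" for A using Suc.prems by(simp add:pev_pCons[OF clin_left] lin_mult sc_minus_left)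
 with Suc show ?case by(simp add:pev_mult[OF clin_left] mult.assoc del: mult_pCons_left mult_pCons_right)
qed (simp add:clin_left)

text \<open>Two generalized eigenspaces meet trivially: induction on \<open>j\<close> leads to a
  true eigenvector for \<open>mu\<close>, on which \<open>X - nu\<close> acts as the nonzero scalar
  \<open>mu - nu\<close>.\<close>

lemma coprime_killed:
 assumes J: "X * Jc = Jc * X" and "nu ~= mu" "lin nu X ^ k * A = 0" "lin mu X ^ j * A = 0"
 shows "A = 0" using assms(3,4)
proof (induction j arbitrary: A)
 case (Suc j)
 define B where "B = lin mu X ^ j * A"
 have comm: "lin nu X * lin mu X = lin mu X * lin nu X" using J by(simp add:lin_def algebra_simps sc_mult_left sc_mult_right)
 have c2: "lin nu X ^ k * lin mu X ^ j = lin mu X ^ j * lin nu X ^ k" by(metis comm power_commuting_commutes)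
 have kB: "lin nu X ^ k * B = 0" using Suc.prems(1) c2 by(simp add:B_def mult.assoc[symmetric]) (simp add:mult.assoc)
 have "lin mu X * B = 0" using Suc.prems(2) by(simp add:B_def mult.assoc)
 hence "X * B = sc mu B" by(simp add:lin_mult)
 hence s: "lin nu X * B = sc (mu - nu) B" by(simp add:lin_mult sc_diff_left)
 have "lin nu X ^ i * B = sc ((mu - nu) ^ i) B" for i by(induction i) (simp_all add: mult.assoc sc_mult_right[OF lin_Jc[OF J]] s mult.commute)
 hence "sc ((mu - nu) ^ k) B = 0" using kB by simp
 hence "sc (1 / (mu - nu) ^ k) (sc ((mu - nu) ^ k) B) = 0" by simp
 hence "B = 0" using assms(2) by simp
 thus ?case using Suc by(simp add:B_def)
qed simp

text \<open>The components of the identity operator under left multiplication by \<open>X\<close>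
  are the projections to the generalized eigenspaces, obtained as polynomials in \<open>X\<close>.
  The set \<open>S\<close> comes from an annihilating polynomial that may not be minimal, so some
  \<open>P nu\<close> may be zero.\<close>

lemma spectral_projections:
 fixes T :: "'a::euclidean_space endo"
 obtains S P where "finite S" "(SUM nu:S. P nu) = 1" "!!nu. EX q. P nu = ev q (cpx T)"
  "!!nu. nu : S ==> EX k. lin nu (cpx T) ^ k * P nu = 0"
  "!!nu. nu : S ==> P nu * P nu = P nu"
  "!!mu B j. lin mu (cpx T) ^ j * B = 0 ==> (!!nu. nu : S ==> nu ~= mu ==> P nu * B = 0)"
proof -
 let ?X = "cpx T"
 have J: "?X * Jc = Jc * ?X" by(rule cpx_Jc)
 obtain p where p: "p ~= 0" "ev p ?X = 0" using ev_poly_annihilator by blast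
 obtain S q where S: "finite S" "1 = (SUM nu:S. pev (q nu) (%A. ?X * A) 1)"
  "ALL nu:S. EX k. pev ([:- nu, 1:] ^ k) (%A. ?X * A) (pev (q nu) (%A. ?X * A) 1) = 0"
  using generalized_eigen_decomposition[OF clin_left[OF J] p(1), of 1] p(2) by(auto simp: ev_def)
 define P where "P nu = ev (q nu) ?X" for nu
 have ex: "EX k. lin nu ?X ^ k * P nu = 0" if "nu : S" for nu using S(3) that by(simp add:pev_linear_power[OF J] P_def ev_def)
 have linc: "lin nu ?X ^ k * P mu = P mu * lin nu ?X ^ k" for nu mu k
 proof -
  have "lin nu ?X * ?X = ?X * lin nu ?X" using J by(simp add:lin_def algebra_simps sc_mult_left sc_mult_right)
  hence "P mu * lin nu ?X = lin nu ?X * P mu" unfolding P_def by(intro ev_commutes J lin_Jc) simp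
  thus ?thesis by(metis power_commuting_commutes)
 qed
 have kill: "P nu * B = 0" if "lin mu ?X ^ j * B = 0" and nuS: "nu : S" and "nu ~= mu" for mu j B nu
 proof -
  obtain k where k: "lin nu ?X ^ k * P nu = 0" using ex[OF nuS] by blast
  show ?thesis
  proof (rule coprime_killed[OF J that(3)])
   show "lin nu ?X ^ k * (P nu * B) = 0" using k by(simp add:mult.assoc[symmetric])
   show "lin mu ?X ^ j * (P nu * B) = 0" using that(1) linc[of mu j nu] by(simp add:mult.assoc[symmetric]) (simp add:mult.assoc)
  qed
 qed
 have one: "(SUM nu:S. P nu) = 1" using S(2) by(simp add:P_def ev_def)
 have idem: "P nu * P nu = P nu" if nu: "nu : S" for nu
 proof -
  obtain k where k: "lin nu ?X ^ k * P nu = 0" using ex[OF nu] by blast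
  have "P nu = (SUM mu:S. P mu) * P nu" by(simp add:one)
  also have "... = (SUM mu:S. if mu = nu then P nu * P nu else 0)" unfolding sum_distrib_right by(rule sum.cong) (auto simp: kill[OF k])
  also have "... = P nu * P nu" using nu S(1) by simp
  finally show ?thesis by simp
 qed
 show ?thesis by(rule that[of S P]) (use S(1) one ex idem kill in \<open>auto simp: P_def\<close>)
qed

lemma power_zero_of_projections:
 fixes T :: "'a::euclidean_space endo"
 assumes S: "finite S" "(SUM nu:S. P nu) = (1 :: ('a \<times> 'a) endo)"
  and k: "!!nu. nu : S ==> EX k. lin nu (cpx T) ^ k * P nu = 0"
  and z: "!!nu. nu : S ==> nu ~= 0 ==> P nu = 0"
 shows "EX k. T ^ k = 0"
proof -
 have "EX k. lin 0 (cpx T) ^ k * P nu = 0" if "nu : S" for nu using k[OF that] z[OF that] by(cases "nu = 0") auto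
 then obtain k where k: "!!nu. nu : S ==> lin 0 (cpx T) ^ k nu * P nu = 0" by metis
 define N where "N = (SUM nu:S. k nu)"
 have "lin 0 (cpx T) ^ N * P nu = 0" if "nu : S" for nu
 proof -
  have "k nu <= N" unfolding N_def using that S(1) by(intro member_le_sum) auto
  hence "lin 0 (cpx T) ^ N = lin 0 (cpx T) ^ (N - k nu) * lin 0 (cpx T) ^ k nu" by(simp flip: power_add)
  thus ?thesis using k[OF that] by(simp add:mult.assoc)
 qed
 hence "lin 0 (cpx T) ^ N * (SUM nu:S. P nu) = 0" by(simp add:sum_distrib_left)
 hence "cpx T ^ N = 0" by(simp add:S(2) lin_def)
 hence "cpx (T ^ N) = 0" by(simp add:cpx_power)
 thus ?thesis using cpx_eq_0 by blast
qed

text \<open>\<open>D\<close> commutes with the nilpotent operator \<open>(X - nu) P\<close>, so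
  their product is nilpotent as well.\<close>

lemma tr_nilpotent_part:
 assumes J: "X * Jc = Jc * X" and DJ: "D * Jc = Jc * D" and comm: "lin nu X * D = D * lin nu X" "P * lin nu X = lin nu X * P" "P * D = D * P"
  and P: "P * P = P" and k: "lin nu X ^ k * P = 0"
 shows "tr (D * (lin nu X * P)) = 0"
proof -
 have 1: "D * (lin nu X * P) = (lin nu X * P) * D" using comm by(simp add:mult_commuting)
 have "(lin nu X * P) ^ Suc k = lin nu X ^ Suc k * P ^ Suc k" by(rule power_mult_commuting) (use comm in simp)
 also have "P ^ Suc k = P" using P by(induction k) auto
 finally have "(lin nu X * P) ^ Suc k = 0" using k by(simp add:mult.assoc)
 hence "(D * (lin nu X * P)) ^ Suc k = 0" using power_mult_commuting[OF 1, of "Suc k"] by(simp del: power_Suc)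
 thus ?thesis by(rule tr_nilpotent)
qed

text \<open>The key step of Cartan's criterion. The operator \<open>S\<close> below acts on each generalized
 eigenspace of \<open>X\<close> by the conjugate eigenvalue; \<open>ad S\<close> does the same for \<open>ad X\<close> and so
 preserves the complexification of the Lie algebra, whence \<open>tr (X S) = \<Sum> |\<nu>|\<^sup>2 dim\<close> vanishes.\<close>

lemma cartan_nilpotent:
 fixes T :: "'v::euclidean_space => 'a::euclidean_space endo"
 assumes T: "linear T" and br: "!!x y. x : R ==> y : R ==> T (br x y) = T x * T y - T y * T x"
  and R: "!!x y. x : R ==> y : R ==> br x y : R"
  and tr0: "!!x y. x : R ==> y : R ==> tr (T x * T y) = 0"
  and x: "x : R" "x : span {br y z | y z. y : R & z : R}"
 shows "EX k. T x ^ k = 0"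
proof -
 let ?X = "cpx (T x)"
 have J: "?X * Jc = Jc * ?X" by(rule cpx_Jc)
 obtain S P where S: "finite S" "(SUM nu:S. P nu) = 1" and Pq: "!!nu. EX q. P nu = ev q ?X"
  and Pk: "!!nu. nu : S ==> EX k. lin nu ?X ^ k * P nu = 0"
  and PP: "!!nu. nu : S ==> P nu * P nu = P nu"
  and kill: "!!mu B j nu. lin mu ?X ^ j * B = 0 ==> nu : S ==> nu ~= mu ==> P nu * B = 0" using spectral_projections[of "T x"] by blast
 have PJ: "P nu * Jc = Jc * P nu" for nu using Pq[of nu] ev_Jc[OF J] by auto
 have Plin: "P nu * lin mu ?X = lin mu ?X * P nu" for nu mu
 proof -
  have "?X * lin mu ?X = lin mu ?X * ?X" using J by(simp add:lin_def algebra_simps sc_mult_left sc_mult_right)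
  thus ?thesis using Pq[of nu] ev_commutes[OF J lin_Jc[OF J]] by auto
 qed
 define s where "s = (SUM nu:S. sc (cnj nu) (P nu))"
 have sB: "s * B = sc (cnj mu) B" if B: "lin mu ?X ^ j * B = 0" for mu j B
 proof -
  have "s * B = (SUM nu:S. sc (cnj nu) (P nu * B))" by(simp add:s_def sum_distrib_right sc_mult_left)
  also have "... = (SUM nu:S. sc (cnj mu) (P nu * B))" by(rule sum.cong) (use kill[OF B] in \<open>auto\<close>, metis sc_zero_right)
  also have "... = sc (cnj mu) ((SUM nu:S. P nu) * B)" by(simp add:sc_sum_right sum_distrib_right)
  finally show ?thesis by(simp add:S)
 qed
 define ad where "ad A = ?X * A - A * ?X" for A
 have ad: "clin ad" unfolding ad_def[abs_def] by(rule clin_ad[OF J])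
 have adJ: "ad A * Jc = Jc * ad A" if "A * Jc = Jc * A" for A
 proof -
  have "?X * A * Jc = Jc * (?X * A)" "A * ?X * Jc = Jc * (A * ?X)" using that J by(simp_all add: mult_commuting)
  thus ?thesis by(simp add:ad_def algebra_simps)
 qed
 have pJ: "pev p ad A * Jc = Jc * pev p ad A" if "A * Jc = Jc * A" for p A
 proof (induction p)
  case (pCons a p)
  have "sc a A * Jc = Jc * sc a A" by(simp add:sc_mult_left sc_mult_right that)
  thus ?case using adJ[OF pCons.IH(1)] pCons by(simp add:pev_pCons[OF ad] distrib_left distrib_right)
 qed simp
 have comm: "s * Z - Z * s = sc (cnj kp) Z"
  if ZJ: "Z * Jc = Jc * Z" and Z: "pev ([:- kp, 1:] ^ j) ad Z = 0" for Z kp j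
 proof -
  \<comment> \<open>An operator of weight \<open>kp\<close> for \<open>ad X\<close> shifts
    eigenvalues by \<open>kp\<close>. By the Leibniz rule, \<open>X - nu - kp\<close> applied to
    \<open>Z A\<close> gives \<open>((ad X - kp) Z) A + Z ((X - nu) A)\<close>, and each summand
    lowers one of the exponents \<open>j\<close> and \<open>k\<close>.\<close>
  have shift: "EX i. lin (nu + kp) ?X ^ i * (Z * A) = 0"
   if "pev ([:- kp, 1:] ^ j) ad Z = 0" "lin nu ?X ^ k * A = 0" "Z * Jc = Jc * Z" for Z A j k nu using that
  proof (induction "j + k" arbitrary: j k Z A rule: less_induct)
   case less
   show ?case
   proof (cases "j = 0 | k = 0")
    case True
    hence "Z = 0 | A = 0" using less.prems ad by auto
    thus ?thesis by auto
   next
    case False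
    then obtain j' k' where jk: "j = Suc j'" "k = Suc k'" by(metis not0_implies_Suc)
    define Z' where "Z' = pev [:- kp, 1:] ad Z"
    have Z': "Z' = ad Z - sc kp Z" by(simp add:Z'_def pev_pCons[OF ad] clinD[OF ad] sc_minus_left)
    have Z'J: "Z' * Jc = Jc * Z'" unfolding Z'_def by(rule pJ[OF less.prems(3)])
    have e1: "pev ([:- kp, 1:] ^ j') ad Z' = 0" unfolding Z'_def pev_mult[OF ad, symmetric] using less.prems(1) by(simp only: jk power_Suc2)
    obtain i1 where i1: "lin (nu + kp) ?X ^ i1 * (Z' * A) = 0" using less.hyps[OF _ e1 less.prems(2) Z'J] jk by auto
    have e2: "lin nu ?X ^ k' * (lin nu ?X * A) = 0" using less.prems(2) by(simp only: jk power_Suc2 mult.assoc)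
    obtain i2 where i2: "lin (nu + kp) ?X ^ i2 * (Z * (lin nu ?X * A)) = 0" using less.hyps[OF _ less.prems(1) e2 less.prems(3)] jk by auto
    have eq: "lin (nu + kp) ?X * (Z * A) = Z' * A + Z * (lin nu ?X * A)" by(simp add:lin_mult Z' ad_def algebra_simps sc_mult_left sc_mult_right[OF less.prems(3)] sc_add_left)
    have le: "lin (nu + kp) ?X ^ (m + n) * B = 0" if "lin (nu + kp) ?X ^ n * B = 0" for m n B using that by(simp add:power_add mult.assoc)
    have "lin (nu + kp) ?X ^ Suc (i1 + i2) * (Z * A) = lin (nu + kp) ?X ^ (i1 + i2) * (Z' * A + Z * (lin nu ?X * A))" by(simp only: power_Suc2 mult.assoc eq)
    also have "... = 0" using le[OF i1, of i2] le[OF i2, of i1] by(simp add:distrib_left add.commute)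
    finally show ?thesis by blast
   qed
  qed
  have *: "(s * Z - Z * s) * P nu = sc (cnj kp) Z * P nu" if nu: "nu : S" for nu
  proof -
   obtain k where k: "lin nu ?X ^ k * P nu = 0" using Pk[OF nu] by blast
   obtain i where i: "lin (nu + kp) ?X ^ i * (Z * P nu) = 0" using shift[OF Z k ZJ] by blast
   have "(s * Z - Z * s) * P nu = s * (Z * P nu) - Z * (s * P nu)" by(simp add:algebra_simps)
   also have "... = sc (cnj (nu + kp)) (Z * P nu) - sc (cnj nu) (Z * P nu)" by(simp add:sB[OF i] sB[OF k] sc_mult_right[OF ZJ])
   finally show ?thesis by(simp add:sc_add_left sc_mult_left)
  qed
  have "(s * Z - Z * s) * (SUM nu:S. P nu) = sc (cnj kp) Z * (SUM nu:S. P nu)" unfolding sum_distrib_left by(rule sum.cong) (use * in auto)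
  thus ?thesis by(simp add:S)
 qed
 have adT: "ad (cpx (T z)) = cpx (T (br x z))" if "z : R" for z using br[OF x(1) that] by(simp add:ad_def cpx_mult cpx_diff)
 \<comment> \<open>Polynomials in \<open>ad X\<close> keep \<open>cpx (T z)\<close> in the complex
   span of the image of \<open>R\<close>, where the trace form vanishes by assumption.\<close>
 have trp: "tr (cpx (T y) * sc c (pev q ad (cpx (T z)))) = 0" if "y : R" "z : R" for y z c q using that(2)
 proof (induction q arbitrary: z c)
  case 0
  thus ?case by simp
 next
  case (pCons a q)
  have "tr (cpx (T y) * sc d (cpx (T z))) = 0" for d
  proof -
   have "cpx (T y) * sc d (cpx (T z)) = Re d *. cpx (T y * T z) + Im d *. (Jc * cpx (T y * T z))" unfolding sc_mult_right[OF cpx_Jc] by(simp add:sc_def cpx_mult)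
   thus ?thesis by(simp add:tr_cpx tr_Jc_cpx tr0[OF `y : R` pCons.prems])
  qed
  moreover have "tr (cpx (T y) * sc c (pev q ad (ad (cpx (T z))))) = 0" unfolding adT[OF pCons.prems] by(rule pCons.IH[OF R[OF x(1) pCons.prems]])
  ultimately show ?case by(simp add:pev_pCons[OF ad] pev_commute[OF ad] sc_add_right distrib_left)
 qed
 have trs: "tr (cpx (T y) * (s * cpx (T z) - cpx (T z) * s)) = 0" if "y : R" "z : R" for y z
 proof -
  have lC: "linear (%w. cpx (T w))" by(rule linearI) (simp_all add: linear_add[OF T] linear_scale[OF T] cpx_add cpx_scale)
  have it: "(ad ^^ i) (cpx (T z)) = cpx (T ((br x ^^ i) z)) & (br x ^^ i) z : R" for i by(induction i) (use `z : R` in \<open>auto simp: adT R[OF x(1)]\<close>)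
  have "EX p. p ~= 0 & pev p ad (cpx (T z)) = 0" by(rule iterates_poly_annihilator[OF ad lC, of z "br x"]) (simp add:it)
  then obtain p where p: "p ~= 0" "pev p ad (cpx (T z)) = 0" by blast
  obtain K q where K: "finite K" "cpx (T z) = (SUM kp:K. pev (q kp) ad (cpx (T z)))"
   "ALL kp:K. EX k. pev ([:- kp, 1:] ^ k) ad (pev (q kp) ad (cpx (T z))) = 0" using generalized_eigen_decomposition[OF ad p] by blast
  let ?Z = "%kp. pev (q kp) ad (cpx (T z))"
  have c: "s * ?Z kp - ?Z kp * s = sc (cnj kp) (?Z kp)" if "kp : K" for kp using K(3) that comm[OF pJ[OF cpx_Jc]] by blast
  have "s * cpx (T z) - cpx (T z) * s = s * (SUM kp:K. ?Z kp) - (SUM kp:K. ?Z kp) * s" using K(2) by simp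
  also have "... = (SUM kp:K. s * ?Z kp - ?Z kp * s)" by(simp only: sum_distrib_left sum_distrib_right sum_subtractf)
  also have "... = (SUM kp:K. sc (cnj kp) (?Z kp))" by(rule sum.cong) (auto simp: c)
  finally show ?thesis by(simp add:sum_distrib_left trp[OF `y : R` `z : R`])
 qed
 \<comment> \<open>On a commutator, \<open>tr ([y, z] s) = - tr (y [s, z])\<close>, and the bracket
   with \<open>s\<close> has already been dealt with.\<close>
 have "tr (cpx (T w) * s) = 0" if "w : span {br y z | y z. y : R & z : R}" for w using that
 proof (induction rule: span_induct_alt)
  case base
  show ?case by(simp add:linear_0[OF T] cpx_zero)
 next
  case (step c u w)
  then obtain y z where u: "u = br y z" "y : R" "z : R" by blast
  have "cpx (T u) * s = cpx (T y) * cpx (T z) * s - cpx (T z) * (cpx (T y) * s)" by(simp add:u br cpx_diff cpx_mult algebra_simps)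
  hence "tr (cpx (T u) * s) = tr (cpx (T y) * cpx (T z) * s) - tr ((cpx (T y) * s) * cpx (T z))" by(simp add:tr_commute[of "cpx (T z)"])
  also have "... = - tr (cpx (T y) * (s * cpx (T z) - cpx (T z) * s))" by(simp add:algebra_simps)
  also have "... = 0" using trs u by simp
  finally have "tr (cpx (T u) * s) = 0" .
  thus ?case using step by(simp add:linear_add[OF T] linear_scale[OF T] cpx_add cpx_scale distrib_right)
 qed
 from this[OF x(2)] have "tr (?X * s) = 0" .
 moreover have "tr (?X * sc (cnj nu) (P nu)) = (cmod nu)\<^sup>2 * tr (P nu)" if nu: "nu : S" for nu
 proof -
  obtain k where k: "lin nu ?X ^ k * P nu = 0" using Pk[OF nu] by blast
  have "?X * sc (cnj nu) (P nu) = sc (cnj nu) (lin nu ?X * P nu) + sc (cnj nu * nu) (P nu)" by(simp add:sc_mult_right[OF J] lin_mult sc_diff_right)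
  also have "sc (cnj nu * nu) (P nu) = (cmod nu)\<^sup>2 *. P nu" by(simp add:mult.commute complex_norm_square[symmetric] sc_of_real[symmetric] del: of_real_power)
  also have "sc (cnj nu) (lin nu ?X * P nu) = sc (cnj nu) 1 * (lin nu ?X * P nu)" by(simp add:sc_mult_left)
  finally show ?thesis using tr_nilpotent_part[OF J, of "sc (cnj nu) 1" nu "P nu" k] Plin PP[OF nu] k by(simp add:sc_mult_left sc_mult_right lin_Jc[OF J] PJ)
 qed
 ultimately have "(SUM nu:S. (cmod nu)\<^sup>2 * tr (P nu)) = 0" by(simp add:s_def sum_distrib_left)
 hence "ALL nu:S. (cmod nu)\<^sup>2 * tr (P nu) = 0" using S(1) tr_idempotent(1)[OF PP] by(subst (asm) sum_nonneg_eq_0_iff) auto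
 hence "P nu = 0" if "nu : S" "nu ~= 0" for nu using that tr_idempotent(2)[OF PP[OF that(1)]] by auto
 thus ?thesis by(intro power_zero_of_projections[OF S Pk]) auto
qed

lemma bounded_linear_cpx: "bounded_linear (cpx :: 'a::euclidean_space endo => _)"
proof (rule bounded_linear_intro)
 fix T :: "'a endo"
 show "norm (cpx T) <= norm T * 2"
 proof (rule norm_endo_le)
  fix z :: "'a \<times> 'a"
  have "norm (eapp (cpx T) z) <= norm (eapp T (fst z)) + norm (eapp T (snd z))" by(simp add:norm_Pair_le)
  also have "... <= norm T * norm (fst z) + norm T * norm (snd z)" by(intro add_mono norm_eapp)
  also have "... <= norm T * norm z + norm T * norm z" by(intro add_mono mult_left_mono) (use norm_fst_le[of "fst z" "snd z"] norm_snd_le[of "snd z" "fst z"] in auto)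
  finally show "norm (eapp (cpx T) z) <= norm T * 2 * norm z" by simp
 qed simp
qed (simp_all add: cpx_add cpx_scale)

lemma norm_sc_le:
 fixes A :: "('a::euclidean_space \<times> 'a) endo"
 shows "norm (sc c A) <= cmod c * (1 + norm (Jc :: ('a \<times> 'a) endo)) * norm A"
proof -
 have "norm (sc c A) <= \<bar>Re c\<bar> * norm A + \<bar>Im c\<bar> * norm (Jc * A)" unfolding sc_def by(rule order_trans[OF norm_triangle_ineq]) simp
 also have "... <= cmod c * norm A + cmod c * (norm (Jc :: ('a \<times> 'a) endo) * norm A)" by(intro add_mono mult_mono abs_Re_le_cmod abs_Im_le_cmod norm_mult_ineq) auto
 finally show ?thesis by(simp add:algebra_simps)
qed

lemma bounded_linear_sc:
 fixes A :: "('a::euclidean_space \<times> 'a) endo"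
 shows "bounded_linear (%c. sc c A)"
proof (rule bounded_linear_intro)
 show "norm (sc c A) <= norm c * ((1 + norm (Jc :: ('a \<times> 'a) endo)) * norm A)" for c using norm_sc_le[of c A] by(simp add:mult.assoc)
qed (simp_all add: sc_def algebra_simps)

lemma exp_eigen:
 assumes J: "X * Jc = Jc * X" and A: "X * A = sc nu A"
 shows "exp X * A = sc (exp nu) A"
proof -
 have p: "X ^ n * A = sc (nu ^ n) A" for n by(induction n) (simp_all add: mult.assoc sc_mult_right[OF J] A mult.commute)
 have "(%n. X ^ n /\<^sub>R fact n * A) sums (exp X * A)" by(intro sums_mult2 exp_converges)
 moreover have "(%n. sc (nu ^ n /\<^sub>R fact n) A) sums sc (exp nu) A" by(intro bounded_linear.sums[OF bounded_linear_sc] exp_converges)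
 moreover have "X ^ n /\<^sub>R fact n * A = sc (nu ^ n /\<^sub>R fact n) A" for n by(simp add:p linear_simps[OF bounded_linear_sc])
 ultimately show ?thesis by(simp add:sums_iff)
qed

text \<open>A bounded one-parameter group is generated by a semisimple operator with imaginary
 spectrum.\<close>

lemma bounded_flow_trace:
 fixes T :: "'a::euclidean_space endo"
 assumes bdd: "!!t. norm (exp (t *. T)) <= C"
 shows "tr (T * T) <= 0" and "tr (T * T) = 0 ==> T = 0"
proof -
 let ?X = "cpx T"
 have J: "?X * Jc = Jc * ?X" by(rule cpx_Jc)
 obtain S P where S: "finite S" "(SUM nu:S. P nu) = 1" and Pq: "!!nu. EX q. P nu = ev q ?X"
  and Pk: "!!nu. nu : S ==> EX k. lin nu ?X ^ k * P nu = 0"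
  and PP: "!!nu. nu : S ==> P nu * P nu = P nu"
  and "!!mu B j nu. lin mu ?X ^ j * B = 0 ==> nu : S ==> nu ~= mu ==> P nu * B = 0" using spectral_projections[of T] by blast
 \<comment> \<open>On a true eigenvector the flow has size \<open>exp (t Re nu)\<close> up to
   constants, and it is bounded for all real \<open>t\<close> of either sign.\<close>
 have imag: "Re nu = 0" if nu: "nu : S" "P nu ~= 0" for nu
 proof -
  define k where "k = (LEAST k. lin nu ?X ^ k * P nu = 0)"
  have k: "lin nu ?X ^ k * P nu = 0" unfolding k_def by(rule LeastI_ex[OF Pk[OF nu(1)]])
  hence "k ~= 0" using nu(2) by(intro notI) simp
  then obtain j where j: "k = Suc j" by(metis not0_implies_Suc)
  define A where "A = lin nu ?X ^ j * P nu"
  have A0: "A ~= 0" unfolding A_def using not_less_Least[of j "%k. lin nu ?X ^ k * P nu = 0"] j k_def by auto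
  have "lin nu ?X * A = 0" using k by(simp add:A_def j mult.assoc)
  hence XA: "?X * A = sc nu A" by(simp add:lin_mult)
  obtain L where L: "L > 0" "!!T::'a endo. norm (cpx T) <= norm T * L" using bounded_linear.pos_bounded[OF bounded_linear_cpx] by blast
  define N where "N = (1 + norm (Jc :: ('a \<times> 'a) endo)) * (C * L)"
  have le: "exp (t * Re nu) <= N" for t
  proof -
   have "(t *. ?X) * A = sc (of_real t * nu) A" by(simp add:XA sc_sc[symmetric] sc_of_real del: sc_sc)
   moreover have "(t *. ?X) * Jc = Jc * (t *. ?X)" using J by simp
   ultimately have e: "exp (t *. ?X) * A = sc (exp (of_real t * nu)) A" by(intro exp_eigen)
   have ex: "exp (t *. ?X) = cpx (exp (t *. T))" using exp_algebra_hom[OF bounded_linear_cpx, of "t *. T"] by(simp add:cpx_power cpx_scale)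
   have n1: "norm (sc (exp (of_real t * nu)) A) <= (C * L) * norm A" unfolding e[symmetric] ex using L bdd[of t]
    by(intro order_trans[OF norm_mult_ineq] mult_right_mono order_trans[OF L(2)]) auto
   have "A = sc (1 / exp (of_real t * nu)) (sc (exp (of_real t * nu)) A)" by simp
   hence "norm A <= cmod (1 / exp (of_real t * nu)) * (1 + norm (Jc :: ('a \<times> 'a) endo)) * ((C * L) * norm A)"
    using norm_sc_le[of "1 / exp (of_real t * nu)" "sc (exp (of_real t * nu)) A"]
     mult_left_mono[OF n1, of "cmod (1 / exp (of_real t * nu)) * (1 + norm (Jc :: ('a \<times> 'a) endo))"] by(smt (verit) mult_nonneg_nonneg norm_ge_zero)
   hence "norm A <= (N / exp (t * Re nu)) * norm A" by(simp add:norm_divide N_def)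
   hence "exp (t * Re nu) * norm A <= N * norm A" by(simp add:field_simps)
   thus ?thesis using A0 by simp
  qed
  show ?thesis
  proof (rule ccontr)
   assume ne: "Re nu ~= 0"
   have "exp (((N + 1) / Re nu) * Re nu) <= N" by(rule le)
   hence "exp (N + 1) <= N" using ne by simp
   thus False using exp_ge_add_one_self[of "N + 1"] by linarith
  qed
 qed
 have trP: "tr (?X * ?X * P nu) = - ((Im nu)\<^sup>2 * tr (P nu))" if nu: "nu : S" for nu
 proof (cases "P nu = 0")
  case False
  obtain k where k: "lin nu ?X ^ k * P nu = 0" using Pk[OF nu] by blast
  define D where "D = ?X + sc nu 1"
  have PJ: "P nu * Jc = Jc * P nu" using Pq[of nu] ev_Jc[OF J] by auto
  have PX: "P nu * ?X = ?X * P nu" using Pq[of nu] ev_commutes[OF J J] by auto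
  have "?X * ?X * P nu = D * (lin nu ?X * P nu) + sc (nu * nu) (P nu)" by(simp add:D_def lin_mult algebra_simps sc_mult_left sc_mult_right[OF J] sc_diff_right)
  moreover have "nu * nu = complex_of_real (- (Im nu)\<^sup>2)" using imag[OF nu False] by(simp add:complex_eq_iff power2_eq_square)
  moreover have "tr (D * (lin nu ?X * P nu)) = 0"
  proof (rule tr_nilpotent_part[OF J])
   show "D * Jc = Jc * D" using J by(simp add:D_def algebra_simps sc_mult_left sc_mult_right)
   show "lin nu ?X * D = D * lin nu ?X" "P nu * lin nu ?X = lin nu ?X * P nu" "P nu * D = D * P nu"
    using J PX PJ by(simp_all add: D_def lin_def algebra_simps sc_mult_left sc_mult_right)
  qed (use PP[OF nu] k in auto)
  ultimately show ?thesis by(simp add:sc_of_real del: of_real_power of_real_minus)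
 qed simp
 have "?X * ?X = (SUM nu:S. ?X * ?X * P nu)" by(simp add:S sum_distrib_left[symmetric])
 hence "tr (?X * ?X) = tr (SUM nu:S. ?X * ?X * P nu)" by(rule arg_cong)
 also have "... = (SUM nu:S. - ((Im nu)\<^sup>2 * tr (P nu)))" unfolding tr_sum by(rule sum.cong) (auto simp: trP)
 finally have "tr (?X * ?X) = - (SUM nu:S. (Im nu)\<^sup>2 * tr (P nu))" by(simp add:sum_negf)
 hence eq: "2 * tr (T * T) = - (SUM nu:S. (Im nu)\<^sup>2 * tr (P nu))" by(simp add:cpx_mult[symmetric] tr_cpx)
 have nn: "0 <= (Im nu)\<^sup>2 * tr (P nu)" if "nu : S" for nu using tr_idempotent(1)[OF PP[OF that]] by simp
 thus "tr (T * T) <= 0" using eq sum_nonneg[of S "%nu. (Im nu)\<^sup>2 * tr (P nu)"] by simp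
 assume "tr (T * T) = 0"
 hence "(SUM nu:S. (Im nu)\<^sup>2 * tr (P nu)) = 0" using eq by simp
 hence z: "ALL nu:S. (Im nu)\<^sup>2 * tr (P nu) = 0" using S(1) nn by(subst (asm) sum_nonneg_eq_0_iff) auto
 have "P nu = 0" if "nu : S" "nu ~= 0" for nu
 proof (rule ccontr)
  assume "P nu ~= 0"
  hence "Im nu = 0" using z that tr_idempotent(2)[OF PP[OF that(1)]] by auto
  thus False using imag[OF that(1) `P nu ~= 0`] that(2) by(simp add:complex_eq_iff)
 qed
 hence ex: "EX k. T ^ k = 0" by(intro power_zero_of_projections[OF S Pk]) auto
 define k where "k = (LEAST k. T ^ k = 0)"
 have k: "T ^ k = 0" unfolding k_def by(rule LeastI_ex[OF ex])
 have kl: "T ^ j ~= 0" if "j < k" for j using that not_less_Least k_def by blast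
 show "T = 0"
 proof (cases "k <= 1")
  case True
  thus ?thesis using k by(cases k) auto
 next
  case False
  then obtain j where j: "k = Suc (Suc j)" by(metis One_nat_def Suc_le_mono le0 not0_implies_Suc)
  \<comment> \<open>Two powers below the first vanishing one, so that \<open>exp (t T)\<close> acts
    on \<open>B\<close> as \<open>1 + t T\<close>. This is unbounded in \<open>t\<close> unless
    \<open>T * B = 0\<close>, contrary to the minimality of \<open>k\<close>.\<close>
  define B where "B = T ^ j"
  have TB: "T * B ~= 0" using kl[of "Suc j"] j by(simp add:B_def)
  have TTB: "T ^ Suc (Suc n) * B = 0" for n
  proof -
   have "T ^ Suc (Suc n) * B = T ^ n * T ^ k" by(simp add:B_def j power_add[symmetric] power_Suc[symmetric] del: power_Suc)
   thus ?thesis by(simp add:k)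
  qed
  have e: "exp (t *. T) * B = B + t *. (T * B)" for t
  proof -
   have "(%n. (t *. T) ^ n /\<^sub>R fact n * B) sums (\<Sum>n<2. (t *. T) ^ n /\<^sub>R fact n * B)"
   proof (rule sums_finite)
    show "(t *. T) ^ n /\<^sub>R fact n * B = 0" if "n ~: {..<2}" for n
    proof -
     have "n = Suc (Suc (n - 2))" using that by simp
     then obtain i where "n = Suc (Suc i)" by blast
     thus ?thesis using TTB[of i] by(simp only: scaleR_power mult_scaleR_left) simp
    qed
   qed simp
   moreover have "(%n. (t *. T) ^ n /\<^sub>R fact n * B) sums (exp (t *. T) * B)" by(intro sums_mult2 exp_converges)
   ultimately have "exp (t *. T) * B = (\<Sum>n<2. (t *. T) ^ n /\<^sub>R fact n * B)" by(rule sums_unique2[symmetric])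
   thus ?thesis by(simp add:numeral_2_eq_2)
  qed
  have le: "t * norm (T * B) <= C * norm B + norm B" for t
  proof -
   have "norm (exp (t *. T) * B) <= C * norm B" using bdd[of t] by(intro order_trans[OF norm_mult_ineq] mult_right_mono) auto
   moreover have "norm (t *. (T * B)) <= norm (B + t *. (T * B)) + norm B" using norm_triangle_ineq4[of "B + t *. (T * B)" B] by simp
   moreover have "t * norm (T * B) <= norm (t *. (T * B))" by(simp add:mult_right_mono)
   ultimately show ?thesis by(simp add:e)
  qed
  from le[of "(C * norm B + norm B + 1) / norm (T * B)"] TB show ?thesis by simp
 qed
qed

section \<open>Engel's theorem\<close>

definition subalgebra :: "(real^'n^'n) set => bool" where "subalgebra H \<longleftrightarrow> subspace H & (ALL x:H. ALL y:H. lb x y : H)"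

definition ad_nilpotent :: "(real^'n^'n) set => (real^'n^'n) set => bool" where "ad_nilpotent V H \<longleftrightarrow> (ALL x:H. EX k. ALL z:V. (lb x ^^ k) z = 0)"

lemma subspace_dim_psubset:
 fixes U V :: "'a::euclidean_space set"
 assumes "subspace U" "subspace V" "U \<subset> V"
 shows "dim U < dim V" using dim_psubset[of U V] span_eq_iff[THEN iffD2, OF assms(1)] span_eq_iff[THEN iffD2, OF assms(2)] assms(3) by simp

lemma maximal_subalgebra:
 assumes H: "subalgebra H" "H ~= {0}"
 obtains M where "subalgebra M" "M \<subset> H" "!!N. subalgebra N ==> M \<subset> N ==> N <= H ==> N = H"
proof -
 have "subalgebra {0} & {0} \<subset> H" using H subspace_0[of H] by(auto simp: subalgebra_def)
 moreover have "ALL M. subalgebra M & M \<subset> H --> dim M < Suc (dim H)" using dim_subset less_Suc_eq_le by blast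
 ultimately obtain M where M: "subalgebra M" "M \<subset> H" "!!N. subalgebra N & N \<subset> H ==> dim N <= dim M"
  using ex_has_greatest_nat[of "%M. subalgebra M & M \<subset> H" "{0}" dim "dim H + 1"] by(metis Suc_eq_plus1)
 show ?thesis
 proof (rule that[OF M(1,2)])
  fix N assume N: "subalgebra N" "M \<subset> N" "N <= H"
  show "N = H"
  proof (rule ccontr)
   assume "N ~= H"
   hence "dim N <= dim M" using M(3) N by blast
   hence "M = N" using N M by(intro subspace_dim_equal) (auto simp: subalgebra_def)
   thus False using N by blast
  qed
 qed
qed

text \<open>As \<open>y\<close> normalizes \<open>M\<close>, the span of \<open>M\<close> and
  \<open>y\<close> is a subalgebra, hence all of \<open>H\<close> by maximality.\<close>

lemma maximal_subalgebra_complement: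
 assumes H: "subalgebra H" and M: "subalgebra M" "M \<subset> H" "!!N. subalgebra N ==> M \<subset> N ==> N <= H ==> N = H"
  and y: "y : H" "y ~: M" "!!m. m : M ==> lb m y : M" and h: "h : H"
 shows "EX c. h - c *. y : M"
proof -
 have sM: "subspace M" and sH: "subspace H" using M H by(auto simp: subalgebra_def)
 let ?N = "span (insert y M)"
 have mem: "x : ?N \<longleftrightarrow> (EX c. x - c *. y : M)" for x using span_breakdown_eq[of x y M] span_eq_iff[THEN iffD2, OF sM] by simp
 have "subalgebra ?N" unfolding subalgebra_def
 proof (intro conjI ballI subspace_span)
  fix x x' assume "x : ?N" "x' : ?N"
  then obtain c c' where c: "x - c *. y : M" "x' - c' *. y : M" using mem by blast
  define m m' where "m = x - c *. y" and "m' = x' - c' *. y"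
  have "x = m + c *. y" "x' = m' + c' *. y" by(simp_all add: m_def m'_def)
  hence "lb x x' = lb m m' + c' *. lb m y - c *. lb m' y" by(simp add:bracket_simps bracket_commute[of y m'])
  moreover have "lb m m' : M" "lb m y : M" "lb m' y : M" using c M(1) y(3) by(auto simp: m_def m'_def subalgebra_def)
  ultimately have "lb x x' : M" using sM by(simp add:subspace_add subspace_diff subspace_scale)
  thus "lb x x' : ?N" by(simp add:span_base)
 qed
 moreover have "M \<subset> ?N" using y(2) by(auto intro: span_base)
 moreover have "?N <= H" using y(1) M(2) sH by(intro span_minimal) auto
 ultimately have "?N = H" by(rule M(3))
 thus ?thesis using h mem by blast
qed

text \<open>Engel's theorem for the action of \<open>H\<close> on the quotient \<open>V / U\<close>,
  phrased by a pair of invariant subspaces. The induction uses it twice for a maximal subalgebra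
  \<open>M\<close>: on the pair \<open>M\<close>, \<open>H\<close> to find a normalizing
  \<open>y\<close>, and on the pair \<open>U\<close>, \<open>V\<close> itself.\<close>

lemma engel_pair:
 assumes "subalgebra H" "ad_nilpotent L H" "H <= L"
  and "subspace U" "subspace V" "U \<subset> V" "V <= L"
  and "!!h u. h : H ==> u : U ==> lb h u : U"
  and "!!h v. h : H ==> v : V ==> lb h v : V"
 shows "EX x:V - U. ALL h:H. lb h x : U" using assms
proof (induction "dim H" arbitrary: H U V rule: less_induct)
 case less
 show ?case
 proof (cases "H = {0}")
  case True
  thus ?thesis using less.prems(6) subspace_0[OF less.prems(4)] by auto
 next
  case False
  obtain M where M: "subalgebra M" "M \<subset> H" "!!N. subalgebra N ==> M \<subset> N ==> N <= H ==> N = H" using maximal_subalgebra[OF less.prems(1) False] by metis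
  have sM: "subspace M" and sH: "subspace H" using M less.prems(1) by(auto simp: subalgebra_def)
  have dM: "dim M < dim H" by(rule subspace_dim_psubset[OF sM sH M(2)])
  have nM: "ad_nilpotent L M" and MsL: "M <= L" using less.prems(2,3) M(2) by(auto simp: ad_nilpotent_def)
  have "EX y:H - M. ALL h:M. lb h y : M" by(rule less.hyps[OF dM M(1) nM MsL sM sH M(2) less.prems(3)])
    (use M less.prems(1) in \<open>auto simp: subalgebra_def\<close>)
  then obtain y where y: "y : H" "y ~: M" "!!m. m : M ==> lb m y : M" by blast
  have "EX x:V - U. ALL h:M. lb h x : U" by(rule less.hyps[OF dM M(1) nM MsL less.prems(4-7)])
    (use M(2) less.prems(8,9) in auto)
  then obtain x0 where x0: "x0 : V" "x0 ~: U" "!!h. h : M ==> lb h x0 : U" by blast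
  \<comment> \<open>Because \<open>y\<close> normalizes \<open>M\<close>, applying
    \<open>ad y\<close> preserves the vectors that \<open>M\<close> maps into \<open>U\<close>. The
    last iterate outside \<open>U\<close> is then mapped into \<open>U\<close> by \<open>y\<close>
    as well.\<close>
  have inv: "(lb y ^^ i) x0 : V & (ALL h:M. lb h ((lb y ^^ i) x0) : U)" for i
  proof (induction i)
   case (Suc i)
   let ?x = "(lb y ^^ i) x0"
   have "lb h (lb y ?x) : U" if h: "h : M" for h
   proof -
    have "lb (lb h y) ?x : U" using Suc y(3)[OF h] by blast
    moreover have "lb y (lb h ?x) : U" using Suc h y(1) less.prems(8) by blast
    ultimately show ?thesis unfolding jacobi[of h y] by(rule subspace_add[OF less.prems(4)])
   qed
   thus ?case using Suc y(1) less.prems(9) by simp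
  qed (use x0 in auto)
  obtain k where "ALL z:L. (lb y ^^ k) z = 0" using less.prems(2) y(1) by(auto simp: ad_nilpotent_def)
  hence "(lb y ^^ k) x0 : U" using x0(1) less.prems(7) subspace_0[OF less.prems(4)] by auto
  hence ex: "EX k. (lb y ^^ k) x0 : U" by blast
  define j where "j = (LEAST k. (lb y ^^ k) x0 : U)"
  have j: "(lb y ^^ j) x0 : U" unfolding j_def by(rule LeastI_ex[OF ex])
  hence "j ~= 0" using x0(2) by(intro notI) simp
  then obtain i where i: "j = Suc i" by(metis not0_implies_Suc)
  define x where "x = (lb y ^^ i) x0"
  have xU: "x ~: U" unfolding x_def using not_less_Least[of i "%k. (lb y ^^ k) x0 : U"] i j_def by auto
  have yx: "lb y x : U" using j by(simp add:x_def i)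
  have "lb h x : U" if h: "h : H" for h
  proof -
   obtain c where c: "h - c *. y : M" using maximal_subalgebra_complement[OF less.prems(1) M y h] by blast
   have "lb h x = lb (h - c *. y) x + c *. lb y x" by(simp add:bracket_simps)
   thus ?thesis using inv[of i] c yx less.prems(4) by(simp add:x_def subspace_add subspace_scale)
  qed
  thus ?thesis using xU inv[of i] by(auto simp: x_def)
 qed
qed

lemma subspace_derived_algebra: "subspace (derived_algebra H)" unfolding derived_algebra_def by(rule subspace_span)

lemma derived_algebra_minimal: "subspace W ==> (!!x y. x : H ==> y : H ==> lb x y : W) ==> derived_algebra H <= W" unfolding derived_algebra_def by(rule span_minimal) auto

lemma bracket_in_derived_algebra: "x : H ==> y : H ==> lb x y : derived_algebra H" unfolding derived_algebra_def by(rule span_base) blast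

lemma derived_algebra_subset: "subalgebra H ==> derived_algebra H <= H" by(rule derived_algebra_minimal) (auto simp: subalgebra_def)

lemma subalgebra_derived_algebra: "subalgebra H ==> subalgebra (derived_algebra H)" unfolding subalgebra_def[of "derived_algebra H"]
 using subspace_derived_algebra derived_algebra_subset bracket_in_derived_algebra by blast

text \<open>\<open>engel_pair\<close> gives an element normalizing a maximal subalgebra
  \<open>M\<close>. Then \<open>H\<close> is \<open>M\<close> plus one line, so its derived algebra
  lies in \<open>M\<close> and has smaller dimension.\<close>

lemma engel_solvable:
 assumes "subalgebra H" "ad_nilpotent H H"
 shows "lie_solvable H" using assms
proof (induction "dim H" arbitrary: H rule: less_induct)
 case less
 show ?case
 proof (cases "H = {0}")
  case True
  thus ?thesis unfolding lie_solvable_def by(intro exI[of _ 0]) simp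
 next
  case False
  obtain M where M: "subalgebra M" "M \<subset> H" "!!N. subalgebra N ==> M \<subset> N ==> N <= H ==> N = H" using maximal_subalgebra[OF less.prems(1) False] by metis
  have sM: "subspace M" and sH: "subspace H" using M less.prems(1) by(auto simp: subalgebra_def)
  have "EX y:H - M. ALL h:M. lb h y : M" by(rule engel_pair[of M H]) (use M less.prems sM sH in \<open>auto simp: subalgebra_def ad_nilpotent_def\<close>)
  then obtain y where y: "y : H" "y ~: M" "!!m. m : M ==> lb m y : M" by blast
  have "derived_algebra H <= M"
  proof (rule derived_algebra_minimal[OF sM])
   fix a b assume ab: "a : H" "b : H"
   obtain c d where cd: "a - c *. y : M" "b - d *. y : M" using maximal_subalgebra_complement[OF less.prems(1) M y] ab by blast
   have "lb a b = lb (a - c *. y) (b - d *. y) + d *. lb (a - c *. y) y - c *. lb (b - d *. y) y" by(simp add:bracket_simps bracket_commute[of y b] algebra_simps)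
   thus "lb a b : M" using cd M(1) y(3) sM by(simp add:subalgebra_def subspace_add subspace_diff subspace_scale)
  qed
  hence sub: "derived_algebra H \<subset> H" using M(2) by blast
  have "dim (derived_algebra H) < dim H" by(rule subspace_dim_psubset[OF subspace_derived_algebra sH sub])
  moreover have "ad_nilpotent (derived_algebra H) (derived_algebra H)" using less.prems(2) sub by(auto simp: ad_nilpotent_def) blast
  ultimately have "lie_solvable (derived_algebra H)" using less.hyps subalgebra_derived_algebra[OF less.prems(1)] by blast
  then obtain k where "(derived_algebra ^^ k) (derived_algebra H) = {0}" by(auto simp: lie_solvable_def)
  hence "(derived_algebra ^^ Suc k) H = {0}" by(simp add:funpow_swap1)
  thus ?thesis unfolding lie_solvable_def by blast
 qed
qed

section \<open>Traces on subspaces and the Killing form\<close>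

lemma tr_basis:
 fixes V :: "'a::euclidean_space set"
 assumes V: "subspace V" and B: "independent B" "span B = V" and T: "!!x. x : V ==> eapp T x : V"
 shows "tr (T * eproj V) = (SUM b:B. representation B (eapp T b) b)"
proof -
 have fin: "finite B" using B(1) by(rule independent_imp_finite)
 have BV: "b : V" if "b : B" for b using that B(2) span_base by blast
 define r where "r b x = representation B (eapp T (proj V x)) b" for b x
 have Tin: "eapp T (proj V x) : span B" for x using T proj_in[OF V] B(2) by simp
 have lr: "linear (r b)" for b
 proof (rule linearI)
  fix x y and c :: real
  show "r b (x + y) = r b x + r b y" unfolding r_def linear_add[OF linear_proj[OF V]] eapp.add_right by(simp add:representation_add[OF B(1) Tin Tin])
  show "r b (c *. x) = c *. r b x" unfolding r_def linear_scale[OF linear_proj[OF V]] eapp.scaleR_right by(simp add:representation_scale[OF B(1) Tin])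
 qed
 have e: "eapp T (proj V x) = (SUM b:B. r b x *. b)" for x unfolding r_def using sum_representation_eq[OF B(1) Tin fin subset_refl] by simp
 have "tr (T * eproj V) = (SUM e:Basis. SUM b:B. r b e * (b \<bullet> e))" by(simp add:tr_def V e inner_sum_left)
 also have "... = (SUM b:B. SUM e:Basis. r b e * (b \<bullet> e))" by(rule sum.swap)
 also have "... = (SUM b:B. r b (SUM e:Basis. (b \<bullet> e) *. e))" by(simp add:linear_sum[OF lr] linear_scale[OF lr] mult.commute)
 also have "... = (SUM b:B. representation B (eapp T b) b)" by(rule sum.cong) (simp_all add: euclidean_representation r_def proj_id[OF V] BV)
 finally show ?thesis .
qed

lemma trace_on_eq_tr:
 assumes V: "subspace V" and f: "linear f" "!!x. x : V ==> f x : V"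
 shows "trace_on V f = tr (endo f * eproj V)"
proof -
 define B where "B = (SOME B. independent B & span B = V)"
 have "EX B. independent B & span B = V" using basis_exists[of V] span_eq_iff[THEN iffD2, OF V] by(metis span_minimal span_span subset_antisym V span_mono)
 hence B: "independent B & span B = V" unfolding B_def by(rule someI_ex)
 have "trace_on V f = (SUM b:B. representation B (f b) b)" by(simp add:trace_on_def B_def[symmetric] Let_def)
 also have "... = tr (endo f * eproj V)" using tr_basis[OF V conjunct1[OF B] conjunct2[OF B], of "endo f"] f by simp
 finally show ?thesis .
qed

context matgroup
begin

abbreviation "gg == lie_algebra G"

abbreviation "eg == eproj gg"

lemmas gg_subspace = subspace_lie_algebra
lemmas gg_cl = subspace_add[OF gg_subspace] subspace_diff[OF gg_subspace]
 subspace_scale[OF gg_subspace] subspace_neg[OF gg_subspace] subspace_0[OF gg_subspace] lie_algebra_bracket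

lemma eapp_eg [simp]: "eapp eg = gproj" by(simp add:gg_subspace)

text \<open>\<open>ad X\<close> on the Lie algebra, extended by zero to its orthogonal complement: a
  total operator whose trace is the trace on \<open>gg\<close>.\<close>

definition adG :: "real^'n^'n => (real^'n^'n) endo" where "adG X = adE X * eg"

lemma eapp_adG [simp]: "eapp (adG X) z = lb X (gproj z)" by(simp add:adG_def)

lemma linear_adG: "linear adG" by(rule linearI; rule endo_eqI) (simp_all add: bracket_simps eapp.add_left eapp.scaleR_left)

lemma adG_bracket:
 assumes "X : gg" "Y : gg"
 shows "adG (lb X Y) = adG X * adG Y - adG Y * adG X" by(rule endo_eqI) (simp add:eapp.diff_left gproj_id lie_algebra_bracket assms gproj_in jacobi[of X Y])

definition kf :: "real^'n^'n => real^'n^'n => real" where "kf X Y = tr (adG X * adG Y)"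

lemma kf_commute: "kf X Y = kf Y X" unfolding kf_def by(rule tr_commute)

lemma kf_simps: "kf (X + Y) Z = kf X Z + kf Y Z" "kf X (Y + Z) = kf X Y + kf X Z"
 "kf (X - Y) Z = kf X Z - kf Y Z" "kf X (Y - Z) = kf X Y - kf X Z"
 "kf (c *. X) Y = c * kf X Y" "kf X (c *. Y) = c * kf X Y"
 "kf (- X) Y = - kf X Y" "kf X (- Y) = - kf X Y" "kf 0 X = 0" "kf X 0 = 0" by(simp_all add: kf_def linear_add[OF linear_adG] linear_diff[OF linear_adG] linear_scale[OF linear_adG]
   linear_neg[OF linear_adG] linear_0[OF linear_adG] algebra_simps)

lemma kf_sum_left: "kf (SUM i:I. X i) Y = (SUM i:I. kf (X i) Y)" by(induction I rule: infinite_finite_induct) (simp_all add: kf_simps)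

lemma kf_invariant:
 assumes "X : gg" "Y : gg" "Z : gg"
 shows "kf (lb X Y) Z = kf X (lb Y Z)"
proof -
 have "tr (adG Y * (adG X * adG Z)) = tr (adG X * (adG Z * adG Y))" using tr_commute[of "adG Y" "adG X * adG Z"] by(simp add:mult.assoc)
 thus ?thesis by(simp add:kf_def adG_bracket assms algebra_simps)
qed

lemma kf_invariant': 
 assumes "X : gg" "Y : gg" "Z : gg"
 shows "kf (lb X Y) Z = - kf Y (lb X Z)" using kf_invariant[OF assms(2,1,3)] bracket_commute[of X Y] by(simp add:kf_simps)

lemma kf_killing_form:
 assumes "X : gg" "Y : gg"
 shows "killing_form G X Y = kf X Y"
proof -
 have l: "linear (%Z. lb X (lb Y Z))" using linear_compose[OF linear_bracket[of Y] linear_bracket[of X]] by(simp add:o_def)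
 have "killing_form G X Y = tr (endo (%Z. lb X (lb Y Z)) * eg)" unfolding killing_form_def using assms by(intro trace_on_eq_tr gg_subspace l) (auto intro: lie_algebra_bracket)
 also have "endo (%Z. lb X (lb Y Z)) * eg = adG X * adG Y" by(rule endo_eqI) (simp add:l gproj_id lie_algebra_bracket assms gproj_in)
 finally show ?thesis by(simp add:kf_def)
qed

lemma kf_Ad:
 assumes g: "g : G" and "X : gg" "Y : gg"
 shows "kf (g**X**mi g) (g**Y**mi g) = kf X Y"
proof -
 define A where "A = endo (%z. g**gproj z**mi g)"
 define A' where "A' = endo (%z. mi g**gproj z**g)"
 have l: "linear (%z. g**gproj z**mi g)" "linear (%z. mi g**gproj z**g)" by(rule linearI; simp add:linear_add[OF linear_gproj] linear_scale[OF linear_gproj] matrix_ring_simps)+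
 have A [simp]: "eapp A z = g**gproj z**mi g" "eapp A' z = mi g**gproj z**g" for z by(simp_all add: A_def A'_def l)
 have gi: "mi g**g = mat 1" "g**mi g = mat 1" using inv[OF g] by simp_all
 have Ad': "mi g**Z**g : gg" if "Z : gg" for Z using lie_algebra_Ad[OF minv[OF g] that] inv[OF g] by simp
 have c: "mi g**(g**Z) = Z" "g**(mi g**Z) = Z" for Z by(simp_all add: mma gi)
 have ad: "adG (g**Z**mi g) = A * adG Z * A'" if "Z : gg" for Z
 proof (rule endo_eqI)
  fix w
  have "eapp (A * adG Z * A') w = g**lb Z (mi g**gproj w**g)**mi g" by(simp add:gproj_id Ad' gproj_in lie_algebra_bracket that)
  also have "... = lb (g**Z**mi g) (gproj w)" unfolding bracket_def mms mm.diff_left mm.diff_right c gi by(simp add:gi)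
  finally show "eapp (adG (g**Z**mi g)) w = eapp (A * adG Z * A') w" by simp
 qed
 have AA: "A' * A = eg"
 proof (rule endo_eqI)
  fix x
  have "gproj (g**gproj x**mi g) = g**gproj x**mi g" by(intro gproj_id lie_algebra_Ad g gproj_in)
  thus "eapp (A' * A) x = eapp eg x" by(simp only: A eapp_mult eapp_eg) (simp add:mms c gi)
 qed
 have eE: "adG Z * eg = adG Z" for Z by(rule endo_eqI) (simp add:gproj_id gproj_in)
 have "tr (A * adG X * A' * (A * adG Y * A')) = tr (A * (adG X * (A' * A) * adG Y * A'))" by(simp add:mult.assoc)
 also have "... = tr (adG X * (A' * A) * adG Y * (A' * A))" by(subst tr_commute) (simp add:mult.assoc)
 also have "... = tr (adG X * adG Y)" by(simp add:AA eE mult.assoc)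
 finally show ?thesis by(simp add:kf_def ad assms)
qed

lemma center_trivial:
 assumes ss: "semisimple G" and X: "X : gg" "!!Y. Y : gg ==> lb X Y = 0"
 shows "X = 0"
proof -
 let ?Z = "{X : gg. ALL Y:gg. lb X Y = 0}"
 have s: "subspace ?Z" unfolding subspace_def by(auto simp: gg_cl bracket_simps)
 have "lie_ideal ?Z gg" unfolding lie_ideal_def
 proof (intro conjI s ballI)
  fix Y Z assume Y: "Y : gg" and Z: "Z : ?Z"
  hence "lb Y Z = 0" using bracket_commute[of Y Z] by simp
  thus "lb Y Z : ?Z" by(simp add:gg_cl)
 qed auto
 moreover have "derived_algebra ?Z <= {0}" by(rule derived_algebra_minimal) auto
 hence "(derived_algebra ^^ 1) ?Z = {0}" using subspace_0[OF subspace_derived_algebra, of ?Z] by auto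
 hence "lie_solvable ?Z" unfolding lie_solvable_def by blast
 ultimately have "?Z = {0}" using ss by(auto simp: semisimple_def)
 thus ?thesis using X by blast
qed

text \<open>The radical of the Killing form is an ideal. Its derived algebra acts nilpotently by
  \<open>cartan_nilpotent\<close> and is solvable by Engel's theorem, so the radical is a solvable
  ideal.\<close>

lemma kf_radical_trivial:
 assumes ss: "semisimple G" and X: "X : gg" "!!Y. Y : gg ==> kf X Y = 0"
 shows "X = 0"
proof -
 let ?R = "{X : gg. ALL Y:gg. kf X Y = 0}"
 have s: "subspace ?R" unfolding subspace_def by(auto simp: gg_cl kf_simps)
 have idl: "lb Y Z : ?R" if "Y : gg" "Z : ?R" for Y Z using that kf_invariant'[OF that(1)] by(auto simp: gg_cl)
 have "lie_ideal ?R gg" unfolding lie_ideal_def using s idl by blast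
 moreover have sub: "subalgebra ?R" unfolding subalgebra_def using s idl by blast
 have sD: "subalgebra (derived_algebra ?R)" by(rule subalgebra_derived_algebra[OF sub])
 have DR: "derived_algebra ?R <= ?R" by(rule derived_algebra_subset[OF sub])
 have nil: "EX k. adG x ^ k = 0" if "x : derived_algebra ?R" for x
 proof (rule cartan_nilpotent[OF linear_adG, of ?R lb])
  show "x : ?R" using that DR by blast
  show "x : span {lb y z |y z. y : ?R & z : ?R}" using that by(simp only: derived_algebra_def)
 qed (use idl in \<open>auto simp: adG_bracket kf_def[symmetric]\<close>)
 have "ad_nilpotent (derived_algebra ?R) (derived_algebra ?R)" unfolding ad_nilpotent_def
 proof
  fix x assume x: "x : derived_algebra ?R"
  then obtain k where k: "adG x ^ k = 0" using nil by blast
  have it: "eapp (adG x ^ i) z = (lb x ^^ i) z & (lb x ^^ i) z : gg" if "z : gg" for i z using that x DR by(induction i) (auto simp: gproj_id gg_cl)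
  have "(lb x ^^ k) z = 0" if "z : derived_algebra ?R" for z using it[of z k] that DR k by(auto simp: eapp.zero_left)
  thus "EX k. ALL z:derived_algebra ?R. (lb x ^^ k) z = 0" by blast
 qed
 hence "lie_solvable (derived_algebra ?R)" by(rule engel_solvable[OF sD])
 then obtain k where "(derived_algebra ^^ k) (derived_algebra ?R) = {0}" by(auto simp: lie_solvable_def)
 hence "(derived_algebra ^^ Suc k) ?R = {0}" by(simp add:funpow_swap1)
 hence "lie_solvable ?R" unfolding lie_solvable_def by blast
 ultimately have "?R = {0}" using ss by(auto simp: semisimple_def)
 thus ?thesis using X by blast
qed

end

section \<open>Compact subgroups and the sign of the Killing form\<close>

lemma lie_algebra_mono: "K <= G ==> lie_algebra K <= lie_algebra G" by(auto simp: lie_algebra_def)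

locale pair = matgroup G for G :: "(real^'n^'n) set" +
 fixes K :: "(real^'n^'n) set"
 assumes K: "matgroup K" "K <= G" "compact K" and ss: "semisimple G"
begin

sublocale K: matgroup K by(rule K(1))

abbreviation "kk == lie_algebra K"

lemma kk_gg: "Y : kk ==> Y : gg" using lie_algebra_mono[OF K(2)] by blast

text \<open>On \<open>gg\<close> the flow is conjugation by elements of the compact group; on the
  orthogonal complement it is the identity. The three intertwining relations separate the two
  parts.\<close>

lemma adG_flow_bounded: "Y : kk ==> EX C. ALL t. norm (exp (t *. adG Y)) <= C"
proof -
 assume Y: "Y : kk"
 hence Yg: "Y : gg" by(rule kk_gg)
 obtain R where R: "R > 0" "!!k. k : K ==> norm k <= R" using compact_imp_bounded[OF K(3)] by(auto simp: bounded_pos)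
 have ead: "norm (exp (t *. adE Y)) <= R * R" for t
 proof (rule norm_endo_le)
  fix z
  have "eapp (exp (t *. adE Y)) z = mexp (t *. Y)**z**mexp ((- t) *. Y)" using exp_adE[of "t *. Y" z] by(simp add:linear_scale[OF linear_adE])
  moreover have "mexp (t *. Y) : K" "mexp ((- t) *. Y) : K" using Y unfolding lie_algebra_def by blast+
  ultimately have "norm (eapp (exp (t *. adE Y)) z) <= (norm (mexp (t *. Y)) * norm z) * norm (mexp ((- t) *. Y))"
   by(simp only:) (intro order_trans[OF norm_matrix_mult] mult_right_mono norm_matrix_mult; simp)
  also have "... <= (R * norm z) * R" using R(2)[OF `mexp (t *. Y) : K`] R(2)[OF `mexp ((- t) *. Y) : K`] R(1) by(intro mult_right_mono mult_mono) auto
  finally show "norm (eapp (exp (t *. adE Y)) z) <= R * R * norm z" by(simp add:mult_ac)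
 qed (use R in simp)
 have 1: "adE Y * eg = eg * adG Y" by(rule endo_eqI) (simp add:gproj_id gg_cl Yg gproj_in)
 have 2: "adG Y * (1 - eg) = (1 - eg) * 0" by(rule endo_eqI) (simp add:eapp.diff_left eapp.zero_left linear_diff[OF linear_gproj] gproj_id gproj_in)
 have 3: "adG Y * eg = eg * adG Y" by(rule endo_eqI) (simp add:gproj_id gg_cl Yg gproj_in)
 have e: "exp (t *. adG Y) = exp (t *. adE Y) * eg + (1 - eg)" for t
 proof -
  have a: "exp (t *. adE Y) * eg = eg * exp (t *. adG Y)" by(rule exp_mult_left_eq) (simp add:1)
  have b: "exp (t *. adG Y) * (1 - eg) = (1 - eg) * exp 0" by(rule exp_mult_left_eq) (simp add:2)
  have c: "exp (t *. adG Y) * eg = eg * exp (t *. adG Y)" by(rule exp_mult_left_eq) (simp add:3)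
  have "exp (t *. adG Y) = exp (t *. adG Y) * eg + exp (t *. adG Y) * (1 - eg)" by(simp add:algebra_simps)
  thus ?thesis using a b c by simp
 qed
 have "norm (exp (t *. adG Y)) <= R * R * norm eg + norm (1 - eg)" for t unfolding e using ead[of t]
  by(intro order_trans[OF norm_triangle_ineq] add_right_mono order_trans[OF norm_mult_ineq] mult_right_mono) auto
 thus ?thesis by blast
qed

lemma kf_kk_neg:
 assumes Y: "Y : kk"
 shows "kf Y Y <= 0" and "kf Y Y = 0 ==> Y = 0"
proof -
 obtain C where C: "!!t. norm (exp (t *. adG Y)) <= C" using adG_flow_bounded[OF Y] by blast
 show "kf Y Y <= 0" unfolding kf_def by(rule bounded_flow_trace(1)[OF C])
 assume "kf Y Y = 0"
 hence "adG Y = 0" unfolding kf_def by(rule bounded_flow_trace(2)[OF C])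
 hence "lb Y Z = 0" if "Z : gg" for Z using eapp_adG[of Y Z] that by(simp add:gproj_id eapp.zero_left)
 thus "Y = 0" using center_trivial[OF ss kk_gg[OF Y]] by blast
qed

end

section \<open>Symmetric operators\<close>

lemma form_orthonormal_independent:
 assumes b: "bilinear bb" and fin: "finite E"
  and on: "!!e f. e : E ==> f : E ==> bb e f = (if e = f then 1 else 0 :: real)"
 shows "independent E"
proof
 assume "dependent E"
 then obtain u where u: "EX v:E. u v ~= 0" "(SUM v:E. u v *. v) = 0" using dependent_finite[OF fin] by auto
 have l: "linear (%x. bb x f)" for f using b by(simp add:bilinear_def)
 have "u f = 0" if f: "f : E" for f
 proof -
  have "bb (SUM v:E. u v *. v) f = (SUM v:E. u v * bb v f)" by(simp add:linear_sum[OF l] linear_scale[OF l])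
  also have "... = (SUM v:E. if v = f then u f else 0)" by(rule sum.cong) (auto simp: on f)
  also have "... = u f" using fin f by simp
  finally show ?thesis using u(2) linear_0[OF l] by simp
 qed
 thus False using u(1) by blast
qed

text \<open>The Rayleigh quotient attains its maximum on the Euclidean unit sphere of
  \<open>V\<close>, which is compact whatever \<open>bb\<close> is; the maximizer is an
  eigenvector.\<close>

lemma symmetric_max_eigenvector:
 fixes bb :: "'a::euclidean_space => 'a => real"
 assumes V: "subspace V" "V ~= {0}" and b: "bilinear bb" and sym: "!!x y. bb x y = bb y x"
  and pd: "!!x. x : V ==> x ~= 0 ==> 0 < bb x x"
  and T: "linear T" "!!x. x : V ==> T x : V" "!!x y. x : V ==> y : V ==> bb (T x) y = bb x (T y)"
 obtains e mu where "e : V" "bb e e = 1" "T e = mu *. e"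
proof -
 have bb: "bounded_bilinear bb" using b by(simp add:bilinear_conv_bounded_bilinear)
 interpret b: bounded_bilinear bb by(rule bb)
 have bT: "bounded_linear T" using T(1) by(simp add:linear_conv_bounded_linear)
 let ?S = "V \<inter> sphere 0 1"
 have cS: "compact ?S" by(intro closed_Int_compact closed_subspace V compact_sphere)
 obtain v where v: "v : V" "v ~= 0" using V subspace_0 by blast
 have "v /\<^sub>R norm v : ?S" using v V by(auto intro: subspace_scale)
 hence ne: "?S ~= {}" by blast
 have pos: "0 < bb x x" if "x : ?S" for x using that by(intro pd) auto
 have "continuous_on ?S (%x. bb (T x) x / bb x x)" using pos by(intro continuous_on_divide b.continuous_on bounded_linear.continuous_on[OF bT] continuous_on_id) fastforce
 then obtain u where u: "u : ?S" "!!x. x : ?S ==> bb (T x) x / bb x x <= bb (T u) u / bb u u" using continuous_attains_sup[OF cS ne] by blast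
 define mu where "mu = bb (T u) u / bb u u"
 have uV: "u : V" "u ~= 0" using u by auto
 have le: "bb (T x) x <= mu * bb x x" if x: "x : V" for x
 proof (cases "x = 0")
  case False
  have "x /\<^sub>R norm x : ?S" using x False V by(auto intro: subspace_scale)
  from u(2)[OF this] have "bb (T x) x / bb x x <= mu" using False by(simp add:mu_def linear_scale[OF T(1)] b.scaleR_left b.scaleR_right)
  thus ?thesis using pd[OF x False] by(simp add:field_simps)
 qed (simp add:b.zero_right)
 have eq: "bb (T u) u = mu * bb u u" using pd[OF uV] by(simp add:mu_def)
 have orth: "bb (T u - mu *. u) w = 0" if w: "w : V" for w
 proof -
  define c where "c = bb (T u - mu *. u) w"
  define d where "d = bb (T w) w - mu * bb w w"
  \<comment> \<open>The variation of the quotient in the direction \<open>w\<close> is at most 0 for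
    every \<open>t\<close>. For small \<open>t\<close> of the sign of \<open>c\<close> the linear
    term would dominate, so \<open>c\<close> must vanish.\<close>
  have q: "2 * t * c + t * t * d <= 0" for t
  proof -
   have "u + t *. w : V" using uV w V by(intro subspace_add subspace_scale) auto
   from le[OF this] have "bb (T (u + t *. w)) (u + t *. w) - mu * bb (u + t *. w) (u + t *. w) <= 0" by simp
   moreover have "bb (T w) u = bb (T u) w" using T(3)[OF w uV(1)] sym[of w "T u"] by simp
   moreover have "bb w u = bb u w" by(rule sym)
   ultimately show ?thesis using eq by(simp add:c_def d_def linear_add[OF T(1)] linear_scale[OF T(1)] b.add_left b.add_right
      b.scaleR_left b.scaleR_right b.diff_left algebra_simps)
  qed
  have "c = 0"
  proof (rule ccontr)
   assume c: "c ~= 0"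
   define t where "t = c / (\<bar>d\<bar> + 1)"
   have "2 * t * c + t * t * d = (c * c) * (2 * (\<bar>d\<bar> + 1) + d) / (\<bar>d\<bar> + 1)\<^sup>2" by(simp add:t_def divide_simps power2_eq_square) (simp add:algebra_simps)
   also have "... > 0"
   proof -
    have "0 < c * c" using c by(simp flip: power2_eq_square)
    thus ?thesis by(intro divide_pos_pos mult_pos_pos[of "c * c"]) auto
   qed
   finally show False using q[of t] by simp
  qed
  thus ?thesis by(simp add:c_def)
 qed
 have "T u - mu *. u : V" using uV V T(2) by(intro subspace_diff subspace_scale) auto
 hence "T u - mu *. u = 0" using orth pd by fastforce
 hence Tu: "T u = mu *. u" by simp
 define e where "e = u /\<^sub>R sqrt (bb u u)"
 have s: "sqrt (bb u u) > 0" using pd[OF uV] by simp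
 show ?thesis
 proof (rule that)
  show "e : V" using uV V by(simp add:e_def subspace_scale)
  show "bb e e = 1" using s pd[OF uV] by(simp add:e_def b.scaleR_left b.scaleR_right field_simps)
  show "T e = mu *. e" by(simp add:e_def linear_scale[OF T(1)] Tu)
 qed
qed

text \<open>Induction splits off one eigenvector and passes to its \<open>bb\<close>-orthogonal
  complement. With \<open>T\<close> the identity it also yields plain orthonormal bases.\<close>

lemma symmetric_eigenbasis:
 fixes bb :: "'a::euclidean_space => 'a => real"
 assumes "subspace V" and b: "bilinear bb" and sym: "!!x y. bb x y = bb y x"
  and "!!x. x : V ==> x ~= 0 ==> 0 < bb x x"
  and T: "linear T" and "!!x. x : V ==> T x : V" "!!x y. x : V ==> y : V ==> bb (T x) y = bb x (T y)"
 shows "EX E mu. finite E & E <= V & (ALL e:E. ALL f:E. bb e f = (if e = f then 1 else 0)) &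
  (ALL x:V. x = (SUM e:E. bb x e *. e)) & (ALL e:E. T e = mu e *. e)" using assms(1,4,6,7)
proof (induction "dim V" arbitrary: V rule: less_induct)
 case less
 have l: "linear (%x. bb x f)" "linear (bb f)" for f using b by(simp_all add: bilinear_def)
 show ?case
 proof (cases "V = {0}")
  case True
  thus ?thesis by(intro exI[of _ "{}"]) auto
 next
  case False
  obtain e m where e: "e : V" "bb e e = 1" "T e = m *. e" using symmetric_max_eigenvector[OF less.prems(1) False b sym less.prems(2) T less.prems(3,4)] by blast
  define W where "W = {x : V. bb x e = 0}"
  have W: "subspace W" using less.prems(1) unfolding subspace_def W_def by(auto simp: linear_add[OF l(1)] linear_scale[OF l(1)] linear_0[OF l(1)])
  have WV: "x : V" if "x : W" for x using that by(simp add:W_def)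
  have "e ~: W" by(simp add:W_def e)
  hence "W \<subset> V" using e(1) WV by blast
  hence d: "dim W < dim V" by(rule subspace_dim_psubset[OF W less.prems(1)])
  have TW: "T x : W" if "x : W" for x using that less.prems(3) less.prems(4)[OF _ e(1), of x] e(3) by(auto simp: W_def linear_scale[OF l(2)])
  obtain E mu where E: "finite E" "E <= W" "ALL e:E. ALL f:E. bb e f = (if e = f then 1 else 0)"
   "ALL x:W. x = (SUM e:E. bb x e *. e)" "ALL e:E. T e = mu e *. e" using less.hyps[OF d W less.prems(2)[OF WV] TW less.prems(4)[OF WV WV]] by blast
  have ne: "e ~: E" using E(2) e(2) by(auto simp: W_def)
  have eE: "bb f e = 0" "bb e f = 0" if "f : E" for f using that E(2) sym[of e f] by(auto simp: W_def)
  have x: "x = (SUM f:insert e E. bb x f *. f)" if x: "x : V" for x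
  proof -
   define w where "w = x - bb x e *. e"
   have wV: "w : V" unfolding w_def using x e(1) less.prems(1) by(intro subspace_diff subspace_scale) auto
   have "bb w e = 0" by(simp add:w_def linear_diff[OF l(1)] linear_scale[OF l(1)] e(2))
   hence wW: "w : W" using wV by(simp add:W_def)
   have "bb w f = bb x f" if "f : E" for f using eE[OF that] by(simp add:w_def linear_diff[OF l(1)] linear_scale[OF l(1)])
   hence "(SUM f:E. bb w f *. f) = (SUM f:E. bb x f *. f)" by simp
   moreover have "w = (SUM f:E. bb w f *. f)" using E(4) wW by blast
   ultimately have "w = (SUM f:E. bb x f *. f)" by simp
   moreover have "x = bb x e *. e + w" by(simp add:w_def)
   ultimately show ?thesis using E(1) ne by simp
  qed
  show ?thesis
  proof (intro exI[of _ "insert e E"] exI[of _ "mu(e := m)"] conjI)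
   show "insert e E <= V" using e E(2) by(auto simp: W_def)
   show "ALL f:insert e E. ALL g:insert e E. bb f g = (if f = g then 1 else 0)" using E(3) e(2) eE ne by auto
   show "ALL f:insert e E. T f = (mu(e := m)) f *. f" using E(5) e(3) ne by auto
   show "ALL x:V. x = (SUM f:insert e E. bb x f *. f)" using x by blast
  qed (use E(1) in simp)
 qed
qed

lemma form_basis_span:
 assumes "finite E" "E <= V" "subspace V" "ALL x:V. x = (SUM e:E. bb x e *. e)"
 shows "span E = V"
proof
 show "span E <= V" using assms by(intro span_minimal)
 show "V <= span E"
 proof
  fix x assume "x : V"
  hence "x = (SUM e:E. bb x e *. e)" using assms(4) by blast
  also have "... : span E" by(intro span_sum span_scale span_base)
  finally show "x : span E" .
 qed
qed

lemma tr_form_basis: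
 fixes V :: "'a::euclidean_space set"
 assumes V: "subspace V" and b: "bilinear bb" and E: "finite E" "E <= V"
  "ALL e:E. ALL f:E. bb e f = (if e = f then 1 else 0)" "ALL x:V. x = (SUM e:E. bb x e *. e)"
  and T: "!!x. x : V ==> eapp T x : V"
 shows "tr (T * eproj V) = (SUM e:E. bb (eapp T e) e)"
proof -
 have ind: "independent E" by(rule form_orthonormal_independent[OF b E(1)]) (use E(3) in auto)
 have sp: "span E = V" by(rule form_basis_span[OF E(1,2) V E(4)])
 have "representation E x e = bb x e" if x: "x : V" and e: "e : E" for x e
 proof -
  have "representation E x e = representation E (SUM f:E. bb x f *. f) e" using E(4) x by simp
  also have "... = (SUM f:E. bb x f * representation E f e)" by(simp add:representation_sum[OF ind] representation_scale[OF ind] span_base span_scale)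
  also have "... = (SUM f:E. if f = e then bb x e else 0)" by(rule sum.cong) (auto simp: representation_basis[OF ind])
  finally show ?thesis using e E(1) by simp
 qed
 hence "(SUM b:E. representation E (eapp T b) b) = (SUM e:E. bb (eapp T e) e)" using E(2) T by(intro sum.cong) auto
 thus ?thesis using tr_basis[OF V ind sp T] by simp
qed

section \<open>Continuity of inversion, induction along the group, and smooth paths\<close>

lemma matrix_inv_near:
 fixes A :: "real^'n^'n"
 assumes A: "invertible A" and e: "0 < e"
 obtains d where "0 < d" "!!B. invertible B ==> norm (B - A) < d ==> norm (mi B - mi A) < e"
proof -
 define N where "N = norm (mi A) + 1"
 have N: "N >= 1" by(simp add:N_def)
 define d where "d = min (1 / (2 * N)) (e / (4 * N * N))"
 show ?thesis
 proof (rule that[of d])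
  show "0 < d" using N e by(simp add:d_def)
  fix B assume B: "invertible B" "norm (B - A) < d"
  let ?b = "norm (mi B)" and ?D = "norm (mi B - mi A)" and ?x = "norm (B - A)"
  have "mi B**(A - B)**mi A = mi B**A**mi A - mi B**B**mi A" by(simp add:matrix_ring_simps)
  also have "... = mi B - mi A" using A B(1) by(simp add:mms matrix_inv_left matrix_inv_right)
  finally have "?D = norm (mi B**(A - B)**mi A)" by simp
  also have "... <= (?b * ?x) * N" using N by(intro order_trans[OF norm_matrix_mult] mult_right_mono mult_mono order_trans[OF norm_matrix_mult])
    (auto simp: norm_minus_commute N_def)
  finally have D: "?D <= ?b * (?x * N)" by(simp add:mult_ac)
  have "?x * N <= d * N" using B(2) N by(intro mult_right_mono) auto
  also have "... <= (1 / (2 * N)) * N" using N by(intro mult_right_mono) (auto simp: d_def)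
  also have "... = 1 / 2" using N by simp
  finally have "?b * (?x * N) <= ?b * (1 / 2)" by(intro mult_left_mono) auto
  moreover have "?b <= ?D + norm (mi A)" using norm_triangle_ineq[of "mi B - mi A" "mi A"] by simp
  ultimately have b: "?b <= 2 * N" using D by(simp add:N_def)
  have "?D <= (2 * N) * (?x * N)" using D b N by(intro order_trans[OF D] mult_right_mono) auto
  also have "... < (2 * N) * ((e / (2 * N * N)) * N)"
  proof -
   have "?x < e / (4 * N * N)" using B(2) by(simp add:d_def)
   also have "... <= e / (2 * N * N)" using e N by(intro divide_left_mono) auto
   finally show ?thesis using N by(intro mult_strict_left_mono mult_strict_right_mono) auto
  qed
  also have "... = e" using N by(simp add:field_simps)
  finally show "?D < e" .
 qed
qed

lemma continuous_on_matrix_inv: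
 fixes f :: "'a::metric_space => real^'n^'n"
 assumes f: "continuous_on S f" and i: "!!x. x : S ==> invertible (f x)"
 shows "continuous_on S (%x. mi (f x))" unfolding continuous_on_iff
proof (intro ballI allI impI)
 fix x and e :: real assume x: "x : S" and e: "0 < e"
 obtain d where d: "0 < d" "!!B. invertible B ==> norm (B - f x) < d ==> norm (mi B - mi (f x)) < e" using matrix_inv_near[OF i[OF x] e] by blast
 obtain d' where "0 < d'" "ALL x':S. dist x' x < d' --> dist (f x') (f x) < d" using f x d(1) unfolding continuous_on_iff by blast
 thus "EX d>0. ALL x':S. dist x' x < d --> dist (mi (f x')) (mi (f x)) < e" using d(2) i by(auto simp: dist_norm)
qed

text \<open>A step by \<open>exp u\<close> is undone by a step by \<open>exp (- u)\<close>, so a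
  property that survives small steps is locally constant on \<open>G\<close>.\<close>

lemma (in matgroup) connected_exp_induct:
 assumes conn: "connected G" and e: "0 < e" and xy: "x : G" "y : G" and P: "P x"
  and step: "!!g u. g : G ==> u : lie_algebra G ==> norm u < e ==> P g ==> P (g**mexp u)"
 shows "P y"
proof (rule connected_induction_simple[where P = P, OF conn xy P])
 obtain d where d: "0 < d" "!!g. g : G ==> norm (g - mat 1) < d ==> EX u:lie_algebra G. norm u < e & g = mexp u" using exp_chart[OF e] by blast
 fix a assume a: "a : G"
 let ?T = "{h : G. norm (mi a**h - mat 1) < d}"
 have o: "openin (top_of_set G) ?T"
 proof -
  have "continuous_on G (%h. norm (mi a**h - mat 1))" by(intro continuous_intros continuous_on_matrix_mult)
  from continuous_openin_preimage_gen[OF this open_lessThan[of d]] show ?thesis by(simp add:vimage_def Int_def)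
 qed
 have aT: "a : ?T" using a inv[OF a] d by simp
 have iff: "P h \<longleftrightarrow> P a" if h: "h : ?T" for h
 proof -
  obtain u where u: "u : lie_algebra G" "norm u < e" "mi a**h = mexp u" using d(2)[of "mi a**h"] h a mult minv by blast
  have "a**(mi a**h) = h" using inv[OF a] by(simp add:mma)
  hence h1: "h = a**mexp u" using u(3) by simp
  have "h**mexp (- u) = a" unfolding h1 by(simp add:mms)
  thus ?thesis using step[OF a u(1,2)] step[of h "- u"] h u subspace_neg[OF subspace_lie_algebra u(1)] h1 by auto
 qed
 show "EX T. openin (top_of_set G) T & a : T & (ALL x:T. ALL y:T. P x --> P y)" using o aT iff by(intro exI[of _ ?T]) blast
qed

text \<open>A path is prolonged by multiplying with \<open>exp (t u)\<close>, which keeps its start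
  and moves its end. No gluing of pieces is involved.\<close>

lemma (in matgroup) smooth_path:
 assumes conn: "connected G" and xy: "x : G" "y : G"
 obtains c c' where "!!t. (c hvd c' t) (at t)" "continuous_on UNIV c'" "!!t. c t : G"
  "c 0 = x" "c (1 :: real) = y"
proof -
 define P where "P y \<longleftrightarrow> (EX c c'. (ALL t. (c hvd c' t) (at t)) & continuous_on UNIV c' & (ALL t. c t : G)
  & c 0 = x & c (1 :: real) = y)" for y
 have "P y"
 proof (rule connected_exp_induct[OF conn zero_less_one xy])
  show "P x" unfolding P_def using xy(1) by(intro exI[of _ "%_. x"] exI[of _ "%_. 0"]) auto
  fix g u assume g: "g : G" and u: "u : lie_algebra G" and "P g"
  then obtain c c' where c: "!!t. (c hvd c' t) (at t)" "continuous_on UNIV c'" "!!t. c t : G"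
   "c 0 = x" "c (1 :: real) = g" unfolding P_def by blast
  have cc: "continuous_on UNIV c" by(intro continuous_at_imp_continuous_on ballI has_vector_derivative_continuous[OF c(1)])
  show "P (g**mexp u)" unfolding P_def
  proof (intro exI conjI allI)
   show "((%t. c t**mexp (t *. u)) hvd
     c t**(mexp (t *. u)**u) + c' t**mexp (t *. u)) (at t)" for t by(intro mm.has_vector_derivative c mat_exp_has_vector_derivative_right)
   show "continuous_on UNIV (%t. c t**(mexp (t *. u)**u) + c' t**mexp (t *. u))" by(intro continuous_intros cc c(2))
   show "c t**mexp (t *. u) : G" for t using u by(intro mult c(3)) (auto simp: lie_algebra_def)
  qed (use c in auto)
 qed
 thus ?thesis using that unfolding P_def by blast
qed

text \<open>\<open>Inf\<close> of a set of reals that is unbounded below is one fixed junk value.\<close>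

lemma real_Inf_unbounded:
 fixes S :: "real set"
 assumes "!!M. EX x:S. x < M"
 shows "Inf S = - (LEAST z :: real. False)"
proof -
 have "(ALL x:uminus ` S. x <= z) = False" for z
 proof -
  obtain x where "x : S" "x < - z" using assms by blast
  thus ?thesis by force
 qed
 thus ?thesis by(simp only: Inf_real_def Sup_real_def)
qed

context pair
begin

lemma bilinear_kf: "bilinear kf" unfolding bilinear_def by(auto intro!: linearI simp: kf_simps)

definition kbasis :: "(real^'n^'n) set" where "kbasis = (SOME E. finite E & E <= kk & (ALL e:E. ALL f:E. - kf e f = (if e = f then 1 else 0)) &
  (ALL x:kk. x = (SUM e:E. (- kf x e) *. e)))"

lemma kbasis: "finite kbasis" "kbasis <= kk" "!!e f. e : kbasis ==> f : kbasis ==> - kf e f = (if e = f then 1 else 0)"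
  "!!x. x : kk ==> x = (SUM e:kbasis. (- kf x e) *. e)"
proof -
 have "EX E mu. finite E & E <= kk & (ALL e:E. ALL f:E. - kf e f = (if e = f then 1 else 0)) &
  (ALL x:kk. x = (SUM e:E. (- kf x e) *. e)) & (ALL e:E. (%x. x) e = mu e *. e)"
 proof (rule symmetric_eigenbasis)
  show "bilinear (%x y. - kf x y)" unfolding bilinear_def by(auto intro!: linearI simp: kf_simps)
  show "0 < - kf x x" if "x : kk" "x ~= 0" for x using kf_kk_neg[OF that(1)] that(2) by fastforce
 qed (auto simp: subspace_lie_algebra K.subspace_lie_algebra kf_commute linear_ident)
 hence "EX E. finite E & E <= kk & (ALL e:E. ALL f:E. - kf e f = (if e = f then 1 else 0)) &
  (ALL x:kk. x = (SUM e:E. (- kf x e) *. e))" by blast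
 from someI_ex[OF this] show "finite kbasis" "kbasis <= kk"
  "!!e f. e : kbasis ==> f : kbasis ==> - kf e f = (if e = f then 1 else 0)"
  "!!x. x : kk ==> x = (SUM e:kbasis. (- kf x e) *. e)" unfolding kbasis_def[symmetric] by blast+
qed

text \<open>The projection to \<open>kk\<close> along its Killing-orthogonal complement. Negative
  definiteness on \<open>kk\<close> makes it available before anything is known about the form on
  \<open>pp\<close>.\<close>

definition kproj :: "real^'n^'n => real^'n^'n" where "kproj x = (SUM e:kbasis. (- kf x e) *. e)"

definition pproj :: "real^'n^'n => real^'n^'n" where "pproj x = gproj x - kproj (gproj x)"

definition pp :: "(real^'n^'n) set" where "pp = {X : gg. ALL Y:kk. kf X Y = 0}"

lemma linear_kproj: "linear kproj" unfolding kproj_def by(rule linearI) (simp_all add: kf_simps scaleR_diff_left sum_subtractf sum_negf scaleR_sum_right)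

lemma kproj_in: "kproj x : kk" unfolding kproj_def using kbasis(2) by(intro subspace_sum subspace_scale K.subspace_lie_algebra) auto

lemma kproj_id: "x : kk ==> kproj x = x" unfolding kproj_def by(rule kbasis(4)[symmetric])

lemma linear_pproj: "linear pproj" unfolding pproj_def[abs_def] using linear_compose_sub[OF linear_gproj linear_compose[OF linear_gproj linear_kproj]] by(simp add:o_def)

lemma kf_kproj: "y : kk ==> kf (kproj x) y = kf x y"
proof -
 assume y: "y : kk"
 have "kf (kproj x) y = (SUM e:kbasis. - kf x e * kf e y)" by(simp add:kproj_def kf_sum_left kf_simps)
 also have "... = kf (SUM e:kbasis. (- kf y e) *. e) x" unfolding kf_sum_left by(rule sum.cong) (simp_all add: kf_simps kf_commute)
 also have "... = kf x y" using kbasis(4)[OF y] by(simp add:kf_commute)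
 finally show ?thesis .
qed

lemma subspace_pp: "subspace pp" unfolding subspace_def pp_def by(auto simp: gg_cl kf_simps)

lemma pp_gg: "X : pp ==> X : gg" by(simp add:pp_def)

lemma pproj_in: "pproj x : pp" unfolding pp_def pproj_def by(auto simp: gg_cl gproj_in kk_gg kproj_in kf_simps kf_kproj)

lemma pp_kk_orth: "X : pp ==> Y : kk ==> kf X Y = 0" "X : pp ==> Y : kk ==> kf Y X = 0" by(auto simp: pp_def kf_commute)

lemma kproj_pp: "X : pp ==> kproj X = 0" unfolding kproj_def using kbasis(2) pp_kk_orth by(intro sum.neutral) auto

lemma pproj_id: "X : pp ==> pproj X = X" by(simp add:pproj_def gproj_id pp_gg kproj_pp)

lemma pproj_kk: "Y : kk ==> pproj Y = 0" by(simp add:pproj_def gproj_id kk_gg kproj_id)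

lemma decomp: "X : gg ==> X = pproj X + kproj X" by(simp add:pproj_def gproj_id)

lemma cartan_complement_eq: "cartan_complement G K = pp" unfolding cartan_complement_def pp_def by(auto simp: kf_killing_form kk_gg)

lemma cartan_projection_eq:
 assumes X: "X : gg"
 shows "cartan_projection G K X = pproj X" unfolding cartan_projection_def cartan_complement_eq
proof (rule the_equality)
 have "X - pproj X = kproj X" using X by(simp add:pproj_def gproj_id)
 thus "pproj X : pp & X - pproj X : kk" by(simp add:pproj_in kproj_in)
 fix Y assume Y: "Y : pp & X - Y : kk"
 have "pproj X = pproj Y + pproj (X - Y)" by(simp flip: linear_add[OF linear_pproj])
 thus "Y = pproj X" using Y by(simp add:pproj_id pproj_kk)
qed

lemma riemannian_length_eq:
 assumes der: "!!t. t : {0..1} ==> (c hvd c' t) (at t)"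
  and cont: "continuous_on {0..1} c'" and cG: "!!t. t : {0..1} ==> c t : G"
 shows "riemannian_length G K c =
   integral {0..1} (%t. sqrt (kf (pproj (mi (c t)**c' t)) (pproj (mi (c t)**c' t))))"
  and "continuous_on {0..1} (%t. sqrt (kf (pproj (mi (c t)**c' t)) (pproj (mi (c t)**c' t))))"
proof -
 have v: "mi (c t)**c' t : gg" if "t : {0..1}" for t by(rule curve_velocity_in_lie_algebra[OF cG that has_vector_derivative_at_within[OF der[OF that]]])
 show "riemannian_length G K c =
   integral {0..1} (%t. sqrt (kf (pproj (mi (c t)**c' t)) (pproj (mi (c t)**c' t))))" unfolding riemannian_length_def Let_def
 proof (rule integral_cong)
  fix t :: real assume t: "t : {0..1}"
  thus "sqrt (killing_form G (cartan_projection G K (mi (c t)**vector_derivative c (at t)))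
    (cartan_projection G K (mi (c t)**vector_derivative c (at t)))) =
   sqrt (kf (pproj (mi (c t)**c' t)) (pproj (mi (c t)**c' t)))" by(simp add:vector_derivative_at[OF der[OF t]] cartan_projection_eq v kf_killing_form pp_gg pproj_in)
 qed
 have bp: "bounded_linear pproj" using linear_pproj by(simp add:linear_conv_bounded_linear)
 have bk: "bounded_bilinear kf" using bilinear_kf by(simp add:bilinear_conv_bounded_bilinear)
 have cc: "continuous_on {0..1} c" using der by(intro continuous_at_imp_continuous_on ballI has_vector_derivative_continuous) auto
 show "continuous_on {0..1} (%t. sqrt (kf (pproj (mi (c t)**c' t)) (pproj (mi (c t)**c' t))))"
  using cG inv by(intro continuous_on_real_sqrt bounded_bilinear.continuous_on[OF bk] bounded_linear.continuous_on[OF bp]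
   continuous_on_matrix_mult continuous_on_matrix_inv cc cont) auto
qed

end

text \<open>A continuously differentiable cutoff, used to join motions in time without
  corners.\<close>

lemma max_square_has_derivative: "((%s :: real. (max 0 s)\<^sup>2) has_real_derivative 2 * max 0 s) (at s)"
proof -
 have b: "\<bar>(max 0 y)\<^sup>2 - (max 0 s)\<^sup>2 - 2 * max 0 s * (y - s)\<bar> <= (y - s)\<^sup>2" for y :: real
 proof (cases "0 <= s"; cases "0 <= y")
  assume "0 <= s" "~ 0 <= y"
  hence "s * y <= 0" by(simp add:mult_nonneg_nonpos)
  hence "0 <= s * s - s * y * 2" using zero_le_square[of s] by linarith
  moreover have "(max 0 y)\<^sup>2 - (max 0 s)\<^sup>2 - 2 * max 0 s * (y - s) = s * s - s * y * 2" using `0 <= s` `~ 0 <= y` by(simp add:max_def power2_eq_square algebra_simps)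
  ultimately show ?thesis using zero_le_square[of y] by(simp add:power2_eq_square algebra_simps)
 next
  assume "~ 0 <= s" "0 <= y"
  hence "s * y <= 0" by(simp add:mult_nonpos_nonneg)
  with `~ 0 <= s` `0 <= y` show ?thesis by(simp add:max_def power2_eq_square algebra_simps)
 qed (use zero_le_power2[of "y - s"] in \<open>auto simp: max_def power2_eq_square algebra_simps abs_if\<close>)
 show ?thesis unfolding has_field_derivative_def has_derivative_within_alt
 proof (intro conjI allI impI bounded_linear_mult_right)
  fix e :: real assume "0 < e"
  thus "EX d>0. ALL y:UNIV. norm (y - s) < d -->
    norm ((max 0 y)\<^sup>2 - (max 0 s)\<^sup>2 - 2 * max 0 s * (y - s)) <= e * norm (y - s)"
  proof (intro exI[of _ e] conjI ballI impI)
   fix y assume y: "norm (y - s) < e"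
   have "(y - s)\<^sup>2 = \<bar>y - s\<bar> * \<bar>y - s\<bar>" by(simp add:power2_eq_square)
   also have "... <= e * \<bar>y - s\<bar>" using y by(intro mult_right_mono) auto
   finally show "norm ((max 0 y)\<^sup>2 - (max 0 s)\<^sup>2 - 2 * max 0 s * (y - s)) <= e * norm (y - s)" using b[of y] by simp
  qed auto
 qed
qed

context pair
begin

lemma lcosets_rep:
 assumes "c : lcosets\<^bsub>grp G\<^esub> K"
 obtains x where "x : G" "c = (%k. x**k) ` K" "x : c"
proof -
 obtain x where x: "x : G" "c = (%k. x**k) ` K" using assms by(auto simp: LCOSETS_def l_coset_def GL_def)
 moreover have "x : (%k. x**k) ` K" using K.one by(intro image_eqI[of _ _ "mat 1"]) auto
 ultimately show ?thesis using that by blast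
qed

definition path_lengths :: "(real^'n^'n) set => (real^'n^'n) set => real set" where "path_lengths X Y = {riemannian_length G K c | c. c C1_differentiable_on {0..1} & c ` {0..1} <= G & c 0 : X & c 1 : Y}"

lemma symmetric_dist_eq: "symmetric_dist G K X Y = Inf (path_lengths X Y)" by(simp add:symmetric_dist_def path_lengths_def)

text \<open>A direction of negative square would have negative length, and running back and forth along
 it would make the path lengths between any two points unbounded below.\<close>

lemma path_lengths_unbounded:
 assumes conn: "connected G" and V: "V : pp" "kf V V < 0" and xy: "x : G" "y : G" "x : X" "y : Y"
 shows "EX l:path_lengths X Y. l < M"
proof -
 obtain c c' where c: "!!t. (c hvd c' t) (at t)" "continuous_on UNIV c'" "!!t. c t : G"
  "c 0 = x" "c (1 :: real) = y" using smooth_path[OF conn xy(1,2)] by blast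
 have cc: "continuous_on UNIV c" by(intro continuous_at_imp_continuous_on ballI has_vector_derivative_continuous[OF c(1)])
 \<comment> \<open>Up to time 1/2 the function \<open>ph\<close> runs along \<open>c\<close> and
   arrives with zero speed; afterwards \<open>f\<close> leaves 0 and returns to 0, a detour at
   \<open>y\<close> in the direction \<open>V\<close>. The factor \<open>T\<close> scales the
   detour.\<close>
 define h where "h s = (max 0 s)\<^sup>2" for s :: real
 define ph where "ph t = 1 - h (1 - 2 * t)" for t
 define ph' where "ph' t = 4 * max 0 (1 - 2 * t)" for t :: real
 define f where "f t = h (2 * t - 1) * (1 - t)" for t
 define f' where "f' t = 4 * max 0 (2 * t - 1) * (1 - t) - h (2 * t - 1)" for t
 have h': "((%t. h (a * t + b)) has_real_derivative 2 * a * max 0 (a * t + b)) (at t)" for a b t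
 proof -
  have "((%t. a * t + b) has_real_derivative a) (at t)" by(auto intro!: derivative_eq_intros)
  from DERIV_chain2[OF max_square_has_derivative this] show ?thesis unfolding h_def by(simp add:mult_ac)
 qed
 have dph: "(ph has_real_derivative ph' t) (at t)" for t unfolding ph_def[abs_def] ph'_def using DERIV_diff[OF DERIV_const h'[of "-2" 1 t], of 1] by(simp add:add.commute)
 have df: "(f has_real_derivative f' t) (at t)" for t unfolding f_def[abs_def] f'_def using DERIV_mult[OF h'[of 2 "-1" t] DERIV_diff[OF DERIV_const DERIV_ident], of 1] by simp
 have contf: "continuous_on UNIV f" "continuous_on UNIV f'" "continuous_on UNIV ph" "continuous_on UNIV ph'"
  unfolding f_def[abs_def] f'_def[abs_def] ph_def[abs_def] ph'_def[abs_def] h_def by(intro continuous_intros)+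
 define C where "C T t = c (ph t)**mexp ((T * f t) *. V)" for T t
 define C' where "C' T t = c (ph t)**((T * f' t) *. (mexp ((T * f t) *. V)**V)) + (ph' t *. c' (ph t))**mexp ((T * f t) *. V)" for T t
 have dC: "(C T hvd C' T t) (at t)" for T t
 proof -
  have 1: "((%t. c (ph t)) hvd ph' t *. c' (ph t)) (at t)" using vector_diff_chain_at[OF dph[unfolded has_real_derivative_iff_has_vector_derivative] c(1)] by(simp add:o_def)
  have "((%t. T * f t) hvd T * f' t) (at t)" using DERIV_cmult[OF df, of T t] by(simp add:has_real_derivative_iff_has_vector_derivative)
  from vector_diff_chain_at[OF this mat_exp_has_vector_derivative_right[where A = V]]
  have 2: "((%t. mexp ((T * f t) *. V)) hvd (T * f' t) *. (mexp ((T * f t) *. V)**V)) (at t)" by(simp add:o_def)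
  show ?thesis unfolding C_def[abs_def] C'_def by(rule mm.has_vector_derivative[OF 1 2])
 qed
 have cC': "continuous_on {0..1} (C' T)" for T unfolding C'_def by(intro continuous_intros continuous_on_compose2[OF cc] continuous_on_compose2[OF c(2)]
    continuous_on_subset[OF contf(1)] continuous_on_subset[OF contf(2)] continuous_on_subset[OF contf(3)] continuous_on_subset[OF contf(4)]) auto
 have CG: "C T t : G" for T t unfolding C_def using pp_gg[OF V(1)] by(intro mult c(3)) (auto simp: lie_algebra_def)
 define S where "S T t = sqrt (kf (pproj (mi (C T t)**C' T t)) (pproj (mi (C T t)**C' T t)))" for T t
 have len: "riemannian_length G K (C T) = integral {0..1} (S T)" and cS: "continuous_on {0..1} (S T)" for T
  using riemannian_length_eq[of "C T" "C' T", OF dC cC' CG] by(simp_all add: S_def[abs_def])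
 define q where "q = sqrt (- kf V V)"
 have S1: "S T t = S 0 t" if "t : {0..1/2}" for T t using that by(simp add:S_def C_def C'_def f_def f'_def h_def)
 \<comment> \<open>The root of a negative real is minus the root of its absolute value, so the speed
   on the detour counts negatively and there is no cancellation between going out and coming
   back.\<close>
 have S2: "S T t = - (T * q * \<bar>f' t\<bar>)" if t: "t : {1/2..1}" and T: "0 <= T" for T t
 proof -
  have z: "ph t = 1" "ph' t = 0" using t by(simp_all add: ph_def ph'_def h_def)
  let ?E = "mexp ((T * f t) *. V)"
  have "mi (C T t)**C' T t = mi (y**?E)**(y**?E)**((T * f' t) *. V)" by(simp add:C_def C'_def z c(5) matrix_ring_simps)
  also have "... = (T * f' t) *. V" using inv[OF xy(2)] by(simp add:matrix_inv_left invertible_mult)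
  finally have "S T t = sqrt ((T * f' t)\<^sup>2 * kf V V)" using V(1) by(simp add:S_def pproj_id subspace_scale[OF subspace_pp] kf_simps power2_eq_square mult_ac)
  also have "... = - (T * q * \<bar>f' t\<bar>)" using T by(simp add:q_def real_sqrt_mult real_sqrt_minus abs_mult mult_ac)
  finally show ?thesis .
 qed
 define A where "A = integral {0..1/2} (S 0)"
 define m where "m = integral {1/2..1} (%t. \<bar>f' t\<bar>)"
 have cf': "continuous_on {1/2..1} (%t. \<bar>f' t\<bar>)" by(intro continuous_intros continuous_on_subset[OF contf(2)]) auto
 have "m ~= 0"
 proof
  assume "m = 0"
  hence "ALL t:{1/2..1}. \<bar>f' t\<bar> = 0" unfolding m_def using integral_eq_0_iff[OF cf'] by simp
  hence "f' 1 = 0" by auto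
  thus False by(simp add:f'_def h_def)
 qed
 moreover have "0 <= m" unfolding m_def by(intro integral_nonneg integrable_continuous_real cf') auto
 ultimately have m: "0 < m" by simp
 have L: "riemannian_length G K (C T) = A - T * q * m" if T: "0 <= T" for T
 proof -
  have "integral {0..1} (S T) = integral {0..1/2} (S T) + integral {1/2..1} (S T)"
   by(rule Henstock_Kurzweil_Integration.integral_combine[symmetric]) (auto intro!: integrable_continuous_real cS)
  also have "integral {0..1/2} (S T) = A" unfolding A_def by(rule integral_cong) (rule S1)
  also have "integral {1/2..1} (S T) = integral {1/2..1} (%t. - (T * q) * \<bar>f' t\<bar>)" by(rule integral_cong) (simp add:S2 T)
  also have "... = - (T * q) * m" unfolding m_def by(rule integral_mult_right)
  finally show ?thesis using len[of T] by simp
 qed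
 have q: "0 < q" using V(2) by(simp add:q_def)
 define T where "T = (\<bar>A\<bar> + \<bar>M\<bar> + 1) / (q * m)"
 have T: "0 <= T" "T * q * m = \<bar>A\<bar> + \<bar>M\<bar> + 1" using q m by(simp_all add: T_def)
 have "riemannian_length G K (C T) < M" unfolding L[OF T(1)] T(2) by linarith
 moreover have "riemannian_length G K (C T) : path_lengths X Y"
 proof -
  have "C T C1_differentiable_on {0..1}" unfolding C1_differentiable_on_def using dC cC' by blast
  moreover have "C T 0 = x" "C T 1 = y" by(simp_all add: C_def ph_def f_def h_def c)
  ultimately show ?thesis unfolding path_lengths_def using CG xy by blast
 qed
 ultimately show ?thesis by blast
qed

text \<open>If some square were negative, all distances would be the same value of
  \<open>Inf\<close>, whereas a ray has points at distances 0 and 1. A nonzero \<open>V\<close> of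
  square 0 would be orthogonal to all of \<open>pp\<close>, since otherwise some
  \<open>W + t V\<close> had square -1; being orthogonal to \<open>kk\<close> too, it would lie in
  the radical.\<close>

lemma kf_pp_pos:
 assumes conn: "connected G" and r: "r : geodesic_rays G K" and V: "V : pp" "V ~= 0"
 shows "0 < kf V V"
proof -
 have nonneg: "0 <= kf W W" if W: "W : pp" for W
 proof (rule ccontr)
  assume neg: "~ 0 <= kf W W"
  have rs: "r s : lcosets\<^bsub>grp G\<^esub> K" if "0 <= s" for s using r that by(auto simp: geodesic_rays_def)
  obtain x where x: "x : G" "x : r 0" using lcosets_rep[OF rs[of 0]] by auto
  obtain y where y: "y : G" "y : r 1" using lcosets_rep[OF rs[of 1]] by auto
  have "symmetric_dist G K (r 0) (r 0) = symmetric_dist G K (r 0) (r 1)" unfolding symmetric_dist_eq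
   using real_Inf_unbounded path_lengths_unbounded[OF conn W] neg x y by(metis not_le_imp_less)
  moreover have "symmetric_dist G K (r 0) (r 0) = 0" "symmetric_dist G K (r 0) (r 1) = 1" using r by(auto simp: geodesic_rays_def)
  ultimately show False by simp
 qed
 have "kf V V ~= 0"
 proof
  assume z: "kf V V = 0"
  have p: "kf V W = 0" if W: "W : pp" for W
  proof (rule ccontr)
   assume ne: "kf V W ~= 0"
   define t where "t = - (kf W W + 1) / (2 * kf V W)"
   have "0 <= kf (W + t *. V) (W + t *. V)" using W V(1) by(intro nonneg subspace_add subspace_scale subspace_pp)
   also have "... = kf W W + 2 * t * kf V W" using z by(simp add:kf_simps kf_commute[of W V])
   also have "... = - 1" using ne by(simp add:t_def field_simps)
   finally show False by simp
  qed
  have "kf V Y = 0" if "Y : gg" for Y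
  proof -
   have "kf V Y = kf V (pproj Y) + kf V (kproj Y)" using decomp[OF that] by(metis kf_simps(2))
   thus ?thesis using p[OF pproj_in] pp_kk_orth(1)[OF V(1) kproj_in] by simp
  qed
  thus False using kf_radical_trivial[OF ss pp_gg[OF V(1)]] V(2) by blast
 qed
 thus ?thesis using nonneg[OF V(1)] by simp
qed

end

section \<open>Cartan decomposition\<close>

locale cartan = pair G K for G K :: "(real^'n^'n) set" +
 assumes pos: "V : pp ==> V ~= 0 ==> 0 < kf V V"
begin

text \<open>The inner product \<open>-B\<close> on \<open>\<kk>\<close>, \<open>B\<close> on \<open>\<pp>\<close>; a symmetric form on all matrices, definite
 on \<open>\<gg>\<close> only.\<close>

definition bt :: "real^'n^'n => real^'n^'n => real" where "bt x y = kf (pproj x) (pproj y) - kf (kproj (gproj x)) (kproj (gproj y))"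

lemma bt_commute: "bt x y = bt y x" by(simp add:bt_def kf_commute)

lemma bt_simps: "bt (x + y) z = bt x z + bt y z" "bt x (y + z) = bt x y + bt x z"
 "bt (x - y) z = bt x z - bt y z" "bt x (y - z) = bt x y - bt x z"
 "bt (c *. x) y = c * bt x y" "bt x (c *. y) = c * bt x y"
 "bt (- x) y = - bt x y" "bt x (- y) = - bt x y" "bt 0 x = 0" "bt x 0 = 0"
 by(simp_all add: bt_def linear_add[OF linear_gproj] linear_add[OF linear_kproj] linear_add[OF linear_pproj]
  linear_diff[OF linear_gproj] linear_diff[OF linear_kproj] linear_diff[OF linear_pproj]
  linear_scale[OF linear_gproj] linear_scale[OF linear_kproj] linear_scale[OF linear_pproj]
  linear_neg[OF linear_gproj] linear_neg[OF linear_kproj] linear_neg[OF linear_pproj]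
  linear_0[OF linear_gproj] linear_0[OF linear_kproj] linear_0[OF linear_pproj] kf_simps algebra_simps)

lemma bt_sum: "bt (SUM i:I. f i) y = (SUM i:I. bt (f i) y)" "bt y (SUM i:I. f i) = (SUM i:I. bt y (f i))" by(induction I rule: infinite_finite_induct; simp add:bt_simps)+

lemma bilinear_bt: "bilinear bt" unfolding bilinear_def by(auto intro!: linearI simp: bt_simps)

lemma bt_pp: "x : pp ==> y : pp ==> bt x y = kf x y" by(simp add:bt_def pproj_id gproj_id pp_gg kproj_pp kf_simps)

lemma bt_kk: "x : kk ==> y : kk ==> bt x y = - kf x y" by(simp add:bt_def pproj_kk gproj_id kk_gg kproj_id kf_simps)

lemma bt_pk: "x : pp ==> y : kk ==> bt x y = 0" "y : kk ==> x : pp ==> bt y x = 0" by(simp_all add: bt_def pproj_id pproj_kk gproj_id pp_gg kk_gg kproj_id kproj_pp kf_simps)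

lemma bt_pos: "x : gg ==> x ~= 0 ==> 0 < bt x x"
proof -
 assume x: "x : gg" "x ~= 0"
 have "bt x x = kf (pproj x) (pproj x) - kf (kproj x) (kproj x)" by(simp add:bt_def gproj_id x)
 moreover have "0 <= kf (pproj x) (pproj x)" "kf (kproj x) (kproj x) <= 0"
  using pos[OF pproj_in, of x] kf_kk_neg(1)[OF kproj_in, of x] by(cases "pproj x = 0"; auto simp: kf_simps)+
 moreover have "pproj x ~= 0 | kproj x ~= 0" using decomp[OF x(1)] x(2) by auto
 moreover have "kproj x ~= 0 ==> kf (kproj x) (kproj x) ~= 0" using kf_kk_neg(2)[OF kproj_in] by blast
 ultimately show ?thesis using pos[OF pproj_in, of x] by fastforce
qed

lemma pbasis_ex: "EX E. finite E & E <= pp & (ALL e:E. ALL f:E. kf e f = (if e = f then 1 else 0)) &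
  (ALL x:pp. x = (SUM e:E. kf x e *. e))"
proof -
 have "EX E mu. finite E & E <= pp & (ALL e:E. ALL f:E. kf e f = (if e = f then 1 else 0)) &
  (ALL x:pp. x = (SUM e:E. kf x e *. e)) & (ALL e:E. (%x. x) e = mu e *. e)" by(rule symmetric_eigenbasis) (auto simp: subspace_pp bilinear_kf kf_commute linear_ident pos)
 thus ?thesis by blast
qed

definition pbasis :: "(real^'n^'n) set" where "pbasis = (SOME E. finite E & E <= pp & (ALL e:E. ALL f:E. kf e f = (if e = f then 1 else 0)) &
  (ALL x:pp. x = (SUM e:E. kf x e *. e)))"

lemma pbasis: "finite pbasis" "pbasis <= pp" "!!e f. e : pbasis ==> f : pbasis ==> kf e f = (if e = f then 1 else 0)"
  "!!x. x : pp ==> x = (SUM e:pbasis. kf x e *. e)" using someI_ex[OF pbasis_ex] unfolding pbasis_def[symmetric] by blast+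

abbreviation "basis == kbasis \<union> pbasis"

lemma basis_disjoint: "kbasis \<inter> pbasis = {}"
proof -
 have False if "e : kbasis" "e : pbasis" for e using kbasis(3)[OF that(1,1)] pbasis(3)[OF that(2,2)] by simp
 thus ?thesis by blast
qed

lemma basis_sum: "(SUM e:basis. f e) = (SUM e:kbasis. f e) + (SUM e:pbasis. f e)" for f :: "real^'n^'n => 'b::comm_monoid_add"
 by(rule sum.union_disjoint[OF kbasis(1) pbasis(1) basis_disjoint])

lemma basis_gg: "e : basis ==> e : gg" using kbasis(2) pbasis(2) kk_gg pp_gg by blast

lemma basis_orthonormal: "e : basis ==> f : basis ==> bt e f = (if e = f then 1 else 0)" using kbasis(2) pbasis(2) kbasis(3)[of e f] pbasis(3)[of e f] basis_disjoint
 by(auto simp: bt_kk bt_pp bt_pk subset_iff)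

lemma basis_expand: "x : gg ==> x = (SUM e:basis. bt x e *. e)"
proof -
 assume x: "x : gg"
 have b: "bt x e = bt (pproj x) e + bt (kproj x) e" for e using decomp[OF x] by(metis bt_simps(1))
 have "(SUM e:kbasis. bt x e *. e) = (SUM e:kbasis. (- kf (kproj x) e) *. e)" by(rule sum.cong) (use kbasis(2) in \<open>auto simp: b bt_pk bt_kk pproj_in kproj_in\<close>)
 moreover have "(SUM e:pbasis. bt x e *. e) = (SUM e:pbasis. kf (pproj x) e *. e)"
  by(rule sum.cong) (use pbasis(2) in \<open>auto simp: b bt_pk bt_pp pproj_in kproj_in subset_iff\<close>)
 ultimately show ?thesis using kbasis(4)[OF kproj_in, of x] pbasis(4)[OF pproj_in, of x] decomp[OF x] by(simp add:basis_sum add.commute)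
qed

lemma tr_basis_kf: "X : gg ==> Y : gg ==> kf X Y =
 (SUM e:pbasis. kf (lb X (lb Y e)) e) - (SUM e:kbasis. kf (lb X (lb Y e)) e)"
proof -
 assume XY: "X : gg" "Y : gg"
 have "tr (adG X * adG Y * eg) = (SUM e:basis. bt (eapp (adG X * adG Y) e) e)" by(rule tr_form_basis[OF gg_subspace bilinear_bt])
   (use kbasis(1) pbasis(1) basis_gg basis_orthonormal basis_expand XY in \<open>auto simp: gg_cl gproj_in\<close>)
 moreover have "adG X * adG Y * eg = adG X * adG Y" by(rule endo_eqI) (simp add:gproj_id gproj_in)
 ultimately have "kf X Y = (SUM e:basis. bt (eapp (adG X * adG Y) e) e)" by(simp add:kf_def)
 also have "... = (SUM e:basis. bt (lb X (lb Y e)) e)"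
 proof (rule sum.cong[OF refl])
  fix e assume "e : basis"
  from basis_gg[OF this] show "bt (eapp (adG X * adG Y) e) e = bt (lb X (lb Y e)) e" by(simp add:gproj_id gg_cl XY)
 qed
 also have "... = (SUM e:kbasis. - kf (lb X (lb Y e)) e) + (SUM e:pbasis. kf (lb X (lb Y e)) e)"
 proof -
  have g: "lb X (lb Y e) : gg" if "e : basis" for e using basis_gg[OF that] XY by(simp add:gg_cl)
  have "bt Z e = - kf Z e" if "e : kbasis" "Z : gg" for Z e
   using that kbasis(2) decomp[of Z] kf_kproj[of e Z] by(auto simp: bt_def gproj_id kk_gg kproj_id pproj_kk kf_simps subset_iff)
  moreover have "bt Z e = kf Z e" if "e : pbasis" "Z : gg" for Z e
  proof -
   have e: "e : pp" using that pbasis(2) by blast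
   have "kf Z e = kf (pproj Z) e + kf (kproj Z) e" using decomp[OF that(2)] by(metis kf_simps(1))
   thus ?thesis using e by(simp add:bt_def pproj_id gproj_id pp_gg kproj_pp kf_simps pp_kk_orth kproj_in)
  qed
  ultimately show ?thesis unfolding basis_sum using g by simp
 qed
 finally show ?thesis by(simp add:sum_negf)
qed

lemma bracket_kk_pp: "Y : kk ==> V : pp ==> lb Y V : pp" "Y : kk ==> V : pp ==> lb V Y : pp"
proof -
 assume Y: "Y : kk" and V: "V : pp"
 have "kf (lb Y V) Z = 0" if "Z : kk" for Z using kf_invariant'[OF kk_gg[OF Y] pp_gg[OF V] kk_gg[OF that]] pp_kk_orth(1)[OF V K.lie_algebra_bracket[OF Y that]] by simp
 thus 1: "lb Y V : pp" using kk_gg[OF Y] pp_gg[OF V] by(simp add:pp_def gg_cl)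
 thus "lb V Y : pp" using bracket_commute[of V Y] subspace_neg[OF subspace_pp] by metis
qed

text \<open>In the trace formula for \<open>kf U U\<close> the terms from \<open>kk\<close> vanish.
  As \<open>U\<close> centralizes \<open>kk\<close>, invariance shows that \<open>ad U\<close>
  preserves \<open>pp\<close>, so the terms from \<open>pp\<close> are minus squared norms and
  \<open>kf U U <= 0\<close>.\<close>

lemma centralizer_kk_pp:
 assumes U: "U : pp" "!!Y. Y : kk ==> lb U Y = 0"
 shows "U = 0"
proof -
 note Ug = pp_gg[OF U(1)]
 have "kf U U = (SUM e:pbasis. kf (lb U (lb U e)) e) - (SUM e:kbasis. kf (lb U (lb U e)) e)" by(rule tr_basis_kf[OF Ug Ug])
 also have "(SUM e:kbasis. kf (lb U (lb U e)) e) = 0" using kbasis(2) U(2) by(intro sum.neutral) (auto simp: kf_simps subset_iff)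
 also have "(SUM e:pbasis. kf (lb U (lb U e)) e) <= 0"
 proof (rule sum_nonpos)
  fix e assume "e : pbasis"
  hence e: "e : pp" using pbasis(2) by blast
  have "kf (lb U e) Y = 0" if Y: "Y : kk" for Y using kf_invariant'[OF Ug pp_gg[OF e] kk_gg[OF Y]] U(2)[OF Y] by(simp add:kf_simps)
  hence "lb U e : pp" using Ug pp_gg[OF e] by(simp add:pp_def gg_cl)
  hence "0 <= kf (lb U e) (lb U e)" using pos[of "lb U e"] by(cases "lb U e = 0") (auto simp: kf_simps)
  thus "kf (lb U (lb U e)) e <= 0" using kf_invariant'[OF Ug _ pp_gg[OF e], of "lb U e"] Ug pp_gg[OF e] by(simp add:gg_cl)
 qed
 finally have "kf U U <= 0" by simp
 thus ?thesis using pos[OF U(1)] by fastforce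
qed

end

context cartan
begin

definition phi :: "real^'n^'n => real^'n^'n => real^'n^'n => real" where "phi x y z = kf (lb x y) z"

definition tl :: "(real^'n^'n => real^'n^'n => real^'n^'n => real) => bool" where "tl F \<longleftrightarrow> (ALL y z. linear (%x. F x y z)) & (ALL x z. linear (%y. F x y z)) & (ALL x y. linear (%z. F x y z))"

text \<open>The infinitesimal action of \<open>T\<close> on trilinear forms, up to sign. For
  \<open>T\<close> skew for the Killing form, the vanishing of \<open>DD T phi\<close> says that
  \<open>T\<close> is a derivation of the bracket.\<close>

definition DD :: "(real^'n^'n => real^'n^'n) => (real^'n^'n => real^'n^'n => real^'n^'n => real)
  => real^'n^'n => real^'n^'n => real^'n^'n => real" where
 "DD T F x y z = F (T x) y z + F x (T y) z + F x y (T z)"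

definition IP :: "(real^'n^'n => real^'n^'n => real^'n^'n => real)
  => (real^'n^'n => real^'n^'n => real^'n^'n => real) => real" where
 "IP F H = (SUM x:basis. SUM y:basis. SUM z:basis. F x y z * H x y z)"

lemma tl_phi: "tl phi" unfolding tl_def phi_def by(auto intro!: linearI simp: bracket_simps kf_simps)

lemma tl_DD:
 assumes F: "tl F" and T: "linear T"
 shows "tl (DD T F)"
proof -
 have c: "linear (%x. f (T x))" if "linear f" for f :: "_ => real" using linear_compose[OF T that] by(simp add:o_def)
 have l: "linear (%x. F x y z)" "linear (%y. F x y z)" "linear (%z. F x y z)" for x y z using F by(auto simp: tl_def)
 show ?thesis unfolding tl_def DD_def by(intro conjI allI linear_compose_add l c[OF l(1)] c[OF l(2)] c[OF l(3)])
qed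

lemma sum3_rotate: "(SUM x:B. SUM y:B. SUM z:B. g x y z) = (SUM y:B. SUM z:B. SUM x:B. g x y z)"
proof -
 have "(SUM x:B. SUM y:B. SUM z:B. g x y z) = (SUM y:B. SUM x:B. SUM z:B. g x y z)" by(rule sum.swap)
 also have "... = (SUM y:B. SUM z:B. SUM x:B. g x y z)" by(rule sum.cong[OF refl]) (rule sum.swap)
 finally show ?thesis .
qed

lemma basis_adjoint:
 assumes F: "linear (F :: _ => real)" and H: "linear (H :: _ => real)"
  and T: "!!e. e : basis ==> T e : gg" "!!e. e : basis ==> T' e : gg"
  and adj: "!!x y. x : basis ==> y : basis ==> bt (T x) y = bt x (T' y)"
 shows "(SUM x:basis. F (T x) * H x) = (SUM x:basis. F x * H (T' x))"
proof -
 have e: "f x = (SUM e:basis. bt x e * f e)" if "linear f" "x : gg" for f :: "_ => real" and x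
 proof -
  have "f x = f (SUM e:basis. bt x e *. e)" using basis_expand[OF that(2)] by simp
  thus ?thesis by(simp add:linear_sum[OF that(1)] linear_scale[OF that(1)])
 qed
 have "(SUM x:basis. F (T x) * H x) = (SUM x:basis. SUM e:basis. bt (T x) e * F e * H x)" by(rule sum.cong[OF refl]) (simp add:e[OF F T(1)] sum_distrib_right)
 also have "... = (SUM e:basis. SUM x:basis. bt (T x) e * F e * H x)" by(rule sum.swap)
 also have "... = (SUM e:basis. F e * H (T' e))"
 proof (rule sum.cong[OF refl])
  fix e assume e': "e : basis"
  have "(SUM x:basis. bt (T x) e * F e * H x) = (SUM x:basis. F e * (bt (T' e) x * H x))" by(rule sum.cong[OF refl]) (simp add:adj[OF _ e'] bt_commute[of _ "T' e"])
  also have "... = F e * H (T' e)" by(simp add:e[OF H T(2)[OF e']] sum_distrib_left)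
  finally show "(SUM x:basis. bt (T x) e * F e * H x) = F e * H (T' e)" .
 qed
 finally show ?thesis .
qed

lemma IP_adjoint:
 assumes F: "tl F" and H: "tl H"
  and T: "!!e. e : basis ==> T e : gg" "!!e. e : basis ==> T' e : gg"
  and adj: "!!x y. x : basis ==> y : basis ==> bt (T x) y = bt x (T' y)"
 shows "IP (DD T F) H = IP F (DD T' H)"
proof -
 have l: "linear (%x. F x y z)" "linear (%y. F x y z)" "linear (%z. F x y z)"
  "linear (%x. H x y z)" "linear (%y. H x y z)" "linear (%z. H x y z)" for x y z using F H by(auto simp: tl_def)
 have 1: "(SUM x:basis. SUM y:basis. SUM z:basis. F (T x) y z * H x y z) = (SUM x:basis. SUM y:basis. SUM z:basis. F x y z * H (T' x) y z)"
  unfolding sum3_rotate[of "%x y z. F (T x) y z * H x y z"] sum3_rotate[of "%x y z. F x y z * H (T' x) y z"] by(intro sum.cong refl basis_adjoint l T adj)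
 have 2: "(SUM x:basis. SUM y:basis. SUM z:basis. F x (T y) z * H x y z) = (SUM x:basis. SUM y:basis. SUM z:basis. F x y z * H x (T' y) z)"
 proof (rule sum.cong[OF refl])
  fix x
  have "(SUM y:basis. SUM z:basis. F x (T y) z * H x y z) = (SUM z:basis. SUM y:basis. F x (T y) z * H x y z)" by(rule sum.swap)
  also have "... = (SUM z:basis. SUM y:basis. F x y z * H x (T' y) z)" by(intro sum.cong refl basis_adjoint[where F = "%y. F x y _" and H = "%y. H x y _"] l T adj)
  also have "... = (SUM y:basis. SUM z:basis. F x y z * H x (T' y) z)" by(rule sum.swap)
  finally show "(SUM y:basis. SUM z:basis. F x (T y) z * H x y z) = (SUM y:basis. SUM z:basis. F x y z * H x (T' y) z)" .
 qed
 have 3: "(SUM x:basis. SUM y:basis. SUM z:basis. F x y (T z) * H x y z) = (SUM x:basis. SUM y:basis. SUM z:basis. F x y z * H x y (T' z))"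
  by(intro sum.cong refl basis_adjoint[where F = "%z. F _ _ z" and H = "%z. H _ _ z"] l T adj)
 show ?thesis unfolding IP_def DD_def distrib_left distrib_right sum.distrib 1 2 3 ..
qed

lemma phi_cyclic: "x : gg ==> y : gg ==> z : gg ==> phi x y z = phi y z x" unfolding phi_def using kf_invariant kf_commute by metis

lemma kf_pproj_left: "Z : gg ==> P : pp ==> kf (pproj Z) P = kf Z P"
proof -
 assume Z: "Z : gg" and P: "P : pp"
 have "kf Z P = kf (pproj Z) P + kf (kproj Z) P" using decomp[OF Z] by(metis kf_simps(1))
 thus ?thesis using pp_kk_orth(2)[OF P kproj_in] by simp
qed

text \<open>Only \<open>y\<close> and \<open>z\<close> in \<open>pp\<close> contribute, since
  otherwise one of the two factors pairs \<open>kk\<close> with \<open>pp\<close>. The remaining sum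
  is minus the trace formula for \<open>kf V Y\<close>, which is zero by orthogonality.\<close>

lemma pp_kk_moment:
 assumes Y: "Y : kk" and V: "V : pp"
 shows "(SUM y:basis. SUM z:basis. phi Y y z * phi V y z) = 0"
proof -
 note Yg = kk_gg[OF Y] and Vg = pp_gg[OF V]
 have k: "(SUM z:basis. phi Y y z * phi V y z) = 0" if "y : kbasis" for y
 proof (rule sum.neutral, rule)
  fix z assume z: "z : basis"
  have y: "y : kk" using that kbasis(2) by blast
  show "phi Y y z * phi V y z = 0"
  proof (cases "z : kbasis")
   case True
   hence "phi V y z = 0" unfolding phi_def using kbasis(2) by(intro pp_kk_orth(1) bracket_kk_pp(2) y V) auto
   thus ?thesis by simp
  next
   case False
   hence "z : pp" using z pbasis(2) by blast
   hence "phi Y y z = 0" unfolding phi_def by(intro pp_kk_orth(2) K.lie_algebra_bracket Y y)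
   thus ?thesis by simp
  qed
 qed
 have p: "(SUM z:basis. phi Y y z * phi V y z) = - kf (lb V (lb Y y)) y" if "y : pbasis" for y
 proof -
  have y: "y : pp" using that pbasis(2) by blast
  note yg = pp_gg[OF y]
  have Yy: "lb Y y : pp" by(rule bracket_kk_pp(1)[OF Y y])
  have "(SUM z:kbasis. phi Y y z * phi V y z) = 0" using kbasis(2) pp_kk_orth(1)[OF Yy] by(intro sum.neutral) (auto simp: phi_def subset_iff)
  hence "(SUM z:basis. phi Y y z * phi V y z) = (SUM z:pbasis. kf (lb Y y) z * kf (lb V y) z)" by(simp add:basis_sum phi_def)
  also have "... = kf (SUM z:pbasis. kf (lb Y y) z *. z) (lb V y)" unfolding kf_sum_left by(rule sum.cong) (simp_all add: kf_simps kf_commute)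
  also have "... = kf (lb V y) (lb Y y)" using pbasis(4)[OF Yy] by(simp add:kf_commute)
  also have "... = - kf y (lb V (lb Y y))" by(rule kf_invariant') (simp_all add: Vg yg Yg gg_cl)
  finally show ?thesis by(simp add:kf_commute)
 qed
 have "0 = kf V Y" using pp_kk_orth(1)[OF V Y] by simp
 also have "... = (SUM e:pbasis. kf (lb V (lb Y e)) e) - (SUM e:kbasis. kf (lb V (lb Y e)) e)" by(rule tr_basis_kf[OF Vg Yg])
 also have "(SUM e:kbasis. kf (lb V (lb Y e)) e) = 0" using kbasis(2) by(intro sum.neutral ballI pp_kk_orth(1) bracket_kk_pp(2) V K.lie_algebra_bracket Y) auto
 finally have "(SUM e:pbasis. kf (lb V (lb Y e)) e) = 0" by simp
 thus ?thesis by(simp add:basis_sum[of "%y. SUM z:basis. phi Y y z * phi V y z"] k p sum_negf)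
qed

text \<open>The block of \<open>ad V\<close> from \<open>pp\<close> to \<open>pp\<close>. For
  \<open>V\<close> in \<open>pp\<close> it is the skew part of \<open>ad V\<close> with respect to
  \<open>bt\<close>, while \<open>Sop V\<close> is the symmetric part and exchanges
  \<open>kk\<close> and \<open>pp\<close>. The aim is to show that \<open>Aop V\<close>
  vanishes.\<close>

definition Aop :: "real^'n^'n => real^'n^'n => real^'n^'n" where "Aop V x = pproj (lb V (pproj x))"

definition Sop :: "real^'n^'n => real^'n^'n => real^'n^'n" where "Sop V x = lb V (gproj x) - Aop V x"

lemma linear_Aop: "linear (Aop V)" unfolding Aop_def[abs_def] using linear_compose[OF linear_compose[OF linear_pproj linear_bracket] linear_pproj] by(simp add:o_def)

lemma linear_Sop: "linear (Sop V)" unfolding Sop_def[abs_def] using linear_compose_sub[OF linear_compose[OF linear_gproj linear_bracket] linear_Aop] by(simp add:o_def)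

lemma Aop_pp: "Aop V x : pp" by(simp add:Aop_def pproj_in)
lemma Aop_kk: "Y : kk ==> Aop V Y = 0" by(simp add:Aop_def pproj_kk linear_0[OF linear_pproj])

lemma Sop_gg: "V : pp ==> Sop V x : gg" unfolding Sop_def by(intro gg_cl pp_gg gproj_in) (auto simp: Aop_pp pp_gg)

lemma Sop_kk: "V : pp ==> x : kk ==> Sop V x = lb V x" by(simp add:Sop_def Aop_kk gproj_id kk_gg)

lemma Sop_pp: "V : pp ==> x : pp ==> Sop V x = kproj (lb V x)" by(simp add:Sop_def Aop_def pproj_id gproj_id pp_gg pproj_def[of "lb V x"] gg_cl)

lemma Aop_skew: "V : pp ==> bt (Aop V x) y = - bt x (Aop V y)"
proof -
 assume V: "V : pp"
 have e: "bt (Aop V x) y = kf (lb V (pproj x)) (pproj y)" for x y using kf_pproj_left[OF _ pproj_in, of "lb V (pproj x)" y] V pproj_in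
  by(simp add:bt_def Aop_def pproj_id[OF pproj_in] gproj_id pp_gg kproj_pp kf_simps gg_cl)
 have "kf (lb V (pproj x)) (pproj y) = - kf (pproj x) (lb V (pproj y))" using V pproj_in by(intro kf_invariant' pp_gg)
 thus ?thesis using e[of x y] e[of y x] by(simp add:bt_commute[of x] kf_commute)
qed

lemma Sop_sym:
 assumes V: "V : pp" and x: "x : basis" and y: "y : basis"
 shows "bt (Sop V x) y = bt x (Sop V y)"
proof -
 have kp: "bt (Sop V x) y = bt x (Sop V y)" if x: "x : kk" and y: "y : pp" for x y
 proof -
  have "bt (Sop V x) y = kf (lb V x) y" using V x y by(simp add:Sop_kk bt_pp bracket_kk_pp)
  also have "... = - kf x (lb V y)" using V x y by(intro kf_invariant' pp_gg kk_gg)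
  also have "... = - kf x (kproj (lb V y))" using kf_kproj[OF x, of "lb V y"] by(simp add:kf_commute)
  also have "... = bt x (Sop V y)" using V x y by(simp add:Sop_pp bt_kk kproj_in)
  finally show ?thesis .
 qed
 consider "x : kk" "y : kk" | "x : kk" "y : pp" | "x : pp" "y : kk" | "x : pp" "y : pp" using x y kbasis(2) pbasis(2) by blast
 thus ?thesis
 proof cases
  case 1 thus ?thesis using V by(simp add:Sop_kk bt_pk bracket_kk_pp)
 next
  case 2 thus ?thesis by(rule kp)
 next
  case 3 thus ?thesis using kp[of y x] by(simp add:bt_commute)
 next
  case 4 thus ?thesis using V by(simp add:Sop_pp bt_pk kproj_in)
 qed
qed

text \<open>The Kempf--Ness argument. The bracket, viewed as the 3-form \<open>phi\<close>, is a critical point of the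
 norm in the directions swapping \<open>\<kk>\<close> and \<open>\<pp>\<close>, so its stabilizer is closed under transposes: the
 skew part \<open>Aop V\<close> of \<open>ad V\<close> kills \<open>phi\<close> as well.\<close>

lemma phi_critical:
 assumes T: "!!x. x : kk ==> T x : pp" "!!x. x : pp ==> T x : kk"
 shows "IP phi (DD T phi) = 0"
proof -
 have Tg: "T x : gg" if "x : basis" for x using that kbasis(2) pbasis(2) T kk_gg pp_gg by blast
 let ?N = "SUM x:basis. SUM y:basis. SUM z:basis. phi x y z * phi (T x) y z"
 have "(SUM y:basis. SUM z:basis. phi x y z * phi (T x) y z) = 0" if "x : basis" for x
 proof (cases "x : kk")
  case True
  thus ?thesis by(intro pp_kk_moment T)
 next
  case False
  hence "x : pp" using that kbasis(2) pbasis(2) by blast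
  thus ?thesis using pp_kk_moment[OF T(2), of x x] by(simp add:mult.commute)
 qed
 hence 1: "?N = 0" by simp
 have "(SUM x:basis. SUM y:basis. SUM z:basis. phi x y z * phi x (T y) z)
  = (SUM x:basis. SUM y:basis. SUM z:basis. phi y z x * phi (T y) z x)" by(intro sum.cong refl) (metis phi_cyclic basis_gg Tg)
 hence 2: "(SUM x:basis. SUM y:basis. SUM z:basis. phi x y z * phi x (T y) z) = 0" using 1 by(simp add:sum3_rotate[of "%x y z. phi y z x * phi (T y) z x"])
 have "(SUM x:basis. SUM y:basis. SUM z:basis. phi x y z * phi x y (T z))
  = (SUM x:basis. SUM y:basis. SUM z:basis. phi z x y * phi (T z) x y)" by(intro sum.cong refl) (metis phi_cyclic basis_gg Tg)
 hence 3: "(SUM x:basis. SUM y:basis. SUM z:basis. phi x y z * phi x y (T z)) = 0" using 1 by(simp add:sum3_rotate[of "%x y z. phi x y z * phi (T x) y z"])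
 show ?thesis unfolding IP_def DD_def distrib_left sum.distrib 1 2 3 by simp
qed

text \<open>Write \<open>A\<close> and \<open>S\<close> for the two parts of \<open>ad V\<close>.
  Invariance of \<open>phi\<close> under \<open>ad V\<close> gives
  \<open>DD S phi = - DD A phi\<close>. Moving \<open>A\<close> and \<open>S\<close> across
  \<open>IP\<close> in both orders shows that twice the product of \<open>DD A phi\<close> and
  \<open>DD S phi\<close> is the product of \<open>phi\<close> with
  \<open>DD (A S - S A) phi\<close>. The commutator exchanges \<open>kk\<close> and
  \<open>pp\<close>, so this is zero by \<open>phi_critical\<close>, and hence
  \<open>DD A phi\<close> has norm zero.\<close>

lemma DD_Aop_phi:
 assumes V: "V : pp" and "x : gg" "y : gg" "z : gg"
 shows "DD (Aop V) phi x y z = 0"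
proof -
 let ?A = "Aop V" and ?S = "Sop V"
 have As: "!!e. e : basis ==> ?A e : gg" "!!e. e : basis ==> ?S e : gg" "!!e. e : basis ==> - ?A e : gg" using Aop_pp Sop_gg[OF V] pp_gg gg_cl(4) by blast+
 have phis: "phi (a - b) y z = phi a y z - phi b y z" "phi y (a - b) z = phi y a z - phi y b z"
  "phi y z (a - b) = phi y z a - phi y z b" "phi (- a) y z = - phi a y z" "phi y (- a) z = - phi y a z"
  "phi y z (- a) = - phi y z a" for a b y z by(simp_all add: phi_def bracket_simps kf_simps)
 have adV: "DD ?S phi x y z = - DD ?A phi x y z" if "x : gg" "y : gg" "z : gg" for x y z
 proof -
  have "phi (lb V x) y z + phi x (lb V y) z + phi x y (lb V z) = 0" using kf_invariant'[OF pp_gg[OF V] lie_algebra_bracket[OF that(1,2)] that(3)]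
   by(simp add:phi_def jacobi[of V x y] kf_simps)
  thus ?thesis using that by(simp add:DD_def Sop_def gproj_id phis)
 qed
 have tlA: "tl (DD ?A phi)" and tlS: "tl (DD ?S phi)" by(intro tl_DD tl_phi linear_Aop linear_Sop)+
 have "IP (DD ?A phi) (DD ?S phi) = IP phi (DD (%x. - ?A x) (DD ?S phi))" by(rule IP_adjoint[OF tl_phi tlS]) (use As in \<open>auto simp: Aop_skew[OF V] bt_simps\<close>)
 moreover have "IP (DD ?S phi) (DD ?A phi) = IP phi (DD ?S (DD ?A phi))" by(rule IP_adjoint[OF tl_phi tlA]) (use As Sop_sym[OF V] in auto)
 moreover have "IP (DD ?A phi) (DD ?S phi) = IP (DD ?S phi) (DD ?A phi)" unfolding IP_def by(simp add:mult.commute)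
 moreover have "IP phi (DD (%x. - ?A x) (DD ?S phi)) + IP phi (DD ?S (DD ?A phi)) = IP phi (DD (%x. ?A (?S x) - ?S (?A x)) phi)" unfolding IP_def sum.distrib[symmetric]
  by(intro sum.cong refl)
   (simp add:DD_def phis linear_neg[OF linear_Sop] algebra_simps)
 moreover have "IP phi (DD (%x. ?A (?S x) - ?S (?A x)) phi) = 0"
 proof (rule phi_critical)
  show "?A (?S x) - ?S (?A x) : pp" if "x : kk" for x by(simp add:Aop_kk[OF that] Aop_pp linear_0[OF linear_Sop])
  show "?A (?S x) - ?S (?A x) : kk" if "x : pp" for x
  proof -
   have "?A (?S x) = 0" using Aop_kk[OF kproj_in] V that by(simp add:Sop_pp)
   moreover have "?S (?A x) : kk" using V by(simp add:Sop_pp Aop_pp kproj_in)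
   ultimately show ?thesis using subspace_neg[OF K.subspace_lie_algebra] by simp
  qed
 qed
 ultimately have z: "IP (DD ?A phi) (DD ?S phi) = 0" by simp
 have "IP (DD ?A phi) (DD ?A phi) = - IP (DD ?A phi) (DD ?S phi)" unfolding IP_def sum_negf[symmetric] by(intro sum.cong refl) (simp add:adV basis_gg)
 hence "(SUM x:basis. SUM y:basis. SUM z:basis. DD ?A phi x y z * DD ?A phi x y z) = 0" using z by(simp add:IP_def)
 hence b0: "DD ?A phi x y z = 0" if "x : basis" "y : basis" "z : basis" for x y z using that kbasis(1) pbasis(1) by(simp add:sum_nonneg_eq_0_iff sum_nonneg)
 have ext: "f x = 0" if "linear f" "x : gg" "!!e. e : basis ==> f e = 0" for f :: "_ => real" and x
 proof -
  have "f x = f (SUM e:basis. bt x e *. e)" using basis_expand[OF that(2)] by simp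
  thus ?thesis by(simp add:linear_sum[OF that(1)] linear_scale[OF that(1)] that(3))
 qed
 have l: "linear (%x. DD ?A phi x y z)" "linear (%y. DD ?A phi x y z)" "linear (%z. DD ?A phi x y z)" for x y z using tlA by(auto simp: tl_def)
 have "DD ?A phi e f z = 0" if "e : basis" "f : basis" for e f by(rule ext[OF l(3) assms(4)]) (rule b0[OF that])
 hence "DD ?A phi e y z = 0" if "e : basis" for e by(intro ext[OF l(2) assms(3)]) (use that in blast)
 thus ?thesis by(intro ext[OF l(1) assms(2)])
qed

text \<open>\<open>Aop V\<close> is skew for the Killing form as well as for \<open>bt\<close>, so
  \<open>DD_Aop_phi\<close> is the derivation rule paired with an arbitrary \<open>z\<close>;
  nondegeneracy of the form does the rest.\<close>

lemma Aop_derivation: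
 assumes V: "V : pp" and x: "x : gg" and y: "y : gg"
 shows "Aop V (lb x y) = lb (Aop V x) y + lb x (Aop V y)"
proof -
 let ?A = "Aop V"
 have Ag: "?A x : gg" for x using Aop_pp pp_gg by blast
 let ?d = "lb (?A x) y + lb x (?A y) - ?A (lb x y)"
 have "kf ?d z = 0" if z: "z : gg" for z
 proof -
  have "kf (lb x y) (?A z) = kf (pproj (lb x y)) (?A z)" using kf_pproj_left[OF lie_algebra_bracket[OF x y] Aop_pp] by simp
  also have "... = bt (lb x y) (?A z)" by(simp add:bt_def pproj_id[OF Aop_pp] gproj_id Ag kproj_pp[OF Aop_pp] kf_simps)
  also have "... = - bt (?A (lb x y)) z" by(simp add:Aop_skew[OF V])
  also have "... = - kf (?A (lb x y)) (pproj z)" by(simp add:bt_def pproj_id[OF Aop_pp] gproj_id Ag kproj_pp[OF Aop_pp] kf_simps)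
  also have "... = - kf (?A (lb x y)) z" using kf_pproj_left[OF z Aop_pp] by(simp add:kf_commute)
  finally show ?thesis using DD_Aop_phi[OF V x y z] by(simp add:DD_def phi_def kf_simps)
 qed
 moreover have "?d : gg" by(simp add:gg_cl x y Ag)
 ultimately have "?d = 0" using kf_radical_trivial[OF ss, of ?d] by blast
 thus ?thesis by simp
qed

text \<open>\<open>D\<close> consists of the \<open>V\<close> whose \<open>Aop V\<close> vanishes.
  Since \<open>Aop V\<close> kills \<open>kk\<close>, the derivation rule makes it commute with
  \<open>ad Y\<close> for \<open>Y\<close> in \<open>kk\<close>, which puts all brackets of
  \<open>kk\<close> with \<open>pp\<close> into \<open>D\<close>. A vector of \<open>pp\<close>
  orthogonal to \<open>D\<close> therefore centralizes \<open>kk\<close> and is zero, so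
  \<open>D\<close> is all of \<open>pp\<close>.\<close>

theorem bracket_pp_pp:
 assumes V: "V : pp" and W: "W : pp"
 shows "lb V W : kk"
proof -
 define D where "D = {V : pp. ALL x:pp. ALL z:pp. kf (lb V x) z = 0}"
 have sD: "subspace D" using subspace_pp unfolding subspace_def D_def by(auto simp: bracket_simps kf_simps)
 have YV: "lb Y V : D" if Y: "Y : kk" and V: "V : pp" for Y V
 proof -
  note Yg = kk_gg[OF Y]
  have "kf (lb (lb Y V) x) z = 0" if x: "x : pp" and z: "z : pp" for x z
  proof -
   note xg = pp_gg[OF x] and Vg = pp_gg[OF V]
   have comm: "pproj (lb Y Z) = lb Y (pproj Z)" if Z: "Z : gg" for Z
   proof -
    have "lb Y Z = lb Y (pproj Z) + lb Y (kproj Z)" using decomp[OF Z] by(metis bracket_add_right)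
    thus ?thesis by(simp add:linear_add[OF linear_pproj] pproj_id bracket_kk_pp(1)[OF Y pproj_in] pproj_kk K.lie_algebra_bracket[OF Y kproj_in])
   qed
   have "lb (lb Y V) x = lb Y (lb V x) - lb V (lb Y x)" using jacobi[of Y V x] by simp
   hence "pproj (lb (lb Y V) x) = lb Y (Aop V x) - Aop V (lb Y x)" by(simp add:linear_diff[OF linear_pproj] comm Vg xg gg_cl Aop_def pproj_id x bracket_kk_pp(1)[OF Y x])
   also have "... = 0" using Aop_derivation[OF V Yg xg] by(simp add:Aop_kk[OF Y])
   finally show ?thesis using kf_pproj_left[OF _ z, of "lb (lb Y V) x"] by(simp add:gg_cl Yg Vg xg kf_simps)
  qed
  thus ?thesis using bracket_kk_pp(1)[OF Y V] by(simp add:D_def)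
 qed
 have Dpp: "D <= pp" by(auto simp: D_def)
 have "EX E mu. finite E & E <= D & (ALL e:E. ALL f:E. kf e f = (if e = f then 1 else 0)) &
  (ALL x:D. x = (SUM e:E. kf x e *. e)) & (ALL e:E. (%x. x) e = mu e *. e)"
  by(rule symmetric_eigenbasis) (use sD Dpp pos in \<open>auto simp: bilinear_kf kf_commute linear_ident\<close>)
 then obtain E where E: "finite E" "E <= D" "ALL e:E. ALL f:E. kf e f = (if e = f then 1 else 0)"
  "ALL x:D. x = (SUM e:E. kf x e *. e)" by blast
 have "V : D"
 proof -
  define U where "U = V - (SUM e:E. kf V e *. e)"
  have sE: "(SUM e:E. kf V e *. e) : D" using E(2) sD by(intro subspace_sum subspace_scale) auto
  have Upp: "U : pp" unfolding U_def using V sE Dpp by(intro subspace_diff subspace_pp) auto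
  have Ue: "kf U f = 0" if f: "f : E" for f
  proof -
   have "kf (SUM e:E. kf V e *. e) f = (SUM e:E. if e = f then kf V f else 0)" unfolding kf_sum_left by(rule sum.cong) (use E(3) f in \<open>auto simp: kf_simps\<close>)
   thus ?thesis using f E(1) by(simp add:U_def kf_simps)
  qed
  have UD: "kf U d = 0" if d: "d : D" for d
  proof -
   have "kf U d = kf (SUM e:E. kf d e *. e) U" using E(4) d by(metis kf_commute)
   also have "... = 0" unfolding kf_sum_left using Ue by(intro sum.neutral ballI) (simp add:kf_simps kf_commute[of _ U])
   finally show ?thesis .
  qed
  have "lb U Y = 0" if Y: "Y : kk" for Y
  proof (rule ccontr)
   assume ne: "lb U Y ~= 0"
   have UY: "lb U Y : pp" by(rule bracket_kk_pp(2)[OF Y Upp])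
   have "kf (lb U Y) (lb U Y) = kf U (lb Y (lb U Y))" by(rule kf_invariant) (use Upp Y UY pp_gg kk_gg in auto)
   also have "... = 0" by(rule UD[OF YV[OF Y UY]])
   finally show False using pos[OF UY ne] by simp
  qed
  hence "U = 0" by(rule centralizer_kk_pp[OF Upp])
  thus ?thesis using sE by(simp add:U_def)
 qed
 have VW: "lb V W : gg" using V W by(simp add:pp_gg gg_cl)
 have "kf (pproj (lb V W)) z = 0" if "z : pp" for z using `V : D` W that kf_pproj_left[OF VW that] by(simp add:D_def)
 hence "pproj (lb V W) = 0" using pos[OF pproj_in, of "lb V W"] pproj_in by fastforce
 hence "lb V W = kproj (lb V W)" using decomp[OF VW] by simp
 thus ?thesis using kproj_in by metis
qed

end

section \<open>The adjoint action and the norm \<open>nb\<close>\<close>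

lemma exp_eigenvector:
 assumes "eapp T e = mu *. e"
 shows "eapp (exp T) e = exp mu *. e"
proof -
 have p: "eapp (T ^ n) e = mu ^ n *. e" for n by(induction n) (simp_all add: assms eapp.scaleR_right mult.commute)
 have "(%n. eapp (T ^ n /\<^sub>R fact n) e) sums eapp (exp T) e" by(intro bounded_linear.sums[OF eapp.bounded_linear_left] exp_converges)
 moreover have "(%n. (mu ^ n /\<^sub>R fact n) *. e) sums (exp mu *. e)" by(intro sums_scaleR_left exp_converges)
 moreover have "eapp (T ^ n /\<^sub>R fact n) e = (mu ^ n /\<^sub>R fact n) *. e" for n by(simp add:eapp.scaleR_left p)
 ultimately show ?thesis by(simp add:sums_iff)
qed

definition Ad :: "real^'n^'n => real^'n^'n => real^'n^'n" where "Ad g x = g**x**mi g"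

lemma Ad_mult: "invertible g ==> invertible h ==> Ad (g**h) x = Ad g (Ad h x)" by(simp add:Ad_def matrix_inv_mult mma)

lemma Ad_one [simp]: "Ad (mat 1) x = x" by(simp add:Ad_def)

lemma linear_Ad: "linear (Ad g)" unfolding Ad_def by(rule linearI) (simp_all add: matrix_ring_simps)

lemma Ad_exp: "Ad (mexp X) Y = eapp (exp (adE X)) Y" by(simp add:Ad_def exp_adE)

lemma Ad_exp_eigenvector: "lb X e = mu *. e ==> Ad (mexp (t *. X)) e = exp (t * mu) *. e" unfolding Ad_exp by(rule exp_eigenvector) (simp add:bracket_simps)

lemma mat_exp_Ad: "invertible g ==> g**mexp X**mi g = mexp (Ad g X)" unfolding Ad_def by(rule mat_exp_conj[symmetric]) simp

context cartan
begin

lemma bt_decomp: "x : gg ==> y : gg ==> bt x y = kf (pproj x) (pproj y) - kf (kproj x) (kproj y)" by(simp add:bt_def gproj_id)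

lemma bt_nonneg: "x : gg ==> 0 <= bt x x" using bt_pos[of x] by(cases "x = 0") (auto simp: bt_simps)

definition nb :: "real^'n^'n => real" where "nb x = sqrt (bt x x)"

lemma nb_nonneg: "x : gg ==> 0 <= nb x" by(simp add:nb_def bt_nonneg)

lemma nb_square: "x : gg ==> nb x ^ 2 = bt x x" by(simp add:nb_def bt_nonneg)

lemma nb_scale: "nb (c *. x) = \<bar>c\<bar> * nb x" by(simp add:nb_def bt_simps real_sqrt_mult flip: mult.assoc)

lemma bt_le_nb:
 assumes x: "x : gg" and y: "y : gg"
 shows "bt x y <= nb x * nb y"
proof (cases "y = 0")
 case False
 define b where "b = bt y y"
 have b: "0 < b" unfolding b_def by(rule bt_pos[OF y False])
 have "0 <= bt (b *. x - bt x y *. y) (b *. x - bt x y *. y)" by(intro bt_nonneg) (simp add:gg_cl x y)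
 also have "... = b * (b * bt x x - bt x y * bt x y)" by(simp add:bt_simps bt_commute[of y x] b_def algebra_simps)
 finally have "bt x y * bt x y <= b * bt x x" using b by(simp add:zero_le_mult_iff)
 hence "\<bar>bt x y\<bar> <= sqrt (b * bt x x)" by(intro real_le_rsqrt) (simp add:power2_eq_square)
 thus ?thesis by(simp add:nb_def b_def real_sqrt_mult mult.commute)
qed (simp add:bt_simps nb_def)

lemma nb_triangle: "x : gg ==> y : gg ==> nb (x + y) <= nb x + nb y"
proof -
 assume x: "x : gg" and y: "y : gg"
 have "nb (x + y) ^ 2 = bt x x + 2 * bt x y + bt y y" using x y by(simp add:nb_square gg_cl bt_simps bt_commute[of y x])
 also have "... <= (nb x + nb y) ^ 2" using bt_le_nb[OF x y] x y by(simp add:power2_sum nb_square)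
 finally show ?thesis by(rule power2_le_imp_le) (simp add:nb_nonneg x y)
qed

lemma nb_equiv:
 obtains m M where "0 < m" "0 < M" "!!x. x : gg ==> m * norm x <= nb x" "!!x. x : gg ==> nb x <= M * norm x"
proof -
 interpret b: bounded_bilinear bt using bilinear_bt by(simp add:bilinear_conv_bounded_bilinear)
 obtain M where M: "0 < M" "!!x y. norm (bt x y) <= norm x * norm y * M" using b.pos_bounded by blast
 have u: "nb x <= sqrt M * norm x" if "x : gg" for x
 proof -
  have "bt x x <= M * (norm x)\<^sup>2" using M(2)[of x x] by(simp add:power2_eq_square mult_ac)
  thus ?thesis unfolding nb_def using real_sqrt_le_mono by(fastforce simp: real_sqrt_mult)
 qed
 have "EX m>0. ALL x:gg. m * norm x <= nb x"
 proof (cases "gg = {0}")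
  case True
  thus ?thesis by(intro exI[of _ 1]) (auto simp: nb_def bt_simps)
 next
  case False
  let ?S = "gg \<inter> sphere 0 1"
  obtain v where v: "v : gg" "v ~= 0" using False gg_cl(5) by blast
  have ne: "?S ~= {}" using v by(intro ex_in_conv[THEN iffD1] exI[of _ "v /\<^sub>R norm v"]) (auto simp: gg_cl)
  have cS: "compact ?S" by(intro closed_Int_compact closed_subspace gg_subspace compact_sphere)
  have "continuous_on ?S nb" unfolding nb_def[abs_def] by(intro continuous_on_real_sqrt b.continuous_on continuous_on_id)
  then obtain u where u: "u : ?S" "!!x. x : ?S ==> nb u <= nb x" using continuous_attains_inf[OF cS ne] by blast
  have "u ~= 0" "u : gg" using u(1) by auto
  hence "0 < nb u" using bt_pos[of u] by(simp add:nb_def)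
  moreover have "nb u * norm x <= nb x" if x: "x : gg" for x
  proof (cases "x = 0")
   case False
   have "x /\<^sub>R norm x : ?S" using x False by(auto simp: gg_cl)
   from u(2)[OF this] show ?thesis using False by(simp add:nb_scale field_simps)
  qed (simp add:nb_def bt_simps)
  ultimately show ?thesis by blast
 qed
 thus ?thesis using that[of _ "sqrt M"] u M(1) by auto
qed

text \<open>\<open>ad V\<close> exchanges \<open>kk\<close> and \<open>pp\<close>, on which
  \<open>bt\<close> and \<open>kf\<close> differ by opposite signs, so the skewness of
  \<open>ad V\<close> for \<open>kf\<close> becomes symmetry for \<open>bt\<close>.\<close>

lemma ad_pp_symmetric:
 assumes V: "V : pp" and x: "x : gg" and y: "y : gg"
 shows "bt (lb V x) y = bt x (lb V y)"
proof -
 have p: "pproj (lb V x) = lb V (kproj x) & kproj (lb V x) = lb V (pproj x)" if x: "x : gg" for x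
 proof -
  have e: "lb V x = lb V (pproj x) + lb V (kproj x)" using decomp[OF x] by(metis bracket_add_right)
  have 1: "lb V (pproj x) : kk" "lb V (kproj x) : pp" using bracket_pp_pp[OF V pproj_in] bracket_kk_pp(2)[OF kproj_in V] by auto
  show ?thesis unfolding e by(simp add:linear_add[OF linear_pproj] linear_add[OF linear_kproj] pproj_kk[OF 1(1)] pproj_id[OF 1(2)] kproj_id[OF 1(1)] kproj_pp[OF 1(2)])
 qed
 note Vg = pp_gg[OF V]
 have "bt (lb V x) y = kf (lb V (kproj x)) (pproj y) - kf (lb V (pproj x)) (kproj y)" using p[OF x] by(simp add:bt_decomp gg_cl Vg x y)
 also have "... = - kf (kproj x) (lb V (pproj y)) + kf (pproj x) (lb V (kproj y))" using kf_invariant'[OF Vg kk_gg[OF kproj_in] pp_gg[OF pproj_in]]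
   kf_invariant'[OF Vg pp_gg[OF pproj_in] kk_gg[OF kproj_in]] by simp
 also have "... = bt x (lb V y)" using p[OF y] by(simp add:bt_decomp gg_cl Vg x y)
 finally show ?thesis .
qed

lemma ad_eigenbasis:
 assumes V: "V : pp"
 obtains E mu where "finite E" "E <= gg" "ALL e:E. ALL f:E. bt e f = (if e = f then 1 else 0)"
  "ALL x:gg. x = (SUM e:E. bt x e *. e)" "!!e. e : E ==> lb V e = mu e *. e"
proof -
 have "EX E mu. finite E & E <= gg & (ALL e:E. ALL f:E. bt e f = (if e = f then 1 else 0)) &
  (ALL x:gg. x = (SUM e:E. bt x e *. e)) & (ALL e:E. lb V e = mu e *. e)" by(rule symmetric_eigenbasis[OF gg_subspace bilinear_bt bt_commute bt_pos linear_bracket])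
   (use V pp_gg in \<open>auto simp: gg_cl ad_pp_symmetric\<close>)
 thus ?thesis using that by blast
qed

lemma Ad_gg: "g : G ==> x : gg ==> Ad g x : gg" unfolding Ad_def by(rule lie_algebra_Ad)

lemma Ad_K_proj:
 assumes k: "k : K" and x: "x : gg"
 shows "pproj (Ad k x) = Ad k (pproj x)" "kproj (Ad k x) = Ad k (kproj x)"
proof -
 have kG: "k : G" and ki: "invertible k" using k K(2) inv by auto
 have kk: "Ad k Y : kk" if "Y : kk" "k : K" for Y k unfolding Ad_def by(rule K.lie_algebra_Ad[OF that(2,1)])
 have pk: "Ad k V : pp" if V: "V : pp" for V
 proof -
  have "kf (Ad k V) Y = 0" if Y: "Y : kk" for Y
  proof -
   define Y' where "Y' = Ad (mi k) Y"
   have Y': "Y' : kk" unfolding Y'_def by(rule kk[OF Y K.minv[OF k]])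
   have "Ad k Y' = Y" using ki by(simp add:Y'_def Ad_mult[symmetric])
   thus ?thesis using kf_Ad[OF kG pp_gg[OF V] kk_gg[OF Y']] pp_kk_orth(1)[OF V Y'] by(simp add:Ad_def)
  qed
  thus ?thesis using Ad_gg[OF kG pp_gg[OF V]] by(simp add:pp_def)
 qed
 have e: "Ad k x = Ad k (pproj x) + Ad k (kproj x)" using decomp[OF x] by(metis linear_add[OF linear_Ad])
 show "pproj (Ad k x) = Ad k (pproj x)" "kproj (Ad k x) = Ad k (kproj x)"
  unfolding e by(simp_all add: linear_add[OF linear_pproj] linear_add[OF linear_kproj] pproj_id pk pproj_in pproj_kk kproj_pp kproj_id kk[OF kproj_in k])
qed

lemma Ad_K_pp: "k : K ==> V : pp ==> Ad k V : pp" using Ad_K_proj(1)[of k V] pproj_in[of "Ad k V"] by(simp add:pp_gg pproj_id)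

lemma bt_Ad_K:
 assumes k: "k : K" and x: "x : gg" and y: "y : gg"
 shows "bt (Ad k x) (Ad k y) = bt x y"
proof -
 have kG: "k : G" using k K(2) by blast
 show ?thesis using kf_Ad[OF kG] by(simp add:bt_decomp Ad_gg kG x y Ad_K_proj[OF k] pp_gg pproj_in kk_gg kproj_in flip: Ad_def)
qed

lemma nb_Ad_K: "k : K ==> x : gg ==> nb (Ad k x) = nb x" by(simp add:nb_def bt_Ad_K)

text \<open>Only the even part of the series of \<open>dexp\<close> contributes, and all its terms are positive.\<close>

lemma dexp_expanding:
 assumes V: "V : pp" and W: "W : pp"
 shows "eapp (dexp (adE V)) W : gg" and "bt W W <= bt (eapp (dexp (adE V)) W) W"
proof -
 define a where "a k = ((-1) ^ k / fact (Suc k) :: real)" for k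
 define b where "b k = (lb V ^^ k) W" for k
 have p: "eapp (adE V ^ k) W = b k" for k unfolding b_def by(induction k) simp_all
 have s: "(%k. a k *. b k) sums eapp (dexp (adE V)) W"
 proof -
  have "(%k. eapp ((-1) ^ k *. adE V ^ k /\<^sub>R fact (Suc k)) W) sums eapp (dexp (adE V)) W" by(intro bounded_linear.sums[OF eapp.bounded_linear_left] dexp_sums)
  thus ?thesis by(simp add:eapp.scaleR_left p a_def divide_inverse mult.commute)
 qed
 have bg: "b k : gg" for k unfolding b_def by(induction k) (simp_all add: pp_gg V W gg_cl)
 have bpk: "b (2 * k) : pp & b (Suc (2 * k)) : kk" for k
 proof (induction k)
  case 0
  show ?case using W bracket_pp_pp[OF V W] by(simp add:b_def)
 next
  case (Suc k)
  have "b (2 * Suc k) = lb V (b (Suc (2 * k)))" by(simp add:b_def)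
  hence "b (2 * Suc k) : pp" using Suc bracket_kk_pp(2) V by simp
  moreover have "b (Suc (2 * Suc k)) = lb V (b (2 * Suc k))" by(simp add:b_def)
  ultimately show ?case using bracket_pp_pp[OF V] by simp
 qed
 \<comment> \<open>By symmetry of \<open>ad V\<close>, powers can be shared between the two
   arguments. With \<open>i = j\<close> the even terms become squared norms, while the odd ones lie
   in \<open>kk\<close>, orthogonal to \<open>W\<close>.\<close>
 have shift: "bt (b (i + j)) W = bt (b i) (b j)" for i j
 proof (induction j arbitrary: i)
  case (Suc j)
  have "bt (b (i + Suc j)) W = bt (b (Suc i)) (b j)" using Suc[of "Suc i"] by simp
  also have "... = bt (b i) (b (Suc j))" using ad_pp_symmetric[OF V bg bg] by(simp add:b_def)
  finally show ?case .
 qed (simp add:b_def)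
 show "eapp (dexp (adE V)) W : gg" by(rule closed_sequentially[OF closed_subspace[OF gg_subspace] _ s[unfolded sums_def]])
   (intro subspace_sum gg_subspace subspace_scale bg)
 have bl: "bounded_linear (%x. bt x W)" using bilinear_bt unfolding bilinear_def linear_conv_bounded_linear by blast
 have s2: "(%k. a k * bt (b k) W) sums bt (eapp (dexp (adE V)) W) W" using bounded_linear.sums[OF bl s] by(simp add:bt_simps)
 have z: "(%k. if k = 0 then bt W W else 0) sums bt W W" by(rule sums_single[of 0 "%_. bt W W"])
 show "bt W W <= bt (eapp (dexp (adE V)) W) W"
 proof (rule sums_le[OF _ z s2])
  fix k
  show "(if k = 0 then bt W W else 0) <= a k * bt (b k) W"
  proof (cases "even k")
   case True
   then obtain j where j: "k = j + j" by(metis evenE mult_2)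
   have "0 <= bt (b k) W" unfolding j shift by(rule bt_nonneg[OF bg])
   thus ?thesis using True by(simp add:a_def b_def)
  next
   case False
   then obtain j where "k = Suc (2 * j)" by(auto elim: oddE)
   thus ?thesis using bpk[of j] bt_pk(2)[OF _ W] by simp
  qed
 qed
qed

text \<open>For injectivity, \<open>F' u\<close> is paired with \<open>pproj u\<close>: the summand
  in \<open>kk\<close> drops out, and \<open>dexp_expanding\<close> bounds the square of
  \<open>pproj u\<close> by the pairing.\<close>

lemma polar_map_derivative:
 assumes V: "V : pp"
 defines "F == %u. mexp (- V)**mexp (V + pproj u)**mexp (kproj (gproj u))"
  and "F' == %u. eapp (dexp (adE V)) (pproj u) + kproj (gproj u)"
 shows "(F has_derivative F') (at 0)"
  and "linear F'" and "!!u. u : gg ==> F' u = 0 ==> u = 0"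
proof -
 have lkg: "linear (%u. kproj (gproj u))" using linear_compose[OF linear_gproj linear_kproj] by(simp add:o_def)
 have bp: "bounded_linear pproj" and bk: "bounded_linear (%u. kproj (gproj u))" using linear_pproj lkg by(simp_all add: linear_conv_bounded_linear)
 have "((%W. mexp (- V)**mexp (V + W)) has_derivative eapp (dexp (adE V))) (at (pproj 0))" using mat_exp_has_derivative_left[of V] by(simp add:linear_0[OF linear_pproj])
 from diff_chain_at[OF bounded_linear_imp_has_derivative[OF bp] this]
 have 1: "((%u. mexp (- V)**mexp (V + pproj u)) has_derivative (%u. eapp (dexp (adE V)) (pproj u))) (at 0)" by(simp add:o_def)
 have "(mexp has_derivative (%x. x)) (at (kproj (gproj 0)))" using mat_exp_has_derivative_0 by(simp add:linear_0[OF lkg])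
 from diff_chain_at[OF bounded_linear_imp_has_derivative[OF bk] this]
 have 2: "((%u. mexp (kproj (gproj u))) has_derivative (%u. kproj (gproj u))) (at 0)" by(simp add:o_def)
 show d: "(F has_derivative F') (at 0)" using mm.FDERIV[OF 1 2] unfolding F_def F'_def by(simp add:linear_0[OF linear_pproj] linear_0[OF lkg] add.commute)
 thus "linear F'" by(rule has_derivative_linear)
 show "u = 0" if u: "u : gg" "F' u = 0" for u
 proof -
  have "bt (F' u) (pproj u) = bt (eapp (dexp (adE V)) (pproj u)) (pproj u)" by(simp add:F'_def bt_simps bt_pk(2)[OF kproj_in pproj_in])
  hence "bt (pproj u) (pproj u) <= 0" using dexp_expanding(2)[OF V pproj_in, of u] u(2) by(simp add:bt_simps)
  hence p0: "pproj u = 0" using bt_pos[OF pp_gg[OF pproj_in], of u] by fastforce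
  hence "kproj u = 0" using u by(simp add:F'_def eapp.zero_right gproj_id)
  thus ?thesis using decomp[OF u(1)] p0 by simp
 qed
qed

lemma polar_chart:
 assumes V: "V : pp"
 obtains d where "0 < d" "!!g. g : G ==> norm (g - mat 1) < d ==>
  EX W:pp. EX Y:kk. g = mexp (- V)**mexp (V + W)**mexp Y"
proof -
 define F where "F = (%u. mexp (- V)**mexp (V + pproj u)**mexp (kproj (gproj u)))"
 define F' where "F' = (%u. eapp (dexp (adE V)) (pproj u) + kproj (gproj u))"
 note F = polar_map_derivative[OF V, folded F_def F'_def]
 have F0: "pproj 0 = 0" "kproj (gproj 0) = 0" by(simp_all add: linear_0[OF linear_pproj] linear_0[OF linear_kproj] linear_0[OF linear_gproj])
 have bp: "bounded_linear pproj" and bk: "bounded_linear (%u. kproj (gproj u))"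
  using linear_pproj linear_compose[OF linear_gproj linear_kproj] by(simp_all add: linear_conv_bounded_linear o_def)
 obtain d where d: "0 < d" "!!g. g : G ==> norm (g - mat 1) < d ==> EX u:gg. norm u < 1 & g = F u"
 proof (rule chart_covers[of F F', OF _ _ _ _ _ _ _ zero_less_one])
  show "continuous_on UNIV F" unfolding F_def[abs_def] by(intro continuous_intros bounded_linear.continuous_on[OF bp] bounded_linear.continuous_on[OF bk])
  show "F u : G" for u unfolding F_def by(intro mult lie_exp) (auto simp: gg_cl pp_gg V pproj_in kk_gg kproj_in)
  show "F 0 = mat 1" by(simp add:F_def F0)
  show "(F has_derivative F') (at 0)" by(rule F(1))
  show "F' u : gg" for u unfolding F'_def by(intro gg_cl(1) dexp_expanding(1) V pproj_in kk_gg kproj_in)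
  show "u = 0" if "u : gg" "F' u = 0" for u using F(3)[OF that(1)] that(2) by(simp add:F'_def)
  show "F' (gproj u) = F' u" for u by(simp add:F'_def gproj_id gproj_in pproj_def)
 qed blast
 show ?thesis
 proof (rule that[OF d(1)])
  fix g assume "g : G" "norm (g - mat 1) < d"
  then obtain u where "g = F u" using d(2) by blast
  thus "EX W:pp. EX Y:kk. g = mexp (- V)**mexp (V + W)**mexp Y" unfolding F_def using pproj_in kproj_in by blast
 qed
qed

end

locale connected_cartan = cartan G K for G K :: "(real^'n^'n) set" +
 assumes conn: "connected G"
begin

text \<open>\<open>K\<close> acts by isometries of \<open>nb\<close>, so bounds on
  \<open>exp V k\<close> and its inverse bound the eigenvalues \<open>exp (mu e)\<close> of
  \<open>Ad (exp V)\<close> from both sides. The square of \<open>V\<close> is the sum of the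
  squares of the \<open>mu e\<close>, by the trace formula.\<close>

lemma polar_bounded: "EX B. ALL V:pp. ALL k:K. norm (mexp V**k) <= R & norm (mi (mexp V**k)) <= R --> norm V <= B"
proof -
 obtain m M where mM: "0 < m" "0 < M" "!!x. x : gg ==> m * norm x <= nb x" "!!x. x : gg ==> nb x <= M * norm x" using nb_equiv by blast
 define R' where "R' = \<bar>R\<bar> + 1"
 have R': "R' > 0" by(simp add:R'_def)
 define C where "C = M * (R' * R') / m"
 have Ad_le: "nb (Ad g x) <= C * nb x" if "g : G" "x : gg" "norm g <= R" "norm (mi g) <= R" for g x
 proof -
  have "norm (Ad g x) <= (norm g * norm x) * norm (mi g)" unfolding Ad_def by(intro order_trans[OF norm_matrix_mult] mult_right_mono norm_matrix_mult) auto
  also have "... <= (R' * norm x) * R'" using that by(intro mult_right_mono mult_mono) (auto simp: R'_def)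
  finally have "M * norm (Ad g x) <= M * (R' * R') * norm x" using mM by(simp add:mult_ac)
  hence "nb (Ad g x) <= M * (R' * R') * norm x" using mM(4)[OF Ad_gg[OF that(1,2)]] by linarith
  also have "... <= M * (R' * R') * (nb x / m)" using mM(1,2) mM(3)[OF that(2)] R' by(intro mult_left_mono) (auto simp: field_simps)
  finally show ?thesis by(simp add:C_def)
 qed
 have C: "0 < C" using mM R' by(simp add:C_def)
 define B where "B = sqrt (real DIM(real^'n^'n) * (ln C)\<^sup>2) / m"
 have "norm V <= B" if V: "V : pp" and k: "k : K"
  and b: "norm (mexp V**k) <= R" "norm (mi (mexp V**k)) <= R" for V k
 proof -
  note Vg = pp_gg[OF V]
  have kG: "k : G" and ki: "invertible k" using k K(2) inv by auto
  let ?g = "mexp V**k"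
  have gG: "?g : G" by(intro mult lie_exp Vg kG)
  have gi: "invertible ?g" by(rule inv[OF gG])
  obtain E mu where E: "finite E" "E <= gg" "ALL e:E. ALL f:E. bt e f = (if e = f then 1 else 0)"
   "ALL x:gg. x = (SUM e:E. bt x e *. e)" "!!e. e : E ==> lb V e = mu e *. e" using ad_eigenbasis[OF V] by blast
  have mu: "\<bar>mu e\<bar> <= ln C" if e: "e : E" for e
  proof -
   have eg: "e : gg" using e E(2) by blast
   have ne: "nb e = 1" using E(3) e by(simp add:nb_def)
   have 1: "Ad (mexp V) e = exp (mu e) *. e" "Ad (mexp (- V)) e = exp (- mu e) *. e"
    using Ad_exp_eigenvector[OF E(5)[OF e], of 1] Ad_exp_eigenvector[OF E(5)[OF e], of "-1"] by simp_all
   define x where "x = Ad (mi k) e"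
   have x: "x : gg" "nb x = 1" unfolding x_def using Ad_gg[OF minv[OF kG] eg] nb_Ad_K[OF K.minv[OF k] eg] ne by auto
   have "Ad ?g x = Ad (mexp V) e" using ki by(simp add:x_def Ad_mult[symmetric] mms invertible_mult)
   hence "exp (mu e) <= C" using Ad_le[OF gG x(1) b] x(2) ne 1 by(simp add:nb_scale)
   moreover have "nb (Ad (mi ?g) e) = exp (- mu e)"
   proof -
    have "mi ?g = mi k**mexp (- V)" using ki by(simp add:matrix_inv_mult)
    hence "Ad (mi ?g) e = Ad (mi k) (Ad (mexp (- V)) e)" using ki by(simp add:Ad_mult)
    hence "nb (Ad (mi ?g) e) = nb (Ad (mexp (- V)) e)" using nb_Ad_K[OF K.minv[OF k]] 1 eg by(simp add:gg_cl)
    thus ?thesis using 1 ne by(simp add:nb_scale)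
   qed
   hence "exp (- mu e) <= C" using Ad_le[OF minv[OF gG] eg] b gi ne by simp
   ultimately show ?thesis using C by(simp add:abs_le_iff ln_ge_iff)
  qed
  have "card E <= DIM(real^'n^'n)"
  proof -
   have "independent E" by(rule form_orthonormal_independent[OF bilinear_bt E(1)]) (use E(3) in auto)
   thus ?thesis by(rule independent_bound[THEN conjunct2])
  qed
  have "kf V V = tr (adG V * adG V * eg)"
  proof -
   have "adG V * adG V * eg = adG V * adG V" by(rule endo_eqI) (simp add:gproj_id gproj_in)
   thus ?thesis by(simp add:kf_def)
  qed
  also have "... = (SUM e:E. bt (eapp (adG V * adG V) e) e)" by(rule tr_form_basis[OF gg_subspace bilinear_bt E(1-4)]) (simp add:gproj_id gg_cl Vg)
  also have "... = (SUM e:E. (mu e)\<^sup>2)" by(rule sum.cong) (use E(2,3,5) in \<open>auto simp: gproj_id gg_cl Vg bracket_simps bt_simps power2_eq_square subset_iff\<close>)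
  also have "... <= (SUM e:E. (ln C)\<^sup>2)" using mu by(intro sum_mono) (metis abs_ge_zero order_trans power2_abs power_mono)
  also have "... <= real DIM(real^'n^'n) * (ln C)\<^sup>2"
  proof -
   have "(SUM e:E. (ln C)\<^sup>2) = real (card E) * (ln C)\<^sup>2" by simp
   also have "... <= real DIM(real^'n^'n) * (ln C)\<^sup>2" using `card E <= _` by(intro mult_right_mono zero_le_power2) (simp only: of_nat_le_iff)
   finally show ?thesis .
  qed
  finally have "nb V <= sqrt (real DIM(real^'n^'n) * (ln C)\<^sup>2)" unfolding nb_def using V by(intro real_sqrt_le_mono) (simp add:bt_pp)
  thus ?thesis using mM(1) mM(3)[OF Vg] unfolding B_def by(simp add:field_simps) 
 qed
 thus ?thesis by blast
qed

text \<open>Properness of the polar map: \<open>polar_bounded\<close> confines the factors to a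
  compact set.\<close>

lemma polar_limit:
 assumes V: "!!n. V n : pp" and k: "!!n. k n : K" and l: "(%n. mexp (V n)**k n) ----> g" and g: "g : G"
 obtains r V' k' where "strict_mono r" "V' : pp" "k' : K" "(%n. V (r n :: nat)) ----> V'" "g = mexp V'**k'"
proof -
 let ?g = "%n. mexp (V n)**k n"
 have gG: "?g n : G" for n using V k K(2) pp_gg by(intro mult lie_exp) auto
 have li: "(%n. mi (?g n)) ----> mi g"
 proof (rule LIMSEQ_I)
  fix e :: real assume "0 < e"
  then obtain d where d: "0 < d" "!!B. invertible B ==> norm (B - g) < d ==> norm (mi B - mi g) < e" using matrix_inv_near[OF inv[OF g]] by blast
  obtain N where "ALL n>=N. norm (?g n - g) < d" using LIMSEQ_D[OF l d(1)] by blast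
  thus "EX N. ALL n>=N. norm (mi (?g n) - mi g) < e" using d(2) inv[OF gG] by blast
 qed
 obtain R1 R2 where R: "!!n. norm (?g n) <= R1" "!!n. norm (mi (?g n)) <= R2"
  using convergent_imp_Bseq[OF convergentI[OF l]] convergent_imp_Bseq[OF convergentI[OF li]] by(auto simp: Bseq_def)
 obtain B where B: "!!V k. V : pp ==> k : K ==> norm (mexp V**k) <= max R1 R2 ==>
   norm (mi (mexp V**k)) <= max R1 R2 ==> norm V <= B" using polar_bounded by blast
 have "norm (V n) <= B" for n using V k R[of n] by(intro B) (auto simp: le_max_iff_disj)
 hence in_: "ALL n. (V n, k n) : (pp \<inter> cball 0 B) \<times> K" using V k by simp
 have "compact ((pp \<inter> cball 0 B) \<times> K)" by(intro compact_Times K closed_Int_compact closed_subspace subspace_pp compact_cball)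
 then obtain l' r where r: "l' : (pp \<inter> cball 0 B) \<times> K" "strict_mono r" "((%n. (V n, k n)) \<circ> r) ----> l'" by(rule seq_compactE[OF compact_imp_seq_compact in_])
 have 1: "(%n. V (r n)) ----> fst l'" "(%n. k (r n)) ----> snd l'" using tendsto_fst[OF r(3)] tendsto_snd[OF r(3)] by(simp_all add: o_def)
 have "isCont (mexp :: real^'n^'n => _) (fst l')" using continuous_on_mat_exp[OF continuous_on_id, of "UNIV :: (real^'n^'n) set"] by(simp add:continuous_on_eq_continuous_at)
 hence "(%n. mexp (V (r n))) ----> mexp (fst l')" using 1(1) by(rule isCont_tendsto_compose)
 hence "(%n. ?g (r n)) ----> mexp (fst l')**snd l'" by(intro mm.tendsto 1)
 moreover have "(%n. ?g (r n)) ----> g" using LIMSEQ_subseq_LIMSEQ[OF l r(2)] by(simp add:o_def)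
 ultimately have "g = mexp (fst l')**snd l'" by(rule LIMSEQ_unique[rotated])
 thus ?thesis using that[of r "fst l'" "snd l'"] r 1 by auto
qed

text \<open>The image of the polar map is open by \<open>polar_chart\<close>, after multiplication
  by \<open>exp V\<close> and \<open>k\<close> on either side, and closed by
  \<open>polar_limit\<close>. Connectedness makes it all of \<open>G\<close>.\<close>

lemma polar_exists: "g : G ==> EX V:pp. EX k:K. g = mexp V**k"
proof -
 define T where "T = {mexp V**k | V k. V : pp & k : K}"
 have TG: "T <= G" unfolding T_def using K(2) pp_gg by(auto intro!: mult lie_exp)
 have "mexp 0**mat 1 : T" unfolding T_def using subspace_0[OF subspace_pp] K.one by blast
 hence ne: "T ~= {}" by blast
 have "openin (top_of_set G) T"
 proof (subst openin_subopen, intro ballI)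
  fix g assume "g : T"
  then obtain V k where Vk: "V : pp" "k : K" "g = mexp V**k" by(auto simp: T_def)
  have ki: "invertible k" using Vk(2) K(2) inv by blast
  obtain d where d: "0 < d" "!!h. h : G ==> norm (h - mat 1) < d ==>
    EX W:pp. EX Y:kk. h = mexp (- V)**mexp (V + W)**mexp Y" using polar_chart[OF Vk(1)] by blast
  let ?U = "{h : G. norm (mexp (- V)**h**mi k - mat 1) < d}"
  have "continuous_on G (%h. norm (mexp (- V)**h**mi k - mat 1))" by(intro continuous_intros)
  from continuous_openin_preimage_gen[OF this open_lessThan[of d]]
  have "openin (top_of_set G) ?U" by(simp add:vimage_def Int_def)
  moreover have "g : ?U" using Vk TG `g : T` ki d(1) by(auto simp: mms) (simp add:mma)?
  moreover have "?U <= T"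
  proof
   fix h assume h: "h : ?U"
   have "mexp (- V)**h**mi k : G" using h Vk(1,2) K(2) pp_gg by(intro mult minv lie_exp gg_cl) auto
   then obtain W Y where WY: "W : pp" "Y : kk" "mexp (- V)**h**mi k = mexp (- V)**mexp (V + W)**mexp Y" using d(2) h by blast
   hence "mexp V**(mexp (- V)**h**mi k)**k = mexp V**(mexp (- V)**mexp (V + W)**mexp Y)**k" by simp
   hence "h = mexp (V + W)**(mexp Y**k)" using ki by(simp add:mma) (simp add:mms)
   thus "h : T" unfolding T_def using WY Vk subspace_add[OF subspace_pp] K.mult K.lie_exp by blast
  qed
  ultimately show "EX U. openin (top_of_set G) U & g : U & U <= T" by blast
 qed
 moreover have "closedin (top_of_set G) T" unfolding closedin_limpt
 proof (intro conjI TG allI impI)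
  fix g assume g: "g islimpt T & g : G"
  then obtain f where f: "!!n. f n : T" "f ----> g" unfolding islimpt_sequential by blast
  have "ALL n. EX V k. V : pp & k : K & f n = mexp V**k" using f(1) unfolding T_def by blast
  then obtain V k where Vk: "!!n. V n : pp" "!!n. k n : K" "!!n. f n = mexp (V n)**k n" by metis
  have l: "(%n. mexp (V n)**k n) ----> g" using f(2) by(simp flip: Vk(3))
  obtain r :: "nat => nat" and V' k' where "V' : pp" "k' : K" "g = mexp V'**k'" by(rule polar_limit[OF Vk(1,2) l conjunct2[OF g]]) blast
  thus "g : T" by(auto simp: T_def)
 qed
 ultimately have "T = G" using conn ne unfolding connected_clopen by blast
 thus "g : G ==> EX V:pp. EX k:K. g = mexp V**k" unfolding T_def by blast
qed

lemma Ad_exp_pp_symmetric: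
 assumes V: "V : pp" and x: "x : gg" and y: "y : gg"
 shows "bt (Ad (mexp V) x) y = bt x (Ad (mexp V) y)"
proof -
 obtain E mu where E: "finite E" "E <= gg" "ALL e:E. ALL f:E. bt e f = (if e = f then 1 else 0)"
  "ALL x:gg. x = (SUM e:E. bt x e *. e)" "!!e. e : E ==> lb V e = mu e *. e" using ad_eigenbasis[OF V] by blast
 have a: "Ad (mexp V) e = exp (mu e) *. e" if "e : E" for e using Ad_exp_eigenvector[OF E(5)[OF that], of 1] by simp
 have f: "bt (Ad (mexp V) x) y = (SUM e:E. bt x e * exp (mu e) * bt e y)" if x: "x : gg" for x y
 proof -
  have "Ad (mexp V) x = Ad (mexp V) (SUM e:E. bt x e *. e)" using E(4) x by simp
  also have "... = (SUM e:E. (bt x e * exp (mu e)) *. e)" by(simp add:linear_sum[OF linear_Ad] linear_scale[OF linear_Ad] a)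
  finally show ?thesis by(simp add:bt_sum bt_simps)
 qed
 show ?thesis unfolding f[OF x] bt_commute[of x "Ad _ y"] f[OF y] by(rule sum.cong) (simp_all add: bt_commute mult_ac)
qed

text \<open>With \<open>exp V = exp V' k0\<close>, the symmetric operator \<open>Ad (exp V)\<close>
  equals both \<open>Ad (exp V') Ad k0\<close> and the adjoint of this. Multiplying the two gives
  \<open>Ad (exp (2 V)) = Ad (exp (2 V'))\<close>. Symmetric operators with equal exponentials
  agree, so \<open>V - V'\<close> is central and hence 0.\<close>

lemma polar_unique:
 assumes V: "V : pp" "V' : pp" and k: "k : K" "k' : K" and eq: "mexp V**k = mexp V'**k'"
 shows "V = V'"
proof -
 note Vg = pp_gg[OF V(1)] pp_gg[OF V(2)]
 have ki: "invertible k" "invertible k'" using k K(2) inv by auto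
 define k0 where "k0 = k'**mi k"
 have k0: "k0 : K" unfolding k0_def using k by(intro K.mult K.minv)
 hence k0i: "invertible k0" using K(2) inv by blast
 have "mexp V**k**mi k = mexp V'**k'**mi k" using eq by simp
 hence e: "mexp V = mexp V'**k0" using ki by(simp add:k0_def mms)
 have g: "mexp V : G" "mexp V' : G" "k0 : G" using lie_exp Vg k0 K(2) by auto
 have A1: "Ad (mexp V) x = Ad (mi k0) (Ad (mexp V') x)" if x: "x : gg" for x
 proof -
  have "bt (Ad (mexp V) x) y = bt (Ad (mi k0) (Ad (mexp V') x)) y" if y: "y : gg" for y
  proof -
   have "bt (Ad (mexp V) x) y = bt x (Ad (mexp V') (Ad k0 y))" using Ad_exp_pp_symmetric[OF V(1) x y] by(simp add:e Ad_mult k0i)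
   also have "... = bt (Ad (mexp V') x) (Ad k0 y)" using Ad_exp_pp_symmetric[OF V(2) x, of "Ad k0 y"] Ad_gg[OF g(3) y] by simp
   also have "... = bt (Ad (mi k0) (Ad (mexp V') x)) (Ad (mi k0) (Ad k0 y))" using bt_Ad_K[OF K.minv[OF k0]] Ad_gg g x y by simp
   also have "Ad (mi k0) (Ad k0 y) = y" using k0i by(simp add:Ad_mult[symmetric])
   finally show ?thesis .
  qed
  moreover have d: "Ad (mexp V) x - Ad (mi k0) (Ad (mexp V') x) : gg" by(intro gg_cl(2) Ad_gg g minv x)
  ultimately have "bt (Ad (mexp V) x - Ad (mi k0) (Ad (mexp V') x)) (Ad (mexp V) x - Ad (mi k0) (Ad (mexp V') x)) = 0" by(simp add:bt_simps(3)[of _ _ "Ad (mexp V) x - _"])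
  thus ?thesis using bt_pos[OF d] by fastforce
 qed
 have A2: "Ad (mexp (2 *. V)) x = Ad (mexp (2 *. V')) x" if x: "x : gg" for x
 proof -
  have d: "mexp (2 *. W) = mexp W**mexp W" for W :: "real^'n^'n" using mat_exp_scale_add[of 1 1 W] by simp
  have "Ad (mexp (2 *. V)) x = Ad (mexp V'**k0) (Ad (mi k0) (Ad (mexp V') x))" unfolding d Ad_mult[OF invertible_mat_exp invertible_mat_exp] A1[OF x, symmetric] by(simp add:e)
  also have "... = Ad (mexp V') (Ad k0 (Ad (mi k0) (Ad (mexp V') x)))" by(simp add:Ad_mult k0i)
  also have "Ad k0 (Ad (mi k0) (Ad (mexp V') x)) = Ad (mexp V') x" using k0i by(simp add:Ad_mult[OF k0i invertible_matrix_inv[OF k0i], symmetric])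
  finally show ?thesis by(simp add:d Ad_mult)
 qed
 obtain E mu where E: "finite E" "E <= gg" "ALL e:E. ALL f:E. bt e f = (if e = f then 1 else 0)"
  "ALL x:gg. x = (SUM e:E. bt x e *. e)" "!!e. e : E ==> lb V e = mu e *. e" using ad_eigenbasis[OF V(1)] by blast
 obtain F nu where F: "finite F" "F <= gg" "ALL e:F. ALL f:F. bt e f = (if e = f then 1 else 0)"
  "ALL x:gg. x = (SUM e:F. bt x e *. e)" "!!e. e : F ==> lb V' e = nu e *. e" using ad_eigenbasis[OF V(2)] by blast
 have be: "lb V' e = mu e *. e" if e: "e : E" for e
 proof -
  have eg: "e : gg" using e E(2) by blast
  have c: "bt e f = 0 | nu f = mu e" if f: "f : F" for f
  proof -
   have fg: "f : gg" using f F(2) by blast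
   have "exp (2 * mu e) * bt e f = bt (Ad (mexp (2 *. V')) e) f" using Ad_exp_eigenvector[OF E(5)[OF e], of 2] A2[OF eg] by(simp add:bt_simps)
   also have "... = bt e (Ad (mexp (2 *. V')) f)" by(rule Ad_exp_pp_symmetric) (use V eg fg subspace_scale[OF subspace_pp] in auto)
   also have "... = exp (2 * nu f) * bt e f" using Ad_exp_eigenvector[OF F(5)[OF f], of 2] by(simp add:bt_simps)
   finally show ?thesis by auto
  qed
  have "lb V' e = lb V' (SUM f:F. bt e f *. f)" using F(4) eg by simp
  also have "... = (SUM f:F. bt e f *. nu f *. f)" by(simp add:linear_sum[OF linear_bracket] bracket_simps F(5))
  also have "... = (SUM f:F. mu e *. (bt e f *. f))" by(rule sum.cong) (use c in auto)
  also have "... = mu e *. (SUM f:F. bt e f *. f)" by(simp add:scaleR_sum_right)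
  also have "(SUM f:F. bt e f *. f) = e" using F(4) eg by simp
  finally show ?thesis .
 qed
 have "lb (V - V') x = 0" if x: "x : gg" for x
 proof -
  have "lb (V - V') x = lb (V - V') (SUM e:E. bt x e *. e)" using E(4) x by simp
  also have "... = (SUM e:E. bt x e *. lb (V - V') e)" by(simp add:linear_sum[OF linear_bracket] linear_scale[OF linear_bracket])
  also have "... = 0" by(intro sum.neutral) (simp add:bracket_simps E(5) be)
  finally show ?thesis .
 qed
 moreover have "V - V' : gg" by(intro gg_cl Vg)
 ultimately have "V - V' = 0" using center_trivial[OF ss] by blast
 thus ?thesis by simp
qed

definition lg :: "real^'n^'n => real^'n^'n" where "lg g = (THE V. V : pp & (EX k:K. g = mexp V**k))"

lemma lg_eq: "V : pp ==> k : K ==> lg (mexp V**k) = V" unfolding lg_def using polar_unique by(intro the_equality) blast+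

lemma lg: assumes "g : G" obtains k where "lg g : pp" "k : K" "g = mexp (lg g)**k" using polar_exists[OF assms] lg_eq by metis

lemma lg_pp: "g : G ==> lg g : pp" using lg by metis

lemma lg_K: "g : G ==> k : K ==> lg (g**k) = lg g" by(metis lg lg_eq K.mult mma)

lemma continuous_on_lg: "continuous_on G lg" unfolding continuous_on_sequentially
proof (intro allI ballI impI)
 fix x g assume g: "g : G" and x: "(ALL n. x n : G) & x ----> g"
 show "(lg \<circ> x) ----> lg g"
 proof (rule ccontr)
  assume "~ (lg \<circ> x) ----> lg g"
  then obtain e where e: "0 < e" "ALL N. EX n>=N. e <= dist (lg (x n)) (lg g)" unfolding lim_sequentially by(auto simp: not_less)
  then obtain s :: "nat => nat" where s: "strict_mono s" "!!n. e <= dist (lg (x (s n))) (lg g)"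
   using infinite_enumerate[of "{n. e <= dist (lg (x n)) (lg g)}"] unfolding infinite_nat_iff_unbounded_le by auto
  have "ALL n. EX k. k : K & x n = mexp (lg (x n))**k" using x lg by metis
  then obtain k where k: "!!n. k n : K" "!!n. x n = mexp (lg (x n))**k n" by metis
  have "(%n. x (s n)) ----> g" using LIMSEQ_subseq_LIMSEQ[OF _ s(1), of x g] x by(simp add:o_def)
  hence "(%n. mexp (lg (x (s n)))**k (s n)) ----> g" by(simp flip: k(2))
  then obtain r V' k' where r: "strict_mono r" "V' : pp" "k' : K" "(%n. lg (x (s (r n)))) ----> V'" "g = mexp V'**k'"
   by(rule polar_limit[of "%n. lg (x (s n))" "%n. k (s n)" g, rotated 2]) (use x lg_pp k(1) g in auto)
  have "V' = lg g" using lg_eq[OF r(2,3)] r(5) by simp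
  then obtain N where "ALL n>=N. dist (lg (x (s (r n)))) (lg g) < e" using r(4) e(1) unfolding lim_sequentially by blast
  thus False using s(2)[of "r N"] by fastforce
 qed
qed

end

text \<open>\<open>F\<close> is differentiable at 0, and \<open>g\<close> inverts \<open>F'\<close>
  on the values of \<open>u\<close>. Continuity of \<open>u\<close> first yields that
  \<open>u t\<close> is at most a multiple of \<open>t - t0\<close>, by absorbing the error term;
  then the error is seen to be of smaller order.\<close>

lemma implicit_has_vector_derivative:
 fixes F :: "'a::euclidean_space => 'b::euclidean_space" and u :: "real => 'a"
 assumes F: "(F has_derivative F') (at 0)" and u: "(u \<longlongrightarrow> 0) (at t0 within S)" "u t0 = 0"
  and g: "linear g" "!!t. g (F' (u t)) = u t"
  and h: "(h hvd h') (at t0 within S)"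
  and eq: "\<forall>\<^sub>F t in at t0 within S. F (u t) = h t" "F 0 = h t0"
 shows "(u hvd g h') (at t0 within S)" unfolding has_vector_derivative_def has_derivative_within_alt
proof (intro conjI allI impI)
 show "bounded_linear (%s. s *. g h')" by(rule bounded_linear_scaleR_left)
 fix e :: real assume e: "0 < e"
 obtain B where B: "0 < B" "!!x. norm (g x) <= norm x * B" using g(1) bounded_linear.pos_bounded unfolding linear_conv_bounded_linear by blast
 define C where "C = norm h' + 1"
 have C: "0 < C" by(simp add:C_def add_nonneg_pos)
 define ep where "ep = min (1 / (2 * B)) (e / (4 * B\<^sup>2 * C))"
 have ep: "0 < ep" "B * ep <= 1 / 2" "B * (ep * (2 * B * C)) <= e / 2"
 proof -
  show "0 < ep" using B C e by(simp add:ep_def)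
  have "B * ep <= B * (1 / (2 * B))" using B by(intro mult_left_mono) (auto simp: ep_def)
  thus "B * ep <= 1 / 2" using B by simp
  have "B * (ep * (2 * B * C)) <= B * (e / (4 * B\<^sup>2 * C) * (2 * B * C))" using B C by(intro mult_left_mono mult_right_mono) (auto simp: ep_def)
  thus "B * (ep * (2 * B * C)) <= e / 2" using B C by(simp add:field_simps power2_eq_square)
 qed
 obtain d1 where d1: "0 < d1" "!!y. norm y < d1 ==> norm (F y - F 0 - F' y) <= ep * norm y" using F ep(1) unfolding has_derivative_at_alt by auto
 define dl where "dl = min 1 (e / (2 * B))"
 have "0 < dl" using B e by(simp add:dl_def)
 then obtain d2 where d2: "0 < d2"
  "!!t. t : S ==> norm (t - t0) < d2 ==> norm (h t - h t0 - (t - t0) *. h') <= dl * norm (t - t0)" using h unfolding has_vector_derivative_def has_derivative_within_alt by blast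
 have "\<forall>\<^sub>F t in at t0 within S. norm (u t) < d1 & F (u t) = h t" using tendstoD[OF u(1) d1(1)] eq(1) by eventually_elim simp
 then obtain d3 where d3: "0 < d3" "!!t. t : S ==> t ~= t0 ==> dist t t0 < d3 ==> norm (u t) < d1 & F (u t) = h t" unfolding eventually_at by blast
 have "norm (u t - u t0 - (t - t0) *. g h') <= e * norm (t - t0)" if t: "t : S" "norm (t - t0) < min d2 d3" for t
 proof (cases "t = t0")
  case False
  have t3: "norm (u t) < d1" "F (u t) = h t" using d3(2)[OF t(1) False] t(2) by(auto simp: dist_norm)
  have a: "norm (h t - h t0 - F' (u t)) <= ep * norm (u t)" using d1(2)[OF t3(1)] t3(2) eq(2) by simp
  have b: "norm (h t - h t0 - (t - t0) *. h') <= dl * norm (t - t0)" using d2(2) t by simp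
  have "norm (h t - h t0) <= norm (h t - h t0 - (t - t0) *. h') + norm ((t - t0) *. h')" using norm_triangle_sub[of "h t - h t0" "(t - t0) *. h'"] by simp
  also have "... <= 1 * norm (t - t0) + norm (t - t0) * norm h'" using b by(intro add_mono order_trans[OF b] mult_right_mono) (auto simp: dl_def)
  finally have c: "norm (h t - h t0) <= C * norm (t - t0)" by(simp add:C_def algebra_simps)
  have "norm (u t) <= norm (F' (u t)) * B" using B(2)[of "F' (u t)"] g(2) by simp
  also have "... <= (C * norm (t - t0) + ep * norm (u t)) * B"
  proof (rule mult_right_mono)
   have "norm (F' (u t)) <= norm (h t - h t0) + norm (h t - h t0 - F' (u t))" by norm
   thus "norm (F' (u t)) <= C * norm (t - t0) + ep * norm (u t)" using a c by linarith
  qed (use B in simp)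
  also have "... = C * norm (t - t0) * B + (B * ep) * norm (u t)" by(simp add:algebra_simps)
  also have "... <= C * norm (t - t0) * B + 1 / 2 * norm (u t)" by(intro add_left_mono mult_right_mono ep(2) norm_ge_zero)
  finally have d: "norm (u t) <= 2 * B * C * norm (t - t0)" by(simp add:algebra_simps)
  have "norm (u t - (t - t0) *. g h') = norm (g (F' (u t) - (t - t0) *. h'))" by(simp only: linear_diff[OF g(1)] linear_scale[OF g(1)] g(2))
  also have "... <= norm (F' (u t) - (t - t0) *. h') * B" by(rule B(2))
  also have "... <= (ep * norm (u t) + dl * norm (t - t0)) * B"
  proof (rule mult_right_mono)
   have "norm (F' (u t) - z) <= norm (h t - h t0 - F' (u t)) + norm (h t - h t0 - z)" for z by norm
   from this[of "(t - t0) *. h'"]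
   have "norm (F' (u t) - (t - t0) *. h') <= norm (h t - h t0 - F' (u t)) + norm (h t - h t0 - (t - t0) *. h')" .
   thus "norm (F' (u t) - (t - t0) *. h') <= ep * norm (u t) + dl * norm (t - t0)" using a b by linarith
  qed (use B in simp)
  also have "... <= (ep * (2 * B * C * norm (t - t0)) + dl * norm (t - t0)) * B" using ep(1) B by(intro mult_right_mono add_right_mono mult_left_mono d) auto
  also have "... = (B * (ep * (2 * B * C)) + dl * B) * norm (t - t0)" by(simp add:algebra_simps)
  also have "... <= (e / 2 + e / 2) * norm (t - t0)"
  proof (intro mult_right_mono add_mono ep(3) norm_ge_zero)
   have "dl * B <= e / (2 * B) * B" using B by(intro mult_right_mono) (auto simp: dl_def)
   thus "dl * B <= e / 2" using B by simp
  qed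
  finally show ?thesis by(simp add:u(2))
 qed simp
 thus "EX d>0. ALL y:S. norm (y - t0) < d --> norm (u y - u t0 - (y - t0) *. g h') <= e * norm (y - t0)" using d2(1) d3(1) by(intro exI[of _ "min d2 d3"]) auto
qed

lemma matrix_inv_cancel [simp]: "invertible A ==> mi A**(A**B) = B" "invertible A ==> A**(mi A**B) = B"
 "mexp (- X)**(mexp X**B) = B" for A :: "real^'n^'n" by(simp_all add: mma)

section \<open>Lengths of curves, distances and geodesic rays\<close>

context connected_cartan
begin

text \<open>Near \<open>t0\<close> the polar chart has the coordinate \<open>u t\<close>, the sum of
  \<open>lg (c t) - V0\<close> and a small logarithm of \<open>k t k0^-1\<close>; it is
  differentiable by the implicit criterion. Its derivative solves \<open>F' u' = Ad k0 X\<close>.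
  Pairing this with the \<open>pp\<close>-part \<open>v\<close> of \<open>u'\<close> gives the
  estimate, because \<open>dexp\<close> does not shorten \<open>v\<close> in its own
  direction.\<close>

lemma lg_curve_derivative:
 assumes c: "!!t. t : {0..1} ==> c t : G" "continuous_on {0..1} c" and t0: "t0 : {0..1 :: real}"
  and der: "(c hvd c') (at t0 within {0..1})"
 obtains v where "v : pp" "((%t. lg (c t)) hvd v) (at t0 within {0..1})"
  "nb v <= nb (pproj (mi (c t0)**c'))"
proof -
 let ?N = "at t0 within {0..1}"
 define V0 where "V0 = lg (c t0)"
 obtain k0 where k0: "V0 : pp" "k0 : K" "c t0 = mexp V0**k0" using lg[OF c(1)[OF t0]] unfolding V0_def by blast
 have k0G: "k0 : G" and k0i: "invertible k0" using k0 K(2) inv by auto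
 define k where "k t = mexp (- lg (c t))**c t" for t
 have kK: "k t : K" and ck: "c t = mexp (lg (c t))**k t" if t: "t : {0..1}" for t
 proof -
  obtain k' where k': "k' : K" "c t = mexp (lg (c t))**k'" using lg[OF c(1)[OF t]] by blast
  have "k t = mexp (- lg (c t))**(mexp (lg (c t))**k')" unfolding k_def using k'(2) by simp
  hence "k t = k'" by(simp add:mma)
  thus "k t : K" "c t = mexp (lg (c t))**k t" using k' by simp_all
 qed
 have kt0: "k t0 = k0" unfolding k_def V0_def[symmetric] by(simp add:k0(3))
 have lgc: "continuous_on {0..1} (%t. lg (c t))" by(rule continuous_on_compose2[OF continuous_on_lg c(2)]) (use c(1) in auto)
 have "continuous_on {0..1} (%t. k t**mi k0 - mat 1)" unfolding k_def by(intro continuous_intros lgc c(2))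
 from this[unfolded continuous_on_def, rule_format, OF t0]
 have kl: "((%t. k t**mi k0 - mat 1) \<longlongrightarrow> 0) ?N" using k0i by(simp add:kt0)
 define Y where "Y t = (SOME Y. Y : kk & mexp Y = k t**mi k0 &
  norm Y <= 2 * norm (k t**mi k0 - mat 1))" for t
 obtain r where r: "0 < r" "!!x y :: real^'n^'n. norm x <= r ==> norm y <= r ==>
  norm (mexp x - mexp y - (x - y)) <= 1 / 2 * norm (x - y)" using mat_exp_near_0[of "1/2"] by auto
 obtain d where d: "0 < d" "!!g. g : K ==> norm (g - mat 1) < d ==> EX u:kk. norm u < r & g = mexp u" using K.exp_chart[OF r(1)] by blast
 have Yt: "Y t : kk & mexp (Y t) = k t**mi k0 & norm (Y t) <= 2 * norm (k t**mi k0 - mat 1)"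
  if t: "t : {0..1}" "norm (k t**mi k0 - mat 1) < d" for t unfolding Y_def
 proof (rule someI_ex)
  have "k t**mi k0 : K" by(intro K.mult K.minv kK t k0)
  then obtain u where u: "u : kk" "norm u < r" "k t**mi k0 = mexp u" using d(2) t(2) by blast
  have "norm (mexp u - mat 1 - u) <= 1 / 2 * norm u" using r(2)[of u 0] u(2) r(1) by simp
  hence "norm u <= 2 * norm (mexp u - mat 1)" by norm
  thus "EX Y. Y : kk & mexp Y = k t**mi k0 & norm Y <= 2 * norm (k t**mi k0 - mat 1)" using u by auto
 qed
 define F where "F = (%u. mexp (- V0)**mexp (V0 + pproj u)**mexp (kproj (gproj u)))"
 define F' where "F' = (%u. eapp (dexp (adE V0)) (pproj u) + kproj (gproj u))"
 note F = polar_map_derivative[OF k0(1), folded F_def F'_def]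
 have F3: "u = 0" if "u : gg" "F' u = 0" for u using F(3)[OF that(1)] that(2) by(simp add:F'_def)
 have "inj_on F' gg" unfolding inj_on_def
 proof (intro ballI impI)
  fix x y assume "x : gg" "y : gg" "F' x = F' y"
  thus "x = y" using F3[of "x - y"] by(simp add:linear_diff[OF F(2)] subspace_diff[OF gg_subspace])
 qed
 then obtain g where g: "linear g" "!!x. x : gg ==> g (F' x) = x" using linear_exists_left_inverse_on[OF F(2) gg_subspace] by blast
 define good where "good t \<longleftrightarrow> t : {0..1} & norm (k t**mi k0 - mat 1) < d" for t
 define u where "u t = (if good t then (lg (c t) - V0) + Y t else 0)" for t
 have good: "\<forall>\<^sub>F t in ?N. good t" using tendstoD[OF kl d(1)] eventually_at_filter[of "%t. t : {0..1}" t0 "{0..1}"]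
  unfolding good_def by(auto simp: eventually_at_filter elim: eventually_mono)
 have goodu: "u t : gg & pproj (u t) = lg (c t) - V0 & F (u t) = mexp (- V0)**c t**mi k0" if "good t" for t
 proof -
  have t: "t : {0..1}" "norm (k t**mi k0 - mat 1) < d" using that by(auto simp: good_def)
  have W: "lg (c t) - V0 : pp" by(intro subspace_diff[OF subspace_pp] lg_pp c(1) t k0)
  have ug: "u t : gg" using that Yt[OF t] unfolding u_def by(simp add:subspace_add[OF gg_subspace] pp_gg[OF W] kk_gg)
  have up: "pproj (u t) = lg (c t) - V0" "kproj (u t) = Y t"
   using that Yt[OF t] by(simp_all add: u_def linear_add[OF linear_pproj] linear_add[OF linear_kproj] pproj_id[OF W] kproj_pp[OF W] pproj_kk kproj_id)
  have "F (u t) = mexp (- V0)**mexp (lg (c t))**(k t**mi k0)" using Yt[OF t] by(simp add:F_def up gproj_id[OF ug])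
  also have "... = mexp (- V0)**(mexp (lg (c t))**k t)**mi k0" by(simp add:mma)
  also have "mexp (lg (c t))**k t = c t" using ck[OF t(1)] by simp
  finally show ?thesis using ug up by simp
 qed
 have ugg: "u t : gg" for t using goodu[of t] by(cases "good t") (auto simp: u_def subspace_0[OF gg_subspace])
 have gt0: "good t0" using t0 d(1) k0i by(simp add:good_def kt0)
 have u0: "u t0 = 0"
 proof -
  have "norm (Y t0) <= 0" using Yt[OF t0] gt0 k0i by(simp add:good_def kt0)
  thus ?thesis by(simp add:u_def V0_def)
 qed
 define h where "h t = mexp (- V0)**c t**mi k0" for t
 define X where "X = mi (c t0)**c'"
 have Xg: "X : gg" unfolding X_def by(rule curve_velocity_in_lie_algebra[OF c(1) t0 der])
 have mc: "mi (c t0) = mi k0**mexp (- V0)" by(simp add:k0(3) matrix_inv_mult k0i)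
 have hX: "mexp (- V0)**c'**mi k0 = Ad k0 X" unfolding X_def Ad_def mc by(simp add:mma k0i)
 have hd: "(h hvd Ad k0 X) ?N" unfolding h_def hX[symmetric]
  by(intro bounded_linear.has_vector_derivative[OF mm.bounded_linear_left] bounded_linear.has_vector_derivative[OF mm.bounded_linear_right] der)
 have ul: "(u \<longlongrightarrow> 0) ?N"
 proof (rule tendsto_norm_zero_cancel, rule tendsto_sandwich)
  show "\<forall>\<^sub>F t in ?N. 0 <= norm (u t)" by simp
  show "\<forall>\<^sub>F t in ?N. norm (u t) <= norm (lg (c t) - V0) + 2 * norm (k t**mi k0 - mat 1)" using good
  proof eventually_elim
   case (elim t)
   hence "norm (Y t) <= 2 * norm (k t**mi k0 - mat 1)" using Yt[of t] by(simp add:good_def)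
   thus ?case using elim norm_triangle_ineq[of "lg (c t) - V0" "Y t"] by(simp add:u_def)
  qed
  have "((%t. lg (c t) - V0) \<longlongrightarrow> V0 - V0) ?N" using lgc t0 unfolding continuous_on_def by(intro tendsto_intros) (auto simp: V0_def)
  thus "((%t. norm (lg (c t) - V0) + 2 * norm (k t**mi k0 - mat 1)) \<longlongrightarrow> 0) ?N"
   using tendsto_add[OF tendsto_norm[of "%t. lg (c t) - V0" 0] tendsto_mult[OF tendsto_const[of "2::real"] tendsto_norm[OF kl]]] by simp
 qed simp
 have ht0: "F 0 = h t0" using goodu[OF gt0] u0 by(simp add:h_def)
 have ev: "\<forall>\<^sub>F t in ?N. F (u t) = h t" using good by eventually_elim (simp add:goodu h_def)
 have ud: "(u hvd g (Ad k0 X)) ?N" by(rule implicit_has_vector_derivative[OF F(1) ul u0 g(1) g(2)[OF ugg] hd ev ht0])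
 define u' where "u' = g (Ad k0 X)"
 have "((%t. F (u t)) has_derivative (%s. F' (s *. u'))) ?N" using has_derivative_compose[of u "%s. s *. u'" t0 "{0..1}" F F'] ud F(1) u0
  by(simp add:has_vector_derivative_def u'_def)
 hence "((%t. F (u t)) hvd F' u') ?N" by(simp add:has_vector_derivative_def linear_scale[OF F(2)])
 hence "(h hvd F' u') ?N" unfolding has_vector_derivative_def using ev ht0 u0 t0 by(auto elim!: has_derivative_transform_eventually)
 hence F'u': "F' u' = Ad k0 X" using vector_derivative_unique_within[OF _ _ hd] t0 by(simp add:trivial_limit_within islimpt_Icc)
 define v where "v = pproj u'"
 have vp: "v : pp" by(simp add:v_def pproj_in)
 have "((%t. pproj (u t)) hvd v) ?N" unfolding v_def u'_def by(rule bounded_linear.has_vector_derivative[OF linear_pproj[unfolded linear_conv_bounded_linear] ud])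
 moreover have ev2: "\<forall>\<^sub>F t in ?N. pproj (u t) = lg (c t) - V0" using good by eventually_elim (simp add:goodu)
 ultimately have "((%t. lg (c t) - V0) hvd v) ?N" unfolding has_vector_derivative_def using goodu[OF gt0] t0 by(auto elim!: has_derivative_transform_eventually)
 from has_vector_derivative_add[OF this has_vector_derivative_const[of V0]]
 have vd: "((%t. lg (c t)) hvd v) ?N" by simp
 have "bt v v <= bt (Ad k0 X) v"
 proof -
  have "bt (Ad k0 X) v = bt (eapp (dexp (adE V0)) v) v" unfolding F'u'[symmetric] F'_def v_def[symmetric] by(simp add:bt_simps(1) bt_pk(2)[OF kproj_in vp])
  thus ?thesis using dexp_expanding(2)[OF k0(1) vp] by simp
 qed
 also have "... = bt (pproj (Ad k0 X)) v" using decomp[OF Ad_gg[OF k0G Xg]] bt_pk(2)[OF kproj_in vp] bt_simps(1)[of "pproj (Ad k0 X)" "kproj (Ad k0 X)" v] by simp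
 also have "... <= nb (pproj (Ad k0 X)) * nb v" by(intro bt_le_nb pp_gg pproj_in vp)
 also have "nb (pproj (Ad k0 X)) = nb (pproj X)" using Ad_K_proj(1)[OF k0(2) Xg] nb_Ad_K[OF k0(2) pp_gg[OF pproj_in]] by simp
 finally have "nb v * nb v <= nb (pproj X) * nb v" using nb_square[OF pp_gg[OF vp]] by(simp add:power2_eq_square)
 hence "nb v <= nb (pproj X)" using nb_nonneg[OF pp_gg[OF vp]] nb_nonneg[OF pp_gg[OF pproj_in], of X] by(cases "nb v = 0") auto
 thus thesis using that vp vd by(simp add:X_def)
qed

text \<open>The velocity of \<open>lg (c t)\<close> is integrated against the fixed vector
  \<open>U\<close>. The fundamental theorem applies to that pairing directly, whereas the
  integrability of \<open>nb (v t)\<close> would have to be shown first.\<close>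

lemma riemannian_length_ge:
 assumes c: "c C1_differentiable_on {0..1}" "c ` {0..1} <= G"
 shows "nb (lg (c 1) - lg (c 0)) <= riemannian_length G K c"
proof -
 obtain c' where c': "!!t. t : {0..1} ==> (c hvd c' t) (at t)" "continuous_on {0..1} c'" using c(1) unfolding C1_differentiable_on_def by blast
 have cG: "!!t. t : {0..1} ==> c t : G" using c(2) by auto
 define s where "s t = sqrt (kf (pproj (mi (c t)**c' t)) (pproj (mi (c t)**c' t)))" for t
 have s: "s t = nb (pproj (mi (c t)**c' t))" for t by(simp add:s_def nb_def bt_pp pproj_in)
 have len: "riemannian_length G K c = integral {0..1} s" and sc: "continuous_on {0..1} s" unfolding s_def using riemannian_length_eq[OF c' cG] by blast+
 have cc: "continuous_on {0..1} c" using c'(1) by(meson continuous_at_imp_continuous_on has_vector_derivative_continuous)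
 have "ALL t:{0..1}. EX v. v : pp & ((%t. lg (c t)) hvd v) (at t within {0..1}) & nb v <= s t"
 proof
  fix t :: real assume t: "t : {0..1}"
  obtain v where "v : pp" "((%t. lg (c t)) hvd v) (at t within {0..1})" "nb v <= s t"
   unfolding s by(rule lg_curve_derivative[OF cG cc t has_vector_derivative_at_within[OF c'(1)[OF t]]])
  thus "EX v. v : pp & ((%t. lg (c t)) hvd v) (at t within {0..1}) & nb v <= s t" by blast
 qed
 then obtain v where v: "!!t. t : {0..1} ==> v t : pp"
  "!!t. t : {0..1} ==> ((%t. lg (c t)) hvd v t) (at t within {0..1})"
  "!!t. t : {0..1} ==> nb (v t) <= s t" by metis
 define U where "U = lg (c 1) - lg (c 0)"
 have Ug: "U : gg" unfolding U_def by(intro subspace_diff[OF gg_subspace] pp_gg lg_pp cG) auto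
 have bl: "bounded_linear (%x. bt x U)" using bilinear_bt unfolding bilinear_def by(simp add:linear_conv_bounded_linear)
 have "((%t. bt (v t) U) has_integral bt (lg (c 1)) U - bt (lg (c 0)) U) {0..1}"
  by(rule fundamental_theorem_of_calculus) (use bounded_linear.has_vector_derivative[OF bl v(2)] in auto)
 moreover have "bt (lg (c 1)) U - bt (lg (c 0)) U = bt U U" using bt_simps(3)[of "lg (c 1)" "lg (c 0)" U] by(simp add:U_def[symmetric])
 ultimately have 1: "((%t. bt (v t) U) has_integral bt U U) {0..1}" by simp
 have si: "(s has_integral integral {0..1} s) {0..1}" by(rule integrable_integral[OF integrable_continuous_interval[OF sc]])
 have 2: "((%t. s t * nb U) has_integral integral {0..1} s * nb U) {0..1}" by(rule has_integral_mult_left[OF si])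
 have "bt (v t) U <= s t * nb U" if t: "t : {0..1}" for t using bt_le_nb[OF pp_gg[OF v(1)[OF t]] Ug] mult_right_mono[OF v(3)[OF t] nb_nonneg[OF Ug]] by linarith
 from has_integral_le[OF 1 2 this] have le: "bt U U <= integral {0..1} s * nb U" by simp
 have s0: "0 <= integral {0..1} s" by(rule has_integral_nonneg[OF si]) (simp add:s nb_nonneg pp_gg pproj_in)
 have "nb U <= integral {0..1} s"
 proof (cases "nb U = 0")
  case False
  hence "nb U * nb U <= integral {0..1} s * nb U" "0 < nb U" using le nb_square[OF Ug] nb_nonneg[OF Ug] by(auto simp: power2_eq_square)
  thus ?thesis by simp
 qed (use s0 in simp)
 thus ?thesis by(simp add:len U_def)
qed

lemma riemannian_length_translate:
 assumes c: "c C1_differentiable_on {0..1}" "c ` {0..1} <= G" and a: "a : G"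
 shows "riemannian_length G K (%t. a**c t) = riemannian_length G K c" "(%t. a**c t) C1_differentiable_on {0..1}"
proof -
 obtain c' where c': "!!t. t : {0..1} ==> (c hvd c' t) (at t)" "continuous_on {0..1} c'" using c(1) unfolding C1_differentiable_on_def by blast
 have cG: "!!t. t : {0..1} ==> c t : G" using c(2) by auto
 have d: "!!t. t : {0..1} ==> ((%t. a**c t) hvd a**c' t) (at t)" by(intro bounded_linear.has_vector_derivative[OF mm.bounded_linear_right] c')
 have cont: "continuous_on {0..1} (%t. a**c' t)" by(intro continuous_intros c')
 show "(%t. a**c t) C1_differentiable_on {0..1}" unfolding C1_differentiable_on_def by(intro exI[of _ "%t. a**c' t"] conjI ballI d cont)
 have "mi (a**c t)**(a**c' t) = mi (c t)**c' t" if "t : {0..1}" for t using inv[OF a] inv[OF cG[OF that]] by(simp add:matrix_inv_mult mms)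
 hence "integral {0..1} (%t. sqrt (kf (pproj (mi (a**c t)**(a**c' t))) (pproj (mi (a**c t)**(a**c' t)))))
  = integral {0..1} (%t. sqrt (kf (pproj (mi (c t)**c' t)) (pproj (mi (c t)**c' t))))" by(intro integral_cong) simp
 thus "riemannian_length G K (%t. a**c t) = riemannian_length G K c" using riemannian_length_eq(1)[OF c' cG] riemannian_length_eq(1)[OF d cont mult[OF a cG]] by simp
qed

abbreviation cs :: "real^'n^'n => (real^'n^'n) set" where "cs x == (%k. x**k) ` K"

lemma path_lengths_ge:
 assumes x: "x : G" and y: "y : G" and l: "l : path_lengths (cs x) (cs y)"
 shows "nb (lg y - lg x) <= l" "nb (lg (mi x**y)) <= l"
proof -
 obtain c where c: "c C1_differentiable_on {0..1}" "c ` {0..1} <= G" "c 0 : cs x" "c 1 : cs y" "l = riemannian_length G K c" using l by(auto simp: path_lengths_def)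
 obtain k k' where k: "k : K" "c 0 = x**k" "k' : K" "c 1 = y**k'" using c(3,4) by auto
 show "nb (lg y - lg x) <= l" using riemannian_length_ge[OF c(1,2)] k x y c(5) by(simp add:lg_K)
 note t = riemannian_length_translate[OF c(1,2) minv[OF x]]
 have "(%t. mi x**c t) ` {0..1} <= G" using c(2) by(auto intro!: mult minv x)
 from riemannian_length_ge[OF t(2) this]
 have "nb (lg (mi x**(y**k')) - lg (mi x**(x**k))) <= l" by(simp add:t(1) c(5) k)
 moreover have "lg (mi x**(y**k')) = lg (mi x**y)" using lg_K[OF mult[OF minv[OF x] y] k(3)] by(simp add:mma)
 moreover have "mi x**(x**k) = k" by(simp add:mma inv[OF x])
 moreover have "lg k = 0" using lg_eq[OF subspace_0[OF subspace_pp] k(1)] by simp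
 ultimately show "nb (lg (mi x**y)) <= l" by simp
qed

lemma path_lengths_geodesic:
 assumes x: "x : G" and y: "y : G"
 shows "nb (lg (mi x**y)) : path_lengths (cs x) (cs y)"
proof -
 define V where "V = lg (mi x**y)"
 obtain k where k: "V : pp" "k : K" "mi x**y = mexp V**k" using lg[OF mult[OF minv[OF x] y]] unfolding V_def by blast
 have ki: "invertible k" using k(2) K(2) inv by blast
 define c where "c t = x**mexp (t *. V)" for t
 have d: "(c hvd c t**V) (at t)" for t unfolding c_def using bounded_linear.has_vector_derivative[OF mm.bounded_linear_right mat_exp_has_vector_derivative_right] by(simp add:mma)
 have cont: "continuous_on {0..1} (%t. c t**V)" unfolding c_def by(intro continuous_intros)
 have cG: "c t : G" for t unfolding c_def by(intro mult x lie_exp subspace_scale[OF gg_subspace] pp_gg k)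
 have "mi (c t)**(c t**V) = V" for t using inv[OF cG[of t]] by(simp add:mma)
 hence "riemannian_length G K c = nb V" using riemannian_length_eq(1)[OF d cont cG] by(simp add:nb_def bt_pp k(1) pproj_id)
 moreover have "c C1_differentiable_on {0..1}" unfolding C1_differentiable_on_def by(intro exI[of _ "%t. c t**V"] conjI ballI d cont)
 moreover have "c 0 : cs x" unfolding c_def using K.one by force
 moreover have "c 1 : cs y"
 proof -
  have "x**(mi x**y)**mi k = x**mexp V**(k**mi k)" unfolding k(3) by(simp add:mma)
  hence "c 1 = y**mi k" using inv[OF x] ki by(simp add:c_def mma)
  thus ?thesis using K.minv[OF k(2)] by blast
 qed
 moreover have "c ` {0..1} <= G" using cG by auto
 ultimately show ?thesis unfolding path_lengths_def V_def[symmetric] by(metis (mono_tags, lifting) mem_Collect_eq)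
qed

lemma symmetric_dist_lg:
 assumes x: "x : G" and y: "y : G"
 shows "symmetric_dist G K (cs x) (cs y) = nb (lg (mi x**y))" unfolding symmetric_dist_eq by(rule cInf_eq_minimum[OF path_lengths_geodesic[OF x y] path_lengths_ge(2)[OF x y]])

lemma lg_nonexpanding: "x : G ==> y : G ==> nb (lg y - lg x) <= nb (lg (mi x**y))" by(rule path_lengths_ge(1)[OF _ _ path_lengths_geodesic])

lemma nb_lg_inv:
 assumes g: "g : G" shows "nb (lg (mi g)) = nb (lg g)"
proof -
 obtain k where k: "lg g : pp" "k : K" "g = mexp (lg g)**k" using lg[OF g] by blast
 have ki: "invertible k" using k(2) K(2) inv by blast
 have "mi g = mi k**mexp (- lg g)" by(subst k(3)) (simp add:matrix_inv_mult ki)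
 also have "... = (mi k**mexp (- lg g)**mi (mi k))**mi k" using ki by(simp add:mms)
 also have "... = mexp (Ad (mi k) (- lg g))**mi k" by(subst mat_exp_Ad) (simp_all add: ki)
 finally have "lg (mi g) = Ad (mi k) (- lg g)" using lg_eq[OF Ad_K_pp[OF K.minv[OF k(2)] subspace_neg[OF subspace_pp k(1)]] K.minv[OF k(2)]] by simp
 hence "nb (lg (mi g)) = nb (- lg g)" using nb_Ad_K[OF K.minv[OF k(2)] pp_gg[OF subspace_neg[OF subspace_pp k(1)]]] by simp
 thus ?thesis using nb_scale[of "-1" "lg g"] by simp
qed

lemma nb_lg_mult:
 assumes g: "g : G" and h: "h : G" shows "nb (lg (g**h)) <= nb (lg g) + nb (lg h)"
proof -
 have gh: "g**h : G" by(rule mult[OF g h])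
 have "nb (lg (g**h)) <= nb (lg g) + nb (lg (g**h) - lg g)"
  using nb_triangle[OF pp_gg[OF lg_pp[OF g]] subspace_diff[OF gg_subspace pp_gg[OF lg_pp[OF gh]] pp_gg[OF lg_pp[OF g]]]] by simp
 also have "nb (lg (g**h) - lg g) <= nb (lg (mi g**(g**h)))" by(rule lg_nonexpanding[OF g gh])
 also have "mi g**(g**h) = h" by(simp add:mma inv[OF g])
 finally show ?thesis by simp
qed

text \<open>After translation to the base point, \<open>V t = lg (y t)\<close> has norm
  \<open>t\<close> and distance at most \<open>|1 - t|\<close> from \<open>V 1\<close>, by
  \<open>lg_nonexpanding\<close>. Equality in the triangle inequality of a Euclidean space forces
  \<open>V t = t V 1\<close>.\<close>

lemma geodesic_ray_eq:
 assumes r: "r : geodesic_rays G K"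
 obtains x0 H where "x0 : G" "H : pp" "nb H = 1" "!!t. 0 <= t ==> r t = cs (x0**mexp (t *. H))"
proof -
 have "ALL t. 0 <= t --> (EX x. x : G & r t = cs x)"
 proof (intro allI impI)
  fix t :: real assume "0 <= t"
  hence "r t : lcosets\<^bsub>grp G\<^esub> K" using r by(auto simp: geodesic_rays_def PiE_iff)
  thus "EX x. x : G & r t = cs x" by(rule lcosets_rep) blast
 qed
 then obtain x where x: "!!t. 0 <= t ==> x t : G" "!!t. 0 <= t ==> r t = cs (x t)" by metis
 have ds: "nb (lg (mi (x s)**x t)) = \<bar>s - t\<bar>" if "0 <= s" "0 <= t" for s t using r that x symmetric_dist_lg[of "x s" "x t"] by(simp add:geodesic_rays_def)
 have xi: "invertible (x t)" if "0 <= t" for t using inv x(1) that by blast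
 define y where "y t = mi (x 0)**x t" for t
 have yG: "y t : G" if "0 <= t" for t unfolding y_def using that by(intro mult minv x(1)) auto
 define V where "V t = lg (y t)" for t
 have Vp: "V t : pp" if "0 <= t" for t unfolding V_def by(intro lg_pp yG that)
 have nV: "nb (V t) = t" if "0 <= t" for t using ds[of 0 t] that by(simp add:V_def y_def)
 have dV: "nb (V t - V 1) <= \<bar>1 - t\<bar>" if "0 <= t" for t
 proof -
  have "mi (y 1)**y t = mi (x 1)**x t" unfolding y_def using that by(simp add:matrix_inv_mult xi mms)
  thus ?thesis using lg_nonexpanding[OF yG[of 1] yG[OF that]] ds[of 1 t] that by(simp add:V_def)
 qed
 define H where "H = V 1"
 have Hp: "H : pp" and nH: "nb H = 1" using Vp nV by(auto simp: H_def)
 have VH: "V t = t *. H" if t: "0 <= t" for t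
 proof -
  have g: "V t : gg" "H : gg" using Vp[OF t] Hp by(auto simp: pp_gg)
  have dg: "V t - H : gg" "V t - t *. H : gg" by(intro subspace_diff[OF gg_subspace] subspace_scale[OF gg_subspace] g)+
  have b1: "bt (V t) (V t) = t\<^sup>2" "bt H H = 1" using nb_square[OF g(1)] nb_square[OF g(2)] nV[OF t] nH by simp_all
  have "bt (V t - H) (V t - H) <= (1 - t)\<^sup>2" using dV[OF t] nb_nonneg[OF dg(1)] power_mono[of "nb (V t - H)" "\<bar>1 - t\<bar>" 2] nb_square[OF dg(1)] by(simp add:H_def)
  hence "t\<^sup>2 + 1 - 2 * bt (V t) H <= (1 - t)\<^sup>2" using b1 by(simp add:bt_simps bt_commute[of H "V t"])
  hence "t <= bt (V t) H" by(simp add:power2_eq_square algebra_simps)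
  moreover have "bt (V t - t *. H) (V t - t *. H) = 2 * t\<^sup>2 - 2 * t * bt (V t) H" using b1 by(simp add:bt_simps bt_commute[of H "V t"] power2_eq_square algebra_simps)
  ultimately have "bt (V t - t *. H) (V t - t *. H) <= 0" using mult_left_mono[of t "bt (V t) H" t] t by(simp add:power2_eq_square)
  thus ?thesis using bt_pos[OF dg(2)] by fastforce
 qed
 have "r t = cs (x 0**mexp (t *. H))" if t: "0 <= t" for t
 proof -
  obtain k where k: "k : K" "y t = mexp (V t)**k" using lg[OF yG[OF t]] unfolding V_def by blast
  have "x t = x 0**y t" by(simp add:y_def mma xi)
  hence "cs (x t) = (%k'. x 0**mexp (t *. H)**k') ` ((%k'. k**k') ` K)" unfolding k(2) VH[OF t] image_image by(simp add:mma)
  also have "(%k'. k**k') ` K = K"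
  proof (intro equalityI subsetI)
   fix k' assume "k' : K"
   hence "k' = k**(mi k**k')" "mi k**k' : K" using K.inv[OF k(1)] by(auto simp: mma intro!: K.mult K.minv k(1))
   thus "k' : (%k'. k**k') ` K" by blast
  qed (use K.mult k(1) in auto)
  finally show ?thesis by(simp add:x(2)[OF t])
 qed
 thus thesis using that[of "x 0" H] x(1) Hp nH by simp
qed

end

section \<open>Bounded parts of the group\<close>

context matgroup
begin

text \<open>An exhaustion of the group by compact sets closed under inversion. All later uniformity
  over group elements refers to it.\<close>

definition bd :: "real => (real^'n^'n) set" where "bd R = {g : G. norm g <= R & norm (mi g) <= R}"

lemma bd_G: "g : bd R ==> g : G" by(simp add:bd_def)

lemma compact_bd: "compact (bd R)" unfolding bd_def by(rule compact_bounded_part)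

lemma bd_inv: "g : bd R ==> mi g : bd R" by(auto simp: bd_def minv inv)

lemma bd_mono: "g : bd R ==> R <= S ==> g : bd S" by(auto simp: bd_def)

lemma bd_mult: "EX T. ALL g:bd R. ALL h:bd S. g**h : bd T"
proof -
 have "g**h : bd (\<bar>R\<bar> * \<bar>S\<bar>)" if g: "g : bd R" and h: "h : bd S" for g h
 proof -
  have b: "norm g <= \<bar>R\<bar>" "norm (mi g) <= \<bar>R\<bar>" "norm h <= \<bar>S\<bar>" "norm (mi h) <= \<bar>S\<bar>" using g h by(auto simp: bd_def)
  have "norm (g**h) <= \<bar>R\<bar> * \<bar>S\<bar>" by(rule order_trans[OF norm_matrix_mult]) (use b in \<open>intro mult_right_mono mult_mono; simp\<close>)
  moreover have "norm (mi h**mi g) <= \<bar>S\<bar> * \<bar>R\<bar>" by(rule order_trans[OF norm_matrix_mult]) (use b in \<open>intro mult_right_mono mult_mono; simp\<close>)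
  ultimately show ?thesis using bd_G[OF g] bd_G[OF h] by(simp add:bd_def mult matrix_inv_mult inv mult.commute)
 qed
 thus ?thesis by blast
qed

lemma bd_compact: assumes C: "compact C" "C <= G" shows "EX R. C <= bd R"
proof -
 have "continuous_on C (%x. x)" by(rule continuous_on_id)
 from continuous_on_matrix_inv[OF this] have "compact (mi ` C)" using C inv by(intro compact_continuous_image) auto
 then obtain R1 R2 where "ALL x:C. norm x <= R1" "ALL x:mi ` C. norm x <= R2" using C(1) unfolding compact_eq_bounded_closed bounded_iff by blast
 hence "C <= bd (max R1 R2)" using C(2) by(auto simp: bd_def le_max_iff_disj)
 thus ?thesis by blast
qed

lemma bd_exp: "EX S. ALL x:lie_algebra G. norm x <= R --> mexp x : bd S"
proof -
 obtain C where C: "C > 0" "ALL A :: real^'n^'n. norm A <= R --> norm (mexp A) <= C" using mat_exp_bounded[where ?'n = 'n] by blast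
 have "mexp x : bd C" if "x : lie_algebra G" "norm x <= R" for x using that C(2)[rule_format, of x] C(2)[rule_format, of "- x"] by(simp add:bd_def lie_exp)
 thus ?thesis by blast
qed

end

context connected_cartan
begin

lemma lg_bd: "EX C. ALL g:bd R. nb (lg g) <= C"
proof -
 obtain M where M: "0 < M" "!!x. x : gg ==> nb x <= M * norm x" by(rule nb_equiv) blast
 have "compact (lg ` bd R)" by(intro compact_continuous_image continuous_on_subset[OF continuous_on_lg] compact_bd) (auto dest: bd_G)
 then obtain B where B: "ALL x:lg ` bd R. norm x <= B" unfolding compact_eq_bounded_closed bounded_iff by blast
 have "nb (lg g) <= M * B" if "g : bd R" for g
 proof -
  have "nb (lg g) <= M * norm (lg g)" by(rule M(2)[OF pp_gg[OF lg_pp[OF bd_G[OF that]]]])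
  also have "... <= M * B" using B that M(1) by(intro mult_left_mono) auto
  finally show ?thesis .
 qed
 thus ?thesis by blast
qed

text \<open>The converse of \<open>lg_bd\<close>: a bound on the displacement
  \<open>nb (lg g)\<close> amounts to membership in some \<open>bd R\<close>. This turns the
  asymptotic condition on rays into boundedness of conjugates.\<close>

lemma bd_lg: "EX R. ALL g:G. nb (lg g) <= C --> g : bd R"
proof -
 obtain m where m: "0 < m" "!!x. x : gg ==> m * norm x <= nb x" by(rule nb_equiv) blast
 obtain S where S: "ALL x:gg. norm x <= C / m --> mexp x : bd S" using bd_exp[of "C / m"] by blast
 obtain R where R: "K <= bd R" using bd_compact[OF K(3,2)] by blast
 obtain T where T: "ALL g:bd S. ALL h:bd R. g**h : bd T" using bd_mult[of S R] by blast
 have "g : bd T" if g: "g : G" "nb (lg g) <= C" for g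
 proof -
  obtain k where k: "lg g : pp" "k : K" "g = mexp (lg g)**k" using lg[OF g(1)] by blast
  have "norm (lg g) <= C / m" using m(2)[OF pp_gg[OF k(1)]] g(2) m(1) by(simp add:field_simps)
  hence "mexp (lg g)**k : bd T" using S T R k pp_gg by blast
  thus ?thesis using k(3) by simp
 qed
 thus ?thesis by blast
qed

lemma l_coset_cs: "g <#\<^bsub>GL\<^esub> cs x = cs (g**x)" by(auto simp: l_coset_def GL_def mma image_iff)

lemma cs_lcosets: "x : G ==> cs x : lcosets\<^bsub>grp G\<^esub> K" by(auto simp: LCOSETS_def l_coset_def GL_def)

lemma lcosets_translate: "X : lcosets\<^bsub>grp G\<^esub> K ==> g : G ==> g <#\<^bsub>GL\<^esub> X : lcosets\<^bsub>grp G\<^esub> K"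
 by(erule lcosets_rep) (simp add:l_coset_cs cs_lcosets mult)

lemma symmetric_dist_translate:
 assumes X: "X : lcosets\<^bsub>grp G\<^esub> K" and Y: "Y : lcosets\<^bsub>grp G\<^esub> K" and g: "g : G"
 shows "symmetric_dist G K (g <#\<^bsub>GL\<^esub> X) (g <#\<^bsub>GL\<^esub> Y) = symmetric_dist G K X Y"
proof -
 obtain x y where x: "x : G" "X = cs x" and y: "y : G" "Y = cs y" using X Y by(metis lcosets_rep)
 have "mi (g**x)**(g**y) = mi x**y" using inv[OF g] inv[OF x(1)] by(simp add:matrix_inv_mult mms)
 thus ?thesis using x y g by(simp add:l_coset_cs symmetric_dist_lg mult)
qed

lemma symmetric_dist_commute:
 assumes X: "X : lcosets\<^bsub>grp G\<^esub> K" and Y: "Y : lcosets\<^bsub>grp G\<^esub> K"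
 shows "symmetric_dist G K X Y = symmetric_dist G K Y X"
proof -
 obtain x y where x: "x : G" "X = cs x" and y: "y : G" "Y = cs y" using X Y by(metis lcosets_rep)
 have "mi y**x = mi (mi x**y)" using inv x(1) y(1) by(simp add:matrix_inv_mult)
 thus ?thesis using x y nb_lg_inv[OF mult[OF minv[OF x(1)] y(1)]] by(simp add:symmetric_dist_lg)
qed

lemma symmetric_dist_triangle:
 assumes X: "X : lcosets\<^bsub>grp G\<^esub> K" and Y: "Y : lcosets\<^bsub>grp G\<^esub> K" and Z: "Z : lcosets\<^bsub>grp G\<^esub> K"
 shows "symmetric_dist G K X Z <= symmetric_dist G K X Y + symmetric_dist G K Y Z"
proof -
 obtain x y z where x: "x : G" "X = cs x" and y: "y : G" "Y = cs y" and z: "z : G" "Z = cs z" using X Y Z by(metis lcosets_rep)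
 have "mi x**z = (mi x**y)**(mi y**z)" using inv[OF y(1)] by(simp add:mms)
 thus ?thesis using x y z nb_lg_mult[OF mult[OF minv[OF x(1)] y(1)] mult[OF minv[OF y(1)] z(1)]] by(simp add:symmetric_dist_lg)
qed

definition tr_ray :: "real^'n^'n => (real => (real^'n^'n) set) => real => (real^'n^'n) set" where "tr_ray g r = (\<lambda>t\<in>{0..}. g <#\<^bsub>GL\<^esub> r t)"

lemma ray_coset: "r : geodesic_rays G K ==> 0 <= t ==> r t : lcosets\<^bsub>grp G\<^esub> K" by(auto simp: geodesic_rays_def PiE_iff)

lemma tr_ray_in: assumes g: "g : G" and r: "r : geodesic_rays G K" shows "tr_ray g r : geodesic_rays G K"
proof -
 have "symmetric_dist G K (g <#\<^bsub>GL\<^esub> r s) (g <#\<^bsub>GL\<^esub> r t) = \<bar>s - t\<bar>" if "0 <= s" "0 <= t" for s t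
  using symmetric_dist_translate[OF ray_coset[OF r that(1)] ray_coset[OF r that(2)] g] r that by(simp add:geodesic_rays_def)
 thus ?thesis using lcosets_translate[OF ray_coset[OF r] g] by(auto simp: tr_ray_def geodesic_rays_def)
qed

lemma tr_ray_inverse:
 assumes g: "g : G" and r: "r : geodesic_rays G K"
 shows "tr_ray g (tr_ray (mi g) r) = r" "tr_ray (mi g) (tr_ray g r) = r"
proof -
 have x: "r t = undefined" if "~ 0 <= t" for t using r that by(auto simp: geodesic_rays_def PiE_iff extensional_def)
 have c: "g <#\<^bsub>GL\<^esub> (mi g <#\<^bsub>GL\<^esub> X) = X" "mi g <#\<^bsub>GL\<^esub> (g <#\<^bsub>GL\<^esub> X) = X" for X
  using inv[OF g] by(auto simp: l_coset_def GL_def)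
 show "tr_ray g (tr_ray (mi g) r) = r" "tr_ray (mi g) (tr_ray g r) = r" by(rule ext, simp add:tr_ray_def x c)+
qed

lemma asymptotic_tr_ray:
 assumes g: "g : G" and a: "(r, r') : asymptotic G K" shows "(tr_ray g r, tr_ray g r') : asymptotic G K"
proof -
 have r: "r : geodesic_rays G K" "r' : geodesic_rays G K" using a by(auto simp: asymptotic_def)
 have "symmetric_dist G K (tr_ray g r t) (tr_ray g r' t) = symmetric_dist G K (r t) (r' t)" if "0 <= t" for t
  using symmetric_dist_translate[OF ray_coset[OF r(1) that] ray_coset[OF r(2) that] g] that by(simp add:tr_ray_def)
 thus ?thesis using a tr_ray_in[OF g] by(auto simp: asymptotic_def)
qed

lemma asymptotic_sym: assumes "(r, r') : asymptotic G K" shows "(r', r) : asymptotic G K"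
proof -
 have "symmetric_dist G K (r' t) (r t) = symmetric_dist G K (r t) (r' t)" if "0 <= t" for t using symmetric_dist_commute ray_coset assms that by(auto simp: asymptotic_def)
 thus ?thesis using assms by(auto simp: asymptotic_def)
qed

lemma asymptotic_trans:
 assumes a: "(r, r') : asymptotic G K" "(r', r'') : asymptotic G K" shows "(r, r'') : asymptotic G K"
proof -
 have r: "r : geodesic_rays G K" "r' : geodesic_rays G K" "r'' : geodesic_rays G K" using a by(auto simp: asymptotic_def)
 obtain C C' where C: "ALL t>=0. symmetric_dist G K (r t) (r' t) <= C" "ALL t>=0. symmetric_dist G K (r' t) (r'' t) <= C'" using a by(auto simp: asymptotic_def)
 have "symmetric_dist G K (r t) (r'' t) <= C + C'" if t: "0 <= t" for t
  using symmetric_dist_triangle[OF ray_coset[OF r(1) t] ray_coset[OF r(2) t] ray_coset[OF r(3) t]] C t by fastforce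
 thus ?thesis using r by(auto simp: asymptotic_def)
qed

lemma boundary_stabilizer:
 assumes r: "r : geodesic_rays G K" and g: "g : G" and xx: "xx = asymptotic G K `` {r}"
 shows "boundary_action g xx = xx \<longleftrightarrow> (r, tr_ray g r) : asymptotic G K"
proof
 have ba: "boundary_action g xx = tr_ray g ` xx" by(simp add:boundary_action_def tr_ray_def)
 have "(r, r) : asymptotic G K" using r by(auto simp: asymptotic_def geodesic_rays_def)
 hence rx: "r : xx" by(simp add:xx)
 show "(r, tr_ray g r) : asymptotic G K" if "boundary_action g xx = xx"
 proof -
  have "tr_ray g r : xx" using imageI[OF rx, of "tr_ray g"] that by(simp add:ba)
  thus ?thesis by(simp add:xx)
 qed
 show "boundary_action g xx = xx" if a: "(r, tr_ray g r) : asymptotic G K" unfolding ba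
 proof (intro equalityI subsetI)
  fix s assume "s : tr_ray g ` xx"
  then obtain r' where r': "(r, r') : asymptotic G K" "s = tr_ray g r'" by(auto simp: xx)
  show "s : xx" using asymptotic_trans[OF a asymptotic_tr_ray[OF g r'(1)]] by(simp add:xx r'(2))
 next
  fix s assume "s : xx"
  hence s: "(r, s) : asymptotic G K" by(simp add:xx)
  hence sr: "s : geodesic_rays G K" by(auto simp: asymptotic_def)
  have "(tr_ray g r, s) : asymptotic G K" by(rule asymptotic_trans[OF asymptotic_sym[OF a] s])
  from asymptotic_tr_ray[OF minv[OF g] this]
  have "(r, tr_ray (mi g) s) : asymptotic G K" by(simp add:tr_ray_inverse(2)[OF g r])
  hence "tr_ray (mi g) s : xx" by(simp add:xx)
  from imageI[OF this, of "tr_ray g"] show "s : tr_ray g ` xx" by(simp add:tr_ray_inverse(1)[OF g sr])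
 qed
qed

end

section \<open>The parabolic subgroup of a ray\<close>

locale parabolic = connected_cartan G K for G K :: "(real^'n^'n) set" +
 fixes H :: "real^'n^'n" and E mu
 assumes H: "H : pp" and E: "finite E" "E <= gg"
  and E_orth: "e : E ==> f : E ==> bt e f = (if e = f then 1 else 0)"
  and E_expand: "x : gg ==> x = (SUM e:E. bt x e *. e)"
  and E_eig: "e : E ==> lb H e = mu e *. e"
begin

definition flow :: "real => real^'n^'n" where "flow t = mexp (t *. H)"

lemma flow_G: "flow t : G" unfolding flow_def by(intro lie_exp subspace_scale[OF gg_subspace] pp_gg H)

lemma flow_add: "flow (s + t) = flow s**flow t" by(simp add:flow_def mat_exp_scale_add)

lemma flow_0 [simp]: "flow 0 = mat 1" by(simp add:flow_def)

lemma flow_i [simp]: "invertible (flow t)" by(simp add:flow_def)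

lemma flow_inv: "mi (flow t) = flow (- t)" by(simp add:flow_def)

lemma flow_cancel: "flow t**(flow (- t)**x) = x" "flow (- t)**(flow t**x) = x" "flow t**flow (- t) = mat 1" "flow (- t)**flow t = mat 1" by(simp_all add: mma flow_add[symmetric])

definition conj :: "real => real^'n^'n => real^'n^'n" where "conj t g = flow (- t)**g**flow t"

lemma conj_mult: "conj t (g**h) = conj t g**conj t h" by(simp add:conj_def mms flow_cancel)

lemma conj_inv: "g : G ==> conj t (mi g) = mi (conj t g)" by(simp add:conj_def matrix_inv_mult inv flow_inv mma invertible_mult)

lemma conj_G: "g : G ==> conj t g : G" unfolding conj_def by(intro mult flow_G)

lemma conj_exp: "conj t (mexp x) = mexp (Ad (flow (- t)) x)" unfolding conj_def using mat_exp_Ad[of "flow (- t)" x] by(simp add:flow_inv)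

lemma flow_exp: "flow t**mexp x = mexp (Ad (flow t) x)**flow t" using mat_exp_Ad[of "flow t" x] by(simp add:mms flow_inv flow_cancel flip: mat_exp_Ad)

text \<open>\<open>nb (lg (conj t g))\<close> is the distance from \<open>exp (t H) K\<close> to
  \<open>g exp (t H) K\<close>, so this is the stabilizer of the end point of the ray
  \<open>exp (t H) K\<close> issuing from the base point.\<close>

definition QH :: "(real^'n^'n) set" where "QH = {g : G. EX C. ALL t>=0. nb (lg (conj t g)) <= C}"

lemma QH_mult: assumes g: "g : QH" and h: "h : QH" shows "g**h : QH"
proof -
 obtain C C' where C: "ALL t>=0. nb (lg (conj t g)) <= C" "ALL t>=0. nb (lg (conj t h)) <= C'" and G: "g : G" "h : G" using g h by(auto simp: QH_def)
 have "nb (lg (conj t (g**h))) <= C + C'" if "0 <= t" for t using nb_lg_mult[OF conj_G[OF G(1)] conj_G[OF G(2)], of t t] C that unfolding conj_mult by fastforce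
 thus ?thesis using G by(auto simp: QH_def mult)
qed

lemma QH_inv: "g : QH ==> mi g : QH" by(auto simp: QH_def minv conj_inv nb_lg_inv conj_G)

lemma QH_G: "g : QH ==> g : G" by(simp add:QH_def)

lemma QH_bounded_orbit: assumes "x : gg" "!!t. 0 <= t ==> norm (Ad (flow (- t)) x) <= R" shows "mexp x : QH"
proof -
 obtain S where S: "ALL x:gg. norm x <= R --> mexp x : bd S" using bd_exp[of R] by blast
 obtain C where C: "ALL g:bd S. nb (lg g) <= C" using lg_bd by blast
 have "nb (lg (conj t (mexp x))) <= C" if "0 <= t" for t unfolding conj_exp using S C assms(2)[OF that] Ad_gg[OF flow_G assms(1)] by blast
 thus ?thesis using assms(1) by(auto simp: QH_def lie_exp)
qed

lemma QH_flow: "flow t : QH"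
proof -
 have "conj s (flow t) = flow t" for s by(simp add:conj_def flow_add[symmetric])
 thus ?thesis by(auto simp: QH_def flow_G)
qed

lemma QH_one: "mat 1 : QH" using QH_flow[of 0] by simp

text \<open>The eigenvectors with negative eigenvalue are contracted by \<open>Ad (flow s)\<close>
  for positive \<open>s\<close> and expanded by \<open>conj\<close>; they will be coordinates
  transversal to \<open>QH\<close>. The remaining ones, collected in \<open>qproj\<close>, stay
  bounded under \<open>conj\<close>.\<close>

definition nproj :: "real^'n^'n => real^'n^'n" where "nproj x = (SUM e:{e\<in>E. mu e < 0}. bt x e *. e)"
definition qproj :: "real^'n^'n => real^'n^'n" where "qproj x = (SUM e:{e\<in>E. ~ mu e < 0}. bt x e *. e)"

lemma nproj_qproj: "x : gg ==> nproj x + qproj x = x"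
proof -
 assume x: "x : gg"
 have "nproj x + qproj x = (SUM e:{e\<in>E. mu e < 0} \<union> {e\<in>E. ~ mu e < 0}. bt x e *. e)"
  unfolding nproj_def qproj_def by(rule sum.union_disjoint[symmetric]) (use E(1) in auto)
 also have "{e\<in>E. mu e < 0} \<union> {e\<in>E. ~ mu e < 0} = E" by auto
 finally show ?thesis using E_expand[OF x] by simp
qed

lemma linear_nproj: "linear nproj" and linear_qproj: "linear qproj" unfolding nproj_def qproj_def by(rule linearI; simp add:bt_simps scaleR_add_left sum.distrib scaleR_sum_right)+

lemma nproj_gg: "nproj x : gg" and qproj_gg: "qproj x : gg" unfolding nproj_def qproj_def using E(2) by(auto intro!: subspace_sum subspace_scale gg_subspace)

lemma nproj_nproj: "nproj (nproj x) = nproj x"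
proof -
 have "bt (nproj x) e = bt x e" if e: "e : E" "mu e < 0" for e
 proof -
  have "bt (nproj x) e = (SUM f:{e\<in>E. mu e < 0}. if f = e then bt x e else 0)" unfolding nproj_def bt_sum by(rule sum.cong) (use e E_orth in \<open>auto simp: bt_simps\<close>)
  thus ?thesis using e E(1) by simp
 qed
 hence "(SUM e:{e\<in>E. mu e < 0}. bt (nproj x) e *. e) = (SUM e:{e\<in>E. mu e < 0}. bt x e *. e)" by(intro sum.cong) auto
 thus ?thesis by(simp flip: nproj_def)
qed

lemma Ad_flow_eig: "e : E ==> Ad (flow t) e = exp (t * mu e) *. e" unfolding flow_def by(rule Ad_exp_eigenvector[OF E_eig])

lemma Ad_flow_sum: "F <= E ==> Ad (flow t) (SUM e:F. c e *. e) = (SUM e:F. (c e * exp (t * mu e)) *. e)" unfolding linear_sum[OF linear_Ad] linear_scale[OF linear_Ad]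
 by(rule sum.cong) (auto simp: Ad_flow_eig subset_iff)

lemma Ad_flow_add: "Ad (flow (s + t)) x = Ad (flow s) (Ad (flow t) x)" by(simp add:flow_add Ad_mult)

lemma Ad_flow_component: "x : gg ==> e : E ==> bt (Ad (flow t) x) e = exp (t * mu e) * bt x e"
proof -
 assume x: "x : gg" and e: "e : E"
 have "bt (Ad (flow t) x) e = bt (SUM f:E. (bt x f * exp (t * mu f)) *. f) e" using Ad_flow_sum[of E t "bt x"] E_expand[OF x] by simp
 also have "... = (SUM f:E. if f = e then bt x e * exp (t * mu e) else 0)" unfolding bt_sum by(rule sum.cong) (use e E_orth in \<open>auto simp: bt_simps\<close>)
 finally show ?thesis using e E(1) by(simp add:mult.commute)
qed

lemma nproj_Ad_flow: "x : gg ==> nproj (Ad (flow t) x) = Ad (flow t) (nproj x)" unfolding nproj_def Ad_flow_sum[of "{e\<in>E. mu e < 0}", OF Collect_subset]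
 by(rule sum.cong) (auto simp: Ad_flow_component mult.commute)

lemma component_bound: obtains M where "0 < M" "!!x e. x : gg ==> e : E ==> norm (bt x e *. e) <= M * norm x"
proof -
 obtain M where M: "0 < M" "!!x. x : gg ==> nb x <= M * norm x" by(rule nb_equiv) blast
 define M' where "M' = M * (SUM e:E. norm e) + 1"
 have M': "0 < M'" unfolding M'_def using M(1) by(intro add_nonneg_pos mult_nonneg_nonneg sum_nonneg) auto
 have "norm (bt x e *. e) <= M' * norm x" if x: "x : gg" and e: "e : E" for x e
 proof -
  have eg: "e : gg" and ne: "nb e = 1" using E(2) e E_orth[OF e e] by(auto simp: nb_def)
  have "\<bar>bt x e\<bar> <= nb x" using bt_le_nb[OF x eg] bt_le_nb[OF subspace_neg[OF gg_subspace x] eg] ne nb_scale[of "-1" x] bt_simps(5)[of "-1" x e] by simp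
  hence "\<bar>bt x e\<bar> * norm e <= (M * norm x) * (SUM e:E. norm e)" using M(2)[OF x] e E(1) by(intro mult_mono member_le_sum) auto
  also have "... <= M' * norm x" by(simp add:M'_def algebra_simps)
  finally show ?thesis by simp
 qed
 thus thesis using that M' by blast
qed

lemma nproj_contraction:
 obtains C dl where "0 < C" "0 < dl"
  "!!x s. x : gg ==> nproj x = x ==> 0 <= s ==> norm (Ad (flow s) x) <= C * exp (- (s * dl)) * norm x"
proof -
 obtain M where M: "0 < M" "!!x e. x : gg ==> e : E ==> norm (bt x e *. e) <= M * norm x" using component_bound by blast
 \<comment> \<open>The entry 1 keeps the set nonempty if no eigenvalue is negative.\<close>
 define dl where "dl = Min (insert 1 ((%e. - mu e) ` {e\<in>E. mu e < 0}))"
 have dl: "0 < dl" "!!e. e : E ==> mu e < 0 ==> mu e <= - dl"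
 proof -
  have f: "finite (insert 1 ((%e. - mu e) ` {e\<in>E. mu e < 0}))" using E(1) by simp
  show "0 < dl" unfolding dl_def using f by(subst Min_gr_iff) auto
  have "dl <= - mu e" if "e : E" "mu e < 0" for e unfolding dl_def by(rule Min_le[OF f]) (use that in auto)
  thus "!!e. e : E ==> mu e < 0 ==> mu e <= - dl" by fastforce
 qed
 define C where "C = real (card E) * M + 1"
 have "norm (Ad (flow s) x) <= C * exp (- (s * dl)) * norm x" if x: "x : gg" "nproj x = x" and s: "0 <= s" for x s
 proof -
  have "Ad (flow s) x = Ad (flow s) (nproj x)" using x(2) by simp
  also have "... = (SUM e:{e\<in>E. mu e < 0}. exp (s * mu e) *. (bt x e *. e))" unfolding nproj_def by(simp add:Ad_flow_sum mult.commute)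
  finally have "norm (Ad (flow s) x) <= (SUM e:{e\<in>E. mu e < 0}. norm (exp (s * mu e) *. (bt x e *. e)))"
   using norm_sum[of "%e. exp (s * mu e) *. (bt x e *. e)" "{e\<in>E. mu e < 0}"] by(simp only:)
  also have "... <= (SUM e:{e\<in>E. mu e < 0}. exp (- (s * dl)) * (M * norm x))"
  proof (rule sum_mono)
   fix e assume "e : {e\<in>E. mu e < 0}"
   hence e: "e : E" "mu e < 0" by auto
   have "s * mu e <= - (s * dl)" using mult_left_mono[OF dl(2)[OF e] s] by simp
   hence "exp (s * mu e) * norm (bt x e *. e) <= exp (- (s * dl)) * (M * norm x)" by(intro mult_mono M(2) x e) simp_all
   thus "norm (exp (s * mu e) *. (bt x e *. e)) <= exp (- (s * dl)) * (M * norm x)" by(simp add:abs_mult mult.assoc)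
  qed
  also have "... = real (card {e\<in>E. mu e < 0}) * (exp (- (s * dl)) * (M * norm x))" by simp
  also have "... <= real (card E) * (exp (- (s * dl)) * (M * norm x))" using M(1) E(1) by(intro mult_right_mono) (auto intro!: card_mono)
  also have "... <= C * exp (- (s * dl)) * norm x" by(simp add:C_def algebra_simps)
  finally show ?thesis .
 qed
 moreover have "0 < C" using M(1) by(simp add:C_def add_nonneg_pos)
 ultimately show thesis using that dl(1) by blast
qed

lemma qproj_QH: obtains C where "!!u. u : gg ==> norm u <= 1 ==> mexp (qproj u) : QH"
 "!!u t. u : gg ==> norm u <= 1 ==> 0 <= t ==> nb (lg (conj t (mexp (qproj u)))) <= C"
proof -
 obtain M where M: "0 < M" "!!x e. x : gg ==> e : E ==> norm (bt x e *. e) <= M * norm x" using component_bound by blast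
 define B where "B = real (card {e\<in>E. ~ mu e < 0}) * M"
 have b: "norm (Ad (flow (- t)) (qproj u)) <= B" if u: "u : gg" "norm u <= 1" and t: "0 <= t" for u t
 proof -
  have "Ad (flow (- t)) (qproj u) = (SUM e:{e\<in>E. ~ mu e < 0}. exp (- t * mu e) *. (bt u e *. e))" unfolding qproj_def by(simp add:Ad_flow_sum mult.commute)
  hence "norm (Ad (flow (- t)) (qproj u)) <= (SUM e:{e\<in>E. ~ mu e < 0}. norm (exp (- t * mu e) *. (bt u e *. e)))"
   using norm_sum[of "%e. exp (- t * mu e) *. (bt u e *. e)" "{e\<in>E. ~ mu e < 0}"] by(simp only:)
  also have "... <= (SUM e:{e\<in>E. ~ mu e < 0}. M)"
  proof (rule sum_mono)
   fix e assume "e : {e\<in>E. ~ mu e < 0}"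
   hence e: "e : E" "0 <= mu e" by auto
   have "exp (- t * mu e) * norm (bt u e *. e) <= 1 * (M * norm u)" by(intro mult_mono M(2) u e) (use t e in auto)
   also have "... <= M" using M(1) u(2) by simp
   finally show "norm (exp (- t * mu e) *. (bt u e *. e)) <= M" by(simp add:abs_mult mult.assoc)
  qed
  finally show ?thesis by(simp add:B_def)
 qed
 obtain S where S: "ALL x:gg. norm x <= B --> mexp x : bd S" using bd_exp[of B] by blast
 obtain C where C: "ALL g:bd S. nb (lg g) <= C" using lg_bd by blast
 show thesis
 proof (rule that)
  show "mexp (qproj u) : QH" if "u : gg" "norm u <= 1" for u by(rule QH_bounded_orbit[OF qproj_gg b[OF that]])
  show "nb (lg (conj t (mexp (qproj u)))) <= C" if "u : gg" "norm u <= 1" "0 <= t" for u t unfolding conj_exp using S C b[OF that] Ad_gg[OF flow_G qproj_gg] by blast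
 qed
qed

lemma contraction_uniform:
 assumes r: "0 < r"
 shows "EX N. ALL n>=N. ALL v:gg. nproj v = v --> norm v <= B --> norm (Ad (flow (real n)) v) < r"
proof -
 obtain C dl where C: "0 < C" "0 < dl"
  "!!x s. x : gg ==> nproj x = x ==> 0 <= s ==> norm (Ad (flow s) x) <= C * exp (- (s * dl)) * norm x" using nproj_contraction by blast
 have "(%n. C * exp (- dl) ^ n * \<bar>B\<bar>) ----> C * 0 * \<bar>B\<bar>" by(intro tendsto_intros LIMSEQ_realpow_zero) (use C(2) in auto)
 hence "\<forall>\<^sub>F n in sequentially. C * exp (- dl) ^ n * \<bar>B\<bar> < r" using r by(intro order_tendstoD) auto
 then obtain N where N: "!!n. N <= n ==> C * exp (- dl) ^ n * \<bar>B\<bar> < r" unfolding eventually_sequentially by blast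
 have "norm (Ad (flow (real n)) v) < r" if n: "N <= n" and v: "v : gg" "nproj v = v" "norm v <= B" for n v
 proof -
  have "norm (Ad (flow (real n)) v) <= C * exp (- (real n * dl)) * norm v" by(rule C(3)[OF v(1,2)]) simp
  also have "... <= C * exp (- dl) ^ n * \<bar>B\<bar>" using v(3) C(1) by(simp flip: exp_of_nat_mult)
  finally show ?thesis using N[OF n] by linarith
 qed
 thus ?thesis by blast
qed

lemma contraction_tendsto:
 assumes v: "!!n. v n : gg" "!!n. nproj (v n) = v n" "!!n. norm (v n) <= B"
 shows "(%n. Ad (flow (real n)) (v n)) ----> 0"
proof (rule LIMSEQ_I)
 fix r :: real assume "0 < r"
 from contraction_uniform[OF this, of B] v show "EX N. ALL n>=N. norm (Ad (flow (real n)) (v n) - 0) < r" by(metis diff_zero)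
qed

text \<open>For \<open>g = exp v\<close> consider \<open>w = Ad g H - H\<close>. Its components with
  \<open>mu < 0\<close> vanish, since \<open>conj t g\<close> stays bounded while
  \<open>conj\<close> would expand them; those with \<open>mu >= 0\<close> vanish, since contracting
  \<open>v\<close> makes \<open>Ad (flow n) w\<close> tend to 0 without shrinking them. So
  \<open>g\<close> commutes with the flow and equals its own contractions, which tend to 1. The
  conclusion is about \<open>exp v\<close>, as \<open>exp\<close> may fail to be injective.\<close>

lemma nproj_QH_trivial:
 assumes v: "v : gg" "nproj v = v" and q: "mexp v : QH" shows "mexp v = mat 1"
proof -
 define g where "g = mexp v"
 have gG: "g : G" unfolding g_def by(rule lie_exp[OF v(1)])
 have Hg: "H : gg" by(rule pp_gg[OF H])
 define w where "w = Ad g H - H"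
 have wg: "w : gg" unfolding w_def by(intro subspace_diff[OF gg_subspace] Ad_gg gG Hg)
 have AH: "Ad (flow t) H = H" for t using Ad_exp_eigenvector[of H H 0 t] by(simp add:flow_def)
 have conj_w: "Ad (flow (- t)) w = Ad (conj t g) H - H" for t
 proof -
  have "Ad (conj t g) H = Ad (flow (- t)) (Ad g (Ad (flow t) H))" using inv[OF gG] by(simp add:conj_def Ad_mult invertible_mult)
  thus ?thesis by(simp add:w_def linear_diff[OF linear_Ad] AH)
 qed
 have lim: "(%n. Ad (flow (real n)) v) ----> 0" by(rule contraction_tendsto[OF v order_refl])
 have comp0: "bt w e = 0" if e: "e : E" for e
 proof (cases "mu e < 0")
  case True
  obtain C where C: "ALL t>=0. nb (lg (conj t g)) <= C" using q by(auto simp: QH_def g_def)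
  obtain R where R: "ALL g:G. nb (lg g) <= C --> g : bd R" using bd_lg by blast
  obtain M where M: "0 < M" "!!x e. x : gg ==> e : E ==> norm (bt x e *. e) <= M * norm x" using component_bound by blast
  define B where "B = M * ((\<bar>R\<bar> * norm H) * \<bar>R\<bar> + norm H)"
  have bnd: "exp (- real n * mu e) * norm (bt w e *. e) <= B" for n
  proof -
   let ?c = "conj (real n) g"
   have c: "norm ?c <= \<bar>R\<bar>" "norm (mi ?c) <= \<bar>R\<bar>" using R[rule_format, OF conj_G[OF gG], of "real n"] C by(auto simp: bd_def)
   have "norm (Ad ?c H) <= (norm ?c * norm H) * norm (mi ?c)" unfolding Ad_def by(intro order_trans[OF norm_matrix_mult] mult_right_mono norm_matrix_mult) auto
   also have "... <= (\<bar>R\<bar> * norm H) * \<bar>R\<bar>" using c by(intro mult_right_mono mult_mono) auto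
   finally have "norm (Ad (flow (- real n)) w) <= (\<bar>R\<bar> * norm H) * \<bar>R\<bar> + norm H" unfolding conj_w using norm_triangle_ineq4[of "Ad ?c H" H] by linarith
   from mult_left_mono[OF this, of M] M(2)[OF Ad_gg[OF flow_G wg] e, of "- real n"]
   have "norm (bt (Ad (flow (- real n)) w) e *. e) <= B" using M(1) unfolding B_def by linarith
   thus ?thesis by(simp add:Ad_flow_component[OF wg e] abs_mult)
  qed
  show ?thesis
  proof (rule ccontr)
   assume "bt w e ~= 0"
   moreover have "e ~= 0" using E_orth[OF e e] bt_simps(5)[of 0 e e] by auto
   ultimately have p: "0 < norm (bt w e *. e)" by simp
   obtain n where n: "B / norm (bt w e *. e) < real n * (- mu e)" using reals_Archimedean3[of "- mu e"] True by auto
   have "real n * (- mu e) < exp (- real n * mu e)" using exp_ge_add_one_self[of "real n * (- mu e)"] by simp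
   with n have "B / norm (bt w e *. e) < exp (- real n * mu e)" by linarith
   thus False using bnd[of n] p by(simp add:field_simps)
  qed
 next
  case False
  note t = tendsto_mat_exp[OF lim, simplified] tendsto_mat_exp[OF tendsto_minus[OF lim], simplified]
  have "Ad (flow (real n)) w = mexp (Ad (flow (real n)) v)**H**mexp (- Ad (flow (real n)) v) - H" for n
   using conj_w[of "- real n"] conj_exp[of "- real n" v] by(simp add:g_def Ad_def)
  hence "(%n. Ad (flow (real n)) w) ----> mat 1**H**mat 1 - H" by(simp only:) (intro tendsto_diff mm.tendsto tendsto_const t)
  hence l: "(%n. Ad (flow (real n)) w) ----> 0" by simp
  have "linear (%x. bt x e)" using bilinear_bt by(simp add:bilinear_def)
  hence "(%n. bt (Ad (flow (real n)) w) e) ----> 0" using bounded_linear.tendsto_zero[OF _ l] by(simp add:linear_conv_bounded_linear)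
  hence l2: "(%n. norm (exp (real n * mu e) * bt w e)) ----> 0" by(intro tendsto_norm_zero) (simp add:Ad_flow_component[OF wg e])
  have "norm (bt w e) <= 0"
  proof (rule LIMSEQ_le_const[OF l2], intro exI allI impI)
   fix n :: nat
   have "1 * norm (bt w e) <= exp (real n * mu e) * norm (bt w e)" using False by(intro mult_right_mono) auto
   thus "norm (bt w e) <= norm (exp (real n * mu e) * bt w e)" by(simp add:abs_mult)
  qed
  thus ?thesis by simp
 qed
 have "w = 0" using E_expand[OF wg] comp0 by simp
 hence gH: "Ad g H = H" by(simp add:w_def)
 have "conj t g = g" for t
 proof -
  have "g**flow t**mi g = flow t" using mat_exp_Ad[OF inv[OF gG], of "t *. H"] gH by(simp add:flow_def linear_scale[OF linear_Ad])
  hence "g**flow t**(mi g**g) = flow t**g" by(simp add:mma)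
  hence "g**flow t = flow t**g" using inv[OF gG] by simp
  thus ?thesis by(simp add:conj_def mms flow_cancel)
 qed
 hence "mexp (Ad (flow (real n)) v) = g" for n using conj_exp[of "- real n" v] by(simp add:g_def)
 hence "(%n :: nat. g) ----> mat 1" using tendsto_mat_exp[OF lim] by simp
 thus ?thesis using LIMSEQ_unique[OF tendsto_const] by(fastforce simp: g_def)
qed

lemma nproj_qproj_chart:
 assumes "0 < r"
 obtains d where "0 < d" "!!g. g : G ==> norm (g - mat 1) < d ==>
  EX u:gg. norm u < r & g = mexp (nproj u)**mexp (qproj u)" by(rule exp_product_chart[of nproj qproj, OF linear_nproj _ linear_qproj _ _ assms])
  (auto simp: nproj_gg qproj_gg nproj_qproj)

text \<open>In the chart \<open>exp (nproj u) exp (qproj u)\<close> the second factor lies in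
  \<open>QH\<close>, so for \<open>h\<close> in \<open>QH\<close> the first does too and is trivial
  by \<open>nproj_QH_trivial\<close>.\<close>

lemma QH_near_one:
 obtains d C where "0 < d" "!!h t. h : QH ==> norm (h - mat 1) < d ==> 0 <= t ==> nb (lg (conj t h)) <= C"
proof -
 obtain C where C: "!!u. u : gg ==> norm u <= 1 ==> mexp (qproj u) : QH"
  "!!u t. u : gg ==> norm u <= 1 ==> 0 <= t ==> nb (lg (conj t (mexp (qproj u)))) <= C" using qproj_QH by blast
 obtain d where d: "0 < d" "!!g. g : G ==> norm (g - mat 1) < d ==>
  EX u:gg. norm u < 1 & g = mexp (nproj u)**mexp (qproj u)" using nproj_qproj_chart[OF zero_less_one] by blast
 have "nb (lg (conj t h)) <= C" if h: "h : QH" "norm (h - mat 1) < d" and t: "0 <= t" for h t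
 proof -
  obtain u where u: "u : gg" "norm u < 1" "h = mexp (nproj u)**mexp (qproj u)" using d(2)[OF QH_G[OF h(1)] h(2)] by blast
  have "mexp (nproj u) = h**mi (mexp (qproj u))" unfolding u(3) by(simp add:mms del: matrix_inv_mat_exp)
  moreover have "mi (mexp (qproj u)) : QH" using C(1)[OF u(1)] u(2) by(intro QH_inv) simp
  ultimately have "mexp (nproj u) : QH" using QH_mult[OF h(1)] by metis
  hence "h = mexp (qproj u)" using nproj_QH_trivial[OF nproj_gg nproj_nproj, of u] u(3) by simp
  thus ?thesis using C(2)[OF u(1) _ t] u(2) by simp
 qed
 thus thesis using that d(1) by blast
qed

text \<open>Each element of \<open>QH\<close> comes with its own bound; compactness makes it
  uniform. In a sequence violating this, a late term is \<open>g0 h\<close> with \<open>g0\<close> a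
  fixed earlier term and \<open>h\<close> in \<open>QH\<close> near 1, so its conjugates are bounded
  by the constants for \<open>g0\<close> and for a neighbourhood of 1.\<close>

lemma QH_bd_conj: "EX S. ALL g:QH \<inter> bd R. ALL t>=0. conj t g : bd S"
proof -
 have "EX C. ALL g:QH \<inter> bd R. ALL t>=0. nb (lg (conj t g)) <= C"
 proof (rule ccontr)
  assume "~ ?thesis"
  hence "ALL n. EX g t. g : QH \<inter> bd R & 0 <= t & real n < nb (lg (conj t g))" by(meson not_le)
  hence "EX g. ALL n. EX t. g n : QH \<inter> bd R & 0 <= t & real n < nb (lg (conj t (g n)))" by(rule choice)
  then obtain g where g0: "ALL n. EX t. g n : QH \<inter> bd R & 0 <= t & real n < nb (lg (conj t (g n)))" by blast
  then obtain t where t: "ALL n. g n : QH \<inter> bd R & 0 <= t n & real n < nb (lg (conj (t n) (g n)))" using choice[OF g0] by blast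
  hence g: "!!n. g n : QH" "!!n. g n : bd R" "!!n. 0 <= t n" "!!n. real n < nb (lg (conj (t n) (g n)))" by blast+
  obtain l r where r: "l : bd R" "strict_mono r" "(g \<circ> r) ----> l" using seq_compactE[OF compact_imp_seq_compact[OF compact_bd]] g(2) by metis
  obtain d C where d: "0 < d" "!!h t. h : QH ==> norm (h - mat 1) < d ==> 0 <= t ==> nb (lg (conj t h)) <= C" using QH_near_one by blast
  define S where "S = \<bar>R\<bar> + 1"
  have S: "0 < S" by(simp add:S_def add_nonneg_pos)
  have "0 < d / S" using d(1) S by simp
  then obtain N where N: "ALL m>=N. ALL n>=N. dist ((g \<circ> r) m) ((g \<circ> r) n) < d / S" using LIMSEQ_imp_Cauchy[OF r(3)] unfolding Cauchy_def by blast
  define g0 where "g0 = g (r N)"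
  obtain C0 where C0: "ALL t>=0. nb (lg (conj t g0)) <= C0" using g(1)[of "r N"] by(auto simp: QH_def g0_def)
  have g0: "g0 : QH" "g0 : G" "norm (mi g0) <= S" using g(1,2)[of "r N"] QH_G by(auto simp: g0_def bd_def S_def)
  obtain n where n: "C0 + C < real n" using reals_Archimedean2 by blast
  define q where "q = r (max n N)"
  have q: "real n <= real q" using seq_suble[OF r(2), of "max n N"] by(simp add:q_def)
  define h where "h = mi g0**g q"
  have hQ: "h : QH" unfolding h_def by(intro QH_mult QH_inv g g0)
  have "norm (h - mat 1) = norm (mi g0**(g q - g0))" using inv[OF g0(2)] by(simp add:h_def mm.diff_right)
  also have "... <= norm (mi g0) * norm (g q - g0)" by(rule norm_matrix_mult)
  also have "... <= S * norm (g q - g0)" using g0(3) by(intro mult_right_mono) auto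
  also have "... < S * (d / S)" using N[rule_format, of "max n N" N] S by(intro mult_strict_right_mono mult_strict_left_mono) (auto simp: g0_def q_def dist_norm)
  also have "... = d" using S by simp
  finally have hd: "norm (h - mat 1) < d" .
  have "g q = g0**h" using inv[OF g0(2)] by(simp add:h_def)
  hence "nb (lg (conj (t q) (g q))) <= C0 + C" using nb_lg_mult[OF conj_G[OF g0(2)] conj_G[OF QH_G[OF hQ]], of "t q" "t q"] C0 d(2)[OF hQ hd g(3)[of q]] g(3)[of q]
   unfolding conj_mult[symmetric] by fastforce
  thus False using g(4)[of q] n q by linarith
 qed
 then obtain C where C: "ALL g:QH \<inter> bd R. ALL t>=0. nb (lg (conj t g)) <= C" by blast
 obtain S where "ALL g:G. nb (lg g) <= C --> g : bd S" using bd_lg by blast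
 thus ?thesis using C QH_G conj_G by blast
qed

text \<open>\<open>kproj - pproj\<close> is the Cartan involution; it reverses \<open>H\<close> and
  therefore the sign of the eigenvalue.\<close>

lemma Cartan_involution_eig:
 assumes e: "e : E" shows "Ad (flow t) (kproj e - pproj e) = exp (- (t * mu e)) *. (kproj e - pproj e)"
proof -
 have eg: "e : gg" using e E(2) by blast
 have b: "lb H (pproj e) : kk" "lb H (kproj e) : pp" using bracket_pp_pp[OF H pproj_in] bracket_kk_pp(2)[OF kproj_in H] by auto
 have "lb H e = lb H (pproj e) + lb H (kproj e)" using decomp[OF eg] bracket_add_right by metis
 hence "pproj (lb H e) = lb H (kproj e)" "kproj (lb H e) = lb H (pproj e)"
  using b by(simp_all add: linear_add[OF linear_pproj] linear_add[OF linear_kproj] pproj_id pproj_kk kproj_id kproj_pp)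
 hence "lb H (kproj e - pproj e) = (- mu e) *. (kproj e - pproj e)"
  by(simp add:bracket_simps E_eig[OF e] linear_scale[OF linear_pproj] linear_scale[OF linear_kproj] scaleR_diff_right flip: E_eig)
 from Ad_exp_eigenvector[OF this, of t] show ?thesis by(simp add:flow_def)
qed

text \<open>With \<open>th\<close> the Cartan involution and \<open>n\<close>, \<open>q\<close> the
  two parts of \<open>u\<close>, write \<open>u = (n + th n) + (q - th n)\<close>. The first summand
  is fixed by \<open>th\<close> and lies in \<open>kk\<close>; the second has only nonnegative
  eigenvalues, so its exponential lies in \<open>QH\<close>.\<close>

lemma K_QH_chart:
 obtains d where "0 < d" "!!g. g : G ==> norm (g - mat 1) < d ==> EX k:K. EX q:QH. g = k**q"
proof -
 define th where "th x = kproj x - pproj x" for x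
 have lth: "linear th" unfolding th_def[abs_def] by(rule linear_compose_sub[OF linear_kproj linear_pproj])
 have thg: "th x : gg" for x unfolding th_def by(intro subspace_diff[OF gg_subspace] kk_gg kproj_in pp_gg pproj_in)
 define a where "a u = nproj u + th (nproj u)" for u
 define b where "b u = qproj u - th (nproj u)" for u
 have a: "linear a" "!!u. u : gg ==> a u : gg" and b: "linear b" "!!u. u : gg ==> b u : gg" unfolding a_def[abs_def] b_def[abs_def]
  using linear_compose_add[OF linear_nproj linear_compose[OF linear_nproj lth]] linear_compose_sub[OF linear_qproj linear_compose[OF linear_nproj lth]]
  by(auto simp: o_def intro!: subspace_add[OF gg_subspace] subspace_diff[OF gg_subspace] nproj_gg qproj_gg thg)
 have ab: "a u + b u = u" if "u : gg" for u using nproj_qproj[OF that] by(simp add:a_def b_def)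
 obtain d where d: "0 < d" "!!g. g : G ==> norm (g - mat 1) < d ==> EX u:gg. norm u < 1 & g = mexp (a u)**mexp (b u)" using exp_product_chart[OF a b ab zero_less_one] by blast
 have aK: "mexp (a u) : K" for u
 proof -
  have "a u = (nproj u - pproj (nproj u)) + kproj (nproj u)" by(simp add:a_def th_def)
  also have "nproj u - pproj (nproj u) = kproj (nproj u)" using decomp[OF nproj_gg, of u] by(metis add_diff_cancel_left')
  finally have "a u = kproj (nproj u) + kproj (nproj u)" .
  thus ?thesis by(simp only:) (intro K.lie_exp subspace_add[OF K.subspace_lie_algebra] kproj_in)
 qed
 have bQ: "mexp (b u) : QH" if u: "u : gg" for u
 proof (rule QH_bounded_orbit[OF b(2)[OF u]])
  fix t :: real assume t: "0 <= t"
  have "Ad (flow (- t)) (qproj u) = (SUM e:{e\<in>E. ~ mu e < 0}. (bt u e * exp (- t * mu e)) *. e)" unfolding qproj_def by(simp add:Ad_flow_sum)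
  hence "norm (Ad (flow (- t)) (qproj u)) <= (SUM e:{e\<in>E. ~ mu e < 0}. norm ((bt u e * exp (- t * mu e)) *. e))"
   using norm_sum[of "%e. (bt u e * exp (- t * mu e)) *. e" "{e\<in>E. ~ mu e < 0}"] by(simp only:)
  also have "... <= (SUM e:{e\<in>E. ~ mu e < 0}. norm (bt u e *. e))" using t by(intro sum_mono) (auto simp: abs_mult mult_le_cancel_right intro!: mult_right_le_one_le)
  finally have 1: "norm (Ad (flow (- t)) (qproj u)) <= (SUM e:{e\<in>E. ~ mu e < 0}. norm (bt u e *. e))" .
  have "Ad (flow (- t)) (th (nproj u)) = (SUM e:{e\<in>E. mu e < 0}. bt u e *. Ad (flow (- t)) (th e))"
   unfolding nproj_def linear_sum[OF lth] linear_sum[OF linear_Ad] linear_scale[OF lth] linear_scale[OF linear_Ad] ..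
  also have "... = (SUM e:{e\<in>E. mu e < 0}. (bt u e * exp (t * mu e)) *. th e)" by(rule sum.cong) (auto simp: th_def Cartan_involution_eig)
  finally have "norm (Ad (flow (- t)) (th (nproj u))) <= (SUM e:{e\<in>E. mu e < 0}. norm ((bt u e * exp (t * mu e)) *. th e))"
   using norm_sum[of "%e. (bt u e * exp (t * mu e)) *. th e" "{e\<in>E. mu e < 0}"] by(simp only:)
  also have "... <= (SUM e:{e\<in>E. mu e < 0}. norm (bt u e *. th e))"
   using t by(intro sum_mono) (auto simp: abs_mult mult_le_cancel_right mult_nonneg_nonpos intro!: mult_right_le_one_le)
  finally have 2: "norm (Ad (flow (- t)) (th (nproj u))) <= (SUM e:{e\<in>E. mu e < 0}. norm (bt u e *. th e))" .
  show "norm (Ad (flow (- t)) (b u)) <= (SUM e:{e\<in>E. ~ mu e < 0}. norm (bt u e *. e)) + (SUM e:{e\<in>E. mu e < 0}. norm (bt u e *. th e))"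
   unfolding b_def linear_diff[OF linear_Ad] using norm_triangle_ineq4[of "Ad (flow (- t)) (qproj u)" "Ad (flow (- t)) (th (nproj u))"] 1 2 by linarith
 qed
 show thesis using that[OF d(1)] d(2) aK bQ by blast
qed

end

section \<open>The compact boundary\<close>

locale boundary = parabolic G K H E mu for G K :: "(real^'n^'n) set" and H E mu +
 fixes x0 :: "real^'n^'n" and Q :: "(real^'n^'n) set" and m :: "(real^'n^'n) set metric"
 assumes x0: "x0 : G" and Q_eq: "Q = (%q. x0**q**mi x0) ` QH"
  and mtop: "mtopology_of m = coset_topology G Q"
begin

abbreviation d where "d == mdist m"
abbreviation M where "M == mspace m"

text \<open>This is the coset \<open>g x0^-1 Q\<close>. The shift by \<open>x0\<close> makes
  \<open>QH\<close>, instead of its conjugate \<open>Q\<close>, the stabilizer of the base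
  point.\<close>

definition pt :: "real^'n^'n => (real^'n^'n) set" where "pt g = (%q. g**q**mi x0) ` QH"

definition act :: "real^'n^'n => (real^'n^'n) set => (real^'n^'n) set" where "act g x = g <#\<^bsub>GL\<^esub> x"

abbreviation base where "base == pt (mat 1)"

lemma act_pt: "act g (pt h) = pt (g**h)" by(auto simp: act_def pt_def l_coset_def GL_def mma)

lemma coset_pt: "g <#\<^bsub>GL\<^esub> Q = pt (g**x0)" by(auto simp: pt_def l_coset_def GL_def mma Q_eq)

lemma mspace_eq: "M = pt ` G"
proof -
 have "M = topspace (mtopology_of m)" by simp
 also have "... = (%g. pt (g**x0)) ` G" unfolding mtop topspace_coset_topology coset_pt[symmetric] by(auto simp: LCOSETS_def l_coset_def)
 also have "... = pt ` (%g. g**x0) ` G" by(simp add:image_image)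
 also have "(%g. g**x0) ` G = G"
 proof (intro equalityI subsetI)
  fix g assume "g : G"
  hence "g = (g**mi x0)**x0" "g**mi x0 : G" using inv[OF x0] by(auto simp: mms intro!: mult minv x0)
  thus "g : (%g. g**x0) ` G" by blast
 qed (auto intro: mult x0)
 finally show ?thesis .
qed

lemma pt_in [simp]: "g : G ==> pt g : M" by(simp add:mspace_eq)

lemma pt_QH: assumes q: "q : QH" shows "pt (g**q) = pt g"
proof -
 have "(%h. q**h) ` QH = QH"
 proof (intro equalityI subsetI)
  fix h assume "h : QH"
  hence "h = q**(mi q**h)" "mi q**h : QH" using inv[OF QH_G[OF q]] by(auto intro!: QH_mult QH_inv q)
  thus "h : (%h. q**h) ` QH" by blast
 qed (auto intro: QH_mult q)
 hence "pt g = (%h. g**h**mi x0) ` ((%h. q**h) ` QH)" by(simp add:pt_def)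
 also have "... = pt (g**q)" by(simp add:pt_def image_image mma)
 finally show ?thesis ..
qed

lemma pt_eqD: assumes g: "g : G" and e: "pt g = pt h" shows "mi g**h : QH"
proof -
 have "h**mat 1**mi x0 : pt g" unfolding e unfolding pt_def using QH_one by blast
 then obtain q where q: "q : QH" "h**mi x0 = g**q**mi x0" by(auto simp: pt_def)
 hence "h**(mi x0**x0) = g**q**(mi x0**x0)" by(simp only: mma)
 hence "h = g**q" using inv[OF x0] by simp
 thus ?thesis using q(1) inv[OF g] by simp
qed

lemma pt_base: "g : G ==> pt g = base ==> g : QH" using pt_eqD[OF one, of g] by simp

lemma base_QH: "q : QH ==> pt q = base" using pt_QH[of q "mat 1"] by simp

lemma act_act: "act g (act h x) = act (g**h) x" by(auto simp: act_def l_coset_def GL_def mma)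

lemma act_one [simp]: "act (mat 1) x = x" by(auto simp: act_def l_coset_def GL_def)

lemma act_in: "g : G ==> x : M ==> act g x : M" by(auto simp: mspace_eq act_pt mult)

lemma act_inv: "g : G ==> act g (act (mi g) x) = x" "g : G ==> act (mi g) (act g x) = x" by(simp_all add: act_act inv)

lemma d_self [simp]: "x : M ==> d x x = 0" by(rule iffD2[OF mdist_zero refl])

lemma open_iff: "openin (mtopology_of m) U \<longleftrightarrow> U <= M & openin (top_of_set G) {g : G. pt g : U}"
proof -
 have top: "lcosets\<^bsub>grp G\<^esub> Q = M" using mtop topspace_coset_topology topspace_mtopology_of by metis
 have c: "continuous_on G (%g. g**a)" for a :: "real^'n^'n" by(intro continuous_intros)
 have "openin (top_of_set G) {g : G. pt (g**x0) : U} \<longleftrightarrow> openin (top_of_set G) {g : G. pt g : U}"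
 proof
  assume o: "openin (top_of_set G) {g : G. pt (g**x0) : U}"
  have "openin (top_of_set G) (G \<inter> (%g. g**mi x0) -` {g : G. pt (g**x0) : U})" by(rule continuous_openin_preimage[OF c _ o]) (auto intro: mult minv x0)
  moreover have "G \<inter> (%g. g**mi x0) -` {g : G. pt (g**x0) : U} = {g : G. pt g : U}" using inv[OF x0] by(auto simp: mms intro: mult minv x0)
  ultimately show "openin (top_of_set G) {g : G. pt g : U}" by simp
 next
  assume o: "openin (top_of_set G) {g : G. pt g : U}"
  have "openin (top_of_set G) (G \<inter> (%g. g**x0) -` {g : G. pt g : U})" by(rule continuous_openin_preimage[OF c _ o]) (auto intro: mult x0)
  moreover have "G \<inter> (%g. g**x0) -` {g : G. pt g : U} = {g : G. pt (g**x0) : U}" by(auto intro: mult x0)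
  ultimately show "openin (top_of_set G) {g : G. pt (g**x0) : U}" by simp
 qed
 thus ?thesis by(simp add:mtop openin_coset_topology top coset_pt)
qed

lemma open_ball: "openin (mtopology_of m) (mball_of m x r)" unfolding mtopology_of_def mball_of_def by(rule Metric_space.openin_mball[OF Metric_space_mspace_mdist])

lemma open_contains_ball:
 assumes "openin (mtopology_of m) U" "x : U" obtains r where "0 < r" "!!y. y : M ==> d x y < r ==> y : U"
proof -
 obtain r where r: "0 < r" "mball_of m x r <= U" using assms unfolding mtopology_of_def mball_of_def Metric_space.openin_mtopology[OF Metric_space_mspace_mdist] by blast
 have "x : M" using assms openin_subset by fastforce
 hence "!!y. y : M ==> d x y < r ==> y : U" using r(2) by auto
 thus thesis using that r(1) by blast
qed

lemma pt_cont: assumes g: "g : G" and e: "0 < e"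
 obtains r where "0 < r" "!!h. h : G ==> norm (h - g) < r ==> d (pt g) (pt h) < e"
proof -
 have "openin (top_of_set G) {h : G. pt h : mball_of m (pt g) e}" using open_ball open_iff by blast
 moreover have "g : {h : G. pt h : mball_of m (pt g) e}" using g e by simp
 ultimately obtain r where r: "0 < r" "ball g r \<inter> G <= {h : G. pt h : mball_of m (pt g) e}" unfolding openin_contains_ball by blast
 have "d (pt g) (pt h) < e" if "h : G" "norm (h - g) < r" for h using r(2) that by(auto simp: dist_norm norm_minus_commute)
 thus thesis using that r(1) by blast
qed

lemma pt_tendsto:
 assumes g: "g : G" and s: "!!n. s n : G" "s ----> g" shows "(%n. d (pt g) (pt (s n))) ----> 0"
proof (rule LIMSEQ_I)
 fix e :: real assume "0 < e"
 then obtain r where r: "0 < r" "!!h. h : G ==> norm (h - g) < r ==> d (pt g) (pt h) < e" using pt_cont[OF g] by metis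
 obtain N where "ALL n>=N. norm (s n - g) < r" using LIMSEQ_D[OF s(2) r(1)] by blast
 thus "EX N. ALL n>=N. norm (d (pt g) (pt (s n)) - 0) < e" using r(2) s(1) by auto
qed

lemma limit_eq:
 assumes "x : M" "y : M" "!!n. z n : M" "(%n. d x (z n)) ----> 0" "(%n. d y (z n)) ----> 0"
 shows "x = y"
proof -
 have "(%n. d x (z n) + d y (z n)) ----> 0 + 0" by(intro tendsto_add assms)
 moreover have "d x y <= d x (z n) + d y (z n)" for n using mdist_triangle[OF assms(1,3,2)] mdist_commute[of m y "z n"] by simp
 ultimately have "d x y <= 0 + 0" by(intro LIMSEQ_le_const) auto
 thus ?thesis using mdist_zero[OF assms(1,2)] mdist_nonneg[of m x y] by simp
qed

text \<open>The set of \<open>g\<close> whose point lies in the \<open>K\<close>-orbit of the base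
  is open by \<open>K_QH_chart\<close> and closed because \<open>K\<close> is compact;
  \<open>G\<close> is connected. Compactness of \<open>G/Q\<close> follows from this.\<close>

lemma K_transitive: assumes x: "x : M" shows "EX k:K. x = pt k"
proof -
 define T where "T = {g : G. EX k:K. pt g = pt k}"
 obtain e where e: "0 < e" "!!g. g : G ==> norm (g - mat 1) < e ==> EX k:K. EX q:QH. g = k**q" using K_QH_chart by blast
 have "openin (top_of_set G) T"
 proof (subst openin_subopen, intro ballI)
  fix g assume "g : T"
  then obtain k where k: "k : K" "pt g = pt k" and g: "g : G" by(auto simp: T_def)
  have kG: "k : G" using k K(2) by blast
  define q where "q = mi k**g"
  have q: "q : QH" "g = k**q" unfolding q_def using pt_eqD[OF kG, of g] k(2) inv[OF kG] by auto
  have qi: "invertible q" and ki: "invertible k" using inv QH_G[OF q(1)] kG by blast+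
  let ?U = "{h : G. norm (mi k**h**mi q - mat 1) < e}"
  have "continuous_on G (%h. norm (mi k**h**mi q - mat 1))" by(intro continuous_intros)
  from continuous_openin_preimage_gen[OF this open_lessThan[of e]]
  have "openin (top_of_set G) ?U" by(simp add:vimage_def Int_def)
  moreover have "g : ?U" using g e(1) qi ki by(simp add:q(2) mms)
  moreover have "?U <= T"
  proof
   fix h assume h: "h : ?U"
   have "mi k**h**mi q : G" using h kG QH_G[OF q(1)] by(auto intro!: mult minv)
   then obtain k' q' where k': "k' : K" "q' : QH" "mi k**h**mi q = k'**q'" using e(2) h by blast
   have "k**(mi k**h**mi q)**q = h" using qi ki by(simp add:mms)
   hence "h = (k**k')**(q'**q)" unfolding k'(3) by(simp add:mma)
   hence "pt h = pt (k**k')" using pt_QH[OF QH_mult[OF k'(2) q(1)]] by simp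
   thus "h : T" using h K.mult[OF k(1) k'(1)] by(auto simp: T_def)
  qed
  ultimately show "EX U. openin (top_of_set G) U & g : U & U <= T" by blast
 qed
 moreover have "closedin (top_of_set G) T" unfolding closedin_limpt
 proof (intro conjI allI impI)
  fix g assume g: "g islimpt T & g : G"
  then obtain f where f: "!!n. f n : T" "f ----> g" unfolding islimpt_sequential by blast
  have "ALL n. EX k. k : K & pt (f n) = pt k" using f(1) unfolding T_def by blast
  from choice[OF this] obtain k where k: "!!n. k n : K" "!!n. pt (f n) = pt (k n)" by blast
  have fG: "f n : G" for n using f(1) unfolding T_def by blast
  obtain l r where r: "l : K" "strict_mono r" "(k \<circ> r) ----> l" using seq_compactE[OF compact_imp_seq_compact[OF K(3)]] k(1) by metis
  have lG: "l : G" using r(1) K(2) by blast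
  have "(%n. d (pt l) (pt (k (r n)))) ----> 0" using pt_tendsto[OF lG _ r(3)] k(1) K(2) by(auto simp: o_def)
  moreover have "(%n. d (pt g) (pt (f (r n)))) ----> 0" using pt_tendsto[of g "f \<circ> r"] g fG LIMSEQ_subseq_LIMSEQ[OF f(2) r(2)] by(simp add:o_def)
  ultimately have "pt g = pt l" using limit_eq[of "pt g" "pt l" "%n. pt (f (r n))"] g lG pt_in[OF fG] by(simp add:k(2))
  thus "g : T" using g r(1) by(auto simp: T_def)
 qed (auto simp: T_def)
 moreover have "mat 1 : T" using one K.one by(auto simp: T_def)
 ultimately have TG: "T = G" using conn unfolding connected_clopen by blast
 obtain g where g: "g : G" "x = pt g" using x by(auto simp: mspace_eq)
 hence "g : T" using TG by simp
 thus ?thesis using g(2) unfolding T_def by blast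
qed

text \<open>Points are represented by elements of \<open>K\<close>, so a counterexample is a
  sequence in the compact set \<open>bd R\<close> times \<open>K\<close> times \<open>K\<close>. In
  the limit the two points coincide, and so do their images.\<close>

lemma act_uniform:
 assumes e: "0 < e"
 obtains r where "0 < r" "!!g x y. g : bd R ==> x : M ==> y : M ==> d x y < r ==> d (act g x) (act g y) < e"
proof (rule ccontr)
 assume no: "~ thesis"
 have "EX w. fst w : bd R & fst (snd w) : K & snd (snd w) : K & d (pt (fst (snd w))) (pt (snd (snd w))) < 1 / real (Suc n)
   & e <= d (pt (fst w**fst (snd w))) (pt (fst w**snd (snd w)))" for n
 proof (rule ccontr)
  assume c: "~ ?thesis"
  have "d (act g x) (act g y) < e" if g: "g : bd R" "x : M" "y : M" "d x y < 1 / real (Suc n)" for g x y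
  proof -
   obtain k k' where k: "k : K" "k' : K" "x = pt k" "y = pt k'" using K_transitive g(2,3) by metis
   show ?thesis using c[unfolded not_ex, rule_format, of "(g, k, k')"] g k by(simp add:act_pt not_le)
  qed
  thus False using no that[of "1 / real (Suc n)"] by(metis of_nat_0_less_iff zero_less_Suc zero_less_divide_1_iff)
 qed
 then obtain w where w: "!!n. fst (w n) : bd R" "!!n. fst (snd (w n)) : K" "!!n. snd (snd (w n)) : K"
  "!!n. d (pt (fst (snd (w n)))) (pt (snd (snd (w n)))) < 1 / real (Suc n)"
  "!!n. e <= d (pt (fst (w n)**fst (snd (w n)))) (pt (fst (w n)**snd (snd (w n))))" by metis
 have cpt: "compact (bd R \<times> K \<times> K)" by(intro compact_Times compact_bd K(3))
 have "ALL n. w n : bd R \<times> K \<times> K" using w(1,2,3) by(simp add:mem_Times_iff)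
 then obtain l r where r: "l : bd R \<times> K \<times> K" "strict_mono r" "(w \<circ> r) ----> l" using seq_compactE[OF compact_imp_seq_compact[OF cpt]] by metis
 obtain g k k' where l: "l = (g, k, k')" by(cases l) auto
 have lG: "g : G" "k : G" "k' : G" using r(1) K(2) bd_G by(auto simp: l)
 have lim: "(%n. fst (w (r n))) ----> g" "(%n. fst (snd (w (r n)))) ----> k" "(%n. snd (snd (w (r n)))) ----> k'"
  using tendsto_fst[OF r(3)] tendsto_fst[OF tendsto_snd[OF r(3)]] tendsto_snd[OF tendsto_snd[OF r(3)]] by(simp_all add: l o_def)
 have wG: "fst (w n) : G" "fst (snd (w n)) : G" "snd (snd (w n)) : G" for n using w(1,2,3) K(2) bd_G by blast+
 have kk: "pt k = pt k'"
 proof (rule limit_eq)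
  show "(%n. d (pt k) (pt (fst (snd (w (r n)))))) ----> 0" by(rule pt_tendsto[OF lG(2) wG(2) lim(2)])
  have b: "(%n. d (pt k') (pt (snd (snd (w (r n)))))) ----> 0" by(rule pt_tendsto[OF lG(3) wG(3) lim(3)])
  have "(%n. 1 / real (Suc (r n))) ----> 0" using LIMSEQ_subseq_LIMSEQ[OF LIMSEQ_inverse_real_of_nat r(2)] by(simp add:o_def inverse_eq_divide)
  from tendsto_add[OF b this]
  have "(%n. d (pt k') (pt (snd (snd (w (r n))))) + 1 / real (Suc (r n))) ----> 0" by simp
  thus "(%n. d (pt k') (pt (fst (snd (w (r n)))))) ----> 0"
  proof (rule Lim_null_comparison[rotated], intro always_eventually allI)
   fix n
   have "d (pt k') (pt (fst (snd (w (r n))))) <= d (pt k') (pt (snd (snd (w (r n))))) + d (pt (fst (snd (w (r n))))) (pt (snd (snd (w (r n)))))"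
    using mdist_triangle[of "pt k'" m "pt (snd (snd (w (r n))))" "pt (fst (snd (w (r n))))"] lG wG
     mdist_commute[of m "pt (fst (snd (w (r n))))"] by simp
   thus "norm (d (pt k') (pt (fst (snd (w (r n)))))) <= d (pt k') (pt (snd (snd (w (r n))))) + 1 / real (Suc (r n))" using w(4)[of "r n"] by simp
  qed
 qed (use lG wG in auto)
 have "(%n. d (pt (g**k)) (pt (fst (w (r n))**fst (snd (w (r n)))))) ----> 0" by(intro pt_tendsto mult lG wG mm.tendsto lim)
 moreover have "(%n. d (pt (g**k')) (pt (fst (w (r n))**snd (snd (w (r n)))))) ----> 0" by(intro pt_tendsto mult lG wG mm.tendsto lim)
 ultimately have "(%n. d (pt (g**k)) (pt (fst (w (r n))**fst (snd (w (r n))))) + d (pt (g**k')) (pt (fst (w (r n))**snd (snd (w (r n)))))) ----> 0 + 0" by(rule tendsto_add)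
 moreover have "e <= d (pt (g**k)) (pt (fst (w (r n))**fst (snd (w (r n))))) + d (pt (g**k')) (pt (fst (w (r n))**snd (snd (w (r n)))))" for n
 proof -
  have gk: "pt (g**k') = pt (g**k)" using kk by(metis act_pt)
  have "d (pt (fst (w (r n))**fst (snd (w (r n))))) (pt (fst (w (r n))**snd (snd (w (r n))))) \<le>
   d (pt (fst (w (r n))**fst (snd (w (r n))))) (pt (g**k)) + d (pt (g**k)) (pt (fst (w (r n))**snd (snd (w (r n)))))" by(intro mdist_triangle pt_in mult lG wG)
  thus ?thesis using w(5)[of "r n"] by(simp add:gk mdist_commute[of m "pt (fst (w (r n))**fst (snd (w (r n))))"])
 qed
 ultimately have "e <= 0 + 0" by(intro LIMSEQ_le_const) auto
 thus False using e by simp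
qed

text \<open>Elements near 1 factor as \<open>exp (nproj u) exp (qproj u)\<close>, and the second
  factor fixes the base point, so the \<open>nproj\<close> directions alone fill a
  neighbourhood.\<close>

lemma base_nhd:
 assumes r: "0 < r"
 obtains e where "0 < e" "!!x. x : M ==> d base x < e ==> EX v:gg. nproj v = v & norm v < r & x = pt (mexp v)"
proof -
 obtain B where B: "0 < B" "!!x. norm (nproj x) <= norm x * B" using linear_nproj bounded_linear.pos_bounded unfolding linear_conv_bounded_linear by blast
 have "0 < min 1 (r / B)" using r B by simp
 then obtain e where e: "0 < e" "!!g. g : G ==> norm (g - mat 1) < e ==> EX u:gg. norm u < min 1 (r / B) & g = mexp (nproj u)**mexp (qproj u)" using nproj_qproj_chart by metis
 obtain C where C: "!!u. u : gg ==> norm u <= 1 ==> mexp (qproj u) : QH" using qproj_QH by blast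
 define U where "U = pt ` {g : G. norm (g - mat 1) < e}"
 have U: "EX v:gg. nproj v = v & norm v < r & x = pt (mexp v)" if "x : U" for x
 proof -
  obtain g where g: "g : G" "norm (g - mat 1) < e" "x = pt g" using `x : U` by(auto simp: U_def)
  obtain u where u: "u : gg" "norm u < min 1 (r / B)" "g = mexp (nproj u)**mexp (qproj u)" using e(2)[OF g(1,2)] by blast
  have "x = pt (mexp (nproj u))" unfolding g(3) u(3) by(rule pt_QH[OF C[OF u(1)]]) (use u(2) in simp)
  moreover have "norm (nproj u) < r" using B(2)[of u] u(2) B(1) by(simp add:field_simps)
  ultimately show ?thesis using nproj_gg nproj_nproj by blast
 qed
 have "openin (mtopology_of m) U" unfolding open_iff
 proof
  show "U <= M" by(auto simp: U_def)
  show "openin (top_of_set G) {g : G. pt g : U}"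
  proof (subst openin_subopen, intro ballI)
   fix g assume "g : {g : G. pt g : U}"
   then obtain h where h: "g : G" "h : G" "norm (h - mat 1) < e" "pt h = pt g" by(auto simp: U_def)
   define q where "q = mi h**g"
   have q: "q : QH" "g = h**q" unfolding q_def using pt_eqD[OF h(2,4)] inv[OF h(2)] by auto
   have qi: "invertible q" using inv QH_G[OF q(1)] by blast
   let ?V = "{x : G. norm (x**mi q - mat 1) < e}"
   have "continuous_on G (%x. norm (x**mi q - mat 1))" by(intro continuous_intros)
   from continuous_openin_preimage_gen[OF this open_lessThan[of e]]
   have "openin (top_of_set G) ?V" by(simp add:vimage_def Int_def)
   moreover have "g : ?V" using h qi by(simp add:q(2) mms)
   moreover have "?V <= {g : G. pt g : U}"
   proof
    fix x assume x: "x : ?V"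
    have "x**mi q : {g : G. norm (g - mat 1) < e}" using x QH_G[OF q(1)] by(auto intro!: mult minv)
    hence "pt (x**mi q) : U" unfolding U_def by(rule imageI)
    thus "x : {g : G. pt g : U}" using pt_QH[OF QH_inv[OF q(1)]] x by simp
   qed
   ultimately show "EX T. openin (top_of_set G) T & g : T & T <= {g : G. pt g : U}" by blast
  qed
 qed
 moreover have "base : U" using e(1) one by(auto simp: U_def)
 ultimately obtain ep where "0 < ep" "!!y. y : M ==> d base y < ep ==> y : U" using open_contains_ball by metis
 thus thesis using that U by blast
qed

text \<open>Move \<open>x\<close> to the base point by \<open>K\<close>. The flow fixes it, so the
  images of \<open>y'\<close> under \<open>flow (- n)\<close> stay in the chart, with coordinates
  \<open>v n\<close> of bounded size. Flowing back contracts these coordinates to 0, hence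
  \<open>y'\<close> is the base point.\<close>

lemma expansive:
 obtains e where "0 < e" "!!x y. x : M ==> y : M ==> (!!g. g : G ==> d (act g x) (act g y) <= e) ==> x = y"
proof -
 obtain e where e: "0 < e" "!!x. x : M ==> d base x < e ==> EX v:gg. nproj v = v & norm v < 1 & x = pt (mexp v)" using base_nhd[OF zero_less_one] by metis
 have "x = y" if x: "x : M" and y: "y : M" and close: "!!g. g : G ==> d (act g x) (act g y) <= e / 2" for x y
 proof -
  obtain k where k: "k : K" "x = pt k" using K_transitive[OF x] by blast
  have kG: "k : G" using k K(2) by blast
  define y' where "y' = act (mi k) y"
  have y': "y' : M" unfolding y'_def by(intro act_in minv kG y)
  have "EX v:gg. nproj v = v & norm v < 1 & act (flow (- real n)) y' = pt (mexp v)" for n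
  proof (rule e(2))
   show "act (flow (- real n)) y' : M" by(intro act_in flow_G y')
   have "act (flow (- real n)**mi k) x = base" using inv[OF kG] base_QH[OF QH_flow] by(simp add:k(2) act_pt mms)
   thus "d base (act (flow (- real n)) y') < e" using close[of "flow (- real n)**mi k"] e(1) by(simp add:y'_def act_act mult flow_G minv kG)
  qed
  then obtain v where v: "!!n. v n : gg" "!!n. nproj (v n) = v n" "!!n. norm (v n) < 1" "!!n. act (flow (- real n)) y' = pt (mexp (v n))" by metis
  have yv: "y' = pt (mexp (Ad (flow (real n)) (v n)))" for n
  proof -
   have "y' = act (flow (real n)) (act (flow (- real n)) y')" by(simp add:act_act flow_cancel)
   also have "... = pt (mexp (Ad (flow (real n)) (v n))**flow (real n))" by(simp add:v(4) act_pt flow_exp)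
   also have "... = pt (mexp (Ad (flow (real n)) (v n)))" by(rule pt_QH[OF QH_flow])
   finally show ?thesis .
  qed
  have "(%n. mexp (Ad (flow (real n)) (v n))) ----> mexp 0" by(rule tendsto_mat_exp[OF contraction_tendsto[OF v(1,2) less_imp_le[OF v(3)]]])
  hence "(%n. d base (pt (mexp (Ad (flow (real n)) (v n))))) ----> 0" by(intro pt_tendsto one lie_exp Ad_gg flow_G v) simp
  hence "(%n :: nat. d base y') ----> 0" by(simp flip: yv)
  hence "d base y' = 0" using LIMSEQ_unique[OF tendsto_const] by blast
  hence "y' = base" using mdist_zero[of base m y'] y' one by simp
  hence "act k y' = pt k" by(simp add:act_pt)
  thus ?thesis using act_inv(1)[OF kG] by(simp add:y'_def k(2))
 qed
 thus thesis using that[of "e / 2"] e(1) by fastforce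
qed

end

section \<open>Products of small exponentials\<close>

primrec exp_prod :: "(nat => real^'n^'n) => nat => real^'n^'n" where
 "exp_prod u 0 = mat 1"
| "exp_prod u (Suc n) = exp_prod u n**mexp (u n)"

context matgroup
begin

lemma exp_prod_in: "(!!j. u j : lie_algebra G) ==> exp_prod u n : G" by(induction n) (auto intro: one mult lie_exp)

lemma exp_prod_add: "exp_prod u (n + k) = exp_prod u n**exp_prod (%j. u (n + j)) k" by(induction k) (simp_all add: mma)

text \<open>As with a product of factors \<open>1 + a j\<close>, the distance from 1 is dominated by
  the scalar exponential of the sum. Passing to \<open>emat\<close> gives a submultiplicative norm
  in which 1 has norm 1.\<close>

lemma exp_prod_near_one: "norm (emat (exp_prod u n) - 1) <= exp (\<Sum>j<n. norm (emat (u j))) - 1"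
proof (induction n)
 case (Suc n)
 let ?p = "emat (exp_prod u n)" and ?y = "emat (u n)" and ?s = "\<Sum>j<n. norm (emat (u j))"
 have y: "norm (exp ?y - 1) <= exp (norm ?y) - 1"
 proof -
  have s: "(%k. ?y ^ Suc k /\<^sub>R fact (Suc k)) sums (exp ?y - 1)" using exp_converges[of ?y] sums_Suc_iff[of "%k. ?y ^ k /\<^sub>R fact k" "exp ?y - 1"] by simp
  have t: "(%k. norm ?y ^ Suc k /\<^sub>R fact (Suc k)) sums (exp (norm ?y) - 1)"
   using exp_converges[of "norm ?y"] sums_Suc_iff[of "%k. norm ?y ^ k /\<^sub>R fact k" "exp (norm ?y) - 1"] by simp
  have le: "norm (?y ^ Suc k /\<^sub>R fact (Suc k)) <= norm ?y ^ Suc k /\<^sub>R fact (Suc k)" for k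
   using norm_power_ineq[of ?y "Suc k"] by(simp add:divide_right_mono mult_left_mono del: power_Suc)
  have "norm (\<Sum>k. ?y ^ Suc k /\<^sub>R fact (Suc k)) <= (\<Sum>k. norm ?y ^ Suc k /\<^sub>R fact (Suc k))" by(rule norm_suminf_le[OF le sums_summable[OF t]])
  thus ?thesis using sums_unique[OF s] sums_unique[OF t] by simp
 qed
 have "emat (exp_prod u (Suc n)) - 1 = (?p - 1) * exp ?y + (exp ?y - 1)" by(simp add:emat_mult emat_exp algebra_simps)
 also have "norm ... <= norm (?p - 1) * norm (exp ?y) + norm (exp ?y - 1)" by(intro norm_triangle_mono norm_mult_ineq) simp
 also have "... <= (exp ?s - 1) * exp (norm ?y) + (exp (norm ?y) - 1)" by(intro add_mono mult_mono Suc.IH norm_exp y) (simp_all add: sum_nonneg)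
 also have "... = exp (\<Sum>j<Suc n. norm (emat (u j))) - 1" by(simp add:exp_add algebra_simps)
 finally show ?case .
qed simp

lemma bd_near_one: obtains r T where "0 < r" "!!g. g : G ==> norm (g - mat 1) <= r ==> g : bd T"
proof -
 obtain e where e: "0 < e" "!!B :: real^'n^'n. invertible B ==> norm (B - mat 1) < e ==> norm (mi B - mi (mat 1)) < 1" using matrix_inv_near[OF inv[OF one] zero_less_one] by blast
 define T where "T = norm (mat 1 :: real^'n^'n) + 1 + e"
 have "g : bd T" if g: "g : G" "norm (g - mat 1) <= e / 2" for g
 proof -
  have "norm (mi g - mat 1) < 1" using e(2)[OF inv[OF g(1)]] g(2) e(1) by simp
  thus ?thesis using g e(1) norm_triangle_sub[of g "mat 1"] norm_triangle_sub[of "mi g" "mat 1"] by(simp add:bd_def T_def)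
 qed
 thus thesis using that[of "e / 2"] e(1) by auto
qed

end

context parabolic
begin

lemma conj_exp_prod: "conj t (exp_prod u n) = exp_prod (%j. Ad (flow (- t)) (u j)) n"
proof (induction n)
 case 0
 show ?case by(simp add:conj_def flow_cancel)
qed (simp add:conj_mult conj_exp)

text \<open>The contracted exponents decay geometrically with ratio \<open>q\<close>, so their sum
  is at most \<open>r L\<close>, whatever \<open>n\<close> and \<open>w\<close> are. The radius
  \<open>r\<close> is chosen so that \<open>exp (r L) = 1 + rh / B\<close>.\<close>

lemma contracted_exp_prod:
 assumes rh: "0 < rh"
 obtains r where "0 < r" "!!w n. ALL j. w j : gg & nproj (w j) = w j & norm (w j) < r ==>
  norm (exp_prod (%j. Ad (flow (real (Suc j))) (w j)) n - mat 1) <= rh"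
proof -
 obtain C dl where C: "0 < C" "0 < dl"
  "!!x s. x : gg ==> nproj x = x ==> 0 <= s ==> norm (Ad (flow s) x) <= C * exp (- (s * dl)) * norm x" using nproj_contraction by blast
 obtain A where A: "0 < A" "!!x :: real^'n^'n. norm (emat x) <= norm x * A" using bounded_linear.pos_bounded[OF bounded_linear_emat] by blast
 obtain B where B: "0 < B" "!!x :: (real^'n) endo. norm (mat_of x) <= norm x * B" using bounded_linear.pos_bounded[OF bounded_linear_mat_of] by blast
 define q where "q = exp (- dl)"
 have q: "0 < q" "q < 1" using C(2) by(auto simp: q_def)
 define L where "L = C * A / (1 - q)"
 have L: "0 < L" using C(1) A(1) q by(simp add:L_def)
 define r where "r = ln (1 + rh / B) / L"
 have r: "0 < r" using L rh B(1) by(simp add:r_def ln_gt_zero)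
 have "norm (exp_prod (%j. Ad (flow (real (Suc j))) (w j)) n - mat 1) <= rh"
  if w: "ALL j. w j : gg & nproj (w j) = w j & norm (w j) < r" for w n
 proof -
  let ?u = "%j. Ad (flow (real (Suc j))) (w j)"
  have "norm (emat (?u j)) <= C * A * r * q ^ j" for j
  proof -
   have "norm (?u j) <= C * exp (- (real (Suc j) * dl)) * norm (w j)" using w by(intro C(3)) auto
   also have "exp (- (real (Suc j) * dl)) = q * q ^ j" unfolding q_def by(simp flip: exp_of_nat_mult exp_add add: algebra_simps)
   also have "C * (q * q ^ j) * norm (w j) <= C * (1 * q ^ j) * r" using C(1) q w less_imp_le by(intro mult_mono mult_left_mono mult_right_mono) auto
   finally have "norm (?u j) * A <= C * q ^ j * r * A" using A(1) by(intro mult_right_mono) auto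
   thus ?thesis using A(2)[of "?u j"] by(simp add:mult_ac)
  qed
  hence "(\<Sum>j<n. norm (emat (?u j))) <= (\<Sum>j<n. C * A * r * q ^ j)" by(rule sum_mono)
  also have "... = C * A * r * (\<Sum>j<n. q ^ j)" by(simp add:sum_distrib_left)
  also have "(\<Sum>j<n. q ^ j) <= 1 / (1 - q)" using q sum_le_suminf[OF summable_geometric[of q], of "{..<n}"] suminf_geometric[of q] by simp
  hence "C * A * r * (\<Sum>j<n. q ^ j) <= C * A * r * (1 / (1 - q))" using C(1) A(1) r by(intro mult_left_mono) auto
  also have "... = ln (1 + rh / B)" using C(1) A(1) q by(simp add:r_def L_def)
  finally have "exp (\<Sum>j<n. norm (emat (?u j))) <= 1 + rh / B" using rh B(1) by(simp add:ln_ge_iff add_pos_pos)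
  hence "norm (emat (exp_prod ?u n) - 1) <= rh / B" using exp_prod_near_one[of ?u n] by linarith
  hence "norm (emat (exp_prod ?u n) - 1) * B <= rh" using B(1) by(simp add:field_simps)
  moreover have "mat_of (emat (exp_prod ?u n) - 1) = exp_prod ?u n - mat 1" by(simp add:linear_diff[OF linear_mat_of])
  ultimately show ?thesis using B(2)[of "emat (exp_prod ?u n) - 1"] by simp
 qed
 thus thesis using that r by blast
qed

end

section \<open>Shadowing\<close>

context boundary
begin

text \<open>The exact solutions of \<open>P (g b) = b^-1 P g\<close> are the maps sending
  \<open>g\<close> to \<open>g^-1 z\<close>. Here the relation is required up to \<open>et\<close>,
  and only for \<open>b\<close> in a bounded set.\<close>

definition quasi :: "(real^'n^'n => (real^'n^'n) set) => real => real => bool" where "quasi P R et \<longleftrightarrow> (ALL g:G. P g : M & (ALL b:bd R. d (P (g**b)) (act (mi b) (P g)) < et))"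

lemma quasi_mono: "quasi P R et ==> R' <= R ==> et <= et' ==> quasi P R' et'" unfolding quasi_def by(meson bd_mono less_le_trans)

lemma quasi_in: "quasi P R et ==> g : G ==> P g : M" by(simp add:quasi_def)

lemma quasiD: "quasi P R et ==> g : G ==> b : bd R ==> d (P (g**b)) (act (mi b) (P g)) < et" by(simp add:quasi_def)

lemma tri: "x : M ==> y : M ==> z : M ==> d x y < a ==> d y z < b ==> d x z < a + b" using mdist_triangle[of x m y z] by linarith

text \<open>Following the flow for one unit may expand the distance to the base, but the value
  remains in the chart, say \<open>pt (exp w)\<close>. Moving on by \<open>exp w\<close> brings it
  back to within the original error, so errors do not accumulate along the iteration.\<close>

lemma nproj_step:
 assumes quasi: "quasi P R et" and g: "g : G"
  and near: "!!x. x : M ==> d base x < ep ==> EX v:gg. nproj v = v & norm v < r & x = pt (mexp v)"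
  and u: "!!x y. x : M ==> y : M ==> d x y < et ==> d (act (flow (- 1)) x) (act (flow (- 1)) y) < ep / 2"
  and et: "et <= ep / 2" and R: "flow 1 : bd R" "!!v. v : gg ==> norm v <= r ==> mexp v : bd R"
  and P: "d (P g) base < et"
 shows "EX w. w : gg & nproj w = w & norm w < r & d (P (g**flow 1**mexp w)) base < et"
proof -
 have gf: "g**flow 1 : G" by(intro mult g flow_G)
 have in1: "P (g**flow 1) : M" "act (flow (- 1)) (P g) : M" using quasi_in[OF quasi] gf g by(auto intro: act_in flow_G)
 have "d (act (flow (- 1)) (P g)) (act (flow (- 1)) base) < ep / 2" by(rule u[OF quasi_in[OF quasi g] pt_in[OF one] P])
 moreover have "act (flow (- 1)) base = base" using base_QH[OF QH_flow] by(simp add:act_pt)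
 moreover have "d (P (g**flow 1)) (act (flow (- 1)) (P g)) < ep / 2" using quasiD[OF quasi g R(1)] et by(simp add:flow_inv)
 ultimately have "d (P (g**flow 1)) base < ep / 2 + ep / 2" using tri[OF in1 pt_in[OF one]] by metis
 then obtain w where w: "w : gg" "nproj w = w" "norm w < r" "P (g**flow 1) = pt (mexp w)" using near[OF in1(1)] mdist_commute[of m base] by auto
 have "d (P (g**flow 1**mexp w)) (act (mi (mexp w)) (P (g**flow 1))) < et" by(rule quasiD[OF quasi gf R(2)[OF w(1)]]) (use w(3) in simp)
 thus ?thesis using w by(auto simp: act_pt)
qed

text \<open>If \<open>P g = pt k\<close>, iterating \<open>nproj_step\<close> from
  \<open>g k\<close> gives \<open>a n = g k p_n flow n\<close>, with \<open>p_n\<close> a product of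
  contracted exponentials. A limit point \<open>q\<close> of these products replaces them all at
  once: \<open>g k q flow n = a n sg_n\<close> with \<open>sg_n\<close> uniformly near 1, so
  \<open>c = k q\<close> works. The bound \<open>S\<close> is chosen before \<open>ep\<close>, which
  the uniqueness argument requires.\<close>

lemma shadow_start: "EX S. ALL ep>0. EX R et. 0 < et & (ALL P. quasi P R et --> (ALL g:G. EX c:bd S. ALL n. d (P (g**c**flow (real n))) base < ep))"
proof -
 obtain rh0 T where T: "0 < rh0" "!!g. g : G ==> norm (g - mat 1) <= rh0 ==> g : bd T" using bd_near_one by blast
 obtain RK where RK: "K <= bd RK" using bd_compact[OF K(3,2)] by blast
 obtain S where S: "ALL g:bd RK. ALL h:bd T. g**h : bd S" using bd_mult by blast
 have "EX R et. 0 < et & (ALL P. quasi P R et --> (ALL g:G. EX c:bd S. ALL n. d (P (g**c**flow (real n))) base < ep))"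
  if ep: "0 < ep" for ep :: real
 proof -
  have e3: "0 < ep / 3" using ep by simp
  obtain dl1 where dl1: "0 < dl1" "!!g x y. g : bd T ==> x : M ==> y : M ==> d x y < dl1 ==> d (act g x) (act g y) < ep / 3" using act_uniform[OF e3] by metis
  obtain rh1 where rh1: "0 < rh1" "!!h. h : G ==> norm (h - mat 1) < rh1 ==> d base (pt h) < ep / 3" using pt_cont[OF one e3] by metis
  obtain rh2 where rh2: "0 < rh2" "!!B :: real^'n^'n. invertible B ==> norm (B - mat 1) < rh2 ==> norm (mi B - mi (mat 1)) < rh1"
   using matrix_inv_near[OF inv[OF one] rh1(1)] by blast
  define rh where "rh = min rh0 (rh2 / 2)"
  have rh: "0 < rh" "rh <= rh0" "rh < rh2" using T(1) rh2(1) by(auto simp: rh_def)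
  obtain r where r: "0 < r" "!!w n. ALL j. w j : gg & nproj (w j) = w j & norm (w j) < r ==>
   norm (exp_prod (%j. Ad (flow (real (Suc j))) (w j)) n - mat 1) <= rh" by(rule contracted_exp_prod[OF rh(1)]) blast
  obtain epN where epN: "0 < epN" "!!x. x : M ==> d base x < epN ==> EX v:gg. nproj v = v & norm v < r & x = pt (mexp v)" using base_nhd[OF r(1)] by metis
  obtain Rf where Rf: "{flow 1, flow (- 1)} <= bd Rf" using bd_compact[of "{flow 1, flow (- 1)}"] flow_G by auto
  have eN2: "0 < epN / 2" using epN(1) by simp
  obtain dl2 where dl2: "0 < dl2" "!!g x y. g : bd Rf ==> x : M ==> y : M ==> d x y < dl2 ==> d (act g x) (act g y) < epN / 2" using act_uniform[OF eN2] by metis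
  obtain Rv where Rv: "ALL v:gg. norm v <= r --> mexp v : bd Rv" using bd_exp by blast
  define R where "R = max (max RK Rf) (max Rv T)"
  define et where "et = min (min dl1 dl2) (min (epN / 2) (ep / 3))"
  have et: "0 < et" "et <= dl1" "et <= dl2" "et <= epN / 2" "et <= ep / 3" using dl1(1) dl2(1) eN2 e3 by(auto simp: et_def)
  have R: "flow 1 : bd R" "!!v. v : gg ==> norm v <= r ==> mexp v : bd R" "!!k. k : K ==> k : bd R" "!!s. s : bd T ==> s : bd R"
   using Rf Rv RK bd_mono unfolding R_def by(meson insert_subset subsetD max.cobounded1 max.cobounded2 order_trans)+
  have "EX c:bd S. ALL n. d (P (g**c**flow (real n))) base < ep" if quasi: "quasi P R et" and g: "g : G" for P g
  proof -
   obtain k where k: "k : K" "P g = pt k" using K_transitive[OF quasi_in[OF quasi g]] by blast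
   have kG: "k : G" using k K(2) by blast
   have start: "d (P (g**k)) base < et" using quasiD[OF quasi g R(3)[OF k(1)]] inv[OF kG] by(simp add:k(2) act_pt)
   have fl: "d (act (flow (- 1)) x) (act (flow (- 1)) y) < epN / 2"
    if "x : M" "y : M" "d x y < et" for x y by(rule dl2(2)) (use that Rf et(3) in auto)
   have "EX a. ALL n. (a n : G & d (P (a n)) base < et & (n = 0 --> a n = g**k)) &
     (EX w. w : gg & nproj w = w & norm w < r & a (Suc n) = a n**flow 1**mexp w)"
   proof (rule dependent_nat_choice)
    show "EX x. x : G & d (P x) base < et & ((0::nat) = 0 --> x = g**k)" using start g kG by(auto intro: mult)
    fix x and n :: nat assume x: "x : G & d (P x) base < et & (n = 0 --> x = g**k)"
    obtain w where w: "w : gg" "nproj w = w" "norm w < r" "d (P (x**flow 1**mexp w)) base < et" using nproj_step[OF quasi conjunct1[OF x] epN(2) fl et(4) R(1,2)] x by blast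
    show "EX y. (y : G & d (P y) base < et & (Suc n = 0 --> y = g**k)) &
     (EX w. w : gg & nproj w = w & norm w < r & y = x**flow 1**mexp w)" using w x by(intro exI[of _ "x**flow 1**mexp w"]) (auto intro!: mult flow_G lie_exp)
   qed
   then obtain a where a: "!!n. a n : G" "!!n. d (P (a n)) base < et" "a 0 = g**k"
    "!!n. EX w. w : gg & nproj w = w & norm w < r & a (Suc n) = a n**flow 1**mexp w" by blast
   from a(4) obtain w where w: "!!n. w n : gg" "!!n. nproj (w n) = w n" "!!n. norm (w n) < r"
    "!!n. a (Suc n) = a n**flow 1**mexp (w n)" by metis
   define u where "u j = Ad (flow (real (Suc j))) (w j)" for j
   have ug: "u j : gg" for j unfolding u_def by(intro Ad_gg flow_G w)
   define p where "p = exp_prod u"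
   have pG: "p n : G" for n unfolding p_def by(rule exp_prod_in[OF ug])
   have ap: "a n = g**k**p n**flow (real n)" for n
   proof (induction n)
    case (Suc n)
    have "a (Suc n) = g**k**p n**(flow (real n)**flow 1)**mexp (w n)" by(simp add:w(4) Suc mma)
    also have "flow (real n)**flow 1 = flow (real (Suc n))" by(simp add:flow_add[symmetric] add.commute)
    also have "g**k**p n**flow (real (Suc n))**mexp (w n) = g**k**p n**(flow (real (Suc n))**mexp (w n))" by(simp add:mma)
    also have "... = g**k**p (Suc n)**flow (real (Suc n))" by(simp add:flow_exp p_def u_def mma)
    finally show ?case .
   qed (simp add:a(3) p_def)
   \<comment> \<open>Conjugation by \<open>flow n\<close> turns the tail of the product into a
     product of the same shape for the shifted sequence \<open>w (n + j)\<close>, so the same bound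
     holds uniformly in \<open>n\<close>.\<close>
   have tail: "norm (conj (real n) (mi (p n)**p (n + i)) - mat 1) <= rh" for n i
   proof -
    have "mi (p n)**p (n + i) = exp_prod (%j. u (n + j)) i" using inv[OF pG] by(simp add:p_def exp_prod_add)
    hence "conj (real n) (mi (p n)**p (n + i)) = exp_prod (%j. Ad (flow (- real n)) (u (n + j))) i" by(simp add:conj_exp_prod)
    also have "(%j. Ad (flow (- real n)) (u (n + j))) = (%j. Ad (flow (real (Suc j))) (w (n + j)))" by(rule ext) (simp add:u_def Ad_flow_add[symmetric])
    finally show ?thesis using r(2)[of "%j. w (n + j)" i] w by simp
   qed
   have "p i : bd T" for i
   proof -
    have "conj (real 0) (mi (p 0)**p (0 + i)) = p i" by(simp add:conj_def p_def)
    hence "norm (p i - mat 1) <= rh0" using tail[of 0 i] rh(2) by simp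
    thus ?thesis using T(2)[OF pG] by blast
   qed
   then obtain q s where q: "q : bd T" "strict_mono s" "(p \<circ> s) ----> q" using seq_compactE[OF compact_imp_seq_compact[OF compact_bd]] by metis
   have qG: "q : G" by(rule bd_G[OF q(1)])
   define sg where "sg n = conj (real n) (mi (p n)**q)" for n
   have sgG: "sg n : G" for n unfolding sg_def by(intro conj_G mult minv pG qG)
   have sg: "norm (sg n - mat 1) <= rh" for n
   proof -
    have "(%i. conj (real n) (mi (p n)**(p \<circ> s) i) - mat 1) ----> sg n - mat 1" unfolding sg_def conj_def by(intro tendsto_diff mm.tendsto tendsto_const q(3))
    hence "(%i. norm (conj (real n) (mi (p n)**(p \<circ> s) i) - mat 1)) ----> norm (sg n - mat 1)" by(rule tendsto_norm)
    thus ?thesis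
    proof (rule LIMSEQ_le_const2, intro exI allI impI)
     fix i assume "n <= i"
     hence "n <= s i" using seq_suble[OF q(2), of i] by linarith
     then obtain l where "s i = n + l" using le_Suc_ex by blast
     thus "norm (conj (real n) (mi (p n)**(p \<circ> s) i) - mat 1) <= rh" using tail[of n l] by simp
    qed
   qed
   have "d (P (g**(k**q)**flow (real n))) base < ep" for n
   proof -
    have sgT: "sg n : bd T" using T(2)[OF sgG] sg[of n] rh(2) by simp
    have "a n**sg n = g**(k**q)**flow (real n)" using inv[OF pG[of n]] by(simp add:ap sg_def conj_def mms flow_cancel)
    hence 1: "d (P (g**(k**q)**flow (real n))) (act (mi (sg n)) (P (a n))) < ep / 3" using quasiD[OF quasi a(1) R(4)[OF sgT], of n] et(5) by simp
    have 2: "d (act (mi (sg n)) (P (a n))) (act (mi (sg n)) base) < ep / 3" using dl1(2)[OF bd_inv[OF sgT] quasi_in[OF quasi a(1)] pt_in[OF one]] a(2)[of n] et(2) by simp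
    have 3: "d (act (mi (sg n)) base) base < ep / 3" using rh1(2)[OF minv[OF sgG]] rh2(2)[OF inv[OF sgG[of n]]] sg[of n] rh(3) by(simp add:act_pt mdist_commute[of m _ base])
    have i: "P (g**(k**q)**flow (real n)) : M" "act (mi (sg n)) (P (a n)) : M" "act (mi (sg n)) base : M"
     by(intro quasi_in[OF quasi] act_in mult g kG qG flow_G minv sgG a pt_in one)+
    show ?thesis using tri[OF i(1,3) pt_in[OF one] tri[OF i 1 2] 3] by simp
   qed
   thus ?thesis using S RK k(1) q(1) by blast
  qed
  thus ?thesis using et(1) by blast
 qed
 thus ?thesis by blast
qed

text \<open>If the images of \<open>v\<close> under \<open>Ad (flow (- n))\<close> remained in the
  ball of radius \<open>r0\<close>, contraction would give \<open>v = 0\<close>. The first exit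
  overshoots by at most the factor \<open>La\<close>, hence \<open>r1 = r0 La\<close>. On the ball
  of radius \<open>r1\<close> the exponential is injective, so the annulus avoids
  \<open>QH\<close>.\<close>

lemma exp_escape:
 obtains r0 r1 where "0 < r0" "!!v. v : gg ==> nproj v = v ==> v ~= 0 ==> norm v < r0 ==>
   EX n. r0 <= norm (Ad (flow (- real n)) v) & norm (Ad (flow (- real n)) v) <= r1"
  "!!v. v : gg ==> nproj v = v ==> r0 <= norm v ==> norm v <= r1 ==> mexp v ~: QH"
proof -
 obtain La where L: "0 < La" "!!x. norm (Ad (flow (- 1)) x) <= norm x * La"
  using linear_Ad[of "flow (- 1)"] bounded_linear.pos_bounded unfolding linear_conv_bounded_linear by blast
 obtain r1 where r1: "0 < r1" "!!x y :: real^'n^'n. norm x <= r1 ==> norm y <= r1 ==>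
  norm (mexp x - mexp y - (x - y)) <= 1 / 2 * norm (x - y)" using mat_exp_near_0[of "1/2"] by auto
 define r0 where "r0 = r1 / La"
 have r0: "0 < r0" using r1(1) L(1) by(simp add:r0_def)
 show thesis
 proof (rule that[OF r0])
  fix v assume v: "v : gg" "nproj v = v" "v ~= 0" "norm v < r0"
  define x where "x n = Ad (flow (- real n)) v" for n
  have vx: "v = Ad (flow (real n)) (x n)" for n by(simp add:x_def Ad_flow_add[symmetric])
  have xg: "x n : gg" "nproj (x n) = x n" for n unfolding x_def using v by(auto intro!: Ad_gg flow_G simp: nproj_Ad_flow)
  have "EX n. r0 <= norm (x n)"
  proof (rule ccontr)
   assume "~ ?thesis"
   hence lt: "norm (x n) < r0" for n by(simp add:not_le)
   have "(%n. v) ----> 0" using contraction_tendsto[of x, OF xg less_imp_le[OF lt]] by(simp flip: vx)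
   hence "v = 0" using LIMSEQ_unique[OF tendsto_const] by blast
   thus False using v(3) by simp
  qed
  define n where "n = (LEAST n. r0 <= norm (x n))"
  have n: "r0 <= norm (x n)" unfolding n_def by(rule LeastI_ex) fact
  have "x 0 = v" by(simp add:x_def)
  hence "n ~= 0" using n v(4) by(metis not_le)
  then obtain k where k: "n = Suc k" using not0_implies_Suc by blast
  have "norm (x k) < r0" using not_less_Least[of k "%n. r0 <= norm (x n)"] k unfolding n_def[symmetric] by simp
  moreover have "x n = Ad (flow (- 1)) (x k)" by(simp add:x_def k Ad_flow_add[symmetric])
  ultimately have "norm (x n) <= r0 * La" using L mult_right_mono[of "norm (x k)" r0 La] by(metis less_eq_real_def order_trans)
  thus "EX n. r0 <= norm (Ad (flow (- real n)) v) & norm (Ad (flow (- real n)) v) <= r1" using n L(1) unfolding x_def by(auto simp: r0_def)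
 next
  fix v assume v: "v : gg" "nproj v = v" "r0 <= norm v" "norm v <= r1"
  show "mexp v ~: QH"
  proof
   assume "mexp v : QH"
   hence "mexp v = mat 1" by(rule nproj_QH_trivial[OF v(1,2)])
   thus False using r1(2)[of v 0] v(3,4) r0 r1(1) by simp
  qed
 qed
qed

text \<open>By compactness of the annulus. The sign is that of the later use, where a value of a
  quasi-equivariant map is displaced by the inverse of \<open>exp v\<close>.\<close>

lemma annulus_away:
 assumes out: "!!v. v : gg ==> nproj v = v ==> r0 <= norm v ==> norm v <= r1 ==> mexp v ~: QH"
 shows "EX e>0. ALL v:gg. nproj v = v --> r0 <= norm v --> norm v <= r1 --> e <= d base (pt (mexp (- v)))"
proof (rule ccontr)
 assume no: "~ ?thesis"
 have "EX v. v : gg & nproj v = v & r0 <= norm v & norm v <= r1 & d base (pt (mexp (- v))) < 1 / real (Suc n)" for n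
 proof -
  have "0 < 1 / real (Suc n)" by simp
  thus ?thesis using no by(meson not_le)
 qed
 then obtain v where v: "!!n. v n : gg" "!!n. nproj (v n) = v n" "!!n. r0 <= norm (v n)" "!!n. norm (v n) <= r1"
  "!!n. d base (pt (mexp (- v n))) < 1 / real (Suc n)" by metis
 have "ALL n. v n : cball 0 r1" using v(4) by simp
 then obtain l s where l: "strict_mono s" "(v \<circ> s) ----> l" using seq_compactE[OF compact_imp_seq_compact[OF compact_cball]] by metis
 have lg: "l : gg" using closed_sequentially[OF closed_subspace[OF gg_subspace] _ l(2)] v(1) by(simp add:o_def)
 have nt: "(%n. nproj ((v \<circ> s) n)) ----> nproj l" by(rule bounded_linear.tendsto[OF linear_nproj[unfolded linear_conv_bounded_linear] l(2)])
 have "(%n. nproj ((v \<circ> s) n)) = v \<circ> s" by(rule ext) (simp add:v(2))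
 with nt have ln: "nproj l = l" by(metis LIMSEQ_unique[OF l(2)])
 have nl: "(%n. norm ((v \<circ> s) n)) ----> norm l" by(rule tendsto_norm[OF l(2)])
 have nr: "r0 <= norm l" "norm l <= r1" using LIMSEQ_le_const[OF nl, of r0] LIMSEQ_le_const2[OF nl, of r1] v(3,4) by auto
 have "(%n. mexp (- (v \<circ> s) n)) ----> mexp (- l)" by(rule tendsto_mat_exp[OF tendsto_minus[OF l(2)]])
 hence a: "(%n. d (pt (mexp (- l))) (pt (mexp (- (v \<circ> s) n)))) ----> 0" by(intro pt_tendsto lie_exp subspace_neg[OF gg_subspace] lg) (simp_all add: v(1))
 have "(%n. 1 / real (Suc (s n))) ----> 0" using LIMSEQ_subseq_LIMSEQ[OF LIMSEQ_inverse_real_of_nat l(1)] by(simp add:o_def inverse_eq_divide)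
 hence b: "(%n. d base (pt (mexp (- (v \<circ> s) n)))) ----> 0" by(rule Lim_null_comparison[rotated]) (use v(5) in \<open>auto intro!: always_eventually less_imp_le\<close>)
 have "pt (mexp (- l)) = base" by(rule limit_eq[OF _ _ _ a b]) (simp_all add: one lie_exp subspace_neg[OF gg_subspace] lg v(1))
 hence "mexp (- l) : QH" by(intro pt_base lie_exp subspace_neg[OF gg_subspace] lg)
 from QH_inv[OF this] show False using out[OF lg ln nr] by simp
qed

text \<open>Closeness at time 0 puts \<open>pt c\<close> in the chart, so \<open>c = exp x q\<close>
  with \<open>q\<close> in \<open>QH\<close>. If \<open>x\<close> is not 0, let \<open>y\<close> be
  its image at an escape time \<open>n\<close>. The element \<open>f flow n exp y\<close> equals
  \<open>f c flow n b\<close> with \<open>b = conj n (q^-1)\<close>, which is bounded and lies in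
  \<open>QH\<close>. Evaluating \<open>P\<close> there through the first form gives a point near
  \<open>pt (exp (- y))\<close>, through the second a point near the base, contrary to
  \<open>annulus_away\<close>.\<close>

lemma shadow_unique: "EX R et ep. 0 < et & 0 < ep & (ALL P f c. quasi P R et --> f : G --> c : bd S --> (ALL n. d (P (f**flow (real n))) base < ep) -->
  (ALL n. d (P (f**c**flow (real n))) base < ep) --> pt c = base)"
proof -
 obtain r0 r1 where r0: "0 < r0" and esc: "!!v. v : gg ==> nproj v = v ==> v ~= 0 ==> norm v < r0 ==>
   EX n. r0 <= norm (Ad (flow (- real n)) v) & norm (Ad (flow (- real n)) v) <= r1"
  and out: "!!v. v : gg ==> nproj v = v ==> r0 <= norm v ==> norm v <= r1 ==> mexp v ~: QH" using exp_escape by metis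
 have "EX e>0. ALL v:gg. nproj v = v --> r0 <= norm v --> norm v <= r1 --> e <= d base (pt (mexp (- v)))" by(rule annulus_away[OF out])
 then obtain e4 where e4: "0 < e4" "!!v. v : gg ==> nproj v = v ==> r0 <= norm v ==> norm v <= r1 ==> e4 <= d base (pt (mexp (- v)))" by blast
 obtain epN where epN: "0 < epN" "!!x. x : M ==> d base x < epN ==> EX v:gg. nproj v = v & norm v < r0 & x = pt (mexp v)" using base_nhd[OF r0] by metis
 obtain Rv where Rv: "ALL v:gg. norm v <= max r0 r1 --> mexp v : bd Rv" using bd_exp by blast
 obtain S' where S': "ALL g:bd Rv. ALL h:bd S. g**h : bd S'" using bd_mult by blast
 obtain S'' where S'': "ALL g:QH \<inter> bd S'. ALL t>=0. conj t g : bd S''" using QH_bd_conj by blast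
 define R where "R = max S (max S'' Rv)"
 \<comment> \<open>Three estimates of size \<open>e\<close> place \<open>pt c\<close> in the chart,
   and four compare the base with the annulus.\<close>
 define e where "e = min (epN / 3) (e4 / 4)"
 have e: "0 < e" "3 * e <= epN" "4 * e <= e4" using epN(1) e4(1) by(auto simp: e_def)
 obtain dl where dl: "0 < dl" "!!g x y. g : bd R ==> x : M ==> y : M ==> d x y < dl ==> d (act g x) (act g y) < e" using act_uniform[OF e(1)] by metis
 define et where "et = min dl e"
 have et: "0 < et" "et <= dl" "et <= e" using dl(1) e(1) by(auto simp: et_def)
 have "pt c = base" if quasi: "quasi P R et" and f: "f : G" and c: "c : bd S"
  and near: "!!n. d (P (f**flow (real n))) base < et" "!!n. d (P (f**c**flow (real n))) base < et" for P f c
 proof -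
  have cG: "c : G" and cR: "c : bd R" using c bd_G bd_mono by(auto simp: R_def)
  have fc: "f**c : G" by(intro mult f cG)
  have "d (act c (P (f**c))) (act c (act (mi c) (P f))) < e"
   using dl(2)[OF cR quasi_in[OF quasi fc] act_in[OF minv[OF cG] quasi_in[OF quasi f]]] quasiD[OF quasi f cR] et(2) by simp
  hence 1: "d (P f) (act c (P (f**c))) < e" by(simp add:act_inv(1)[OF cG] mdist_commute)
  have "d (act c (P (f**c))) (act c base) < e" using dl(2)[OF cR quasi_in[OF quasi fc] pt_in[OF one]] near(2)[of 0] et(2) by simp
  hence 2: "d (act c (P (f**c))) (pt c) < e" by(simp add:act_pt)
  have 0: "d base (P f) < e" using near(1)[of 0] et(3) by(simp add:mdist_commute)
  have i: "P f : M" "act c (P (f**c)) : M" "pt c : M" "base : M" by(intro quasi_in[OF quasi] f fc act_in cG pt_in one)+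
  have "d base (pt c) < e + (e + e)" by(rule tri[OF i(4,1,3) 0 tri[OF i(1-3) 1 2]])
  then obtain x where x: "x : gg" "nproj x = x" "norm x < r0" "pt c = pt (mexp x)" using epN(2)[OF i(3)] e(2) by auto
  have ex: "mexp x : G" by(rule lie_exp[OF x(1)])
  define q where "q = mexp (- x)**c"
  have q: "q : QH" unfolding q_def using pt_eqD[OF ex, of c] x(4) by simp
  have "mexp (- x) : bd Rv" using Rv x(1,3) by(simp add:subspace_neg[OF gg_subspace])
  hence qb: "q : QH \<inter> bd S'" unfolding q_def using S' c q by(simp add:q_def)
  have "x = 0"
  proof (rule ccontr)
   assume "x ~= 0"
   then obtain n where n: "r0 <= norm (Ad (flow (- real n)) x)" "norm (Ad (flow (- real n)) x) <= r1" using esc x by blast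
   define y where "y = Ad (flow (- real n)) x"
   have y: "y : gg" "nproj y = y" unfolding y_def using x by(auto intro!: Ad_gg flow_G simp: nproj_Ad_flow)
   have yR: "mexp y : bd R" using Rv y(1) n(2) bd_mono[of "mexp y" Rv R] by(simp add:y_def[symmetric] R_def)
   define b where "b = conj (real n) (mi q)"
   have bi: "mi b = conj (real n) q" using inv[OF QH_G[OF q]] conj_inv[OF minv[OF QH_G[OF q]]] by(simp add:b_def)
   have "mi b : bd S''" using S'' qb bi by simp
   from bd_mono[OF this, of R] have biR: "mi b : bd R" by(simp add:R_def)
   have bG: "b : G" unfolding b_def by(intro conj_G minv QH_G q)
   have bR: "b : bd R" using bd_inv[OF biR] inv[OF bG] by simp
   have biQ: "mi b : QH" unfolding bi conj_def by(intro QH_mult QH_flow q)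
   let ?h = "f**flow (real n)**mexp y"
   have fl: "f**flow (real n) : G" "f**c**flow (real n) : G" by(intro mult f cG flow_G)+
   have hG: "?h : G" by(intro mult fl lie_exp y)
   have "flow (real n)**mexp y = mexp x**flow (real n)" unfolding flow_exp y_def by(simp add:Ad_flow_add[symmetric])
   hence "?h = f**(mexp x**flow (real n))" by(metis mma)
   also have "mexp x = c**mi q" using inv[OF cG] by(simp add:q_def matrix_inv_mult)
   also have "f**(c**mi q**flow (real n)) = f**c**flow (real n)**b" by(simp add:b_def conj_def mms flow_cancel)
   finally have hb: "?h = f**c**flow (real n)**b" .
   have A: "d (P ?h) (act (mexp (- y)) (P (f**flow (real n)))) < e" using quasiD[OF quasi fl(1) yR] et(3) by simp
   have B: "d (act (mexp (- y)) (P (f**flow (real n)))) (pt (mexp (- y))) < e"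
    using dl(2)[OF bd_inv[OF yR] quasi_in[OF quasi fl(1)] pt_in[OF one]] near(1)[of n] et(2) by(simp add:act_pt)
   have D: "d (P ?h) (act (mi b) (P (f**c**flow (real n)))) < e" using quasiD[OF quasi fl(2) bR] et(3) unfolding hb by simp
   have F: "d (act (mi b) (P (f**c**flow (real n)))) base < e" using dl(2)[OF biR quasi_in[OF quasi fl(2)] pt_in[OF one]] near(2)[of n] et(2) base_QH[OF biQ] by(simp add:act_pt)
   have j: "P ?h : M" "act (mexp (- y)) (P (f**flow (real n))) : M" "pt (mexp (- y)) : M"
    "act (mi b) (P (f**c**flow (real n))) : M" by(intro quasi_in[OF quasi] hG act_in fl pt_in lie_exp subspace_neg[OF gg_subspace] y minv bG)+
   have "d (P ?h) base < e + e" by(rule tri[OF j(1,4) i(4) D F])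
   hence "d base (P ?h) < e + e" by(simp add:mdist_commute)
   hence "d base (pt (mexp (- y))) < (e + e) + (e + e)" by(rule tri[OF i(4) j(1,3) _ tri[OF j(1-3) A B]])
   thus False using e4(2)[OF y] n e(3) by(simp add:y_def)
  qed
  thus ?thesis using x(4) by simp
 qed
 thus ?thesis using et(1) by blast
qed

lemma shadowing:
 assumes ep: "0 < ep"
 obtains R et where "0 < et" "!!P. quasi P R et ==> EX z:M. ALL g:G. d (act (mi g) z) (P g) < ep"
proof -
 obtain S where S: "ALL ep>0. EX R et. 0 < et & (ALL P. quasi P R et --> (ALL g:G. EX c:bd S. ALL n. d (P (g**c**flow (real n))) base < ep))" using shadow_start by blast
 obtain R1 where R1: "ALL u:gg. norm u <= 1 --> mexp u : bd R1" using bd_exp by blast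
 obtain S1 where S1: "ALL g:bd S. ALL h:bd R1. g**h : bd S1" using bd_mult by blast
 obtain S2 where S2: "ALL g:bd S1. ALL h:bd S. g**h : bd S2" using bd_mult by blast
 obtain RB etB epB where B: "0 < etB" "0 < epB" "!!P f c. quasi P RB etB ==> f : G ==> c : bd S2 ==> (ALL n. d (P (f**flow (real n))) base < epB) ==>
  (ALL n. d (P (f**c**flow (real n))) base < epB) ==> pt c = base" using shadow_unique[of S2] by blast
 have e2: "0 < ep / 2" using ep by simp
 obtain dl where dl: "0 < dl" "!!g x y. g : bd S ==> x : M ==> y : M ==> d x y < dl ==> d (act g x) (act g y) < ep / 2" using act_uniform[OF e2] by metis
 have "0 < min epB dl" using B(2) dl(1) by simp
 then obtain RA etA where A: "0 < etA" "!!P g. quasi P RA etA ==> g : G ==> EX c:bd S. ALL n. d (P (g**c**flow (real n))) base < min epB dl" using S by metis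
 define R where "R = max S (max RA RB)"
 define et where "et = min (ep / 2) (min etA etB)"
 have "EX z:M. ALL g:G. d (act (mi g) z) (P g) < ep" if quasi: "quasi P R et" for P
 proof -
  have qA: "quasi P RA etA" and qB: "quasi P RB etB" using quasi_mono[OF quasi] by(auto simp: R_def et_def)
  have "ALL g:G. EX c. c : bd S & (ALL n. d (P (g**c**flow (real n))) base < min epB dl)" using A(2)[OF qA] by blast
  from bchoice[OF this] obtain c where c: "!!g. g : G ==> c g : bd S" "!!g n. g : G ==> d (P (g**c g**flow (real n))) base < min epB dl" by blast
  have cG: "c g : G" if "g : G" for g using bd_G[OF c(1)[OF that]] .
  define z where "z = pt (c (mat 1))"
  have eq: "pt (g**c g) = z" if g: "g : G" for g
  proof (rule connected_exp_induct[OF conn zero_less_one one g, where P = "%g. pt (g**c g) = z"])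
   fix g u assume gu: "g : G" "u : gg" "norm u < 1" and IH: "pt (g**c g) = z"
   let ?g = "g**mexp u"
   have gG: "?g : G" by(intro mult gu lie_exp)
   \<comment> \<open>The bounded element leading from one shadowing sequence, at
     \<open>g c g\<close>, to the neighbouring one, at \<open>?g c ?g\<close>. Both stay near the
     base for all times, so uniqueness shows that \<open>b\<close> fixes the base point.\<close>
   define b where "b = mi (c g)**mexp u**c ?g"
   have bS: "b : bd S2" unfolding b_def using S1 S2 R1 gu c(1) gG bd_inv by simp
   have fb: "g**c g**b = ?g**c ?g" using inv[OF cG[OF gu(1)]] by(simp add:b_def mms)
   have "pt b = base"
   proof (rule B(3)[OF qB mult[OF gu(1) cG[OF gu(1)]] bS])
    show "ALL n. d (P (g**c g**flow (real n))) base < epB" using c(2)[OF gu(1)] by simp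
    show "ALL n. d (P (g**c g**b**flow (real n))) base < epB" unfolding fb using c(2)[OF gG] by simp
   qed
   hence "act (g**c g) (pt b) = act (g**c g) base" by simp
   thus "pt (?g**c ?g) = z" using IH by(simp add:act_pt fb)
  qed (simp add:z_def)
  have "d (act (mi g) z) (P g) < ep" if g: "g : G" for g
  proof -
   have gc: "g**c g : G" and cR: "mi (c g) : bd R" using mult[OF g cG[OF g]] bd_mono[OF bd_inv[OF c(1)[OF g]], of R] by(auto simp: R_def)
   have "d (P (g**c g**mi (c g))) (act (mi (mi (c g))) (P (g**c g))) < et" by(rule quasiD[OF quasi gc cR])
   hence 1: "d (act (c g) (P (g**c g))) (P g) < ep / 2" using inv[OF cG[OF g]] by(simp add:et_def mms mdist_commute)
   have "d base (P (g**c g)) < dl" using c(2)[OF g, of 0] by(simp add:mdist_commute)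
   hence 2: "d (act (c g) base) (act (c g) (P (g**c g))) < ep / 2" by(rule dl(2)[OF c(1)[OF g] pt_in[OF one] quasi_in[OF quasi gc]])
   have "act (mi g) z = act (c g) base" using eq[OF g] inv[OF g] by(simp add:act_pt flip: eq[OF g])
   moreover have "d (act (c g) base) (P g) < ep / 2 + ep / 2" by(rule tri[OF _ _ _ 2 1]) (intro act_in cG g pt_in one quasi_in[OF quasi] gc)+
   ultimately show ?thesis by simp
  qed
  moreover have "z : M" unfolding z_def by(intro pt_in cG one)
  ultimately show ?thesis by blast
 qed
 moreover have "0 < et" using e2 A(1) B(1) by(simp add:et_def)
 ultimately show thesis using that by blast
qed

end

section \<open>Topology of the boundary: continuity, compactness, finite nets\<close>

lemma m_inv_grp:
 assumes "A : G" "mi A : G" "invertible A" shows "inv\<^bsub>grp G\<^esub> A = mi A" unfolding m_inv_def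
proof (rule the_equality)
 show "mi A : carrier (grp G) & A \<otimes>\<^bsub>grp G\<^esub> mi A = \<one>\<^bsub>grp G\<^esub> & mi A \<otimes>\<^bsub>grp G\<^esub> A = \<one>\<^bsub>grp G\<^esub>"
  using assms by(simp add:GL_def)
 show "B = mi A" if "B : carrier (grp G) & A \<otimes>\<^bsub>grp G\<^esub> B = \<one>\<^bsub>grp G\<^esub> & B \<otimes>\<^bsub>grp G\<^esub> A = \<one>\<^bsub>grp G\<^esub>" for B
  using that matrix_inv_eqI[of A B] by(simp add:GL_def)
qed

context boundary
begin

lemma continuous_map_iff: "continuous_map (mtopology_of m) (mtopology_of m) f \<longleftrightarrow>
  f ` M <= M & (ALL a:M. ALL ep>0. EX dl>0. ALL x. x : M & d a x < dl --> d (f a) (f x) < ep)" unfolding mtopology_of_def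
 by(rule Metric_space.metric_continuous_map[OF Metric_space_mspace_mdist Metric_space_mspace_mdist])

lemma singleton_bd: "g : G ==> EX R. g : bd R" using bd_compact[of "{g}"] by auto

lemma act_continuous: assumes g: "g : G" shows "continuous_map (mtopology_of m) (mtopology_of m) (act g)" unfolding continuous_map_iff
proof (intro conjI ballI allI impI)
 show "act g ` M <= M" using act_in[OF g] by blast
 fix a and e :: real assume a: "a : M" and e: "0 < e"
 obtain R where R: "g : bd R" using singleton_bd[OF g] by blast
 obtain r where "0 < r" "!!g x y. g : bd R ==> x : M ==> y : M ==> d x y < r ==> d (act g x) (act g y) < e" using act_uniform[OF e] by metis
 thus "EX dl>0. ALL x. x : M & d a x < dl --> d (act g a) (act g x) < e" using R a by blast
qed

lemma convergent_subsequence: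
 assumes x: "!!n. x n : M"
 obtains l r where "l : M" "strict_mono (r :: nat => nat)" "(%n. d l (x (r n))) ----> 0"
proof -
 have "ALL n. EX k. k : K & x n = pt k" using K_transitive[OF x] by blast
 from choice[OF this] obtain k where k: "!!n. k n : K" "!!n. x n = pt (k n)" by blast
 obtain l r where r: "l : K" "strict_mono r" "(k \<circ> r) ----> l" using seq_compactE[OF compact_imp_seq_compact[OF K(3)]] k(1) by metis
 have lG: "l : G" using r(1) K(2) by blast
 have "(%n. d (pt l) (pt ((k \<circ> r) n))) ----> 0" using k(1) K(2) by(intro pt_tendsto lG r(3)) auto
 hence "(%n. d (pt l) (x (r n))) ----> 0" by(simp add:k(2))
 thus thesis using that pt_in[OF lG] r(2) by blast
qed

lemma compact_boundary: "compact_space (mtopology_of m)"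
proof -
 have "continuous_map (top_of_set G) (mtopology_of m) pt" unfolding continuous_map_def using open_iff by auto
 moreover have "compactin (top_of_set G) K" using K(2,3) by(simp add:compactin_subtopology)
 ultimately have "compactin (mtopology_of m) (pt ` K)" by(rule image_compactin[rotated])
 moreover have "pt ` K = M" using K_transitive pt_in K(2) by blast
 ultimately show ?thesis by(simp add:compact_space_def)
qed

lemma finite_net:
 assumes "0 < r" obtains F where "finite F" "F <= M" "!!x. x : M ==> EX a:F. d a x < r"
proof -
 let ?U = "(%a. mball_of m a r) ` M"
 have "(ALL U:?U. openin (mtopology_of m) U) & \<Union> ?U = topspace (mtopology_of m)" using open_ball assms by auto
 then obtain \<F> where F: "finite \<F>" "\<F> <= ?U" "\<Union> \<F> = M" using compact_boundary unfolding compact_space by(metis topspace_mtopology_of)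
 obtain F where f: "F <= M" "finite F" "\<F> = (%a. mball_of m a r) ` F" using finite_subset_image[OF F(1,2)] by blast
 have "EX a:F. d a x < r" if "x : M" for x
 proof -
  have "x : (\<Union>a\<in>F. mball_of m a r)" using F(3) that unfolding f(3) by simp
  thus ?thesis by auto
 qed
 thus thesis using that f by blast
qed

end

section \<open>Uniform lattices and perturbed actions\<close>

locale lattice = boundary G K H E mu x0 Q m for G K :: "(real^'n^'n) set" and H E mu x0 Q m +
 fixes Gam :: "(real^'n^'n) set"
 assumes lattice: "uniform_lattice Gam G"
begin

lemma Gam_G: "gm : Gam ==> gm : G" using lattice subgroup.subset[of Gam "grp G"] by(auto simp: uniform_lattice_def)

lemma Gam_one: "mat 1 : Gam" using lattice subgroup.one_closed[of Gam "grp G"] by(simp add:uniform_lattice_def GL_def)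

lemma Gam_mult: "gm : Gam ==> bb : Gam ==> gm**bb : Gam" using lattice subgroup.m_closed[of Gam "grp G" gm bb] by(simp add:uniform_lattice_def GL_def)

lemma Gam_inv: "gm : Gam ==> mi gm : Gam" using lattice subgroup.m_inv_closed[of Gam "grp G" gm] m_inv_grp[of gm G] Gam_G[of gm] minv[of gm] inv[of gm]
 by(simp add:uniform_lattice_def)

text \<open>An injective sequence in a compact set has a convergent subsequence; the quotients of
  consecutive terms tend to 1, which is isolated in the lattice.\<close>

lemma Gam_finite: "finite (Gam \<inter> bd R)"
proof (rule ccontr)
 assume "infinite (Gam \<inter> bd R)"
 then obtain f :: "nat => real^'n^'n" where f: "inj f" "range f <= Gam \<inter> bd R" using infinite_countable_subset by blast
 have "ALL n. f n : bd R" using f(2) by blast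
 then obtain l r where r: "l : bd R" "strict_mono r" "(f \<circ> r) ----> l" using seq_compactE[OF compact_imp_seq_compact[OF compact_bd]] by metis
 have lG: "l : G" by(rule bd_G[OF r(1)])
 have fG: "f n : G" for n using f(2) bd_G by blast
 have "continuous_on G mi" using continuous_on_matrix_inv[OF continuous_on_id] inv by blast
 hence "(%n. mi (f (r n))) ----> mi l" using r(3) lG fG unfolding continuous_on_sequentially by(auto simp: o_def)
 moreover have "(%n. f (r (Suc n))) ----> l" using LIMSEQ_Suc[OF r(3)] by(simp add:o_def)
 ultimately have "(%n. mi (f (r n))**f (r (Suc n))) ----> mi l**l" by(rule mm.tendsto)
 hence lim: "(%n. mi (f (r n))**f (r (Suc n))) ----> mat 1" using inv[OF lG] by simp
 have "mat 1 isolated_in Gam" using lattice Gam_one by(auto simp: uniform_lattice_def discrete_def)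
 then obtain U where U: "open U" "U \<inter> Gam = {mat 1}" by(auto simp: isolated_in_def)
 have "\<forall>\<^sub>F n in sequentially. mi (f (r n))**f (r (Suc n)) : U" using topological_tendstoD[OF lim U(1)] U(2) by blast
 then obtain n where "mi (f (r n))**f (r (Suc n)) : U" unfolding eventually_sequentially by blast
 moreover have "mi (f (r n))**f (r (Suc n)) : Gam" using f(2) by(intro Gam_mult Gam_inv) auto
 ultimately have "mi (f (r n))**f (r (Suc n)) = mat 1" using U(2) by blast
 hence "f (r n)**(mi (f (r n))**f (r (Suc n))) = f (r n)" by simp
 hence "f (r (Suc n)) = f (r n)" using inv[OF fG] by simp
 hence "r (Suc n) = r n" using f(1) by(simp add:inj_eq)
 thus False using strict_monoD[OF r(2), of n "Suc n"] by simp
qed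

text \<open>The images of bounded open parts of \<open>G\<close> form an increasing open cover of
  the compact quotient, so one of them is everything. The cosets have the lattice on the right;
  applying this to \<open>g^-1\<close> moves the lattice element to the left.\<close>

lemma cocompact: "EX R. ALL g:G. EX gm:Gam. gm**g : bd R"
proof -
 have lc: "g <#\<^bsub>GL\<^esub> Gam = (%gm. g**gm) ` Gam" for g by(auto simp: l_coset_def GL_def)
 have le: "EX gm:Gam. h = g**gm" if "h <#\<^bsub>GL\<^esub> Gam = g <#\<^bsub>GL\<^esub> Gam" for g h
 proof -
  have "h**mat 1 : (%gm. g**gm) ` Gam" using that Gam_one unfolding lc by blast
  thus ?thesis by auto
 qed
 have el: "(h**gm) <#\<^bsub>GL\<^esub> Gam = h <#\<^bsub>GL\<^esub> Gam" if gm: "gm : Gam" for h gm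
 proof -
  have "(%bb. gm**bb) ` Gam = Gam"
  proof (intro equalityI subsetI)
   fix bb assume "bb : Gam"
   hence "bb = gm**(mi gm**bb)" "mi gm**bb : Gam" using inv[OF Gam_G[OF gm]] by(auto intro: Gam_mult Gam_inv gm)
   thus "bb : (%bb. gm**bb) ` Gam" by blast
  qed (use Gam_mult gm in auto)
  moreover have "(h**gm) <#\<^bsub>GL\<^esub> Gam = (%bb. h**bb) ` (%bb. gm**bb) ` Gam" by(simp add:lc image_image mma)
  ultimately show ?thesis by(simp add:lc)
 qed
 define U where "U n = (%g. g <#\<^bsub>GL\<^esub> Gam) ` {g : G. norm g < real n & norm (mi g) < real n}" for n :: nat
 have Uo: "openin (coset_topology G Gam) (U n)" for n unfolding openin_coset_topology
 proof
  show "U n <= lcosets\<^bsub>grp G\<^esub> Gam" by(auto simp: U_def LCOSETS_def l_coset_def)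
  show "openin (top_of_set G) {g : G. g <#\<^bsub>GL\<^esub> Gam : U n}"
  proof (subst openin_subopen, intro ballI)
   fix h assume "h : {g : G. g <#\<^bsub>GL\<^esub> Gam : U n}"
   then obtain g where g: "h : G" "g : G" "norm g < real n" "norm (mi g) < real n" "h <#\<^bsub>GL\<^esub> Gam = g <#\<^bsub>GL\<^esub> Gam" by(auto simp: U_def)
   obtain gm where gm: "gm : Gam" "h = g**gm" using le[OF g(5)] by blast
   have gmi: "invertible gm" using inv[OF Gam_G[OF gm(1)]] .
   let ?V = "{x : G. max (norm (x**mi gm)) (norm (gm**mi x)) < real n}"
   have "continuous_on G (%x. max (norm (x**mi gm)) (norm (gm**mi x)))" by(intro continuous_intros continuous_on_matrix_inv inv)
   from continuous_openin_preimage_gen[OF this open_lessThan[of "real n"]]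
   have "openin (top_of_set G) ?V" by(simp add:vimage_def Int_def)
   moreover have "h : ?V" using g gm gmi inv[OF g(2)] by(simp add:matrix_inv_mult mms)
   moreover have "?V <= {g : G. g <#\<^bsub>GL\<^esub> Gam : U n}"
   proof
    fix x assume x: "x : ?V"
    hence "x**mi gm : {g : G. norm g < real n & norm (mi g) < real n}" using gmi inv[of x] Gam_G[OF gm(1)] by(auto simp: matrix_inv_mult intro!: mult minv)
    hence "(x**mi gm) <#\<^bsub>GL\<^esub> Gam : U n" unfolding U_def by(rule imageI)
    thus "x : {g : G. g <#\<^bsub>GL\<^esub> Gam : U n}" using el[OF Gam_inv[OF gm(1)]] x by simp
   qed
   ultimately show "EX T. openin (top_of_set G) T & h : T & T <= {g : G. g <#\<^bsub>GL\<^esub> Gam : U n}" by blast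
  qed
 qed
 have Um: "U n <= U k" if "n <= k" for n k unfolding U_def using that by fastforce
 have Uc: "\<Union> (range U) = lcosets\<^bsub>grp G\<^esub> Gam"
 proof (intro equalityI subsetI)
  fix X assume "X : lcosets\<^bsub>grp G\<^esub> Gam"
  then obtain g where g: "g : G" "X = g <#\<^bsub>GL\<^esub> Gam" by(auto simp: LCOSETS_def l_coset_def)
  obtain n :: nat where "max (norm g) (norm (mi g)) < real n" using reals_Archimedean2 by blast
  hence "X : U n" using g by(auto simp: U_def)
  thus "X : \<Union> (range U)" by blast
 qed (auto simp: U_def LCOSETS_def l_coset_def)
 have "compact_space (coset_topology G Gam)" using lattice by(simp add:uniform_lattice_def)
 moreover have "(ALL V:range U. openin (coset_topology G Gam) V) & \<Union> (range U) = topspace (coset_topology G Gam)" using Uo Uc by simp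
 ultimately obtain \<F> where F: "finite \<F>" "\<F> <= range U" "\<Union> \<F> = lcosets\<^bsub>grp G\<^esub> Gam" unfolding compact_space by(metis topspace_coset_topology)
 obtain N where N: "finite N" "\<F> = U ` N" using finite_subset_image[OF F(1,2)] by blast
 define n0 where "n0 = Max (insert 0 N)"
 have "EX gm:Gam. gm**g : bd (real n0)" if g: "g : G" for g
 proof -
  have "mi g <#\<^bsub>GL\<^esub> Gam : lcosets\<^bsub>grp G\<^esub> Gam" using minv[OF g] by(auto simp: LCOSETS_def l_coset_def)
  then obtain n where n: "n : N" "mi g <#\<^bsub>GL\<^esub> Gam : U n" using F(3) N(2) by auto
  have "n <= n0" unfolding n0_def using N(1) n(1) by simp
  hence "mi g <#\<^bsub>GL\<^esub> Gam : U n0" using n(2) Um by blast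
  then obtain h where h: "h : G" "norm h < real n0" "norm (mi h) < real n0" "mi g <#\<^bsub>GL\<^esub> Gam = h <#\<^bsub>GL\<^esub> Gam" by(auto simp: U_def)
  obtain gm where gm: "gm : Gam" "mi g = h**gm" using le[OF h(4)] by blast
  have "mi h**(mi g**g) = gm**g" unfolding gm(2) using inv[OF h(1)] by(simp add:mma)
  hence "gm**g = mi h" using inv[OF g] by simp
  thus ?thesis using h inv[OF h(1)] minv[OF h(1)] gm(1) by(intro bexI[of _ gm]) (auto simp: bd_def)
 qed
 thus ?thesis by blast
qed

definition gact :: "(real^'n^'n => (real^'n^'n) set => (real^'n^'n) set) => bool" where "gact rh \<longleftrightarrow> (ALL gm:Gam. continuous_map (mtopology_of m) (mtopology_of m) (rh gm)) &
  (ALL gm:Gam. ALL bb:Gam. ALL x:M. rh (gm**bb) x = rh gm (rh bb x)) & (ALL x:M. rh (mat 1) x = x)"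

lemma gact_in: "gact rh ==> gm : Gam ==> x : M ==> rh gm x : M" unfolding gact_def continuous_map_iff by blast

lemma gact_mult: "gact rh ==> gm : Gam ==> bb : Gam ==> x : M ==> rh (gm**bb) x = rh gm (rh bb x)" by(simp add:gact_def)

definition close :: "(real^'n^'n) set => real => (real^'n^'n => (real^'n^'n) set => (real^'n^'n) set) => bool" where "close F ep rh \<longleftrightarrow> (ALL gm:F. ALL x:M. d (rh gm x) (act gm x) < ep)"

text \<open>The perturbed orbit of \<open>x\<close> extends from \<open>\<Gamma>\<close> to all of \<open>G\<close> as the map
 \<open>g \<mapsto> (c g)\<^sup>-\<^sup>1 \<rho>(c) x\<close>, where \<open>c = c(g) \<in> \<Gamma>\<close> moves \<open>g\<close> into a fixed compact set.\<close>

lemma almost_equivariant_extension: "EX c. (ALL g:G. c g : Gam) & (ALL gm:Gam. c gm = mi gm) & (ALL R et. 0 < et -->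
  (EX F ep. finite F & F <= Gam & 0 < ep & (ALL rh x. gact rh --> close F ep rh --> x : M -->
    quasi (%g. act (mi (c g**g)) (rh (c g) x)) R et)))"
proof -
 obtain R1 where R1: "ALL g:G. EX gm:Gam. gm**g : bd R1" using cocompact by blast
 obtain R2 where R2: "mat 1 : bd R2" using singleton_bd[OF one] by blast
 define R0 where "R0 = max R1 R2"
 have "ALL g:G. EX c. c : Gam & c**g : bd R0 & (g : Gam --> c = mi g)"
 proof
  fix g assume g: "g : G"
  show "EX c. c : Gam & c**g : bd R0 & (g : Gam --> c = mi g)"
  proof (cases "g : Gam")
   case True
   thus ?thesis using R2 bd_mono[OF R2, of R0] inv[OF g] by(intro exI[of _ "mi g"]) (auto simp: R0_def Gam_inv)
  next
   case False
   obtain gm where "gm : Gam" "gm**g : bd R1" using R1 g by blast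
   thus ?thesis using False bd_mono[of "gm**g" R1 R0] by(auto simp: R0_def)
  qed
 qed
 from bchoice[OF this] obtain c where c: "!!g. g : G ==> c g : Gam" "!!g. g : G ==> c g**g : bd R0" "!!gm. gm : Gam ==> c gm = mi gm" using Gam_G by blast
 have "EX F ep. finite F & F <= Gam & 0 < ep & (ALL rh x. gact rh --> close F ep rh --> x : M -->
    quasi (%g. act (mi (c g**g)) (rh (c g) x)) R et)" if et: "0 < et" for R et :: real
 proof -
  obtain T1 where T1: "ALL g:bd R0. ALL h:bd R. g**h : bd T1" using bd_mult by blast
  obtain T2 where T2: "ALL g:bd R0. ALL h:bd T1. g**h : bd T2" using bd_mult by blast
  \<comment> \<open>Two lattice elements chosen for \<open>g\<close> and \<open>g b\<close>, with
    \<open>b\<close> in \<open>bd R\<close>, differ by a bounded factor, so only these finitely many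
    elements have to be compared.\<close>
  define F where "F = Gam \<inter> bd T2"
  obtain ep where ep: "0 < ep" "!!g x y. g : bd R0 ==> x : M ==> y : M ==> d x y < ep ==> d (act g x) (act g y) < et" using act_uniform[OF et] by metis
  have "quasi (%g. act (mi (c g**g)) (rh (c g) x)) R et" if rh: "gact rh" "close F ep rh" and x: "x : M" for rh x unfolding quasi_def
  proof (intro ballI conjI)
   fix g assume g: "g : G"
   have cG: "c g : G" by(intro Gam_G c g)
   have y: "rh (c g) x : M" by(rule gact_in[OF rh(1) c(1)[OF g] x])
   show "act (mi (c g**g)) (rh (c g) x) : M" by(rule act_in[OF minv[OF mult[OF cG g]] y])
   fix b assume b: "b : bd R"
   have bG: "b : G" and gb: "g**b : G" using bd_G[OF b] by(auto intro: mult g)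
   define c' where "c' = c (g**b)"
   have c': "c' : Gam" "c'**(g**b) : bd R0" "c' : G" using c gb Gam_G by(auto simp: c'_def)
   define dl where "dl = c'**mi (c g)"
   have dlGam: "dl : Gam" unfolding dl_def by(intro Gam_mult Gam_inv c' c g)
   have i: "invertible (c g)" "invertible g" "invertible b" using inv cG g bG by auto
   have "dl = (c'**(g**b))**(mi b**mi (c g**g))" using i by(simp add:dl_def matrix_inv_mult mms)
   moreover have "mi b**mi (c g**g) = mi (c g**g**b)" using i by(simp add:matrix_inv_mult invertible_mult)
   moreover have "mi (c g**g**b) : bd T1" using T1 c(2)[OF g] b by(intro bd_inv) simp
   ultimately have "dl : bd T2" using T2 c'(2) by simp
   hence F: "dl : F" using dlGam by(simp add:F_def)
   have "dl**c g = c'" using i by(simp add:dl_def mms)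
   hence "rh c' x = rh dl (rh (c g) x)" using gact_mult[OF rh(1) dlGam c(1)[OF g] x] by simp
   hence "d (rh c' x) (act dl (rh (c g) x)) < ep" using rh(2) F y by(simp add:close_def)
   hence "d (act (mi (c'**(g**b))) (rh c' x)) (act (mi (c'**(g**b))) (act dl (rh (c g) x))) < et"
    by(rule ep(2)[OF bd_inv[OF c'(2)] gact_in[OF rh(1) c'(1) x] act_in[OF Gam_G[OF dlGam] y]])
   moreover have "mi (c'**(g**b))**dl = mi b**mi (c g**g)" using i inv[OF c'(3)] by(simp add:dl_def matrix_inv_mult invertible_mult mms)
   ultimately show "d (act (mi (c (g**b)**(g**b))) (rh (c (g**b)) x)) (act (mi b) (act (mi (c g**g)) (rh (c g) x))) < et" by(simp add:act_act flip: c'_def)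
  qed
  moreover have "finite F" "F <= Gam" unfolding F_def using Gam_finite by auto
  ultimately show ?thesis using ep(1) by blast
 qed
 thus ?thesis using c by blast
qed

text \<open>On the lattice the extension reproduces the orbit exactly: since \<open>c\<close>
  inverts elements of \<open>Gam\<close>, its value at \<open>gm^-1\<close> is
  \<open>rh gm x\<close>.\<close>

lemma lattice_shadowing:
 assumes e: "0 < e"
 obtains F ep where "finite F" "F <= Gam" "0 < ep"
  "!!rh x. gact rh ==> close F ep rh ==> x : M ==> EX z:M. ALL gm:Gam. d (act gm z) (rh gm x) < e"
proof -
 obtain c where c: "ALL g:G. c g : Gam" "ALL gm:Gam. c gm = mi gm" and ex: "ALL R et. 0 < et -->
  (EX F ep. finite F & F <= Gam & 0 < ep & (ALL rh x. gact rh --> close F ep rh --> x : M -->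
    quasi (%g. act (mi (c g**g)) (rh (c g) x)) R et))" using almost_equivariant_extension by blast
 obtain R et where R: "0 < et" "!!P. quasi P R et ==> EX z:M. ALL g:G. d (act (mi g) z) (P g) < e" using shadowing[OF e] by metis
 from mp[OF spec[OF spec[OF ex, of R]] R(1)] obtain F ep where F: "finite F" "F <= Gam" "0 < ep"
  and q: "ALL rh x. gact rh --> close F ep rh --> x : M --> quasi (%g. act (mi (c g**g)) (rh (c g) x)) R et" by(elim exE conjE) (rule that; assumption)
 have "EX z:M. ALL gm:Gam. d (act gm z) (rh gm x) < e" if rh: "gact rh" "close F ep rh" and x: "x : M" for rh x
 proof -
  obtain z where z: "z : M" "ALL g:G. d (act (mi g) z) (act (mi (c g**g)) (rh (c g) x)) < e" using R(2) q rh x by blast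
  have "d (act gm z) (rh gm x) < e" if gm: "gm : Gam" for gm
  proof -
   have i: "invertible gm" by(rule inv[OF Gam_G[OF gm]])
   have "c (mi gm) = gm" using c(2) Gam_inv[OF gm] i by simp
   thus ?thesis using bspec[OF z(2) minv[OF Gam_G[OF gm]]] i by simp
  qed
  thus ?thesis using z(1) by blast
 qed
 thus thesis using that F by blast
qed

text \<open>Any \<open>g\<close> is a bounded element times a lattice element, so closeness along
  \<open>Gam\<close> gives closeness along \<open>G\<close>, by uniform continuity.\<close>

lemma lattice_expansive:
 obtains e where "0 < e" "!!x y. x : M ==> y : M ==> (!!gm. gm : Gam ==> d (act gm x) (act gm y) <= e) ==> x = y"
proof -
 obtain e where e: "0 < e" "!!x y. x : M ==> y : M ==> (!!g. g : G ==> d (act g x) (act g y) <= e) ==> x = y" by(rule expansive) blast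
 obtain R where R: "ALL g:G. EX gm:Gam. gm**g : bd R" using cocompact by blast
 obtain r where r: "0 < r" "!!g x y. g : bd R ==> x : M ==> y : M ==> d x y < r ==> d (act g x) (act g y) < e" using act_uniform[OF e(1)] by metis
 show thesis
 proof (rule that[of "r / 2"])
  fix x y assume x: "x : M" and y: "y : M" and c: "!!gm. gm : Gam ==> d (act gm x) (act gm y) <= r / 2"
  show "x = y"
  proof (rule e(2)[OF x y])
   fix g assume g: "g : G"
   obtain gm where gm: "gm : Gam" "gm**mi g : bd R" using R minv[OF g] by blast
   have gG: "gm : G" by(rule Gam_G[OF gm(1)])
   have "d (act gm x) (act gm y) < r" using c[OF gm(1)] r(1) by linarith
   hence "d (act (mi (gm**mi g)) (act gm x)) (act (mi (gm**mi g)) (act gm y)) < e" by(intro r(2) bd_inv gm act_in gG x y)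
   moreover have "mi (gm**mi g)**gm = g" using inv[OF gG] inv[OF g] by(simp add:matrix_inv_mult mms)
   ultimately show "d (act g x) (act g y) <= e" by(simp add:act_act)
  qed
 qed (use r(1) in simp)
qed

text \<open>Contraction lets \<open>g flow n\<close> map a fixed ball around the base point into a
  given small ball outside \<open>Z\<close>. A lattice element turns \<open>g flow n\<close> into a
  bounded \<open>h\<close>, at the cost of a factor that preserves \<open>Z\<close>. So
  \<open>Z\<close> misses a ball around \<open>pt h\<close> whose radius depends only on the
  bound.\<close>

lemma invariant_gap:
 obtains dl where "0 < dl" "!!Z. openin (mtopology_of m) (M - Z) ==> (!!gm z. gm : Gam ==> z : Z ==> act gm z : Z) ==>
  Z <= M ==> Z ~= M ==> EX y:M. ALL z:Z. dl <= d y z"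
proof -
 obtain rh where rh: "0 < rh" "!!x. x : M ==> d base x < rh ==> EX v:gg. nproj v = v & norm v < 1 & x = pt (mexp v)" using base_nhd[OF zero_less_one] by metis
 obtain R where R: "ALL g:G. EX gm:Gam. gm**g : bd R" using cocompact by blast
 obtain dl where dl: "0 < dl" "!!g x y. g : bd R ==> x : M ==> y : M ==> d x y < dl ==> d (act g x) (act g y) < rh" using act_uniform[OF rh(1)] by metis
 show thesis
 proof (rule that[OF dl(1)])
  fix Z assume o: "openin (mtopology_of m) (M - Z)" and inv': "!!gm z. gm : Gam ==> z : Z ==> act gm z : Z"
   and Z: "Z <= M" "Z ~= M"
  obtain w where w: "w : M - Z" using Z by blast
  obtain r where r: "0 < r" "!!y. y : M ==> d w y < r ==> y : M - Z" using open_contains_ball[OF o w] by metis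
  obtain g where g: "g : G" "w = pt g" using w by(auto simp: mspace_eq)
  obtain r1 where r1: "0 < r1" "!!h. h : G ==> norm (h - g) < r1 ==> d (pt g) (pt h) < r" using pt_cont[OF g(1) r(1)] by metis
  have "continuous_on UNIV (%v. g**mexp v)" by(intro continuous_intros)
  from this[unfolded continuous_on_iff, rule_format, of 0, OF _ r1(1)]
  obtain r2 where r2: "0 < r2" "!!v :: real^'n^'n. norm v < r2 ==> norm (g**mexp v - g) < r1" by(auto simp: dist_norm)
  obtain n where n: "!!v. v : gg ==> nproj v = v ==> norm v <= 1 ==> norm (Ad (flow (real n)) v) < r2" using contraction_uniform[OF r2(1), of 1] by blast
  have far: "act (g**flow (real n)) x ~: Z" if x: "x : M" "d base x < rh" for x
  proof -
   obtain v where v: "v : gg" "nproj v = v" "norm v < 1" "x = pt (mexp v)" using rh(2)[OF x] by blast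
   have "act (g**flow (real n)) x = pt (g**mexp (Ad (flow (real n)) v)**flow (real n))" by(simp add:v(4) act_pt flow_exp mms)
   also have "... = pt (g**mexp (Ad (flow (real n)) v))" by(rule pt_QH[OF QH_flow])
   finally have eq: "act (g**flow (real n)) x = pt (g**mexp (Ad (flow (real n)) v))" .
   have "norm (g**mexp (Ad (flow (real n)) v) - g) < r1" using r2(2)[OF n[OF v(1,2)]] v(3) by simp
   hence "d w (act (g**flow (real n)) x) < r" unfolding eq g(2) by(intro r1(2) mult g lie_exp Ad_gg flow_G v)
   thus ?thesis using r(2) act_in[OF mult[OF g(1) flow_G] x(1)] by blast
  qed
  obtain gm where gm: "gm : Gam" "gm**(g**flow (real n)) : bd R" using R mult[OF g(1) flow_G] by blast
  define h where "h = gm**(g**flow (real n))"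
  have hG: "h : G" unfolding h_def by(rule bd_G[OF gm(2)])
  show "EX y:M. ALL z:Z. dl <= d y z"
  proof (intro bexI ballI)
   show "pt h : M" using hG by simp
   fix z assume z: "z : Z"
   show "dl <= d (pt h) z"
   proof (rule ccontr)
    assume "~ dl <= d (pt h) z"
    hence "d (act (mi h) (pt h)) (act (mi h) z) < rh" using z Z(1) hG gm(2) by(intro dl(2) bd_inv) (auto simp: h_def)
    hence "d base (act (mi h) z) < rh" using inv[OF hG] by(simp add:act_pt)
    hence "act (g**flow (real n)) (act (mi h) z) ~: Z" using z Z(1) by(intro far act_in minv hG) auto
    moreover have "act (g**flow (real n)) (act (mi h) z) = act (mi gm) z"
    proof -
     have "g**flow (real n)**mi h = mi gm" using inv[OF Gam_G[OF gm(1)]] inv[OF g(1)] inv[OF mult[OF g(1) flow_G]] unfolding h_def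
      by(simp add:matrix_inv_mult mms flow_inv flow_cancel)
     thus ?thesis by(simp add:act_act)
    qed
    ultimately show False using inv'[OF Gam_inv[OF gm(1)] z] by simp
   qed
  qed
 qed
qed

end

lemma limitin_mtopology_of: "limitin (mtopology_of M1) f l F \<longleftrightarrow> l : mspace M1 & (ALL ep>0. \<forall>\<^sub>F x in F. f x : mspace M1 & mdist M1 (f x) l < ep)"
 unfolding mtopology_of_def by(rule Metric_space.limitin_metric[OF Metric_space_mspace_mdist])

section \<open>Topologies on actions and maps, and structural stability\<close>

context lattice
begin

abbreviation X where "X == mtopology_of m"

definition act0 :: "real^'n^'n => (real^'n^'n) set => (real^'n^'n) set" where "act0 = left_mult_action Gam G Q"

lemma act0_eq: "act0 = (\<lambda>gm\<in>Gam. \<lambda>x\<in>M. act gm x)"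
proof -
 have "lcosets\<^bsub>grp G\<^esub> Q = M" using mtop topspace_coset_topology topspace_mtopology_of by metis
 thus ?thesis by(simp add:act0_def left_mult_action_def act_def)
qed

lemma act0_act: "gm : Gam ==> x : M ==> act0 gm x = act gm x" by(simp add:act0_eq)

lemma actions_homeo: "rh : actions Gam X ==> gm : Gam ==> rh gm : extensional M & homeomorphic_map X X (rh gm)" by(auto simp: actions_def hom_def homeo_group_def Pi_iff)

lemma actions_gact: assumes rh: "rh : actions Gam X" shows "gact rh" unfolding gact_def
proof (intro conjI ballI)
 show "continuous_map X X (rh gm)" if "gm : Gam" for gm using actions_homeo[OF rh that] homeomorphic_imp_continuous_map by blast
 show mul: "rh (gm**bb) x = rh gm (rh bb x)" if "gm : Gam" "bb : Gam" "x : M" for gm bb x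
 proof -
  have "rh (gm**bb) = compose M (rh gm) (rh bb)" using rh that by(simp add:actions_def hom_def homeo_group_def GL_def)
  thus ?thesis using that by(simp add:compose_eq)
 qed
 \<comment> \<open>\<open>hom\<close> records products only; an idempotent injective map is the
   identity.\<close>
 show "rh (mat 1) x = x" if x: "x : M" for x
 proof -
  have h: "homeomorphic_map X X (rh (mat 1))" using actions_homeo[OF rh Gam_one] by blast
  have inj: "inj_on (rh (mat 1)) M" and im: "rh (mat 1) ` M = M" using homeomorphic_imp_injective_map[OF h] homeomorphic_imp_surjective_map[OF h] by simp_all
  have "rh (mat 1) x : M" using im x by blast
  moreover have "rh (mat 1) (rh (mat 1) x) = rh (mat 1) x" using mul[OF Gam_one Gam_one x] by simp
  ultimately show ?thesis using inj x by(simp add:inj_on_eq_iff)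
 qed
qed

lemma act0_actions: "act0 : actions Gam X"
proof -
 have h: "homeomorphic_map X X (act gm)" if "gm : Gam" for gm
 proof -
  have g: "gm : G" by(rule Gam_G[OF that])
  have "homeomorphic_maps X X (act gm) (act (mi gm))" unfolding homeomorphic_maps_def using act_continuous[OF g] act_continuous[OF minv[OF g]] act_inv[OF g] by simp
  thus ?thesis by(rule homeomorphic_maps_imp_map)
 qed
 have "homeomorphic_map X X (act0 gm)" if "gm : Gam" for gm by(rule homeomorphic_map_eq[OF h[OF that]]) (simp add:act0_act that)
 moreover have "act0 (gm**bb) = compose M (act0 gm) (act0 bb)" if "gm : Gam" "bb : Gam" for gm bb
  by(rule ext) (use that in \<open>simp add:act0_eq compose_def Gam_mult Gam_G act_in act_act\<close>)
 ultimately show ?thesis by(auto simp: actions_def hom_def homeo_group_def GL_def act0_eq)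
qed

lemma topspace_homeo_topology: "topspace (homeo_topology X) = carrier (homeo_group X)"
proof -
 have "f : topspace (compact_open_topology X X)" if "f : carrier (homeo_group X)" for f
 proof -
  have "f : {f : extensional (topspace X). continuous_map X X f & f ` {} <= {}}" using that homeomorphic_imp_continuous_map by(auto simp: homeo_group_def)
  moreover have "compactin X {}" "openin X {}" by simp_all
  ultimately show ?thesis unfolding compact_open_topology_def topology_generated_by_topspace by blast
 qed
 thus ?thesis by(auto simp: homeo_topology_def)
qed

lemma topspace_action_topology: assumes "S <= Gam" shows "topspace (action_topology S Gam X) = actions Gam X"
proof -
 have "restrict rh S : (\<Pi>\<^sub>E s\<in>S. topspace (homeo_topology X))" if "rh : actions Gam X" for rh
  using actions_homeo[OF that] assms by(auto simp: topspace_homeo_topology homeo_group_def)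
 thus ?thesis by(auto simp: action_topology_def topspace_pullback_topology)
qed

text \<open>Uniform closeness from the compact-open topology: finitely many closed balls
  \<open>C a\<close> cover the space, each is sent by the unperturbed generator into a small ball
  \<open>U a\<close>, and asking the same of \<open>rh s\<close> is an open condition.\<close>

lemma eventually_close_generator:
 assumes S: "S <= Gam" and s: "s : S" and e: "0 < e"
 shows "\<forall>\<^sub>F rh in nhdsin (action_topology S Gam X) act0. close {s} e rh"
proof -
 have sGam: "s : Gam" and sG: "s : G" using S s Gam_G by auto
 have e2: "0 < e / 2" using e by simp
 obtain R where R: "s : bd R" using singleton_bd[OF sG] by blast
 obtain r where r: "0 < r" "!!g x y. g : bd R ==> x : M ==> y : M ==> d x y < r ==> d (act g x) (act g y) < e / 2" using act_uniform[OF e2] by metis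
 have r2: "0 < r / 2" using r(1) by simp
 obtain F where F: "finite F" "F <= M" "!!x. x : M ==> EX a:F. d a x < r / 2" by(rule finite_net[OF r2]) blast
 define C where "C a = Metric_space.mcball M d a (r / 2)" for a
 define U where "U a = mball_of m (act s a) (e / 2)" for a
 have inC: "x : C a \<longleftrightarrow> a : M & x : M & d a x <= r / 2" for a x unfolding C_def by(rule Metric_space.in_mcball[OF Metric_space_mspace_mdist])
 have Cc: "compactin X (C a)" for a unfolding C_def by(rule closedin_compact_space[OF compact_boundary])
   (simp add:mtopology_of_def Metric_space.closedin_mcball[OF Metric_space_mspace_mdist])
 have "\<forall>\<^sub>F rh in nhdsin (action_topology S Gam X) act0. rh s ` C a <= U a" if a: "a : F" for a
 proof -
  define W where "W = {f : extensional (topspace X). continuous_map X X f & f ` C a <= U a}"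
  have "openin X (U a)" unfolding U_def by(rule open_ball)
  hence "openin (compact_open_topology X X) W" unfolding compact_open_topology_def W_def using Cc[of a] by(intro topology_generated_by_Basis) blast
  hence "openin (homeo_topology X) (W \<inter> carrier (homeo_group X))" unfolding homeo_topology_def openin_subtopology by blast
  hence o: "openin (product_topology (%_. homeo_topology X) S)
    {f : topspace (product_topology (%_. homeo_topology X) S). f s : W \<inter> carrier (homeo_group X)}"
   by(rule openin_continuous_map_preimage[OF continuous_map_product_projection[OF s]])
  define N where "N = (%rh. restrict rh S) -` {f : topspace (product_topology (%_. homeo_topology X) S). f s : W \<inter> carrier (homeo_group X)} \<inter> actions Gam X"
  have "openin (action_topology S Gam X) N" unfolding action_topology_def openin_pullback_topology N_def using o by blast
  moreover have "act0 : N"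
  proof -
   have "act0 s x : U a" if x: "x : C a" for x
   proof -
    have "d (act s a) (act s x) < e / 2" using r(2)[OF R] x r(1) by(auto simp: inC)
    thus ?thesis using x by(simp add:U_def inC act0_act sGam act_in sG)
   qed
   moreover have "act0 s : carrier (homeo_group X)" using actions_homeo[OF act0_actions sGam] by(simp add:homeo_group_def)
   ultimately have "act0 s : W \<inter> carrier (homeo_group X)" using homeomorphic_imp_continuous_map by(auto simp: W_def homeo_group_def)
   moreover have "restrict act0 S : topspace (product_topology (%_. homeo_topology X) S)"
    using actions_homeo[OF act0_actions] S by(auto simp: topspace_homeo_topology homeo_group_def)
   ultimately show ?thesis using act0_actions s by(simp add:N_def)
  qed
  moreover have "rh s ` C a <= U a" if "rh : N" for rh using that s by(auto simp: N_def W_def)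
  ultimately show ?thesis unfolding eventually_nhdsin by blast
 qed
 hence "\<forall>\<^sub>F rh in nhdsin (action_topology S Gam X) act0. ALL a:F. rh s ` C a <= U a" by(intro eventually_ball_finite F(1)) auto
 thus ?thesis
 proof eventually_elim
  case (elim rh)
  have "d (rh s x) (act s x) < e" if x: "x : M" for x
  proof -
   obtain a where a: "a : F" "d a x < r / 2" using F(3)[OF x] by blast
   have am: "a : M" using a F(2) by blast
   have "rh s x : U a" using elim a x am by(force simp: inC)
   hence 1: "d (rh s x) (act s a) < e / 2" "rh s x : M" by(auto simp: U_def mdist_commute)
   have 2: "d (act s a) (act s x) < e / 2" using r(2)[OF R am x] a(2) r(1) by simp
   show ?thesis using tri[OF 1(2) act_in[OF sG am] act_in[OF sG x] 1(1) 2] by simp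
  qed
  thus ?case by(simp add:close_def)
 qed
qed

lemma eventually_gact: "S <= Gam ==> \<forall>\<^sub>F rh in nhdsin (action_topology S Gam X) act0. gact rh" unfolding eventually_nhdsin
 by(intro disjI2 exI[of _ "topspace (action_topology S Gam X)"] conjI openin_topspace)
  (simp_all add: act0_actions actions_gact topspace_action_topology)

lemma closeD: "close F e rh ==> gm : F ==> x : M ==> d (rh gm x) (act gm x) < e" by(simp add:close_def)

text \<open>Induction over words in the generators. For products and inverses the error is
  transported by the unperturbed action, which is uniformly continuous; for an inverse, the estimate
  for \<open>s\<close> is taken at \<open>rh (s^-1) x\<close> and then moved by
  \<open>s^-1\<close>.\<close>

lemma eventually_close:
 assumes S: "S <= Gam" "generate (grp Gam) S = Gam" and F: "finite F" "F <= Gam" and e: "0 < e"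
 shows "\<forall>\<^sub>F rh in nhdsin (action_topology S Gam X) act0. close F e rh"
proof -
 let ?N = "nhdsin (action_topology S Gam X) act0"
 note ga = eventually_gact[OF S(1)]
 have "gm : generate (grp Gam) S ==> ALL e>0. \<forall>\<^sub>F rh in ?N. close {gm} e rh" for gm
 proof (induction gm rule: generate.induct)
  case one
  show ?case
  proof (intro allI impI)
   fix e :: real assume "0 < e"
   show "\<forall>\<^sub>F rh in ?N. close {\<one>\<^bsub>grp Gam\<^esub>} e rh" using ga by eventually_elim (simp add:close_def GL_def gact_def `0 < e`)
  qed
 next
  case (incl s)
  thus ?case using eventually_close_generator[OF S(1)] by blast
 next
  case (inv s)
  have s: "s : Gam" and sG: "s : G" using inv S(1) Gam_G by auto
  have si: "inv\<^bsub>grp Gam\<^esub> s = mi s" by(rule m_inv_grp[OF s Gam_inv[OF s] matgroup.inv[OF matgroup_axioms sG]])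
  show ?case
  proof (intro allI impI)
   fix e :: real assume e: "0 < e"
   obtain R where R: "mi s : bd R" using singleton_bd[OF minv[OF sG]] by blast
   obtain r where r: "0 < r" "!!g x y. g : bd R ==> x : M ==> y : M ==> d x y < r ==> d (act g x) (act g y) < e" using act_uniform[OF e] by metis
   show "\<forall>\<^sub>F rh in ?N. close {inv\<^bsub>grp Gam\<^esub> s} e rh" using ga eventually_close_generator[OF S(1) inv r(1)]
   proof eventually_elim
    case (elim rh)
    have "d (rh (mi s) x) (act (mi s) x) < e" if x: "x : M" for x
    proof -
     define y where "y = rh (mi s) x"
     have y: "y : M" unfolding y_def by(rule gact_in[OF elim(1) Gam_inv[OF s] x])
     have sy: "rh s y = x" using gact_mult[OF elim(1) s Gam_inv[OF s] x] matgroup.inv[OF matgroup_axioms sG] elim(1) x by(simp add:y_def gact_def)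
     have "d (rh s y) (act s y) < r" by(rule closeD[OF elim(2) _ y]) simp
     hence "d (act (mi s) (act s y)) (act (mi s) x) < e" using r(2)[OF R x act_in[OF sG y]] by(simp add:sy mdist_commute)
     thus ?thesis using act_inv(2)[OF sG] by(simp add:y_def)
    qed
    thus ?case by(simp add:close_def si)
   qed
  qed
 next
  case (eng a b)
  have ab: "a : Gam" "b : Gam" using eng(1,2) S(2) by auto
  show ?case
  proof (intro allI impI)
   fix e :: real assume "0 < e"
   hence e2: "0 < e / 2" by simp
   obtain R where R: "a : bd R" using singleton_bd[OF Gam_G[OF ab(1)]] by blast
   obtain r where r: "0 < r" "!!g x y. g : bd R ==> x : M ==> y : M ==> d x y < r ==> d (act g x) (act g y) < e / 2" using act_uniform[OF e2] by metis
   show "\<forall>\<^sub>F rh in ?N. close {a \<otimes>\<^bsub>grp Gam\<^esub> b} e rh" using ga eng(3)[rule_format, OF e2] eng(4)[rule_format, OF r(1)]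
   proof eventually_elim
    case (elim rh)
    have "d (rh (a**b) x) (act (a**b) x) < e" if x: "x : M" for x
    proof -
     have b: "rh b x : M" "act b x : M" by(rule gact_in[OF elim(1) ab(2) x], rule act_in[OF Gam_G[OF ab(2)] x])
     have 1: "d (rh a (rh b x)) (act a (rh b x)) < e / 2" by(rule closeD[OF elim(2) _ b(1)]) simp
     have "d (rh b x) (act b x) < r" by(rule closeD[OF elim(3) _ x]) simp
     hence 2: "d (act a (rh b x)) (act a (act b x)) < e / 2" by(rule r(2)[OF R b])
     have "d (rh a (rh b x)) (act a (act b x)) < e / 2 + e / 2" by(rule tri[OF gact_in[OF elim(1) ab(1) b(1)] act_in[OF Gam_G[OF ab(1)] b(1)] act_in[OF Gam_G[OF ab(1)] b(2)] 1 2])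
     thus ?thesis using gact_mult[OF elim(1) ab x] by(simp add:act_act)
    qed
    thus ?case by(simp add:close_def GL_def)
   qed
  qed
 qed
 hence "\<forall>\<^sub>F rh in ?N. close {gm} e rh" if "gm : F" for gm using that F(2) S(2) e by blast
 hence "\<forall>\<^sub>F rh in ?N. ALL gm:F. close {gm} e rh" by(intro eventually_ball_finite F(1)) auto
 thus ?thesis by eventually_elim (simp add:close_def)
qed

lemma cfunspace_in: "continuous_map X X f ==> f : extensional M ==> f : mspace (cfunspace X m)"
proof -
 assume f: "continuous_map X X f" "f : extensional M"
 have "compactin X (f ` M)" using image_compactin[OF _ f(1)] compact_boundary by(simp add:compact_space_def)
 hence "Metric_space.mbounded M d (f ` M)" unfolding mtopology_of_def by(rule Metric_space.compactin_imp_mbounded[OF Metric_space_mspace_mdist])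
 moreover have "f : M \<rightarrow> M" using continuous_map_image_subset_topspace[OF f(1)] by auto
 ultimately show ?thesis using f by simp
qed

text \<open>Two points that shadow the same orbit within \<open>e\<close> are \<open>2 e\<close>
  close along the lattice and hence equal. Equivariance and continuity follow by exhibiting another
  point that shadows; the bound is not strict so that it survives limits. If the closed invariant
  image were proper, some \<open>y\<close> would be farther than \<open>e\<close> from it, although
  \<open>ph y\<close> is within \<open>e\<close> of \<open>y\<close>.\<close>

lemma shadow_semi_conjugacy:
 assumes rh: "gact rh" and e: "0 < e"
  and uniq: "!!x y. x : M ==> y : M ==> (!!gm. gm : Gam ==> d (act gm x) (act gm y) <= 2 * e) ==> x = y"
  and gap: "!!Z. openin X (M - Z) ==> (!!gm z. gm : Gam ==> z : Z ==> act gm z : Z) ==>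
  Z <= M ==> Z ~= M ==> EX y:M. ALL z:Z. e < d y z"
  and ph: "!!x. x : M ==> ph x : M"
  and sh: "!!x gm. x : M ==> gm : Gam ==> d (act gm (ph x)) (rh gm x) <= e"
 shows "semi_conjugacy Gam X rh act0 ph"
proof -
 have unique: "y = ph x" if x: "x : M" and y: "y : M" "!!gm. gm : Gam ==> d (act gm y) (rh gm x) <= e" for x y
 proof (rule uniq[OF y(1) ph[OF x]])
  fix gm assume gm: "gm : Gam"
  have "d (act gm y) (act gm (ph x)) <= d (act gm y) (rh gm x) + d (rh gm x) (act gm (ph x))"
   by(rule mdist_triangle[OF act_in[OF Gam_G[OF gm] y(1)] gact_in[OF rh gm x] act_in[OF Gam_G[OF gm] ph[OF x]]])
  thus "d (act gm y) (act gm (ph x)) <= 2 * e" using y(2)[OF gm] sh[OF x gm] by(simp add:mdist_commute[of m "rh gm x"])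
 qed
 have equi: "ph (rh bb x) = act bb (ph x)" if bb: "bb : Gam" and x: "x : M" for bb x
 proof (rule unique[symmetric, OF gact_in[OF rh bb x] act_in[OF Gam_G[OF bb] ph[OF x]]])
  fix gm assume "gm : Gam"
  thus "d (act gm (act bb (ph x))) (rh gm (rh bb x)) <= e" using sh[OF x Gam_mult[of gm bb]] gact_mult[OF rh, of gm bb x] bb x by(simp add:act_act)
 qed
 have lim: "y = ph x" if x: "x : M" "!!n. s n : M" "(%n. d x (s n)) ----> 0"
  and y: "y : M" "(%n. d y (ph (s n))) ----> 0" for x y s
 proof (rule unique[OF x(1) y(1)])
  fix gm assume gm: "gm : Gam"
  have cont: "(%n. d (f a) (f (t n))) ----> 0"
   if f: "continuous_map X X f" and a: "a : M" "!!n. t n : M" "(%n. d a (t n)) ----> 0" for f a t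
  proof (rule LIMSEQ_I)
   fix ep :: real assume "0 < ep"
   then obtain dl where dl: "0 < dl" "ALL x. x : M & d a x < dl --> d (f a) (f x) < ep" using f a(1) unfolding continuous_map_iff by blast
   obtain N where "ALL n>=N. norm (d a (t n) - 0) < dl" using LIMSEQ_D[OF a(3) dl(1)] by blast
   thus "EX N. ALL n>=N. norm (d (f a) (f (t n)) - 0) < ep" using dl(2) a(2) by auto
  qed
  have 1: "(%n. d (act gm y) (act gm (ph (s n)))) ----> 0" by(rule cont[OF act_continuous[OF Gam_G[OF gm]] y(1) ph[OF x(2)] y(2)])
  have 2: "(%n. d (rh gm x) (rh gm (s n))) ----> 0" by(rule cont[OF _ x]) (use rh gm in \<open>simp add:gact_def\<close>)
  have "(%n. d (act gm y) (act gm (ph (s n))) + e + d (rh gm x) (rh gm (s n))) ----> 0 + e + 0" by(intro tendsto_add 1 2 tendsto_const)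
  moreover have "d (act gm y) (rh gm x) <= d (act gm y) (act gm (ph (s n))) + e + d (rh gm x) (rh gm (s n))" for n
  proof -
   have i: "act gm y : M" "act gm (ph (s n)) : M" "rh gm (s n) : M" "rh gm x : M"
    by(rule act_in[OF Gam_G[OF gm] y(1)], rule act_in[OF Gam_G[OF gm] ph[OF x(2)]], rule gact_in[OF rh gm x(2)], rule gact_in[OF rh gm x(1)])
   show ?thesis using mdist_triangle[OF i(1,2,4)] mdist_triangle[OF i(2,3,4)] sh[OF x(2) gm, of n] by(simp add:mdist_commute[of m "rh gm x"])
  qed
  ultimately have "d (act gm y) (rh gm x) <= 0 + e + 0" by(intro LIMSEQ_le_const) auto
  thus "d (act gm y) (rh gm x) <= e" by simp
 qed
 have cont: "continuous_map X X ph" unfolding continuous_map_iff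
 proof (intro conjI ballI allI impI)
  show "ph ` M <= M" using ph by blast
  fix a and ep :: real assume a: "a : M" and ep: "0 < ep"
  show "EX dl>0. ALL x. x : M & d a x < dl --> d (ph a) (ph x) < ep"
  proof (rule ccontr)
   assume c: "~ ?thesis"
   have "ALL n. EX x. x : M & d a x < 1 / real (Suc n) & ep <= d (ph a) (ph x)"
   proof
    fix n
    have "0 < 1 / real (Suc n)" by simp
    thus "EX x. x : M & d a x < 1 / real (Suc n) & ep <= d (ph a) (ph x)" using c by(meson not_le)
   qed
   from choice[OF this] obtain s where s: "!!n. s n : M" "!!n. d a (s n) < 1 / real (Suc n)" "!!n. ep <= d (ph a) (ph (s n))" by blast
   obtain y r where y: "y : M" "strict_mono (r :: nat => nat)" "(%n. d y (ph (s (r n)))) ----> 0" using convergent_subsequence[of "%n. ph (s n)"] ph s(1) by metis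
   have "(%n. 1 / real (Suc (r n))) ----> 0" using LIMSEQ_subseq_LIMSEQ[OF LIMSEQ_inverse_real_of_nat y(2)] by(simp add:o_def inverse_eq_divide)
   hence "(%n. d a (s (r n))) ----> 0" by(rule Lim_null_comparison[rotated]) (use s(2) in \<open>auto intro!: always_eventually less_imp_le\<close>)
   hence "y = ph a" by(rule lim[OF a s(1) _ y(1,3)])
   hence "ep <= 0" using LIMSEQ_le_const[OF y(3), of ep] s(3) by auto
   thus False using ep by simp
  qed
 qed
 have "ph ` M = M"
 proof (rule ccontr)
  assume ne: "ph ` M ~= M"
  have "compactin X (ph ` M)" using image_compactin[OF _ cont] compact_boundary by(simp add:compact_space_def)
  hence "closedin X (ph ` M)" by(rule compactin_imp_closedin[rotated])
    (simp add:mtopology_of_def Metric_space.Hausdorff_space_mtopology[OF Metric_space_mspace_mdist])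
  hence o: "openin X (M - ph ` M)" by(simp add:closedin_def)
  have "EX y:M. ALL z:ph ` M. e < d y z"
  proof (rule gap[OF o _ _ ne])
   fix gm z assume "gm : Gam" "z : ph ` M"
   thus "act gm z : ph ` M" using equi gact_in[OF rh] by(force simp flip: equi)
  qed (use ph in blast)
  then obtain y where y: "y : M" "e < d y (ph y)" by blast
  moreover have "d (ph y) y <= e" using sh[OF y(1) Gam_one] rh y(1) by(simp add:gact_def)
  ultimately show False by(simp add:mdist_commute)
 qed
 thus ?thesis unfolding semi_conjugacy_def using cont equi ph by(simp add:act0_act)
qed

theorem structural_stability:
 assumes S: "S <= Gam" "generate (grp Gam) S = Gam"
 shows "EX U0 V0.
   neighbourhood_in (action_topology S Gam X) act0 U0 &
   neighbourhood_in (mtopology_of (cfunspace X m)) (\<lambda>x\<in>topspace X. x) V0 &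
   (ALL rh:U0. EX! ph. ph : V0 & semi_conjugacy Gam X rh act0 ph) &
   limitin (mtopology_of (cfunspace X m))
    (%rh. THE ph. ph : V0 & semi_conjugacy Gam X rh act0 ph) (\<lambda>x\<in>topspace X. x)
    (nhdsin (action_topology S Gam X) act0)"
proof -
 let ?T = "action_topology S Gam X" and ?C = "cfunspace X m"
 define I where "I = (\<lambda>x\<in>topspace X. x)"
 obtain e1 where e1: "0 < e1" "!!x y. x : M ==> y : M ==> (!!gm. gm : Gam ==> d (act gm x) (act gm y) <= e1) ==> x = y" by(rule lattice_expansive) blast
 obtain dl where dl: "0 < dl" "!!Z. openin X (M - Z) ==> (!!gm z. gm : Gam ==> z : Z ==> act gm z : Z) ==>
  Z <= M ==> Z ~= M ==> EX y:M. ALL z:Z. dl <= d y z" by(rule invariant_gap) blast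
 \<comment> \<open>Half the expansivity constant, because two shadows are compared through the
   orbit, and strictly below the gap \<open>dl\<close>, for surjectivity.\<close>
 define e where "e = min (e1 / 2) (dl / 2)"
 have e: "0 < e" "2 * e <= e1" "e < dl" using e1(1) dl(1) by(auto simp: e_def)
 have uniq: "x = y" if "x : M" "y : M" "!!gm. gm : Gam ==> d (act gm x) (act gm y) <= 2 * e" for x y using e1(2)[OF that(1,2)] that(3) e(2) by force
 have gap: "EX y:M. ALL z:Z. e < d y z"
  if "openin X (M - Z)" "!!gm z. gm : Gam ==> z : Z ==> act gm z : Z" "Z <= M" "Z ~= M" for Z using dl(2)[OF that] e(3) by force
 define V0 where "V0 = {ph : mspace ?C. ALL x:M. d (ph x) x <= e}"
 \<comment> \<open>Used with \<open>e' = e\<close> for existence and with small \<open>e'\<close>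
   for convergence: a finer shadow also lies in \<open>V0\<close>, so by uniqueness there it is the
   same semi-conjugacy.\<close>
 have semi: "EX ph. (ph : V0 & semi_conjugacy Gam X rh act0 ph) & (ALL x:M. d (ph x) x <= e') &
   (ALL ps. ps : V0 & semi_conjugacy Gam X rh act0 ps --> ps = ph)"
  if rh: "gact rh" and e': "e' <= e"
   and z: "!!x. x : M ==> EX z:M. ALL gm:Gam. d (act gm z) (rh gm x) < e'" for rh e'
 proof -
  have "ALL x:M. EX z. z : M & (ALL gm:Gam. d (act gm z) (rh gm x) < e')" using z by blast
  from bchoice[OF this] obtain f where f: "!!x. x : M ==> f x : M"
   "!!x gm. x : M ==> gm : Gam ==> d (act gm (f x)) (rh gm x) < e'" by blast
  define ph where "ph = restrict f M"
  have phm: "ph x : M" if "x : M" for x using f(1) that by(simp add:ph_def)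
  have sh: "d (act gm (ph x)) (rh gm x) <= e" if "x : M" "gm : Gam" for x gm using f(2)[OF that] e' that by(simp add:ph_def)
  have sc: "semi_conjugacy Gam X rh act0 ph" by(rule shadow_semi_conjugacy[OF rh e(1) uniq gap phm sh])
  have small: "d (ph x) x <= e'" if x: "x : M" for x using f(2)[OF x Gam_one] rh x by(simp add:ph_def gact_def)
  have V: "ph : V0" unfolding V0_def using sc small e' cfunspace_in[of ph] by(force simp: semi_conjugacy_def ph_def simp del: mspace_cfunspace)
  have "ps = ph" if ps: "ps : V0" "semi_conjugacy Gam X rh act0 ps" for ps
  proof (rule extensionalityI)
   show "ps : extensional M" "ph : extensional M" using ps(1) by(auto simp: V0_def ph_def)
   fix x assume x: "x : M"
   have psx: "ps x : M" using ps(1) x by(auto simp: V0_def)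
   show "ps x = ph x"
   proof (rule uniq[OF psx phm[OF x]])
    fix gm assume gm: "gm : Gam"
    have rx: "rh gm x : M" by(rule gact_in[OF rh gm x])
    have "ps (rh gm x) = act gm (ps x)" using ps(2) gm x psx by(simp add:semi_conjugacy_def act0_act)
    hence 1: "d (act gm (ps x)) (rh gm x) <= e" using ps(1) rx by(force simp: V0_def)
    have "d (act gm (ps x)) (act gm (ph x)) <= d (act gm (ps x)) (rh gm x) + d (rh gm x) (act gm (ph x))"
     by(rule mdist_triangle[OF act_in[OF Gam_G[OF gm] psx] rx act_in[OF Gam_G[OF gm] phm[OF x]]])
    thus "d (act gm (ps x)) (act gm (ph x)) <= 2 * e" using 1 sh[OF x gm] by(simp add:mdist_commute[of m "rh gm x"])
   qed
  qed
  thus ?thesis using sc V small by blast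
 qed
 have shadowed: "\<forall>\<^sub>F rh in nhdsin ?T act0. gact rh & (ALL x:M. EX z:M. ALL gm:Gam. d (act gm z) (rh gm x) < e')" if e': "0 < e'" for e'
 proof -
  obtain F ep where F: "finite F" "F <= Gam" "0 < ep"
   "!!rh x. gact rh ==> close F ep rh ==> x : M ==> EX z:M. ALL gm:Gam. d (act gm z) (rh gm x) < e'" using lattice_shadowing[OF e'] by metis
  show ?thesis using eventually_gact[OF S(1)] eventually_close[OF S F(1,2,3)] by eventually_elim (use F(4) in blast)
 qed
 have act0T: "act0 : topspace ?T" using act0_actions topspace_action_topology[OF S(1)] by simp
 obtain U0 where U0: "openin ?T U0" "act0 : U0"
  "!!rh. rh : U0 ==> gact rh & (ALL x:M. EX z:M. ALL gm:Gam. d (act gm z) (rh gm x) < e)" using shadowed[OF e(1)] act0T unfolding eventually_nhdsin by blast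
 have IC: "I : mspace ?C"
 proof (rule cfunspace_in)
  have "continuous_map X X id" by simp
  thus "continuous_map X X I" by(rule continuous_map_eq) (simp add:I_def)
 qed (simp add:I_def)
 have N1: "neighbourhood_in ?T act0 U0" unfolding neighbourhood_in_def using U0 openin_subset by blast
 have N2: "neighbourhood_in (mtopology_of ?C) I V0" unfolding neighbourhood_in_def
 proof (intro conjI exI[of _ "mball_of ?C I e"])
  show "V0 <= topspace (mtopology_of ?C)" unfolding V0_def topspace_mtopology_of by blast
  show "openin (mtopology_of ?C) (mball_of ?C I e)" unfolding mtopology_of_def mball_of_def by(rule Metric_space.openin_mball[OF Metric_space_mspace_mdist])
  show "I : mball_of ?C I e" unfolding in_mball_of iffD2[OF mdist_zero[OF IC IC] refl] using IC e(1) by blast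
  show "mball_of ?C I e <= V0"
  proof
   fix ph assume "ph : mball_of ?C I e"
   hence ph: "ph : mspace ?C" "mdist ?C I ph <= e" unfolding in_mball_of by auto
   have "d (ph x) x <= e" if x: "x : M" for x using mdist_cfunspace_imp_mdist_le[OF IC ph(1,2), of x] x by(simp add:I_def mdist_commute)
   thus "ph : V0" using ph(1) unfolding V0_def by blast
  qed
 qed
 have ex1: "EX! ph. ph : V0 & semi_conjugacy Gam X rh act0 ph" if rh: "rh : U0" for rh
 proof -
  obtain ph where "ph : V0 & semi_conjugacy Gam X rh act0 ph" "ALL ps. ps : V0 & semi_conjugacy Gam X rh act0 ps --> ps = ph" using semi[of rh e] U0(3)[OF rh] by blast
  thus ?thesis by(intro ex1I[of _ ph]) blast+
 qed
 have "limitin (mtopology_of ?C) (%rh. THE ph. ph : V0 & semi_conjugacy Gam X rh act0 ph) I (nhdsin ?T act0)" unfolding limitin_mtopology_of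
 proof (intro conjI IC allI impI)
  fix ep :: real assume ep: "0 < ep"
  define e' where "e' = min e (ep / 2)"
  have e': "0 < e'" "e' <= e" "e' < ep" using e(1) ep by(auto simp: e'_def)
  show "\<forall>\<^sub>F rh in nhdsin ?T act0. (THE ph. ph : V0 & semi_conjugacy Gam X rh act0 ph) : mspace ?C &
    mdist ?C (THE ph. ph : V0 & semi_conjugacy Gam X rh act0 ph) I < ep" using shadowed[OF e'(1)]
  proof eventually_elim
   case (elim rh)
   obtain ph where ph: "ph : V0 & semi_conjugacy Gam X rh act0 ph" "ALL x:M. d (ph x) x <= e'"
    "ALL ps. ps : V0 & semi_conjugacy Gam X rh act0 ps --> ps = ph" using semi[of rh e'] elim e'(2) by blast
   have eq: "(THE ph. ph : V0 & semi_conjugacy Gam X rh act0 ph) = ph" using ph(1,3) by(intro the_equality) blast+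
   have "mdist ?C ph I <= e'" by(rule mdist_cfunspace_le) (use ph(2) e'(1) in \<open>auto simp: I_def\<close>)
   thus ?case unfolding eq using ph(1) e'(3) unfolding V0_def by auto
  qed
 qed
 thus ?thesis using N1 N2 ex1 unfolding I_def by blast
qed

end

context parabolic
begin

text \<open>At time \<open>t\<close> the ray and its translate by \<open>g\<close> are at distance
  \<open>nb (lg (conj t (x0^-1 g x0)))\<close>, so being asymptotic is the defining condition of
  \<open>QH\<close> for the conjugate of \<open>g\<close>.\<close>

lemma boundary_stabilizer_QH:
 assumes r: "r : geodesic_rays G K" and x0: "x0 : G" and eq: "!!t. 0 <= t ==> r t = cs (x0**flow t)"
 shows "{g : G. boundary_action g (asymptotic G K `` {r}) = asymptotic G K `` {r}} = (%q. x0**q**mi x0) ` QH"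
proof -
 have xi: "invertible x0" by(rule inv[OF x0])
 have iff: "boundary_action g (asymptotic G K `` {r}) = asymptotic G K `` {r} \<longleftrightarrow> mi x0**g**x0 : QH" if g: "g : G" for g
 proof -
  have dist: "symmetric_dist G K (r t) (tr_ray g r t) = nb (lg (conj t (mi x0**g**x0)))" if t: "0 <= t" for t
  proof -
   have G: "x0**flow t : G" "g**(x0**flow t) : G" by(intro mult g x0 flow_G)+
   have "mi (x0**flow t)**(g**(x0**flow t)) = conj t (mi x0**g**x0)" by(simp add:matrix_inv_mult xi flow_inv conj_def mma)
   thus ?thesis using symmetric_dist_lg[OF G] t by(simp add:tr_ray_def eq l_coset_cs)
  qed
  have "(r, tr_ray g r) : asymptotic G K \<longleftrightarrow> (EX C. ALL t>=0. nb (lg (conj t (mi x0**g**x0))) <= C)" using r tr_ray_in[OF g r] by(simp add:asymptotic_def dist)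
  moreover have "mi x0**g**x0 : G" by(intro mult minv x0 g)
  ultimately show ?thesis using boundary_stabilizer[OF r g refl] by(simp add:QH_def)
 qed
 show ?thesis
 proof (intro equalityI subsetI)
  fix g assume "g : {g : G. boundary_action g (asymptotic G K `` {r}) = asymptotic G K `` {r}}"
  hence "mi x0**g**x0 : QH" using iff by blast
  moreover have "g = x0**(mi x0**g**x0)**mi x0" using xi by(simp add:mms)
  ultimately show "g : (%q. x0**q**mi x0) ` QH" by blast
 next
  fix g assume "g : (%q. x0**q**mi x0) ` QH"
  then obtain q where q: "q : QH" "g = x0**q**mi x0" by blast
  have g: "g : G" unfolding q(2) by(intro mult minv x0 QH_G q)
  have "mi x0**g**x0 = q" unfolding q(2) using xi by(simp add:mms)
  thus "g : {g : G. boundary_action g (asymptotic G K `` {r}) = asymptotic G K `` {r}}" using iff[OF g] g q(1) by simp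
 qed
qed

end

theorem theorem7p1:
  fixes G \<Gamma> Q S :: "(real^'n^'n) set"
    and X :: "(real^'n^'n) set topology"
    and m :: "(real^'n^'n) set metric"
    and \<rho>0 :: "real^'n^'n \<Rightarrow> (real^'n^'n) set \<Rightarrow> (real^'n^'n) set"
  defines "X \<equiv> coset_topology G Q"
    and "\<rho>0 \<equiv> left_mult_action \<Gamma> G Q"
  assumes "linear_lie_group G" and "connected G" and "semisimple G" and "no_compact_factors G"
    and "uniform_lattice \<Gamma> G"
    and "parabolic_subgroup Q G"
    and "finite S" and "S \<subseteq> \<Gamma>" and "generate (grp \<Gamma>) S = \<Gamma>"
    and "mtopology_of m = X"
  shows "\<exists>U0 V0.
      neighbourhood_in (action_topology S \<Gamma> X) \<rho>0 U0 \<and>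
      neighbourhood_in (mtopology_of (cfunspace X m)) (\<lambda>x\<in>topspace X. x) V0 \<and>
      (\<forall>\<rho>\<in>U0. \<exists>!\<phi>. \<phi> \<in> V0 \<and> semi_conjugacy \<Gamma> X \<rho> \<rho>0 \<phi>) \<and>
      limitin (mtopology_of (cfunspace X m))
        (\<lambda>\<rho>. THE \<phi>. \<phi> \<in> V0 \<and> semi_conjugacy \<Gamma> X \<rho> \<rho>0 \<phi>) (\<lambda>x\<in>topspace X. x)
        (nhdsin (action_topology S \<Gamma> X) \<rho>0)"
proof -
  interpret matgroup G by (rule matgroup_linear_lie_group[OF \<open>linear_lie_group G\<close>])
  obtain K \<xi> where K: "maximal_compact_subgroup K G" and \<xi>: "\<xi> \<in> geodesic_boundary G K"
    and Q: "Q = {g \<in> G. boundary_action g \<xi> = \<xi>}"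
    using \<open>parabolic_subgroup Q G\<close> by (auto simp: parabolic_subgroup_def)
  obtain r where r: "r \<in> geodesic_rays G K" and \<xi>r: "\<xi> = asymptotic G K `` {r}"
    using \<xi> unfolding geodesic_boundary_def by (rule quotientE) blast
  have sub: "subgroup K (grp G)" and Kc: "compact K" using K by (auto simp: maximal_compact_subgroup_def)
  interpret pair G K
    using matgroup_subgroup[OF matgroup_axioms sub compact_imp_closed[OF Kc]] subgroup.subset[OF sub] Kc \<open>semisimple G\<close>
    by (intro pair.intro pair_axioms.intro matgroup_axioms) simp_all
  interpret connected_cartan G K
    by unfold_locales (use kf_pp_pos[OF \<open>connected G\<close> r] \<open>connected G\<close> in simp_all)
  obtain x0 H where x0: "x0 \<in> G" and H: "H \<in> pp" and r_eq: "\<And>t. 0 \<le> t \<Longrightarrow> r t = cs (x0 ** mat_exp (t *\<^sub>R H))"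
    by (rule geodesic_ray_eq[OF r]) blast
  obtain E \<mu> where E: "finite E" "E \<subseteq> gg" "\<forall>e\<in>E. \<forall>f\<in>E. bt e f = (if e = f then 1 else 0)"
    "\<forall>x\<in>gg. x = (\<Sum>e\<in>E. bt x e *\<^sub>R e)" "\<And>e. e \<in> E \<Longrightarrow> bracket H e = \<mu> e *\<^sub>R e"
    using ad_eigenbasis[OF H] by blast
  interpret parabolic G K H E \<mu>
    by unfold_locales (use H E in auto)
  have "Q = (\<lambda>q. x0 ** q ** matrix_inv x0) ` QH"
    unfolding Q \<xi>r by (rule boundary_stabilizer_QH[OF r x0]) (simp add: r_eq flow_def)
  then interpret lattice G K H E \<mu> x0 Q m \<Gamma>
    using x0 \<open>mtopology_of m = X\<close> \<open>uniform_lattice \<Gamma> G\<close> by unfold_locales (simp_all add: X_def)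
  show ?thesis
    using structural_stability[OF \<open>S \<subseteq> \<Gamma>\<close> \<open>generate (grp \<Gamma>) S = \<Gamma>\<close>]
    by (simp only: \<open>mtopology_of m = X\<close> act0_def assms(2)[symmetric])
qed

end
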